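(* Let $Q$ be a random ideal quadrilateral and let $T^2_*$ be the rectangular punctured torus arising from the side pairings of $Q$. Then the length $\ell$ of the shortest closed geodesic of $T^2_*$ has probability density function \[ X_\ell=\frac{6}{\pi^2}\,\operatorname{csch}(\ell)\Big[4\log\cosh\frac{\ell}{2}+2(\cosh(\ell)-1)\log\coth\frac{\ell}{2}\Big],\qquad 0<\ell\le\log\frac{\sqrt2+1}{\sqrt2-1}. \] The expected value of the length of the shortest geodesic is \[ E[\ell]=\frac{6}{\pi^2}\int_0^{\log(3+2\sqrt2)}\operatorname{csch}(\ell)\Big[4\log\cosh\frac{\ell}{2}+2(\cosh(\ell)-1)\log\coth\frac{\ell}{2}\Big]\,\ell\,d\ell\approx 0.984154, \] and its median value is approximately $0.99929$.
   Context: The hyperbolic plane is identified with the unit disk $\mathbb{D}$ with its complete hyperbolic metric of curvature $-1$. A random ideal quadrilateral $Q$ is the hyperbolic convex hull in $\mathbb{D}$ of four independent uniformly distributed points on the unit circle. The rectangular punctured torus arising from $Q$ is the complete hyperbolic surface of area $2\pi$ obtained by identifying each of the two pairs of opposite sides of $Q$ by an orientation-preserving hyperbolic isometry in such a way that the mutually closest points of the two opposite sides (the feet of their common perpendicular) are identified; equivalently each side-pairing is the hyperbolic translation along the common perpendicular of the paired opposite sides. Here $\operatorname{csch}=1/\sinh$. *)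

theory Defs
  imports "HOL-Probability.Probability"
begin

definition csch :: "real \<Rightarrow> real" where
  "csch x = 1 / sinh x"

definition coth :: "real \<Rightarrow> real" where
  "coth x = cosh x / sinh x"


section \<open>The hyperbolic plane\<close>

text \<open>The distance of the complete metric of curvature \<open>-1\<close> on the open unit disk, that is, of
  the Riemannian metric \<open>2 |dz| / (1 - |z|^2)\<close>.  Only its values on \<open>ball 0 1\<close> matter.\<close>

definition hdist :: "complex \<Rightarrow> complex \<Rightarrow> real" where
  "hdist z w = arcosh (1 + 2 * (norm (z - w))\<^sup>2 / ((1 - (norm z)\<^sup>2) * (1 - (norm w)\<^sup>2)))"

definition geodesic_line :: "complex set \<Rightarrow> bool" where
  "geodesic_line L \<longleftrightarrow>
     (\<exists>\<gamma>::real \<Rightarrow> complex. range \<gamma> \<subseteq> ball 0 1 \<and> (\<forall>s t. hdist (\<gamma> s) (\<gamma> t) = \<bar>s - t\<bar>) \<and> L = range \<gamma>)"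

text \<open>The geodesic joining the two ideal points that make up \<open>E\<close>; the set \<open>E\<close> is always a
  two-element subset of the unit circle.\<close>

definition geodesic_with_ends :: "complex set \<Rightarrow> complex set" where
  "geodesic_with_ends E = (THE L. geodesic_line L \<and> closure L \<inter> sphere 0 1 = E)"

definition hyp_convex :: "complex set \<Rightarrow> bool" where
  "hyp_convex C \<longleftrightarrow> C \<subseteq> ball 0 1 \<and>
     (\<forall>x\<in>C. \<forall>y\<in>C. \<forall>z\<in>ball 0 1. hdist x z + hdist z y = hdist x y \<longrightarrow> z \<in> C)"

text \<open>An isometry of the disk preserves orientation iff it is holomorphic.  The values outside
  the disk are irrelevant.\<close>

definition orientation_preserving_isometry :: "(complex \<Rightarrow> complex) \<Rightarrow> bool" where
  "orientation_preserving_isometry g \<longleftrightarrow>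
     g ` ball 0 1 = ball 0 1 \<and> g holomorphic_on ball 0 1 \<and>
     (\<forall>z\<in>ball 0 1. \<forall>w\<in>ball 0 1. hdist (g z) (g w) = hdist z w)"

text \<open>Nontrivial translations along \<open>L\<close>.  The orientation-preserving isometries that map \<open>L\<close>
  to itself are the translations along \<open>L\<close> and the half-turns about points of \<open>L\<close>;
  the absence of fixed points excludes the half-turns and the identity.\<close>

definition translation_along :: "complex set \<Rightarrow> (complex \<Rightarrow> complex) \<Rightarrow> bool" where
  "translation_along L g \<longleftrightarrow>
     geodesic_line L \<and> orientation_preserving_isometry g \<and> g ` L = L \<and> (\<forall>z\<in>ball 0 1. g z \<noteq> z)"

text \<open>For disjoint geodesics without common ideal endpoint, \<open>p\<close> and \<open>q\<close> are the feet of the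
  common perpendicular.\<close>

definition closest_points :: "complex set \<Rightarrow> complex set \<Rightarrow> complex \<Rightarrow> complex \<Rightarrow> bool" where
  "closest_points A B p q \<longleftrightarrow> p \<in> A \<and> q \<in> B \<and> (\<forall>x\<in>A. \<forall>y\<in>B. hdist p q \<le> hdist x y)"


section \<open>Ideal quadrilaterals and their side pairings\<close>

text \<open>Throughout, \<open>V\<close> is the set of the four ideal vertices.\<close>

definition ideal_vertices :: "complex set \<Rightarrow> bool" where
  "ideal_vertices V \<longleftrightarrow> V \<subseteq> sphere 0 1 \<and> card V = 4"

text \<open>The convex hull of a set of ideal points is the smallest convex subset of the disk that
  contains all geodesics joining two of them.\<close>

definition ideal_hull :: "complex set \<Rightarrow> complex set" where
  "ideal_hull V = hyp_convex hull (\<Union>E\<in>{E. E \<subseteq> V \<and> card E = 2}. geodesic_with_ends E)"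

text \<open>A side is given by its pair \<open>E\<close> of ideal endpoints; the two diagonals are excluded because
  they meet the interior.  The side opposite to \<open>E\<close> is \<open>V - E\<close>.\<close>

definition sides :: "complex set \<Rightarrow> complex set set" where
  "sides V = {E. E \<subseteq> V \<and> card E = 2 \<and> geodesic_with_ends E \<subseteq> frontier (ideal_hull V)}"

definition side_pairing :: "complex set \<Rightarrow> complex set \<Rightarrow> (complex \<Rightarrow> complex) \<Rightarrow> bool" where
  "side_pairing V E g \<longleftrightarrow> E \<in> sides V \<and>
     g ` geodesic_with_ends E = geodesic_with_ends (V - E) \<and>
     (\<exists>p q L. closest_points (geodesic_with_ends E) (geodesic_with_ends (V - E)) p q \<and>
        p \<in> L \<and> q \<in> L \<and> translation_along L g \<and> g p = q)"


section \<open>The rectangular punctured torus\<close>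

text \<open>This relation is symmetric: each pair of opposite sides is taken in both orders, with
  mutually inverse pairings.\<close>

definition glued :: "complex set \<Rightarrow> (complex \<times> complex) set" where
  "glued V = {(x, y). x \<in> ideal_hull V \<and> y \<in> ideal_hull V \<and>
     (x = y \<or> (\<exists>E g. side_pairing V E g \<and> x \<in> geodesic_with_ends E \<and> y = g x))}"

definition torus_points :: "complex set \<Rightarrow> complex set set" where
  "torus_points V = ideal_hull V // glued V"

text \<open>The quotient metric: the infimum of the lengths of chains
  \<open>x 0, y 0, x 1, y 1, \<dots>, x n, y n\<close> from one class to the other, in which \<open>y i\<close> is identified
  with \<open>x (i + 1)\<close>.  As the quadrilateral is convex, \<open>hdist\<close> is its own path metric, so this is
  the path metric of the glued surface.\<close>

definition torus_dist :: "complex set \<Rightarrow> complex set \<Rightarrow> complex set \<Rightarrow> real" where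
  "torus_dist V A B = Inf {\<Sum>i\<le>n. hdist (x i) (y i) | (n::nat) x y.
     x 0 \<in> A \<and> y n \<in> B \<and> (\<forall>i\<le>n. x i \<in> ideal_hull V \<and> y i \<in> ideal_hull V) \<and>
     (\<forall>i<n. (y i, x (Suc i)) \<in> glued V)}"

text \<open>A closed geodesic of length \<open>l\<close> in a set \<open>T\<close> with metric \<open>d\<close>, parametrized by arc length:
  an \<open>l\<close>-periodic curve that is locally distance-realizing, including at the point where it
  closes up.\<close>

definition closed_geodesic :: "'a set \<Rightarrow> ('a \<Rightarrow> 'a \<Rightarrow> real) \<Rightarrow> real \<Rightarrow> (real \<Rightarrow> 'a) \<Rightarrow> bool" where
  "closed_geodesic T d l c \<longleftrightarrow> 0 < l \<and> (\<forall>t. c t \<in> T) \<and> (\<forall>t. c (t + l) = c t) \<and>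
     (\<forall>t. \<exists>e>0. \<forall>r\<in>ball t e. \<forall>s\<in>ball t e. d (c r) (c s) = \<bar>r - s\<bar>)"

text \<open>Four independent uniform points on the circle are almost surely distinct; the value 0 in
  the degenerate case is a convention on a null set.  \<open>LEAST\<close> requires the minimum to be attained.\<close>

definition shortest_geodesic_length :: "complex set \<Rightarrow> real" where
  "shortest_geodesic_length V =
     (if ideal_vertices V
      then (LEAST l. \<exists>c. closed_geodesic (torus_points V) (torus_dist V) l c) else 0)"


section \<open>Probability\<close>

definition uniform_circle :: "complex measure" where
  "uniform_circle = distr (uniform_measure lborel {0..2 * pi}) borel cis"

definition is_median :: "'a measure \<Rightarrow> ('a \<Rightarrow> real) \<Rightarrow> real \<Rightarrow> bool" where
  "is_median M X m \<longleftrightarrow>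
     measure M {\<omega> \<in> space M. X \<omega> \<le> m} \<ge> 1/2 \<and> measure M {\<omega> \<in> space M. X \<omega> \<ge> m} \<ge> 1/2"

end

theory Submission
  imports Defs "HOL-Complex_Analysis.Complex_Analysis" "HOL-Real_Asymp.Real_Asymp"
begin

text \<open>In the hyperboloid model, scale the null vectors of the four vertices so that
  \<open>V1 + V3 = V2 + V4\<close>.  In the orthonormal frame adapted to the two symmetry axes the quadrilateral is
  then the rectangle \<open>|x1| \<le> c x0, |x2| \<le> s x0\<close> with \<open>c\<^sup>2 + s\<^sup>2 = 1\<close>, and the side pairings change
  the sign of \<open>x1\<close> or of \<open>x2\<close> on the boundary.  Functions on the rectangle that are 1-Lipschitz and
  compatible with the pairings bound the distance of the torus from below.  They show that the two
  core curves, of lengths \<open>2 arsinh (c / s)\<close> and \<open>2 arsinh (s / c)\<close>, are closed geodesics, and that a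
  closed geodesic that meets both an axis and a side parallel to it is at least as long as the shorter
  one.  A closed geodesic of any other kind would attain a maximum of \<open>x0 - \<kappa> |x1| - \<kappa>' |x2|\<close> for
  suitable \<open>\<kappa> \<in> {0, c}\<close> and \<open>\<kappa>' \<in> {0, s}\<close>, which contradicts the convexity of this function along
  geodesics.  The length thus depends only on the smaller of \<open>c / s\<close> and \<open>s / c\<close>, hence on the cross ratio
  of the vertices.

  Four uniform points on the circle are four Cauchy variables in the Cayley coordinate.  A rotation
  moves one of them to infinity, and the cross ratio becomes a ratio of differences of the three others,
  whose density is elementary.  In the variable \<open>y = tanh (l / 2) \<le> 1 / \<surd>2\<close> the density of the length
  is squeezed between polynomials in \<open>y\<close> and \<open>ln y\<close>, which yields the numerical values.\<close>

section \<open>The hyperboloid model\<close>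

text \<open>The obstacle is that \<open>closed_geodesic\<close> speaks only of distances, in a
  quotient metric that is an infimum over chains: there is no covering map, no lift to the plane and
  no homotopy class to argue with. Lower bounds can therefore only come from functions on the
  quadrilateral, and upper bounds only from explicit short chains. The coefficients \<kappa> and
  \<kappa>' are dictated by the curve. With \<kappa> = \<open>c\<close> the function has a kink on
  the axis \<open>x1 = 0\<close>; with \<kappa> = 0 it folds along the sides
  \<open>|x1| = c x0\<close>, because the pairing does not preserve \<open>x0\<close>. A curve
  shorter than both core curves cannot meet both places, so one of the two choices is always
  harmless; likewise for \<open>x2\<close> and \<kappa>'. In the numerical part the variable
  \<open>y = tanh (l / 2)\<close> is chosen because \<open>l = 2 artanh y\<close> and the density
  both become power series whose terms are nonnegative, the logarithm entering only as
  \<open>- ln y >= 0\<close>. Partial sums are then lower bounds, and the bounds for the two factors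
  of the expectation can be multiplied.\<close>

declare mem_ball [simp del] mem_ball_0 [simp del]

definition mink :: "real \<times> complex \<Rightarrow> real \<times> complex \<Rightarrow> real" where
  "mink X Y = fst X * fst Y - snd X \<bullet> snd Y"

definition hyperboloid :: "(real \<times> complex) set" where
  "hyperboloid = {X. mink X X = 1 \<and> fst X > 0}"

text \<open>Inverse of \<open>hproj\<close>, the stereographic projection from
  \<open>(-1, 0)\<close>: the disk is the Poincare model of the upper sheet.\<close>

definition hlift :: "complex \<Rightarrow> real \<times> complex" where
  "hlift z = ((1 + (norm z)\<^sup>2) / (1 - (norm z)\<^sup>2), (2 / (1 - (norm z)\<^sup>2)) *\<^sub>R z)"

definition hproj :: "real \<times> complex \<Rightarrow> complex" where
  "hproj X = snd X /\<^sub>R (1 + fst X)"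

lemma mink_commute: "mink X Y = mink Y X"
  by (simp add: mink_def inner_commute mult.commute)

lemma mink_add_left [simp]: "mink (X + Y) Z = mink X Z + mink Y Z"
  and mink_add_right [simp]: "mink Z (X + Y) = mink Z X + mink Z Y"
  and mink_diff_left [simp]: "mink (X - Y) Z = mink X Z - mink Y Z"
  and mink_diff_right [simp]: "mink Z (X - Y) = mink Z X - mink Z Y"
  and mink_minus_left [simp]: "mink (- X) Z = - mink X Z"
  and mink_minus_right [simp]: "mink Z (- X) = - mink Z X"
  and mink_scaleR_left [simp]: "mink (r *\<^sub>R X) Z = r * mink X Z"
  and mink_scaleR_right [simp]: "mink Z (r *\<^sub>R X) = r * mink Z X"
  and mink_zero_left [simp]: "mink 0 Z = 0"
  and mink_zero_right [simp]: "mink Z 0 = 0"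
  by (simp_all add: mink_def inner_add_left inner_add_right inner_diff_left inner_diff_right algebra_simps)

lemma mink_self: "mink X X = (fst X)\<^sup>2 - (norm (snd X))\<^sup>2"
  by (simp add: mink_def power2_eq_square dot_square_norm)

lemma hyperboloid_norm_less: "X \<in> hyperboloid \<Longrightarrow> norm (snd X) < fst X"
  by (simp add: hyperboloid_def mink_self) (metis less_add_one le_less pos_add_strict power2_less_imp_less diff_eq_eq add.commute)

lemma mink_pos:
  assumes "norm (snd X) < fst X" "norm (snd Y) \<le> fst Y" "Y \<noteq> 0"
  shows "mink X Y > 0"
proof -
  have Y: "fst Y > 0"
    using assms by (metis norm_ge_zero order.trans prod_eq_iff fst_zero snd_zero norm_le_zero_iff antisym_conv2 not_le)
  have "snd X \<bullet> snd Y \<le> norm (snd X) * norm (snd Y)" by (rule norm_cauchy_schwarz)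
  also have "\<dots> \<le> norm (snd X) * fst Y" using assms by (simp add: mult_left_mono)
  also have "\<dots> < fst X * fst Y" using assms Y by simp
  finally show ?thesis by (simp add: mink_def)
qed

lemma mink_hyperboloid_pos: "X \<in> hyperboloid \<Longrightarrow> Y \<in> hyperboloid \<Longrightarrow> mink X Y > 0"
  by (rule mink_pos) (auto simp: hyperboloid_norm_less less_imp_le hyperboloid_def)

text \<open>The orthogonal complement of a timelike vector is negative definite: Cauchy-Schwarz for
  the complex parts, with \<open>norm (snd Y) < fst Y\<close>, makes \<open>|fst W|\<close> smaller
  than \<open>norm (snd W)\<close> unless \<open>W = 0\<close>. Equality of two vectors is
  afterwards proved by showing that their difference is null and orthogonal to a point.\<close>

lemma mink_orthogonal:
  assumes Y: "Y \<in> hyperboloid" and 0: "mink W Y = 0"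
  shows "mink W W \<le> 0" "mink W W = 0 \<Longrightarrow> W = 0"
proof -
  have y: "norm (snd Y) < fst Y" "fst Y > 0"
    using Y hyperboloid_norm_less by (auto simp: hyperboloid_def)
  have "\<bar>fst W\<bar> * fst Y = \<bar>snd W \<bullet> snd Y\<bar>"
    using 0 y by (simp add: mink_def abs_mult) (metis abs_mult abs_of_pos)
  also have "\<dots> \<le> norm (snd W) * norm (snd Y)" by (rule Cauchy_Schwarz_ineq2)
  finally have *: "\<bar>fst W\<bar> * fst Y \<le> norm (snd W) * norm (snd Y)" .
  have le: "\<bar>fst W\<bar> < norm (snd W) \<or> (fst W = 0 \<and> snd W = 0)"
  proof (cases "snd W = 0")
    case True
    with * y show ?thesis by (simp add: mult_le_0_iff)
  next
    case False
    then have "norm (snd W) * norm (snd Y) < norm (snd W) * fst Y" using y by simp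
    with * have "\<bar>fst W\<bar> * fst Y < norm (snd W) * fst Y" by linarith
    then show ?thesis using y by simp
  qed
  then have "(fst W)\<^sup>2 < (norm (snd W))\<^sup>2 \<or> (fst W = 0 \<and> snd W = 0)"
    by (metis abs_ge_zero power2_abs power_strict_mono zero_less_numeral)
  then show "mink W W \<le> 0" "mink W W = 0 \<Longrightarrow> W = 0"
    by (auto simp: mink_self prod_eq_iff)
qed

text \<open>Reversed Cauchy-Schwarz: the component \<open>W\<close> of \<open>X\<close> orthogonal
  to \<open>Y\<close> has \<open>mink W W = 1 - (mink X Y)^2\<close>, and this is at most 0.\<close>

lemma mink_ge_1:
  assumes "X \<in> hyperboloid" "Y \<in> hyperboloid"
  shows "mink X Y \<ge> 1" "mink X Y = 1 \<Longrightarrow> X = Y"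
proof -
  define W where "W = X - mink X Y *\<^sub>R Y"
  have 1: "mink X X = 1" "mink Y Y = 1" using assms by (auto simp: hyperboloid_def)
  have "mink W Y = 0" by (simp add: W_def 1)
  note o = mink_orthogonal[OF assms(2) this]
  have ww: "mink W W = 1 - (mink X Y)\<^sup>2"
    by (simp add: W_def 1 mink_commute[of Y X] power2_eq_square algebra_simps)
  then show "mink X Y \<ge> 1"
    using power2_le_imp_le[of 1 "mink X Y"] o(1) mink_hyperboloid_pos[OF assms] by simp
  show "X = Y" if "mink X Y = 1"
    using o(2) ww that by (simp add: W_def)
qed

text \<open>One positive pairing with a known point decides the sheet: if \<open>X\<close> were on
  the lower sheet, \<open>- X\<close> would be a point, and points pair positively.\<close>

lemma hyperboloidI:
  assumes "mink X X = 1" "mink X P > 0" "P \<in> hyperboloid"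
  shows "X \<in> hyperboloid"
proof (rule ccontr)
  assume "X \<notin> hyperboloid"
  then have "fst X \<le> 0" using assms by (simp add: hyperboloid_def)
  moreover have "(norm (snd X))\<^sup>2 < (fst X)\<^sup>2" using assms by (simp add: mink_self)
  ultimately have "norm (snd (- X)) < fst (- X)"
    using power2_less_imp_less[of "norm (snd X)" "- fst X"] by simp
  then have "0 < fst (- X)" using norm_ge_zero[of "snd (- X)"] by linarith
  then have "- X \<in> hyperboloid" using assms(1) by (simp add: hyperboloid_def)
  from mink_hyperboloid_pos[OF this assms(3)] assms(2) show False by simp
qed

lemma ball_norm: "z \<in> ball 0 1 \<Longrightarrow> (norm (z::complex))\<^sup>2 < 1"
  by (simp add: mem_ball_0 power_less_one_iff)

lemma hlift_in [simp]: "z \<in> ball 0 1 \<Longrightarrow> hlift z \<in> hyperboloid"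
proof -
  assume "z \<in> ball 0 1"
  then have z: "(norm z)\<^sup>2 < 1" by (rule ball_norm)
  have "((1 + a) / (1 - a))\<^sup>2 - (2 / (1 - a))\<^sup>2 * a = 1" if "a < 1" for a :: real
    using that by (simp add: power_divide divide_simps) (simp add: power2_eq_square algebra_simps)
  from this[OF z] have "((1 + (norm z)\<^sup>2) / (1 - (norm z)\<^sup>2))\<^sup>2 - (2 / (1 - (norm z)\<^sup>2) * norm z)\<^sup>2 = 1"
    by (simp add: power_mult_distrib power_divide)
  with z show ?thesis
    by (auto simp: hyperboloid_def mink_self hlift_def power_mult_distrib intro!: divide_pos_pos add_pos_nonneg)
qed

lemma hlift_self [simp]: "z \<in> ball 0 1 \<Longrightarrow> mink (hlift z) (hlift z) = 1"
  using hlift_in by (simp add: hyperboloid_def)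

lemma hproj_hlift [simp]: "z \<in> ball 0 1 \<Longrightarrow> hproj (hlift z) = z"
proof -
  assume "z \<in> ball 0 1"
  then have z: "(norm z)\<^sup>2 < 1" by (rule ball_norm)
  then have "1 + (1 + (norm z)\<^sup>2) / (1 - (norm z)\<^sup>2) = 2 / (1 - (norm z)\<^sup>2)" by (simp add: field_simps)
  moreover have "inverse (2 / (1 - (norm z)\<^sup>2)) * (2 / (1 - (norm z)\<^sup>2)) = 1"
    using z by (intro left_inverse) auto
  ultimately show ?thesis by (simp only: hproj_def hlift_def fst_conv snd_conv scaleR_scaleR scaleR_one)
qed

lemma hproj_in [simp]: "X \<in> hyperboloid \<Longrightarrow> hproj X \<in> ball 0 1"
  and hlift_hproj [simp]: "X \<in> hyperboloid \<Longrightarrow> hlift (hproj X) = X"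
proof -
  assume X: "X \<in> hyperboloid"
  note n = hyperboloid_norm_less[OF X]
  have f: "fst X > 0" and "(fst X)\<^sup>2 - (norm (snd X))\<^sup>2 = 1" using X by (auto simp: hyperboloid_def mink_self)
  then have e: "(norm (snd X))\<^sup>2 = (fst X + 1) * (fst X - 1)" by (simp add: algebra_simps power2_eq_square)
  have np: "(norm (hproj X))\<^sup>2 = (fst X - 1) / (fst X + 1)"
    using f by (simp add: hproj_def power_mult_distrib e power_divide divide_simps) (simp add: power2_eq_square algebra_simps)
  show "hproj X \<in> ball 0 1" using n f by (simp add: mem_ball_0 hproj_def field_simps)
  have d: "1 - (norm (hproj X))\<^sup>2 = 2 / (1 + fst X)" "1 + (norm (hproj X))\<^sup>2 = 2 * fst X / (1 + fst X)"
    using f by (simp_all add: np divide_simps)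
  show "hlift (hproj X) = X"
  proof -
    have *: "2 / (2 / y) * inverse y = 1" "2 * x / y / (2 / y) = x" if "y > 0" for x y :: real using that by auto
    have p: "1 + fst X > 0" using f by simp
    show ?thesis unfolding hlift_def d unfolding hproj_def scaleR_scaleR *[OF p] by simp
  qed
qed

lemma hlift_inject: "z \<in> ball 0 1 \<Longrightarrow> w \<in> ball 0 1 \<Longrightarrow> hlift z = hlift w \<longleftrightarrow> z = w"
  by (metis hproj_hlift)

lemma mink_hlift:
  assumes "z \<in> ball 0 1" "w \<in> ball 0 1"
  shows "mink (hlift z) (hlift w) = 1 + 2 * (norm (z - w))\<^sup>2 / ((1 - (norm z)\<^sup>2) * (1 - (norm w)\<^sup>2))"
proof -
  have zw: "(norm z)\<^sup>2 < 1" "(norm w)\<^sup>2 < 1" using assms ball_norm by auto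
  have "(norm (z - w))\<^sup>2 = (norm z)\<^sup>2 + (norm w)\<^sup>2 - 2 * (z \<bullet> w)"
    by (simp add: power2_norm_eq_inner inner_diff_left inner_diff_right inner_commute)
  then have e: "2 * (norm (z - w))\<^sup>2 = 2 * (norm z)\<^sup>2 + 2 * (norm w)\<^sup>2 - 4 * (z \<bullet> w)" by simp
  have nz: "1 - (norm z)\<^sup>2 \<noteq> 0" "1 - (norm w)\<^sup>2 \<noteq> 0" using zw by auto
  have "(2 - A) / A * ((2 - B) / B) - 2 / A * (2 / B * i)
      = 1 + (2 * (1 - A) + 2 * (1 - B) - 4 * i) / (A * B)" if "A \<noteq> 0" "B \<noteq> 0" for A B i :: real
    using that by (simp add: field_simps)
  from this[OF nz, of "z \<bullet> w"] show ?thesis unfolding e by (simp add: mink_def hlift_def mult.commute)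
qed

lemma hdist_mink:
  assumes "z \<in> ball 0 1" "w \<in> ball 0 1"
  shows "hdist z w = arcosh (mink (hlift z) (hlift w))"
  by (simp add: hdist_def mink_hlift[OF assms])

lemma cosh_hdist:
  assumes "z \<in> ball 0 1" "w \<in> ball 0 1"
  shows "cosh (hdist z w) = mink (hlift z) (hlift w)"
  using assms by (simp add: hdist_mink mink_ge_1(1))

lemma hdist_nonneg:
  assumes "z \<in> ball 0 1" "w \<in> ball 0 1"
  shows "hdist z w \<ge> 0"
  using mink_ge_1(1)[of "hlift z" "hlift w"] assms by (simp add: hdist_mink arcosh_nonneg_real)

lemma hdist_commute: "hdist z w = hdist w z"
  by (simp add: hdist_def norm_minus_commute mult.commute)

lemma hdist_eqI:
  assumes "z \<in> ball 0 1" "w \<in> ball 0 1" "d \<ge> 0" "mink (hlift z) (hlift w) = cosh d"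
  shows "hdist z w = d"
  using assms by (simp add: hdist_mink arcosh_cosh_real)

lemma hdist_leI:
  assumes "z \<in> ball 0 1" "w \<in> ball 0 1" "d \<ge> 0" "mink (hlift z) (hlift w) \<le> cosh d"
  shows "hdist z w \<le> d"
  using assms by (metis cosh_hdist cosh_real_nonneg_le_iff hdist_nonneg)

lemma hdist_geI:
  assumes "z \<in> ball 0 1" "w \<in> ball 0 1" "mink (hlift z) (hlift w) \<ge> cosh d"
  shows "hdist z w \<ge> d"
proof (cases "d \<ge> 0")
  case True
  then show ?thesis using assms by (metis cosh_hdist cosh_real_nonneg_le_iff hdist_nonneg)
next
  case False
  then show ?thesis using assms hdist_nonneg by (smt (verit))
qed

lemma hdist_eq_0:
  assumes "z \<in> ball 0 1" "w \<in> ball 0 1"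
  shows "hdist z w = 0 \<longleftrightarrow> z = w"
  by (metis assms cosh_0 cosh_hdist hdist_eqI hlift_in hlift_inject hlift_self mink_ge_1(2) order_refl)

lemma mink_orthogonal_Cauchy_Schwarz:
  assumes Y: "Y \<in> hyperboloid" and "mink U Y = 0" "mink W Y = 0"
  shows "(mink U W)\<^sup>2 \<le> mink U U * mink W W"
proof (cases "W = 0")
  case False
  then have w: "mink W W < 0" using mink_orthogonal[OF Y assms(3)] by linarith
  define T where "T = U - (mink U W / mink W W) *\<^sub>R W"
  have "mink T T \<le> 0" by (rule mink_orthogonal[OF Y]) (simp add: T_def assms)
  moreover have "mink T T = mink U U - (mink U W)\<^sup>2 / mink W W"
    using w by (simp add: T_def mink_commute[of W U] power2_eq_square field_simps)
  ultimately have "mink U U \<le> (mink U W)\<^sup>2 / mink W W" by simp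
  then show ?thesis using w by (simp add: neg_le_divide_eq)
qed simp

text \<open>The law of cosines at the middle point \<open>Y\<close>: \<open>mink X Z\<close> is
  \<open>cosh a * cosh b\<close> plus the pairing of the components orthogonal to \<open>Y\<close>,
  which Cauchy-Schwarz bounds by \<open>sinh a * sinh b\<close>.\<close>

lemma mink_triangle:
  assumes "X \<in> hyperboloid" "Y \<in> hyperboloid" "Z \<in> hyperboloid"
    and "mink X Y = cosh a" "mink Y Z = cosh b" "a \<ge> 0" "b \<ge> 0"
  shows "mink X Z \<le> cosh (a + b)"
proof -
  have 1: "mink X X = 1" "mink Y Y = 1" "mink Z Z = 1" using assms by (auto simp: hyperboloid_def)
  define U W where "U = X - cosh a *\<^sub>R Y" and "W = Z - cosh b *\<^sub>R Y"
  have m: "mink Y X = cosh a" "mink Z Y = cosh b" using assms(4,5) by (simp_all add: mink_commute)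
  have o: "mink U Y = 0" "mink W Y = 0" using assms 1 m by (simp_all add: U_def W_def)
  have "mink U U = 1 - (cosh a)\<^sup>2" "mink W W = 1 - (cosh b)\<^sup>2"
    using assms(4,5) 1 m by (simp_all add: U_def W_def power2_eq_square algebra_simps)
  then have "mink U U = - (sinh a)\<^sup>2" "mink W W = - (sinh b)\<^sup>2" by (simp_all add: cosh_square_eq)
  then have "mink U U * mink W W = (sinh a * sinh b)\<^sup>2" by (simp add: power_mult_distrib)
  then have "(mink U W)\<^sup>2 \<le> (sinh a * sinh b)\<^sup>2"
    using mink_orthogonal_Cauchy_Schwarz[OF assms(2) o] by simp
  then have "mink U W \<le> sinh a * sinh b"
    using assms by (meson mult_nonneg_nonneg power2_le_imp_le sinh_real_nonneg_iff)
  moreover have "mink U W = mink X Z - cosh a * cosh b"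
    using assms 1 m by (simp add: U_def W_def algebra_simps)
  ultimately show ?thesis by (simp add: cosh_add)
qed

lemma hdist_triangle:
  assumes "x \<in> ball 0 1" "y \<in> ball 0 1" "z \<in> ball 0 1"
  shows "hdist x z \<le> hdist x y + hdist y z"
  using assms by (intro hdist_leI mink_triangle[where Y = "hlift y"]) (simp_all add: cosh_hdist hdist_nonneg)

text \<open>The equality case of the triangle inequality. The difference \<open>W\<close> of the two
  sides is null and orthogonal to \<open>hlift z\<close>, hence 0.\<close>

lemma hdist_between:
  assumes "x \<in> ball 0 1" "y \<in> ball 0 1" "z \<in> ball 0 1" "hdist x z + hdist z y = hdist x y"
  shows "sinh (hdist x y) *\<^sub>R hlift z = sinh (hdist z y) *\<^sub>R hlift x + sinh (hdist x z) *\<^sub>R hlift y"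
proof -
  define a b where ab: "a = hdist x z" "b = hdist z y"
  have c: "hdist x y = a + b" using assms ab by simp
  define W where "W = sinh b *\<^sub>R hlift x + sinh a *\<^sub>R hlift y - sinh (a + b) *\<^sub>R hlift z"
  have m': "mink (hlift x) (hlift z) = cosh a" "mink (hlift z) (hlift y) = cosh b"
    "mink (hlift x) (hlift y) = cosh (a + b)"
    unfolding c[symmetric] unfolding ab by (simp_all only: cosh_hdist[OF assms(1,2)] cosh_hdist[OF assms(1,3)] cosh_hdist[OF assms(3,2)])
  note m = m' m'(1)[unfolded mink_commute[of "hlift x"]] m'(2)[unfolded mink_commute[of "hlift z"]]
    m'(3)[unfolded mink_commute[of "hlift x"]]
  have 1: "mink (hlift x) (hlift x) = 1" "mink (hlift y) (hlift y) = 1" "mink (hlift z) (hlift z) = 1"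
    using assms by auto
  have "mink W (hlift z) = 0" by (simp add: W_def m 1 sinh_add)
  moreover have "mink W W = 0"
  proof -
    have "mink W W = (sinh b)\<^sup>2 + (sinh a)\<^sup>2 + (sinh (a + b))\<^sup>2 + 2 * sinh a * sinh b * cosh (a + b)
       - 2 * sinh (a + b) * (sinh b * cosh a + sinh a * cosh b)"
      by (simp add: W_def m 1 power2_eq_square algebra_simps)
    also have "\<dots> = (sinh b)\<^sup>2 + (sinh a)\<^sup>2 + 2 * sinh a * sinh b * (cosh a * cosh b + sinh a * sinh b)
       - (sinh a * cosh b + cosh a * sinh b)\<^sup>2"
      by (simp add: sinh_add cosh_add power2_eq_square algebra_simps)
    also have "\<dots> = (sinh b)\<^sup>2 + (sinh a)\<^sup>2 + 2 * (sinh a)\<^sup>2 * (sinh b)\<^sup>2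
       - ((sinh a)\<^sup>2 * (cosh b)\<^sup>2 + (cosh a)\<^sup>2 * (sinh b)\<^sup>2)"
      by (simp add: power2_eq_square algebra_simps)
    also have "\<dots> = 0" by (simp add: cosh_square_eq algebra_simps)
    finally show ?thesis .
  qed
  ultimately have "W = 0" using mink_orthogonal(2) assms hlift_in by blast
  then show ?thesis by (simp add: W_def c flip: ab)
qed

lemma mink_combination_between:
  assumes "x \<in> ball 0 1" "y \<in> ball 0 1" "z \<in> ball 0 1" "s \<ge> 0" "t \<ge> 0"
    and z: "hlift z = s *\<^sub>R hlift x + t *\<^sub>R hlift y"
  shows "hdist x z + hdist z y = hdist x y"
proof -
  define c where "c = hdist x y"
  define C where "C = cosh c"
  have c0: "c \<ge> 0" using assms by (simp add: c_def hdist_nonneg)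
  have m: "mink (hlift x) (hlift y) = C" "mink (hlift y) (hlift x) = C"
    using cosh_hdist[OF assms(1,2)] by (simp_all add: c_def C_def mink_commute)
  have "mink (hlift z) (hlift z) = s\<^sup>2 + t\<^sup>2 + 2 * s * t * C"
    unfolding z using hlift_self[OF assms(1)] hlift_self[OF assms(2)]
    by (simp add: m power2_eq_square algebra_simps)
  then have 1: "s\<^sup>2 + t\<^sup>2 + 2 * s * t * C = 1" using hlift_self[OF assms(3)] by simp
  define a b where ab: "a = hdist x z" "b = hdist z y"
  have ab0: "a \<ge> 0" "b \<ge> 0" using assms by (auto simp: ab hdist_nonneg)
  have ca: "cosh a = s + t * C" "cosh b = s * C + t"
    using m hlift_self[OF assms(1)] hlift_self[OF assms(2)] by (simp_all add: ab cosh_hdist[OF assms(1,3)] cosh_hdist[OF assms(3,2)] z)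
  have C2: "(sinh c)\<^sup>2 = C\<^sup>2 - 1" by (simp add: C_def sinh_square_eq)
  have "(sinh a)\<^sup>2 = (cosh a)\<^sup>2 - (s\<^sup>2 + t\<^sup>2 + 2 * s * t * C)" by (simp add: 1 sinh_square_eq)
  also have "\<dots> = (t * sinh c)\<^sup>2" unfolding ca power_mult_distrib C2 by (simp add: power2_eq_square algebra_simps)
  finally have sa: "sinh a = t * sinh c" using ab0 c0 assms by (simp add: power2_eq_iff_nonneg)
  have "(sinh b)\<^sup>2 = (cosh b)\<^sup>2 - (s\<^sup>2 + t\<^sup>2 + 2 * s * t * C)" by (simp add: 1 sinh_square_eq)
  also have "\<dots> = (s * sinh c)\<^sup>2" unfolding ca power_mult_distrib C2 by (simp add: power2_eq_square algebra_simps)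
  finally have sb: "sinh b = s * sinh c" using ab0 c0 assms by (simp add: power2_eq_iff_nonneg)
  have "cosh (a + b) = (s + t * C) * (s * C + t) + s * t * (sinh c)\<^sup>2"
    by (simp add: cosh_add ca sa sb power2_eq_square)
  also have "\<dots> = C * (s\<^sup>2 + t\<^sup>2 + 2 * s * t * C)" unfolding C2 by (simp add: power2_eq_square algebra_simps)
  finally have "cosh (a + b) = C" by (simp only: 1 mult_1_right)
  then have "a + b = c" using ab0 c0 arcosh_cosh_real[of "a + b"] arcosh_cosh_real[of c] by (simp add: C_def)
  then show ?thesis by (simp add: ab c_def)
qed

lemma hdist_between_iff:
  assumes "x \<in> ball 0 1" "y \<in> ball 0 1" "z \<in> ball 0 1"
  shows "hdist x z + hdist z y = hdist x y \<longleftrightarrow>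
     (\<exists>s\<ge>0. \<exists>t\<ge>0. hlift z = s *\<^sub>R hlift x + t *\<^sub>R hlift y)"
proof
  assume L: "hdist x z + hdist z y = hdist x y"
  show "\<exists>s\<ge>0. \<exists>t\<ge>0. hlift z = s *\<^sub>R hlift x + t *\<^sub>R hlift y"
  proof (cases "hdist x y = 0")
    case True
    then have "hdist x z = 0" using L hdist_nonneg assms by (smt (verit))
    then have "z = x" using hdist_eq_0 assms by blast
    then have "hlift z = 1 *\<^sub>R hlift x + 0 *\<^sub>R hlift y" by simp
    then show ?thesis by (metis zero_le_one order_refl)
  next
    case False
    then have p: "sinh (hdist x y) > 0" using hdist_nonneg[OF assms(1,2)] by simp
    have "hlift z = inverse (sinh (hdist x y)) *\<^sub>R (sinh (hdist x y) *\<^sub>R hlift z)" using p by simp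
    also have "\<dots> = (sinh (hdist z y) / sinh (hdist x y)) *\<^sub>R hlift x + (sinh (hdist x z) / sinh (hdist x y)) *\<^sub>R hlift y"
      unfolding hdist_between[OF assms L] by (simp add: scaleR_add_right divide_inverse mult.commute)
    finally show ?thesis using p hdist_nonneg assms
      by (metis divide_nonneg_pos sinh_real_nonneg_iff)
  qed
qed (use mink_combination_between assms in blast)

lemma cosh_abs_real: "cosh \<bar>x\<bar> = cosh (x::real)"
  by (cases "x \<ge> 0") auto

text \<open>For a unit spacelike \<open>N\<close>, \<open>arsinh (mink N (hlift x))\<close> is the
  signed distance of \<open>x\<close> to the geodesic orthogonal to \<open>N\<close>. The feet of
  the perpendiculars are the vectors in \<open>key\<close>; that two feet pair to at least 1 is the
  inequality \<open>mink X Y >= cosh (a - b)\<close>. Nearly all Lipschitz bounds for the torus come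
  from here.\<close>

lemma arsinh_mink_Lipschitz:
  assumes N: "mink N N = -1" and "x \<in> ball 0 1" "y \<in> ball 0 1"
  shows "\<bar>arsinh (mink N (hlift x)) - arsinh (mink N (hlift y))\<bar> \<le> hdist x y"
proof -
  define X Y a b where d: "X = hlift x" "Y = hlift y" "a = arsinh (mink N X)" "b = arsinh (mink N Y)"
  have s: "mink N X = sinh a" "mink N Y = sinh b" "mink X N = sinh a" "mink Y N = sinh b"
    by (simp_all add: d sinh_arsinh_real mink_commute[of _ N])
  have h: "X \<in> hyperboloid" "Y \<in> hyperboloid" using assms by (simp_all add: d)
  have 1: "mink X X = 1" "mink Y Y = 1" using assms by (simp_all add: d)
  have key: "(1 / cosh c) *\<^sub>R (Z + sinh c *\<^sub>R N) \<in> hyperboloid"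
    if Z: "Z \<in> hyperboloid" "mink N Z = sinh c" for Z c
  proof (rule hyperboloidI)
    define V where "V = Z + sinh c *\<^sub>R N"
    have ZZ: "mink Z Z = 1" "mink Z N = sinh c" using Z by (auto simp: hyperboloid_def mink_commute)
    have "mink V V = 1 + (sinh c)\<^sup>2" by (simp add: V_def Z ZZ N power2_eq_square)
    then have "mink V V = cosh c * cosh c" by (simp add: cosh_square_eq flip: power2_eq_square)
    then show "mink ((1 / cosh c) *\<^sub>R V) ((1 / cosh c) *\<^sub>R V) = 1" by simp
    have "mink V Z = 1 + sinh c * sinh c" by (simp add: V_def Z ZZ)
    also have "\<dots> > 0" by (intro add_pos_nonneg) auto
    finally show "mink ((1 / cosh c) *\<^sub>R V) Z > 0" by simp
  qed (fact Z)
  define X' Y' where X': "X' = X + sinh a *\<^sub>R N" and Y': "Y' = Y + sinh b *\<^sub>R N"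
  have "mink ((1 / cosh a) *\<^sub>R X') ((1 / cosh b) *\<^sub>R Y') \<ge> 1"
    unfolding X' Y' by (intro mink_ge_1 key h s)
  moreover have "mink X' Y' = mink X Y + sinh a * sinh b"
    by (simp add: X' Y' s N)
  ultimately have "mink X Y + sinh a * sinh b \<ge> cosh a * cosh b"
    by (simp add: le_divide_eq mult.commute)
  then have "mink X Y \<ge> cosh (a - b)" by (simp add: cosh_diff)
  then have "mink X Y \<ge> cosh \<bar>a - b\<bar>" by (simp add: cosh_abs_real)
  then show ?thesis using hdist_geI assms d by simp
qed

lemma continuous_on_mink [continuous_intros]:
  assumes "continuous_on A f" "continuous_on A g"
  shows "continuous_on A (\<lambda>x. mink (f x) (g x))"
  unfolding mink_def by (intro continuous_intros assms)

lemma continuous_on_hlift [continuous_intros]: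
  assumes "continuous_on A f" "f ` A \<subseteq> ball 0 1"
  shows "continuous_on A (\<lambda>x. hlift (f x))"
proof -
  have "1 - (norm (f x))\<^sup>2 \<noteq> 0" if "x \<in> A" for x
    using ball_norm[of "f x"] that assms(2) by auto
  then show ?thesis unfolding hlift_def by (intro continuous_intros assms) auto
qed

text \<open>The unit speed geodesic through \<open>hproj P\<close> with tangent vector \<open>U\<close>.\<close>

definition hline :: "real \<times> complex \<Rightarrow> real \<times> complex \<Rightarrow> real \<Rightarrow> complex" where
  "hline P U t = hproj (cosh t *\<^sub>R P + sinh t *\<^sub>R U)"

definition hline_frame :: "real \<times> complex \<Rightarrow> real \<times> complex \<Rightarrow> bool" where
  "hline_frame P U \<longleftrightarrow> P \<in> hyperboloid \<and> mink U U = -1 \<and> mink P U = 0"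

lemma hline_frame_in:
  assumes "hline_frame P U"
  shows "cosh t *\<^sub>R P + sinh t *\<^sub>R U \<in> hyperboloid"
proof (rule hyperboloidI)
  show P: "P \<in> hyperboloid" using assms by (simp add: hline_frame_def)
  then have *: "mink P P = 1" "mink U U = -1" "mink P U = 0" "mink U P = 0"
    using assms by (auto simp: hline_frame_def hyperboloid_def mink_commute[of U P])
  show "mink (cosh t *\<^sub>R P + sinh t *\<^sub>R U) (cosh t *\<^sub>R P + sinh t *\<^sub>R U) = 1"
    using hyperbolic_pythagoras[of t] by (simp add: * power2_eq_square algebra_simps)
  show "mink (cosh t *\<^sub>R P + sinh t *\<^sub>R U) P > 0" by (simp add: *)
qed

lemma hlift_hline:
  "hline_frame P U \<Longrightarrow> hlift (hline P U t) = cosh t *\<^sub>R P + sinh t *\<^sub>R U"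
  by (simp add: hline_def hline_frame_in)

lemma hline_in_ball: "hline_frame P U \<Longrightarrow> hline P U t \<in> ball 0 1"
  by (simp add: hline_def hline_frame_in)

lemma hdist_hline:
  assumes "hline_frame P U"
  shows "hdist (hline P U s) (hline P U t) = \<bar>s - t\<bar>"
proof (rule hdist_eqI)
  have *: "mink P P = 1" "mink U U = -1" "mink P U = 0" "mink U P = 0"
    using assms by (auto simp: hline_frame_def hyperboloid_def mink_commute[of U P])
  show "mink (hlift (hline P U s)) (hlift (hline P U t)) = cosh \<bar>s - t\<bar>"
    by (simp add: hlift_hline assms * cosh_diff cosh_abs_real)
qed (auto simp: assms hline_in_ball)

lemma geodesic_line_hline: "hline_frame P U \<Longrightarrow> geodesic_line (range (hline P U))"
  unfolding geodesic_line_def using hline_in_ball hdist_hline by blast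

text \<open>Any three points of an isometric curve satisfy the linear relation
  \<open>hdist_between\<close>, so \<open>\<gamma> 0\<close> and \<open>\<gamma> 1\<close> determine
  the whole curve. The three cases tell which of the parameters \<open>0\<close>, \<open>1\<close>,
  \<open>t\<close> lies in the middle.\<close>

lemma isometric_line_eq_hline:
  assumes b: "range \<gamma> \<subseteq> ball 0 1" and d: "\<And>s t. hdist (\<gamma> s) (\<gamma> t) = \<bar>s - t\<bar>"
  obtains U where "hline_frame (hlift (\<gamma> 0)) U" "\<And>t. \<gamma> t = hline (hlift (\<gamma> 0)) U t"
proof -
  define P where "P = hlift (\<gamma> 0)"
  define U where "U = (1 / sinh 1) *\<^sub>R (hlift (\<gamma> 1) - cosh 1 *\<^sub>R P)"
  have g: "\<gamma> t \<in> ball 0 1" for t using b by auto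
  have s1: "sinh (1::real) > 0" by simp
  have m: "mink (hlift (\<gamma> s)) (hlift (\<gamma> t)) = cosh \<bar>s - t\<bar>" for s t
    by (simp add: g d flip: cosh_hdist)
  have PP: "mink P P = 1" "mink P (hlift (\<gamma> 1)) = cosh 1" "mink (hlift (\<gamma> 1)) P = cosh 1"
    by (simp_all add: P_def m g)
  define W where "W = hlift (\<gamma> 1) - cosh 1 *\<^sub>R P"
  have "mink W W = 1 - (cosh 1)\<^sup>2" by (simp add: W_def PP g power2_eq_square)
  then have "mink W W = - (sinh 1 * sinh 1)" by (simp add: cosh_square_eq flip: power2_eq_square)
  moreover have "mink P W = 0" by (simp add: W_def PP)
  ultimately have fr: "hline_frame P U"
    using s1 unfolding hline_frame_def U_def W_def[symmetric] by (simp add: P_def g)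
  have G1: "hlift (\<gamma> 1) = cosh 1 *\<^sub>R P + sinh 1 *\<^sub>R U" using s1 by (simp add: U_def)
  have bt: "sinh (r - p) *\<^sub>R hlift (\<gamma> q) = sinh (r - q) *\<^sub>R hlift (\<gamma> p) + sinh (q - p) *\<^sub>R hlift (\<gamma> r)"
    if "p \<le> q" "q \<le> r" for p q r
    using hdist_between[OF g[of p] g[of r] g[of q]] that by (simp add: d abs_of_nonpos)
  have "hlift (\<gamma> t) = cosh t *\<^sub>R P + sinh t *\<^sub>R U" for t
  proof -
    consider "t < 0" | "0 \<le> t" "t \<le> 1" | "1 < t" by linarith
    then have "sinh 1 *\<^sub>R hlift (\<gamma> t) = sinh (1 - t) *\<^sub>R P + sinh t *\<^sub>R hlift (\<gamma> 1)"
    proof cases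
      case 1
      have "sinh (1 - t) *\<^sub>R P = sinh 1 *\<^sub>R hlift (\<gamma> t) + sinh (-t) *\<^sub>R hlift (\<gamma> 1)"
        using bt[of t 0 1] 1 by (simp add: P_def)
      then show ?thesis by simp
    next
      case 2
      show ?thesis using bt[of 0 t 1] 2 by (simp add: P_def)
    next
      case 3
      have "sinh t *\<^sub>R hlift (\<gamma> 1) = sinh (t - 1) *\<^sub>R P + sinh 1 *\<^sub>R hlift (\<gamma> t)"
        using bt[of 0 1 t] 3 by (simp add: P_def)
      moreover have "sinh (1 - t) = - sinh (t - 1)" by (metis minus_diff_eq sinh_minus)
      ultimately show ?thesis by simp
    qed
    also have "\<dots> = sinh 1 *\<^sub>R (cosh t *\<^sub>R P + sinh t *\<^sub>R U)"
      unfolding G1 by (simp add: sinh_diff algebra_simps)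
    finally show ?thesis using s1 by (metis real_vector.scale_left_imp_eq less_irrefl)
  qed
  then have "\<gamma> t = hline P U t" for t
    unfolding hline_def by (metis g hproj_hlift)
  with fr show ?thesis using that unfolding P_def by blast
qed

lemma geodesic_line_iff: "geodesic_line L \<longleftrightarrow> (\<exists>P U. hline_frame P U \<and> L = range (hline P U))"
proof
  assume "geodesic_line L"
  then obtain \<gamma> where g: "range \<gamma> \<subseteq> ball 0 1" "\<And>s t. hdist (\<gamma> s) (\<gamma> t) = \<bar>s - t\<bar>" "L = range \<gamma>"
    unfolding geodesic_line_def by blast
  from isometric_line_eq_hline[OF g(1,2)] obtain U where
    "hline_frame (hlift (\<gamma> 0)) U" "\<And>t. \<gamma> t = hline (hlift (\<gamma> 0)) U t" by blast
  then show "\<exists>P U. hline_frame P U \<and> L = range (hline P U)" using g(3) by (metis ext)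
qed (auto simp: geodesic_line_hline)

text \<open>Both lines are reparametrized to start at \<open>p\<close> and to run towards
  \<open>q\<close>; the initial direction is then an expression in \<open>p\<close> and
  \<open>q\<close>, the same for both.\<close>

lemma geodesic_line_unique:
  assumes "geodesic_line L" "geodesic_line L'" "p \<in> L \<inter> L'" "q \<in> L \<inter> L'" "p \<noteq> q"
  shows "L = L'"
proof -
  have pq: "hlift q = cosh (hdist p q) *\<^sub>R hlift p + sinh (hdist p q) *\<^sub>R V \<Longrightarrow>
     V = (1 / sinh (hdist p q)) *\<^sub>R (hlift q - cosh (hdist p q) *\<^sub>R hlift p)"
    if "sinh (hdist p q) \<noteq> 0" for V using that by simp
  have *: "\<exists>V. hline_frame (hlift p) V \<and> L = range (hline (hlift p) V) \<and> q = hline (hlift p) V (hdist p q) \<and> sinh (hdist p q) \<noteq> 0"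
    if L: "geodesic_line L" "p \<in> L" "q \<in> L" for L
  proof -
    obtain \<gamma> where g: "range \<gamma> \<subseteq> ball 0 1" "\<And>s t. hdist (\<gamma> s) (\<gamma> t) = \<bar>s - t\<bar>" "L = range \<gamma>"
      using L unfolding geodesic_line_def by blast
    obtain a b where ab: "p = \<gamma> a" "q = \<gamma> b" using L g by blast
    define e where "e = (if a \<le> b then 1 else (-1::real))"
    define \<delta> where "\<delta> t = \<gamma> (a + e * t)" for t
    have "range \<delta> \<subseteq> ball 0 1" using g by (auto simp: \<delta>_def)
    moreover have "hdist (\<delta> s) (\<delta> t) = \<bar>s - t\<bar>" for s t by (simp add: \<delta>_def g e_def abs_minus_commute)
    ultimately obtain U where U: "hline_frame (hlift (\<delta> 0)) U" "\<And>t. \<delta> t = hline (hlift (\<delta> 0)) U t"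
      using isometric_line_eq_hline by blast
    have "\<delta> 0 = p" by (simp add: \<delta>_def ab)
    moreover have "range \<delta> = L"
    proof -
      have "\<gamma> t = \<delta> (e * (t - a))" for t by (simp add: \<delta>_def e_def)
      then show ?thesis using g(3) by (auto simp: \<delta>_def)
    qed
    moreover have "q = \<delta> (hdist p q)" by (simp add: \<delta>_def ab g e_def abs_minus_commute)
    moreover have "hdist p q \<noteq> 0" using ab g assms(5) by (metis abs_eq_0 right_minus_eq)
    then have "sinh (hdist p q) \<noteq> 0" by simp
    ultimately show ?thesis using U by (metis ext)
  qed
  obtain V where V: "hline_frame (hlift p) V" "L = range (hline (hlift p) V)" "q = hline (hlift p) V (hdist p q)" "sinh (hdist p q) \<noteq> 0"
    using *[of L] assms by auto
  obtain W where W: "hline_frame (hlift p) W" "L' = range (hline (hlift p) W)" "q = hline (hlift p) W (hdist p q)"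
    using *[of L'] assms by auto
  have "V = W" using pq[OF V(4)] V W hlift_hline by metis
  then show ?thesis using V W by simp
qed

section \<open>Geodesics through their ideal endpoints\<close>

definition ideal :: "real \<times> complex \<Rightarrow> bool" where
  "ideal A \<longleftrightarrow> fst A > 0 \<and> mink A A = 0"

text \<open>The geodesic whose ideal endpoints are the directions of the null vectors \<open>A\<close> and \<open>B\<close>.\<close>

definition hgeo :: "real \<times> complex \<Rightarrow> real \<times> complex \<Rightarrow> complex set" where
  "hgeo A B = {z \<in> ball 0 1. \<exists>s>0. \<exists>t>0. hlift z = s *\<^sub>R A + t *\<^sub>R B}"

lemma ideal_norm: "ideal A \<Longrightarrow> norm (snd A) = fst A"
  by (simp add: ideal_def mink_self) (metis abs_norm_cancel abs_of_pos power2_eq_iff_nonneg less_imp_le norm_ge_zero)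

lemma hgeo_commute: "hgeo A B = hgeo B A"
  by (auto simp: hgeo_def add.commute) (metis add.commute)+

lemma hgeo_scale: "a > 0 \<Longrightarrow> hgeo (a *\<^sub>R A) B = hgeo A B"
proof -
  assume a: "a > 0"
  have "\<exists>s>0. \<exists>t>0. X = s *\<^sub>R A + t *\<^sub>R B" if "\<exists>s>0. \<exists>t>0. X = s *\<^sub>R a *\<^sub>R A + t *\<^sub>R B" for X
    using that a by (metis mult_pos_pos scaleR_scaleR)
  moreover have "\<exists>s>0. \<exists>t>0. X = s *\<^sub>R a *\<^sub>R A + t *\<^sub>R B" if "\<exists>s>0. \<exists>t>0. X = s *\<^sub>R A + t *\<^sub>R B" for X
  proof -
    from that obtain s t where "s > 0" "t > 0" "X = (s / a) *\<^sub>R a *\<^sub>R A + t *\<^sub>R B" using a by auto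
    then show ?thesis using a by (metis divide_pos_pos)
  qed
  ultimately show ?thesis unfolding hgeo_def by blast
qed

text \<open>The normalization \<open>mink A B = 2\<close> turns half the sum and half the difference
  of two null vectors into a point and a unit tangent vector there. A point of the geodesic has
  coefficients with product \<open>1 / 4\<close>, which are therefore \<open>exp t / 2\<close> and
  \<open>exp (-t) / 2\<close>.\<close>

lemma range_hline_eq_hgeo:
  assumes AB: "ideal A" "ideal B" "mink A B = 2"
  defines "P \<equiv> (1/2) *\<^sub>R (A + B)" and "U \<equiv> (1/2) *\<^sub>R (A - B)"
  shows "hline_frame P U" "range (hline P U) = hgeo A B"
    "\<And>t. hlift (hline P U t) = (exp t / 2) *\<^sub>R A + (exp (-t) / 2) *\<^sub>R B"
proof -
  have m: "mink A A = 0" "mink B B = 0" "mink A B = 2" "mink B A = 2"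
    using AB by (auto simp: ideal_def mink_commute)
  show fr: "hline_frame P U"
    using AB by (auto simp: hline_frame_def P_def U_def hyperboloid_def m ideal_def)
  show l: "hlift (hline P U t) = (exp t / 2) *\<^sub>R A + (exp (-t) / 2) *\<^sub>R B" for t
  proof -
    have "hlift (hline P U t) = ((cosh t + sinh t) / 2) *\<^sub>R A + ((cosh t - sinh t) / 2) *\<^sub>R B"
      unfolding hlift_hline[OF fr]
      by (simp add: P_def U_def algebra_simps add_divide_distrib diff_divide_distrib)
    then show ?thesis by (simp only: cosh_plus_sinh cosh_minus_sinh)
  qed
  show "range (hline P U) = hgeo A B"
  proof (intro subset_antisym subsetI)
    fix z assume "z \<in> range (hline P U)"
    then show "z \<in> hgeo A B" unfolding hgeo_def using l hline_in_ball[OF fr]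
      by auto (metis exp_gt_zero half_gt_zero)
  next
    fix z assume "z \<in> hgeo A B"
    then obtain s t where z: "z \<in> ball 0 1" "s > 0" "t > 0" "hlift z = s *\<^sub>R A + t *\<^sub>R B"
      unfolding hgeo_def by blast
    have "1 = mink (hlift z) (hlift z)" using hlift_self[OF z(1)] by simp
    also have "\<dots> = 4 * s * t" unfolding z(4) by (simp add: m)
    finally have st: "t = inverse (2 * s) / 2" using z by (simp add: field_simps)
    have "hlift z = (exp (ln (2 * s)) / 2) *\<^sub>R A + (exp (- ln (2 * s)) / 2) *\<^sub>R B"
      using z by (simp add: st exp_minus)
    also have "\<dots> = hlift (hline P U (ln (2 * s)))" by (rule l[symmetric])
    finally have "z = hline P U (ln (2 * s))" using z hlift_inject hline_in_ball[OF fr] by blast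
    then show "z \<in> range (hline P U)" by blast
  qed
qed

text \<open>The null vectors are \<open>P + U\<close> and \<open>P - U\<close>; Cauchy-Schwarz gives
  \<open>|fst U| < fst P\<close>, so both point to the future.\<close>

lemma geodesic_line_imp_hgeo:
  assumes "geodesic_line L"
  obtains A B where "ideal A" "ideal B" "mink A B = 2" "L = hgeo A B"
proof -
  obtain P U where fr: "hline_frame P U" and L: "L = range (hline P U)"
    using assms geodesic_line_iff by blast
  have m: "mink P P = 1" "mink U U = -1" "mink P U = 0" "mink U P = 0" "fst P > 0"
    using fr by (auto simp: hline_frame_def hyperboloid_def mink_commute[of U P])
  have "\<bar>fst U\<bar> < fst P"
  proof -
    have "fst P * fst U = snd P \<bullet> snd U" using m by (simp add: mink_def)
    then have "(fst P)\<^sup>2 * (fst U)\<^sup>2 \<le> (norm (snd P))\<^sup>2 * (norm (snd U))\<^sup>2"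
      by (metis Cauchy_Schwarz_ineq2 abs_ge_zero power2_abs power_mono power_mult_distrib)
    moreover have "(norm (snd P))\<^sup>2 = (fst P)\<^sup>2 - 1" "(norm (snd U))\<^sup>2 = (fst U)\<^sup>2 + 1"
      using m by (auto simp: mink_self)
    ultimately have "(fst U)\<^sup>2 < (fst P)\<^sup>2" by (simp add: algebra_simps)
    then show ?thesis using m by (metis abs_of_pos power2_abs power2_less_imp_less less_imp_le)
  qed
  then have "ideal (P + U)" "ideal (P - U)" "mink (P + U) (P - U) = 2"
    by (auto simp: ideal_def m)
  moreover have "(1/2) *\<^sub>R ((P + U) + (P - U)) = P" "(1/2) *\<^sub>R ((P + U) - (P - U)) = U"
    by (simp_all add: algebra_simps flip: scaleR_2) 
  ultimately show ?thesis using range_hline_eq_hgeo[of "P + U" "P - U"] L that by metis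
qed

lemma scaleR_divideR_cancel: "k \<noteq> 0 \<Longrightarrow> (k *\<^sub>R v) /\<^sub>R (k * d) = (v :: 'a :: real_vector) /\<^sub>R d"
  by (simp add: inverse_eq_divide)

lemma ideal_ends:
  assumes A: "ideal A" "ideal B" "mink A B = 2"
  shows "closure (hgeo A B) \<inter> sphere 0 1 = {snd A /\<^sub>R fst A, snd B /\<^sub>R fst B}"
proof -
  have end1: "snd A /\<^sub>R fst A \<in> closure (hgeo A B) \<inter> sphere 0 1"
    if A: "ideal A" "ideal B" "mink A B = 2" for A B
  proof -
    define P U where "P = (1/2) *\<^sub>R (A + B)" and "U = (1/2) *\<^sub>R (A - B)"
    note r = range_hline_eq_hgeo[OF A, folded P_def U_def]
    have f: "fst A > 0" using A by (simp add: ideal_def)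
    \<comment> \<open>The geodesic in the variable \<open>x = exp (-t)\<close>. In this form the
      formula extends continuously to \<open>x = 0\<close>, where its value is the ideal
      endpoint.\<close>
    define h where "h x = (snd A + (x\<^sup>2) *\<^sub>R snd B) /\<^sub>R (2 * x + fst A + x\<^sup>2 * fst B)" for x :: real
    have eq: "hline P U t = h (exp (-t))" for t
    proof -
      define e where "e = exp t"
      have e: "e > 0" "exp (-t) = 1 / e" by (simp_all add: e_def exp_minus divide_inverse)
      have pos: "2 * (1/e) + fst A + (1/e)\<^sup>2 * fst B > 0" using e f A by (auto simp: ideal_def intro!: add_pos_pos)
      have "hline P U t = hproj ((e / 2) *\<^sub>R A + (1 / e / 2) *\<^sub>R B)"
        using r(3)[of t] hline_in_ball[OF r(1)] hproj_hlift e by (metis e_def)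
      also have "\<dots> = ((e/2) *\<^sub>R (snd A + ((1/e)\<^sup>2) *\<^sub>R snd B)) /\<^sub>R ((e/2) * (2 * (1/e) + fst A + (1/e)\<^sup>2 * fst B))"
        using e by (simp add: hproj_def algebra_simps power2_eq_square)
      also have "\<dots> = h (1 / e)" unfolding h_def using e by (intro scaleR_divideR_cancel) simp
      finally show ?thesis by (simp add: e)
    qed
    have "((\<lambda>n::nat. h (exp (- real n))) \<longlongrightarrow> h 0) sequentially"
    proof (rule isCont_tendsto_compose[of _ h])
      show "isCont h 0" unfolding h_def using f by (intro continuous_intros) auto
      show "(\<lambda>n. exp (- real n)) \<longlonglongrightarrow> 0"
        by (rule filterlim_compose[OF exp_at_bot]) (simp add: filterlim_uminus_at_bot filterlim_real_sequentially)
    qed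
    moreover have "h (exp (- real n)) \<in> hgeo A B" for n using eq r(2) by (metis rangeI)
    ultimately have "h 0 \<in> closure (hgeo A B)"
      unfolding closure_sequential by (intro exI[of _ "\<lambda>n. h (exp (- real n))"]) auto
    moreover have "h 0 = snd A /\<^sub>R fst A" by (simp add: h_def)
    ultimately show ?thesis using ideal_norm[OF A(1)] f by (simp add: mem_sphere_0)
  qed
  have "w \<in> {snd A /\<^sub>R fst A, snd B /\<^sub>R fst B}" if w: "w \<in> closure (hgeo A B)" "norm w = 1" for w
  proof -
    define Z :: "complex \<Rightarrow> real \<times> complex" where "Z z = (1 + (norm z)\<^sup>2, 2 *\<^sub>R z)" for z
    \<comment> \<open>Clearing denominators in the equation \<open>mink X A * mink X B = 1\<close>
      of the geodesic gives a closed condition on the whole plane. On the unit circle its right-hand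
      side vanishes and only the two endpoints remain.\<close>
    define C where "C = {z. mink (Z z) A * mink (Z z) B = (1 - (norm z)\<^sup>2)\<^sup>2}"
    have m: "mink A A = 0" "mink B B = 0" "mink A B = 2" "mink B A = 2"
      using A by (auto simp: ideal_def mink_commute)
    have "closed C" unfolding C_def Z_def mink_def fst_conv snd_conv
      by (intro closed_Collect_eq continuous_intros)
    moreover have "hgeo A B \<subseteq> C"
    proof
      fix z assume "z \<in> hgeo A B"
      then obtain s t where z: "z \<in> ball 0 1" "s > 0" "t > 0" "hlift z = s *\<^sub>R A + t *\<^sub>R B"
        unfolding hgeo_def by blast
      have "1 = mink (hlift z) (hlift z)" using hlift_self[OF z(1)] by simp
      also have "\<dots> = 4 * s * t" unfolding z(4) by (simp add: m)
      finally have st: "4 * s * t = 1" by simp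
      have "y * (x / y) = x" if "y > 0" for x y :: real using that by simp
      from this[of "1 - (norm z)\<^sup>2"] have "Z z = (1 - (norm z)\<^sup>2) *\<^sub>R hlift z"
        using ball_norm[OF z(1)] by (simp only: Z_def hlift_def scaleR_Pair scaleR_scaleR real_scaleR_def diff_gt_0_iff_gt)
      then have "mink (Z z) A * mink (Z z) B = (1 - (norm z)\<^sup>2)\<^sup>2 * (4 * s * t)"
        unfolding z(4) by (simp add: m power2_eq_square)
      then show "z \<in> C" by (simp add: C_def st)
    qed
    ultimately have "w \<in> C" using w closure_minimal by blast
    then have "mink (Z w) A = 0 \<or> mink (Z w) B = 0" using w by (simp add: C_def)
    moreover have "w = snd A /\<^sub>R fst A" if "mink (Z w) A = 0" "ideal A" for A
    proof -
      have f: "fst A > 0" "norm (snd A) = fst A" using that ideal_norm by (auto simp: ideal_def)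
      have "w \<bullet> snd A = norm w * norm (snd A)" using that w f by (simp add: Z_def mink_def)
      then have "norm w *\<^sub>R snd A = norm (snd A) *\<^sub>R w" by (simp add: norm_cauchy_schwarz_eq)
      then have "snd A = fst A *\<^sub>R w" using w f by simp
      then show ?thesis using f by simp
    qed
    ultimately show ?thesis using A by blast
  qed
  moreover have "snd B /\<^sub>R fst B \<in> closure (hgeo A B) \<inter> sphere 0 1"
    using end1[of B A] A by (simp add: mink_commute hgeo_commute)
  ultimately show ?thesis using end1[OF A] mem_sphere_0 by blast
qed

text \<open>The description by \<open>THE\<close> is resolved because every geodesic is
  \<open>hgeo\<close> of two null vectors, and \<open>hgeo\<close> depends only on their directions,
  which are the ideal endpoints.\<close>

lemma geodesic_with_ends_hgeo:
  assumes AB: "ideal A" "ideal B" "mink A B > 0"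
  shows "geodesic_with_ends {snd A /\<^sub>R fst A, snd B /\<^sub>R fst B} = hgeo A B"
    "geodesic_line (hgeo A B)"
proof -
  define A' where "A' = (2 / mink A B) *\<^sub>R A"
  have A': "ideal A'" "mink A' B = 2" using AB by (auto simp: A'_def ideal_def)
  have e: "snd A' /\<^sub>R fst A' = snd A /\<^sub>R fst A"
    using AB scaleR_divideR_cancel[of "2 / mink A B"] by (simp add: A'_def)
  have h: "hgeo A' B = hgeo A B" using AB by (simp add: A'_def hgeo_scale del: scaleR_scaleR)
  show gl: "geodesic_line (hgeo A B)"
    using range_hline_eq_hgeo[OF A'(1) AB(2) A'(2)] geodesic_line_hline h by metis
  show "geodesic_with_ends {snd A /\<^sub>R fst A, snd B /\<^sub>R fst B} = hgeo A B"
    unfolding geodesic_with_ends_def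
  proof (rule the_equality)
    show "geodesic_line (hgeo A B) \<and> closure (hgeo A B) \<inter> sphere 0 1 = {snd A /\<^sub>R fst A, snd B /\<^sub>R fst B}"
      using gl ideal_ends[OF A'(1) AB(2) A'(2)] e h by simp
  next
    fix L assume L: "geodesic_line L \<and> closure L \<inter> sphere 0 1 = {snd A /\<^sub>R fst A, snd B /\<^sub>R fst B}"
    then obtain C D where CD: "ideal C" "ideal D" "mink C D = 2" "L = hgeo C D"
      using geodesic_line_imp_hgeo by metis
    have sc: "hgeo E B' = hgeo (1, snd E /\<^sub>R fst E) B'" if "ideal E" for E B'
    proof -
      have "E = fst E *\<^sub>R (1, snd E /\<^sub>R fst E)" using that by (simp add: ideal_def prod_eq_iff)
      then show ?thesis using that hgeo_scale by (metis ideal_def)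
    qed
    have sc2: "hgeo E E' = hgeo (1, snd E /\<^sub>R fst E) (1, snd E' /\<^sub>R fst E')" if "ideal E" "ideal E'" for E E'
      using sc that hgeo_commute by metis
    have "{snd C /\<^sub>R fst C, snd D /\<^sub>R fst D} = {snd A /\<^sub>R fst A, snd B /\<^sub>R fst B}"
      using ideal_ends[OF CD(1-3)] CD(4) L by simp
    then show "L = hgeo A B"
      unfolding CD(4) sc2[OF CD(1,2)] sc2[OF AB(1,2)] by (metis doubleton_eq_iff hgeo_commute)
  qed
qed

section \<open>Half-turns and translations\<close>

text \<open>The half-turn about the midpoint of \<open>0\<close> and \<open>a\<close>; it acts on the hyperboloid by
  \<open>X \<mapsto> 2 mink M X M - X\<close>.  A translation is the product of two half-turns.\<close>

definition hturn :: "complex \<Rightarrow> complex \<Rightarrow> complex" where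
  "hturn a z = (a - z) / (1 - cnj a * z)"

lemma hturn_denominator: "norm a < 1 \<Longrightarrow> norm z < 1 \<Longrightarrow> 1 - cnj a * z \<noteq> 0"
proof
  assume *: "norm a < 1" "norm z < 1" "1 - cnj a * z = 0"
  then have "norm a * norm z = 1" by (metis complex_mod_cnj eq_iff_diff_eq_0 norm_mult norm_one)
  moreover have "norm a * norm z \<le> norm a * 1" using * by (intro mult_left_mono) auto
  ultimately show False using * by simp
qed

text \<open>\<open>a\<close> is the Klein model coordinate of \<open>M\<close>. With
  \<open>N = (fst M)^2\<close>, the identity \<open>N * (1 - |a|^2) = 1\<close> removes
  \<open>N\<close> from the projected formula; numerator and denominator then share the factor
  \<open>1 - a * cnj z\<close>, and what remains is the Moebius map.\<close>

lemma hturn_hlift: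
  assumes M: "M \<in> hyperboloid" and z: "z \<in> ball 0 1"
  defines "a \<equiv> snd M /\<^sub>R fst M"
  shows "norm a < 1" "hturn a z \<in> ball 0 1"
    "hlift (hturn a z) = (2 * mink M (hlift z)) *\<^sub>R M - hlift z"
proof -
  define m X where "m = mink M (hlift z)" and "X = (2 * m) *\<^sub>R M - hlift z"
  have f: "fst M > 0" "mink M M = 1" using M by (auto simp: hyperboloid_def)
  have Ma: "snd M = fst M *\<^sub>R a" using f by (simp add: a_def)
  show a1: "norm a < 1" using hyperboloid_norm_less[OF M] f by (simp add: a_def field_simps)
  have z1: "norm z < 1" using z by (simp add: mem_ball_0)
  have X: "X \<in> hyperboloid"
  proof (rule hyperboloidI)
    show "mink X X = 1" using f z by (simp add: X_def m_def mink_commute[of "hlift z" M])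
    show "mink X M > 0" using f mink_hyperboloid_pos[OF M hlift_in[OF z]]
      by (simp add: X_def m_def mink_commute[of "hlift z" M])
  qed (fact M)
  have "hproj X = hturn a z"
  proof -
    define n q D N where d: "n = (norm z)\<^sup>2" "q = 1 + n - 2 * (a \<bullet> z)" "D = 1 - n" "N = (fst M)\<^sup>2"
    have D: "D > 0" using ball_norm[OF z] by (simp add: d)
    have NA: "N * (1 - (norm a)\<^sup>2) = 1"
      using f(2) by (simp add: mink_self Ma d power_mult_distrib algebra_simps)
    have N0: "N > 0" using f by (simp add: d)
    have m: "m = fst M * q / D"
      by (simp add: m_def mink_def hlift_def Ma d field_simps diff_divide_distrib)
    have fX: "1 + fst X = 2 * (N * q - n) / D"
    proof -
      have "fst X = 2 * N * q / D - (1 + n) / D"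
        by (simp add: X_def m hlift_def d power2_eq_square)
      moreover have "1 = D / D" using D by simp
      ultimately have "1 + fst X = D / D + (2 * N * q / D - (1 + n) / D)" by simp
      also have "\<dots> = (D + 2 * N * q - (1 + n)) / D" by (simp only: add_divide_distrib diff_divide_distrib)
      finally show ?thesis by (simp add: d)
    qed
    have sX: "snd X = (2 / D) *\<^sub>R ((N * q) *\<^sub>R a - z)"
    proof -
      have "snd X = (2 * m * fst M) *\<^sub>R a - (2 / D) *\<^sub>R z" by (simp add: X_def Ma hlift_def d)
      also have "2 * m * fst M = (2 / D) * (N * q)" by (simp add: m d(4) power2_eq_square)
      finally show ?thesis by (simp only: scaleR_diff_right scaleR_scaleR)
    qed
    have "hproj X = (1 / (N * q - n)) *\<^sub>R ((N * q) *\<^sub>R a - z)"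
    proof -
      have *: "inverse (2 * x / D) * (2 / D) = 1 / x" for x using D by (simp add: field_simps)
      show ?thesis unfolding hproj_def sX fX scaleR_scaleR * ..
    qed
    also have "\<dots> = (1 / (N * (q - n * (1 - (norm a)\<^sup>2)))) *\<^sub>R (N *\<^sub>R (q *\<^sub>R a - (1 - (norm a)\<^sup>2) *\<^sub>R z))"
    proof -
      have "N * (q - n * (1 - (norm a)\<^sup>2)) = N * q - n * (N * (1 - (norm a)\<^sup>2))" by (simp add: algebra_simps)
      then show ?thesis unfolding scaleR_diff_right scaleR_scaleR NA by simp
    qed
    also have "\<dots> = (1 / (q - n * (1 - (norm a)\<^sup>2))) *\<^sub>R (q *\<^sub>R a - (1 - (norm a)\<^sup>2) *\<^sub>R z)"
      using N0 by simp
    also have "\<dots> = hturn a z"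
    proof -
      have cn: "of_real n = z * cnj z" "of_real ((norm a)\<^sup>2) = a * cnj a"
        by (simp_all add: d complex_norm_square del: of_real_power)
      have ci: "of_real (2 * (a \<bullet> z)) = a * cnj z + cnj a * z"
        by (simp add: complex_eq_iff inner_complex_def)
      have cq: "of_real q = 1 + z * cnj z - (a * cnj z + cnj a * z)"
        by (simp add: d(2) cn(1)[symmetric] ci[symmetric])
      have nz: "1 - a * cnj z \<noteq> 0" "1 - cnj a * z \<noteq> 0"
        using hturn_denominator[OF z1 a1] hturn_denominator[OF a1 z1] by (auto simp: mult.commute)
      have den: "of_real (q - n * (1 - (norm a)\<^sup>2)) = (1 - cnj a * z) * (1 - a * cnj z)"
        unfolding of_real_diff of_real_mult cq cn of_real_1 by (simp add: algebra_simps)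
      have num: "of_real q * a - of_real (1 - (norm a)\<^sup>2) * z = (a - z) * (1 - a * cnj z)"
        unfolding of_real_diff of_real_mult cq cn of_real_1 by (simp add: algebra_simps)
      show ?thesis unfolding scaleR_conv_of_real of_real_divide den num hturn_def using nz by simp
    qed
    finally show ?thesis .
  qed
  then show "hturn a z \<in> ball 0 1" "hlift (hturn a z) = (2 * mink M (hlift z)) *\<^sub>R M - hlift z"
    using hproj_in[OF X] hlift_hproj[OF X] by (simp_all add: X_def m_def)
qed

definition htrans :: "real \<times> complex \<Rightarrow> real \<times> complex \<Rightarrow> complex \<Rightarrow> complex" where
  "htrans M N z = hturn (snd N /\<^sub>R fst N) (hturn (snd M /\<^sub>R fst M) z)"

lemma htrans_isometry:
  assumes M: "M \<in> hyperboloid" and N: "N \<in> hyperboloid"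
  shows "orientation_preserving_isometry (htrans M N)"
proof -
  have t: "hturn (snd M /\<^sub>R fst M) z \<in> ball 0 1 \<and>
      hlift (hturn (snd M /\<^sub>R fst M) z) = (2 * mink M (hlift z)) *\<^sub>R M - hlift z"
    if "M \<in> hyperboloid" "z \<in> ball 0 1" for M z
    using hturn_hlift[OF that] by simp
  have inv: "hturn (snd M /\<^sub>R fst M) (hturn (snd M /\<^sub>R fst M) z) = z"
    if h: "M \<in> hyperboloid" "z \<in> ball 0 1" for M z
  proof -
    have "mink M M = 1" using h by (simp add: hyperboloid_def)
    then have "hlift (hturn (snd M /\<^sub>R fst M) (hturn (snd M /\<^sub>R fst M) z)) = hlift z"
      using t[OF h] t[OF h(1), of "hturn (snd M /\<^sub>R fst M) z"] by simp
    then show ?thesis using hlift_inject t h by blast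
  qed
  have iso: "hdist (hturn (snd M /\<^sub>R fst M) z) (hturn (snd M /\<^sub>R fst M) w) = hdist z w"
    if h: "M \<in> hyperboloid" "z \<in> ball 0 1" "w \<in> ball 0 1" for M z w
  proof -
    have "mink M M = 1" using h by (simp add: hyperboloid_def)
    then show ?thesis using t[OF h(1,2)] t[OF h(1,3)] h by (simp add: hdist_mink mink_commute[of "hlift z" M])
  qed
  have im: "hturn (snd M /\<^sub>R fst M) ` ball 0 1 = ball 0 1" if "M \<in> hyperboloid" for M
    using t[OF that] inv[OF that] by (metis image_eqI image_subsetI subsetI subset_antisym)
  have hol: "hturn (snd M /\<^sub>R fst M) holomorphic_on ball 0 1" if h: "M \<in> hyperboloid" for M
  proof -
    have "norm (snd M /\<^sub>R fst M) < 1" using hturn_hlift(1)[OF h, of 0] by simp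
    then have "1 - cnj (snd M /\<^sub>R fst M) * z \<noteq> 0" if "z \<in> ball 0 1" for z
      using hturn_denominator[of "snd M /\<^sub>R fst M" z] that by (simp add: mem_ball_0)
    then show ?thesis unfolding hturn_def by (intro holomorphic_intros) blast
  qed
  have e: "htrans M N = hturn (snd N /\<^sub>R fst N) \<circ> hturn (snd M /\<^sub>R fst M)"
    by (simp add: htrans_def fun_eq_iff)
  show ?thesis unfolding orientation_preserving_isometry_def
  proof (intro conjI ballI)
    show "htrans M N ` ball 0 1 = ball 0 1" unfolding e image_comp[symmetric] by (simp add: im M N)
    show "htrans M N holomorphic_on ball 0 1" unfolding e
      by (rule holomorphic_on_compose[OF hol[OF M]]) (simp add: im M hol N)
    fix z w :: complex assume "z \<in> ball 0 1" "w \<in> ball 0 1"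
    then show "hdist (htrans M N z) (htrans M N w) = hdist z w"
      unfolding htrans_def using iso t M N by metis
  qed
qed

lemma hlift_htrans:
  assumes M: "M \<in> hyperboloid" and N: "N \<in> hyperboloid" and z: "z \<in> ball 0 1"
  shows "htrans M N z \<in> ball 0 1"
    "hlift (htrans M N z) = (2 * mink N ((2 * mink M (hlift z)) *\<^sub>R M - hlift z)) *\<^sub>R N
       - ((2 * mink M (hlift z)) *\<^sub>R M - hlift z)"
  using hturn_hlift(2,3)[OF N hturn_hlift(2)[OF M z]] unfolding hturn_hlift(3)[OF M z]
  by (simp_all add: htrans_def)

text \<open>On \<open>L\<close> a map without fixed points is a shift of the arc length parameter,
  so one value determines it there. As \<open>L\<close> has a limit point in the disk, the identity
  theorem for holomorphic functions extends the agreement to the whole disk.\<close>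

lemma translation_unique:
  assumes g: "translation_along L g" and h: "translation_along L h"
    and p: "p \<in> L" "g p = h p" and z: "z \<in> ball 0 1"
  shows "g z = h z"
proof -
  obtain \<gamma> where \<gamma>: "range \<gamma> \<subseteq> ball 0 1" "\<And>s t. hdist (\<gamma> s) (\<gamma> t) = \<bar>s - t\<bar>" "L = range \<gamma>"
    using g unfolding translation_along_def geodesic_line_def by blast
  have inb: "\<gamma> t \<in> ball 0 1" for t using \<gamma>(1) by auto
  have inj: "\<gamma> s = \<gamma> t \<Longrightarrow> s = t" for s t using \<gamma>(2)[of s t] \<gamma>(2)[of t t] by simp
  have shift: "\<exists>d. \<forall>t. g (\<gamma> t) = \<gamma> (t + d)" if g: "translation_along L g" for g
  proof -
    have gL: "g ` L = L" using g unfolding translation_along_def by simp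
    have "hdist (g (\<gamma> s)) (g (\<gamma> t)) = hdist (\<gamma> s) (\<gamma> t)" for s t
      using g inb unfolding translation_along_def orientation_preserving_isometry_def by blast
    then have iso: "hdist (g (\<gamma> s)) (g (\<gamma> t)) = \<bar>s - t\<bar>" for s t by (simp only: \<gamma>(2))
    have nf: "g (\<gamma> t) \<noteq> \<gamma> t" for t using g inb unfolding translation_along_def by blast
    have "g (\<gamma> t) \<in> range \<gamma>" for t using gL \<gamma>(3) by blast
    then have "\<forall>t. \<exists>u. g (\<gamma> t) = \<gamma> u" by blast
    then obtain k where k: "\<And>t. g (\<gamma> t) = \<gamma> (k t)" by metis
    have kd: "\<bar>k s - k t\<bar> = \<bar>s - t\<bar>" for s t using iso[of s t] by (simp add: k \<gamma>(2))
    have "k t = t + k 0" for t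
    \<comment> \<open>Otherwise \<open>k\<close> would reverse the line like
      \<open>t \<mapsto> k 0 - t\<close>, and \<open>k 0 / 2\<close> would give a fixed point of
      \<open>g\<close>.\<close>
    proof (rule ccontr)
      assume "k t \<noteq> t + k 0"
      then have kt: "k t = k 0 - t" "t \<noteq> 0" using kd[of t 0] by linarith+
      have "k (k 0 / 2) = k 0 / 2"
        using kd[of "k 0 / 2" 0] kd[of "k 0 / 2" t] kt by argo
      then show False using nf[of "k 0 / 2"] k[of "k 0 / 2"] by metis
    qed
    then show ?thesis using k by metis
  qed
  obtain d e where d: "\<And>t. g (\<gamma> t) = \<gamma> (t + d)" and e: "\<And>t. h (\<gamma> t) = \<gamma> (t + e)"
    using shift[OF g] shift[OF h] by metis
  obtain u where "p = \<gamma> u" using p \<gamma>(3) by blast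
  then have "\<gamma> (u + d) = \<gamma> (u + e)" using p(2) d[of u] e[of u] by metis
  then have "d = e" using inj[of "u + d" "u + e"] by simp
  then have gh: "g (\<gamma> t) = h (\<gamma> t)" for t using d[of t] e[of t] by metis
  have eqL: "g w = h w" if w: "w \<in> L" for w
  proof -
    obtain t where "w = \<gamma> t" using w \<gamma>(3) by blast
    then show ?thesis using gh by metis
  qed
  have gl: "geodesic_line L" using g unfolding translation_along_def by simp
  have "connected L"
  proof -
    obtain P U where PU: "hline_frame P U" "L = range (hline P U)"
      using gl unfolding geodesic_line_iff by blast
    have pos: "1 + fst (cosh t *\<^sub>R P + sinh t *\<^sub>R U) \<noteq> 0" for t
      using hline_frame_in[OF PU(1), of t] by (auto simp: hyperboloid_def)
    have "continuous_on UNIV (hline P U)"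
      unfolding hline_def hproj_def by (intro continuous_intros) (use pos in simp)
    then show ?thesis unfolding PU(2) by (rule connected_continuous_image) simp
  qed
  moreover have "\<gamma> 0 \<in> L" "\<gamma> 1 \<in> L" "\<gamma> 0 \<noteq> \<gamma> 1" using \<gamma>(3) inj[of 0 1] by auto
  ultimately have lim: "\<gamma> 0 islimpt L" using connected_imp_perfect[of L "\<gamma> 0"] by (metis singletonD)
  have "g z - h z = 0"
  proof (rule analytic_continuation[of "\<lambda>z. g z - h z" "ball 0 1" L "\<gamma> 0"])
    show "(\<lambda>z. g z - h z) holomorphic_on ball 0 1"
      using g h unfolding translation_along_def orientation_preserving_isometry_def
      by (intro holomorphic_intros) auto
    show "L \<subseteq> ball 0 1" using \<gamma>(1,3) by simp
  qed (use inb lim eqL z in auto)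
  then show ?thesis by simp
qed

lemma continuous_on_hline: "hline_frame P U \<Longrightarrow> continuous_on UNIV (hline P U)"
proof -
  assume f: "hline_frame P U"
  have pos: "1 + fst (cosh t *\<^sub>R P + sinh t *\<^sub>R U) \<noteq> 0" for t
    using hline_frame_in[OF f, of t] by (auto simp: hyperboloid_def)
  show ?thesis
    unfolding hline_def hproj_def by (intro continuous_intros) (use pos in simp)
qed

section \<open>Ideal quadrilaterals in normal form\<close>

text \<open>\<open>sum\<close> encodes the cyclic order: the diagonals \<open>V1 V3\<close> and
  \<open>V2 V4\<close> meet in the point \<open>e0\<close>, half of the common sum. It also fixes
  the scales of the four null vectors up to a common factor, which \<open>m13\<close> fixes.\<close>

locale quad =
  fixes V1 V2 V3 V4 :: "real \<times> complex"
  assumes ideal: "ideal V1" "ideal V2" "ideal V3" "ideal V4"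
    and sum: "V1 + V3 = V2 + V4"
    and m13: "mink V1 V3 = 2" and m12: "mink V1 V2 > 0" and m14: "mink V1 V4 > 0"
begin

definition "s = sqrt (mink V1 V2 / 2)"
definition "c = sqrt (mink V1 V4 / 2)"
definition "e0 = (1/2) *\<^sub>R (V1 + V3)"
definition "e1 = (1 / (2 * c)) *\<^sub>R (V2 - V3)"
definition "e2 = (1 / (2 * s)) *\<^sub>R (V1 - V2)"

lemma s_pos: "s > 0" and c_pos: "c > 0"
  using m12 m14 by (simp_all add: s_def c_def)

lemma mink_V_self: "mink V1 V1 = 0" "mink V2 V2 = 0" "mink V3 V3 = 0" "mink V4 V4 = 0"
  using ideal by (auto simp: ideal_def)

text \<open>Everything follows from pairing the relation \<open>sum\<close> with the vertices and
  with itself.\<close>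

lemma mink_V_values:
  "mink V1 V2 = 2 * (s * s)" "mink V1 V4 = 2 * (c * c)" "mink V3 V4 = 2 * (s * s)" "mink V2 V3 = 2 * (c * c)"
  "mink V2 V4 = 2" and cs: "c * c + s * s = 1"
proof -
  have ss: "mink V1 V2 = 2 * (s * s)" and cc: "mink V1 V4 = 2 * (c * c)"
    using m12 m14 by (simp_all add: s_def c_def)
  have "mink V1 (V1 + V3) = mink V1 (V2 + V4)" by (simp only: sum)
  then show "c * c + s * s = 1" by (simp add: mink_V_self m13 ss cc)
  then have c: "c * c = 1 - s * s" by simp
  have "mink (V1 + V3) (V1 + V3) = mink (V2 + V4) (V2 + V4)" by (simp only: sum)
  then show m24: "mink V2 V4 = 2" by (simp add: mink_V_self m13 mink_commute[of V3 V1] mink_commute[of V4 V2])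
  have "mink V2 (V1 + V3) = mink V2 (V2 + V4)" "mink V3 (V1 + V3) = mink V3 (V2 + V4)" by (simp_all only: sum)
  then show "mink V2 V3 = 2 * (c * c)" "mink V3 V4 = 2 * (s * s)"
    by (simp_all add: mink_V_self m13 m24 ss mink_commute[of V2 V1] mink_commute[of V3 V1] mink_commute[of V3 V2] c algebra_simps)
  show "mink V1 V2 = 2 * (s * s)" "mink V1 V4 = 2 * (c * c)" by fact+
qed

text \<open>Statements about one side are proved once and transported to the other three by renaming
  the vertices cyclically.\<close>

lemma quad_rotate: "quad V2 V3 V4 V1"
  using ideal sum mink_V_values s_pos c_pos
  by unfold_locales (auto simp: algebra_simps mink_commute[of V2 V1])

lemma quad_rotate2: "quad V3 V4 V1 V2"
  using quad.quad_rotate[OF quad_rotate] .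

lemma quad_rotate3: "quad V4 V1 V2 V3"
  using quad.quad_rotate[OF quad_rotate2] .

lemma s_rotate: "quad.s V2 V3 = c" and c_rotate: "quad.c V2 V1 = s"
  using s_pos c_pos
  by (simp_all add: quad.s_def[OF quad_rotate] quad.c_def[OF quad_rotate] mink_V_values mink_commute[of V2 V1] real_sqrt_mult_self)

lemma V_eq: "V1 = e0 + c *\<^sub>R e1 + s *\<^sub>R e2" "V2 = e0 + c *\<^sub>R e1 - s *\<^sub>R e2"
  "V3 = e0 - c *\<^sub>R e1 - s *\<^sub>R e2" "V4 = e0 - c *\<^sub>R e1 + s *\<^sub>R e2"
proof -
  have c: "c *\<^sub>R e1 = (1/2) *\<^sub>R (V2 - V3)" and s: "s *\<^sub>R e2 = (1/2) *\<^sub>R (V1 - V2)"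
    using c_pos s_pos by (simp_all add: e1_def e2_def)
  have V4: "V4 = V1 + V3 - V2" using sum by (simp add: algebra_simps)
  have h: "(1/2) *\<^sub>R X + (1/2) *\<^sub>R X = X" for X :: "real \<times> complex" by (simp flip: scaleR_add_left)
  show "V1 = e0 + c *\<^sub>R e1 + s *\<^sub>R e2" "V2 = e0 + c *\<^sub>R e1 - s *\<^sub>R e2"
    "V3 = e0 - c *\<^sub>R e1 - s *\<^sub>R e2"
    unfolding c s e0_def using h[of V1] h[of V2] h[of V3] by (simp_all add: algebra_simps)
  show "V4 = e0 - c *\<^sub>R e1 + s *\<^sub>R e2"
    apply (rule trans[OF V4])
    unfolding c s e0_def using h[of V1] h[of V2] h[of V3] by (simp add: algebra_simps)
qed

lemma e0_in: "e0 \<in> hyperboloid"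
  using ideal by (auto simp: hyperboloid_def e0_def mink_V_self m13 mink_commute[of V3 V1] ideal_def)

lemma mink_frame [simp]: "mink e0 e0 = 1" "mink e1 e1 = -1" "mink e2 e2 = -1"
  "mink e0 e1 = 0" "mink e1 e0 = 0" "mink e0 e2 = 0" "mink e2 e0 = 0" "mink e1 e2 = 0" "mink e2 e1 = 0"
proof -
  have m: "mink V2 V1 = 2 * (s * s)" "mink V3 V2 = 2 * (c * c)" "mink V3 V1 = 2" "c * c = 1 - s * s"
    using mink_V_values m13 cs mink_commute by (metis, metis, metis, linarith)
  have c0: "c \<noteq> 0" "s \<noteq> 0" using c_pos s_pos by auto
  have f0: "mink e0 (V2 - V3) = 0" "mink e0 (V1 - V2) = 0" "mink (V2 - V3) (V1 - V2) = 0"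
    "mink (V2 - V3) (V2 - V3) = - 4 * (c * c)" "mink (V1 - V2) (V1 - V2) = - 4 * (s * s)"
    unfolding e0_def by (simp_all add: m mink_V_values mink_V_self m13)
  show "mink e0 e0 = 1" using e0_in by (simp add: hyperboloid_def)
  show g: "mink e0 e1 = 0" "mink e0 e2 = 0" "mink e1 e2 = 0"
    unfolding e1_def e2_def mink_scaleR_left mink_scaleR_right f0 by simp_all
  show "mink e1 e1 = -1" "mink e2 e2 = -1"
    unfolding e1_def e2_def mink_scaleR_left mink_scaleR_right f0 using c0 by (simp_all add: field_simps)
  show "mink e1 e0 = 0" "mink e2 e0 = 0" "mink e2 e1 = 0" using g by (simp_all add: mink_commute)
qed

lemma frame_expansion: "X = mink e0 X *\<^sub>R e0 - mink e1 X *\<^sub>R e1 - mink e2 X *\<^sub>R e2"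
proof -
  have nz: "e2 \<noteq> 0" "e1 \<noteq> 0" "e0 \<noteq> 0" using mink_frame(1-3) by (metis mink_zero_left zero_neq_neg_one zero_neq_one)+
  have o: "mink A Y = 0" if "Y \<in> span B" "\<And>b. b \<in> B \<Longrightarrow> mink A b = 0" for A Y B
    using that by (induction rule: span_induct_alt) auto
  have n1: "e1 \<notin> span {e2}" using o[of e1 "{e2}" e1] by auto
  have n0: "e0 \<notin> span {e1, e2}" using o[of e0 "{e1, e2}" e0] mink_frame by (metis insertE singletonD zero_neq_one)
  have "independent {e0, e1, e2}"
    using nz n1 n0 by (auto simp: independent_insert)
  moreover have "card {e0, e1, e2} = 3"
    using n0 n1 by (metis card_3_iff insertCI span_base)
  ultimately have "UNIV \<subseteq> span {e0, e1, e2}"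
    by (intro card_ge_dim_independent) (auto simp: dim_UNIV)
  then have "X \<in> span {e0, e1, e2}" by auto
  then obtain k0 k1 k2 where X: "X = k0 *\<^sub>R e0 + k1 *\<^sub>R e1 + k2 *\<^sub>R e2"
    by (auto simp: span_insert span_singleton algebra_simps)
  show ?thesis by (simp add: X)
qed

text \<open>As \<open>mink\<close> is negative definite on the span of \<open>e1\<close> and \<open>e2\<close>, the coordinates \<open>x1\<close> and \<open>x2\<close>
  carry a sign.\<close>

definition "x0 z = mink e0 (hlift z)"
definition "x1 z = - mink e1 (hlift z)"
definition "x2 z = - mink e2 (hlift z)"

lemma hlift_coords: "hlift z = x0 z *\<^sub>R e0 + x1 z *\<^sub>R e1 + x2 z *\<^sub>R e2"
  using frame_expansion[of "hlift z"] by (simp add: x0_def x1_def x2_def)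

lemma mink_coords: "mink (hlift z) (hlift w) = x0 z * x0 w - x1 z * x1 w - x2 z * x2 w"
  by (subst (1 2) hlift_coords) (simp add: algebra_simps)

lemma coords_norm: "z \<in> ball 0 1 \<Longrightarrow> (x0 z)\<^sup>2 = 1 + (x1 z)\<^sup>2 + (x2 z)\<^sup>2"
  using mink_coords[of z z] by (simp add: power2_eq_square)

lemma x0_pos: "z \<in> ball 0 1 \<Longrightarrow> x0 z > 0"
  unfolding x0_def by (intro mink_hyperboloid_pos e0_in hlift_in)

lemma cosh_hdist_coords:
  "z \<in> ball 0 1 \<Longrightarrow> w \<in> ball 0 1 \<Longrightarrow> cosh (hdist z w) = x0 z * x0 w - x1 z * x1 w - x2 z * x2 w"
  by (simp add: cosh_hdist mink_coords)

definition "pt p0 p1 p2 = hproj (p0 *\<^sub>R e0 + p1 *\<^sub>R e1 + p2 *\<^sub>R e2)"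

lemma pt:
  assumes "p0\<^sup>2 = 1 + p1\<^sup>2 + p2\<^sup>2" "p0 > 0"
  shows "pt p0 p1 p2 \<in> ball 0 1" "x0 (pt p0 p1 p2) = p0" "x1 (pt p0 p1 p2) = p1" "x2 (pt p0 p1 p2) = p2"
    "hlift (pt p0 p1 p2) = p0 *\<^sub>R e0 + p1 *\<^sub>R e1 + p2 *\<^sub>R e2"
proof -
  have "p0 *\<^sub>R e0 + p1 *\<^sub>R e1 + p2 *\<^sub>R e2 \<in> hyperboloid"
    by (rule hyperboloidI[OF _ _ e0_in]) (use assms in \<open>simp_all add: power2_eq_square\<close>)
  then show "pt p0 p1 p2 \<in> ball 0 1" "x0 (pt p0 p1 p2) = p0" "x1 (pt p0 p1 p2) = p1" "x2 (pt p0 p1 p2) = p2"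
    "hlift (pt p0 p1 p2) = p0 *\<^sub>R e0 + p1 *\<^sub>R e1 + p2 *\<^sub>R e2"
    by (simp_all add: pt_def x0_def x1_def x2_def)
qed

lemma coords_inject:
  assumes "z \<in> ball 0 1" "w \<in> ball 0 1" "x1 z = x1 w" "x2 z = x2 w"
  shows "z = w"
proof -
  have "(x0 z)\<^sup>2 = (x0 w)\<^sup>2" using assms by (simp add: coords_norm)
  then have "x0 z = x0 w" using x0_pos[OF assms(1)] x0_pos[OF assms(2)] by (simp add: power2_eq_iff_nonneg)
  then have "hlift z = hlift w" using assms by (simp add: hlift_coords[of z] hlift_coords[of w])
  then show ?thesis using assms hlift_inject by blast
qed

lemma coords_rotate: "quad.x0 V2 V4 z = x0 z" "quad.x1 V2 V3 V4 V1 z = - x2 z" "quad.x2 V2 V3 z = x1 z"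
proof -
  interpret r: quad V2 V3 V4 V1 by (rule quad_rotate)
  have V: "V3 - V4 = - (V1 - V2)" using sum by (simp add: algebra_simps)
  have "r.e1 = - e2" unfolding r.e1_def e2_def c_rotate V by (rule scaleR_minus_right)
  then have "r.e0 = e0" "r.e1 = - e2" "r.e2 = e1"
    by (simp_all add: r.e0_def r.e1_def r.e2_def e0_def e1_def e2_def s_rotate c_rotate sum)
  then show "quad.x0 V2 V4 z = x0 z" "quad.x1 V2 V3 V4 V1 z = - x2 z" "quad.x2 V2 V3 z = x1 z"
    by (simp_all add: r.x0_def r.x1_def r.x2_def x0_def x1_def x2_def)
qed

end

section \<open>The convex hull of the vertices and its sides\<close>

context quad
begin

lemma coords_V: "mink e0 V1 = 1" "mink e0 V2 = 1" "mink e0 V3 = 1" "mink e0 V4 = 1"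
  "mink e1 V1 = - c" "mink e1 V2 = - c" "mink e1 V3 = c" "mink e1 V4 = c"
  "mink e2 V1 = - s" "mink e2 V2 = s" "mink e2 V3 = s" "mink e2 V4 = - s"
proof -
  have *: "mink X V1 = mink X e0 + c * mink X e1 + s * mink X e2" "mink X V2 = mink X e0 + c * mink X e1 - s * mink X e2"
    "mink X V3 = mink X e0 - c * mink X e1 - s * mink X e2" "mink X V4 = mink X e0 - c * mink X e1 + s * mink X e2" for X
    using arg_cong[OF V_eq(1), of "mink X"] arg_cong[OF V_eq(2), of "mink X"]
      arg_cong[OF V_eq(3), of "mink X"] arg_cong[OF V_eq(4), of "mink X"] by simp_all
  show "mink e0 V1 = 1" "mink e0 V2 = 1" "mink e0 V3 = 1" "mink e0 V4 = 1"
    "mink e1 V1 = - c" "mink e1 V2 = - c" "mink e1 V3 = c" "mink e1 V4 = c"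
    "mink e2 V1 = - s" "mink e2 V2 = s" "mink e2 V3 = s" "mink e2 V4 = - s"
    unfolding * mink_frame by simp_all
qed

lemma s_less_1: "s < 1"
proof -
  have "c * c > 0" using c_pos by auto
  then have "s\<^sup>2 < 1\<^sup>2" using cs by (simp add: power2_eq_square)
  then show ?thesis using power2_less_imp_less[of s 1] by simp
qed

definition "a1 = snd V1 /\<^sub>R fst V1"
definition "a2 = snd V2 /\<^sub>R fst V2"
definition "a3 = snd V3 /\<^sub>R fst V3"
definition "a4 = snd V4 /\<^sub>R fst V4"

definition "vertices = {a1, a2, a3, a4}"

text \<open>In the Klein coordinates \<open>x1 / x0\<close> and \<open>x2 / x0\<close> geodesics are
  chords, and this is the Euclidean rectangle whose corners, with coordinates \<open>c\<close> and
  \<open>s\<close> up to sign, lie on the unit circle.\<close>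

definition Q :: "complex set" where
  "Q = {z \<in> ball 0 1. \<bar>x1 z\<bar> \<le> c * x0 z \<and> \<bar>x2 z\<bar> \<le> s * x0 z}"

lemma vertex_distinct:
  assumes "ideal A" "ideal B" "mink A B > 0"
  shows "snd A /\<^sub>R fst A \<noteq> snd B /\<^sub>R fst B"
proof
  assume e: "snd A /\<^sub>R fst A = snd B /\<^sub>R fst B"
  have "A = fst A *\<^sub>R (1, snd A /\<^sub>R fst A)" "B = fst B *\<^sub>R (1, snd B /\<^sub>R fst B)"
    using assms by (auto simp: ideal_def prod_eq_iff)
  then have "B = (fst B / fst A) *\<^sub>R A" using e assms by (metis ideal_def less_irrefl nonzero_divide_eq_eq scaleR_scaleR)
  then have "mink A B = (fst B / fst A) * mink A A" by (metis mink_scaleR_right)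
  then show False using assms by (simp add: ideal_def)
qed

lemma mink_V_pos: "mink V1 V2 > 0" "mink V1 V3 > 0" "mink V1 V4 > 0" "mink V2 V3 > 0" "mink V2 V4 > 0" "mink V3 V4 > 0"
  using mink_V_values m13 s_pos c_pos by simp_all

lemma vertices_distinct: "a1 \<noteq> a2" "a1 \<noteq> a3" "a1 \<noteq> a4" "a2 \<noteq> a3" "a2 \<noteq> a4" "a3 \<noteq> a4"
  unfolding a1_def a2_def a3_def a4_def
  by (intro vertex_distinct ideal mink_V_pos)+

lemma vertices_ideal: "ideal_vertices vertices"
proof -
  have "norm (snd A /\<^sub>R fst A) = 1" if "ideal A" for A
    using that ideal_norm[OF that] by (simp add: ideal_def)
  then show ?thesis using vertices_distinct ideal
    unfolding ideal_vertices_def vertices_def by (simp add: a1_def a2_def a3_def a4_def)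
qed

lemma geodesic_with_ends_vertices: "geodesic_with_ends {a1, a2} = hgeo V1 V2" "geodesic_with_ends {a1, a3} = hgeo V1 V3"
  "geodesic_with_ends {a1, a4} = hgeo V1 V4" "geodesic_with_ends {a2, a3} = hgeo V2 V3"
  "geodesic_with_ends {a2, a4} = hgeo V2 V4" "geodesic_with_ends {a3, a4} = hgeo V3 V4"
  unfolding a1_def a2_def a3_def a4_def
  by (intro geodesic_with_ends_hgeo(1) ideal mink_V_pos)+

lemma two_element_subsets: "{E. E \<subseteq> vertices \<and> card E = 2} = {{a1, a2}, {a1, a3}, {a1, a4}, {a2, a3}, {a2, a4}, {a3, a4}}"
proof (intro subset_antisym subsetI)
  fix E assume "E \<in> {E. E \<subseteq> vertices \<and> card E = 2}"
  then have E: "E \<subseteq> vertices" "card E = 2" by simp_all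
  then obtain x y where xy: "E = {x, y}" "x \<noteq> y" using card_2_iff[of E] by blast
  then have "x \<in> vertices" "y \<in> vertices" using E by simp_all
  then show "E \<in> {{a1, a2}, {a1, a3}, {a1, a4}, {a2, a3}, {a2, a4}, {a3, a4}}"
    unfolding vertices_def xy(1) using xy(2) by (elim insertE emptyE) (simp_all add: doubleton_eq_iff)
next
  fix E assume "E \<in> {{a1, a2}, {a1, a3}, {a1, a4}, {a2, a3}, {a2, a4}, {a3, a4}}"
  then show "E \<in> {E. E \<subseteq> vertices \<and> card E = 2}"
    using vertices_distinct by (elim insertE emptyE) (simp_all add: vertices_def)
qed

lemma coords_combination:
  assumes "hlift z = s' *\<^sub>R A + t' *\<^sub>R B"
  shows "x0 z = s' * mink e0 A + t' * mink e0 B" "x1 z = - (s' * mink e1 A) - t' * mink e1 B"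
    "x2 z = - (s' * mink e2 A) - t' * mink e2 B"
  by (simp_all add: x0_def x1_def x2_def assms)

lemma hyp_convex_Q: "hyp_convex Q"
  unfolding hyp_convex_def
proof (intro conjI ballI impI)
  show "Q \<subseteq> ball 0 1" by (auto simp: Q_def)
  fix x y z assume x: "x \<in> Q" and y: "y \<in> Q" and z: "z \<in> ball 0 1" and b: "hdist x z + hdist z y = hdist x y"
  have "x \<in> ball 0 1" "y \<in> ball 0 1" using x y by (auto simp: Q_def)
  then obtain u v where uv: "u \<ge> 0" "v \<ge> 0" "hlift z = u *\<^sub>R hlift x + v *\<^sub>R hlift y"
    using b z hdist_between_iff by blast
  note cc = coords_combination[OF uv(3), folded x0_def]
  have xs: "x0 z = u * x0 x + v * x0 y" "x1 z = u * x1 x + v * x1 y" "x2 z = u * x2 x + v * x2 y"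
    using cc by (simp_all add: x0_def x1_def x2_def)
  have conv: "\<bar>u * p + v * q\<bar> \<le> k * (u * p' + v * q')" if "\<bar>p\<bar> \<le> k * p'" "\<bar>q\<bar> \<le> k * q'" for p q p' q' k
  proof -
    have "\<bar>u * p + v * q\<bar> \<le> u * \<bar>p\<bar> + v * \<bar>q\<bar>" using uv abs_triangle_ineq[of "u * p" "v * q"] by (simp add: abs_mult)
    also have "\<dots> \<le> u * (k * p') + v * (k * q')" using uv that by (intro add_mono mult_left_mono) auto
    finally show ?thesis by (simp add: algebra_simps)
  qed
  show "z \<in> Q" unfolding Q_def using z x y conv by (auto simp: xs Q_def)
qed

lemma hgeo_subset_Q:
  assumes "A \<in> {V1, V2, V3, V4}" "B \<in> {V1, V2, V3, V4}"
  shows "hgeo A B \<subseteq> Q"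
proof
  fix z assume "z \<in> hgeo A B"
  then obtain u v where z: "z \<in> ball 0 1" "u > 0" "v > 0" "hlift z = u *\<^sub>R A + v *\<^sub>R B"
    by (auto simp: hgeo_def)
  note cc = coords_combination[OF z(4)]
  have "mink e0 A = 1" "\<bar>mink e1 A\<bar> = c" "\<bar>mink e2 A\<bar> = s" "mink e0 B = 1" "\<bar>mink e1 B\<bar> = c" "\<bar>mink e2 B\<bar> = s"
    using assms coords_V c_pos s_pos by auto
  moreover have "\<bar>- (u * p) - v * q\<bar> \<le> k * (u + v)" if "\<bar>p\<bar> = k" "\<bar>q\<bar> = k" for p q k :: real
  proof -
    have "\<bar>- (u * p) - v * q\<bar> \<le> u * \<bar>p\<bar> + v * \<bar>q\<bar>"
      using abs_triangle_ineq4[of "- (u * p)" "v * q"] z by (simp add: abs_mult)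
    then show ?thesis using that by (simp add: algebra_simps)
  qed
  ultimately show "z \<in> Q" using z(1) by (simp add: Q_def cc)
qed

text \<open>For the second inclusion: by \<open>c^2 + s^2 = 1\<close>, the equation
  \<open>x1 = c x0\<close> alone forces \<open>|x2| < s x0\<close> on the hyperboloid, and this is
  the positivity of the two coefficients over \<open>V1\<close> and \<open>V2\<close>.\<close>

lemma side12_eq: "hgeo V1 V2 = {z \<in> ball 0 1. x1 z = c * x0 z}"
proof (intro subset_antisym subsetI)
  fix z assume "z \<in> hgeo V1 V2"
  then obtain u v where z: "z \<in> ball 0 1" "hlift z = u *\<^sub>R V1 + v *\<^sub>R V2"
    by (auto simp: hgeo_def)
  then show "z \<in> {z \<in> ball 0 1. x1 z = c * x0 z}"
    using coords_combination[OF z(2)] by (simp add: coords_V algebra_simps)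
next
  fix z assume "z \<in> {z \<in> ball 0 1. x1 z = c * x0 z}"
  then have z: "z \<in> ball 0 1" "x1 z = c * x0 z" by auto
  have "(x0 z)\<^sup>2 = 1 + (c * x0 z)\<^sup>2 + (x2 z)\<^sup>2" using coords_norm[OF z(1)] z(2) by simp
  moreover have "(s * x0 z)\<^sup>2 + (c * x0 z)\<^sup>2 = (c * c + s * s) * (x0 z)\<^sup>2"
    by (simp add: power2_eq_square algebra_simps)
  ultimately have "(x2 z)\<^sup>2 < (s * x0 z)\<^sup>2" unfolding cs by linarith
  then have "\<bar>x2 z\<bar> < s * x0 z"
    using x0_pos[OF z(1)] s_pos power2_less_imp_less[of "\<bar>x2 z\<bar>" "s * x0 z"] by simp
  then have "\<bar>x2 z / s\<bar> < x0 z" using s_pos by (simp add: field_simps)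
  then have p: "(x0 z + x2 z / s) / 2 > 0" "(x0 z - x2 z / s) / 2 > 0" by (simp_all only: abs_less_iff) simp_all
  have "hlift z = x0 z *\<^sub>R (e0 + c *\<^sub>R e1) + (x2 z / s) *\<^sub>R (s *\<^sub>R e2)"
    using z s_pos by (subst hlift_coords) (simp add: algebra_simps)
  also have "\<dots> = ((x0 z + x2 z / s) / 2) *\<^sub>R V1 + ((x0 z - x2 z / s) / 2) *\<^sub>R V2"
  proof -
    have "a *\<^sub>R X + b *\<^sub>R Y = ((a + b) / 2) *\<^sub>R (X + Y) + ((a - b) / 2) *\<^sub>R (X - Y)" for a b and X Y :: "real \<times> complex"
    proof -
      have "(a + b) / 2 + (a - b) / 2 = a" "(a + b) / 2 - (a - b) / 2 = b" by (simp_all add: field_simps)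
      then have "a *\<^sub>R X = ((a + b) / 2) *\<^sub>R X + ((a - b) / 2) *\<^sub>R X" "b *\<^sub>R Y = ((a + b) / 2) *\<^sub>R Y - ((a - b) / 2) *\<^sub>R Y"
        by (simp_all only: scaleR_add_left[symmetric] scaleR_diff_left[symmetric])
      then show ?thesis by (simp add: scaleR_add_right scaleR_diff_right)
    qed
    from this[of _ "e0 + c *\<^sub>R e1" _ "s *\<^sub>R e2"] show ?thesis unfolding V_eq(1,2)[symmetric] .
  qed
  finally show "z \<in> hgeo V1 V2" unfolding hgeo_def using z(1) p by blast
qed

lemma side23_eq: "hgeo V2 V3 = {z \<in> ball 0 1. x2 z = - (s * x0 z)}"
  unfolding quad.side12_eq[OF quad_rotate] coords_rotate c_rotate by auto

lemma side34_eq: "hgeo V3 V4 = {z \<in> ball 0 1. x1 z = - (c * x0 z)}"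
  unfolding quad.side23_eq[OF quad_rotate] coords_rotate s_rotate by auto

lemma side41_eq: "hgeo V4 V1 = {z \<in> ball 0 1. x2 z = s * x0 z}"
  unfolding quad.side34_eq[OF quad_rotate] coords_rotate c_rotate by auto

lemma Q_rotate: "quad.Q V2 V3 V4 V1 = Q"
proof -
  interpret r: quad V2 V3 V4 V1 by (rule quad_rotate)
  show ?thesis unfolding r.Q_def Q_def by (auto simp: coords_rotate s_rotate c_rotate)
qed

lemma vertices_rotate: "quad.vertices V2 V3 V4 V1 = vertices"
proof -
  interpret r: quad V2 V3 V4 V1 by (rule quad_rotate)
  show ?thesis unfolding r.vertices_def vertices_def
    by (auto simp: r.a1_def r.a2_def r.a3_def r.a4_def a1_def a2_def a3_def a4_def)
qed

text \<open>A point of the rectangle lies on a chord \<open>x2 / x0 = k2\<close> between the sides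
  \<open>x1 = c x0\<close> and \<open>x1 = - c x0\<close>. The ends of the chord have
  \<open>x0 = 1 / D\<close>. \<open>D\<close> vanishes when the chord is itself a side, hence the
  case distinction.\<close>

lemma Q_subset_convex:
  assumes C: "hyp_convex C" and sub: "hgeo V1 V2 \<subseteq> C" "hgeo V2 V3 \<subseteq> C" "hgeo V3 V4 \<subseteq> C" "hgeo V4 V1 \<subseteq> C"
  shows "Q \<subseteq> C"
proof
  fix z assume "z \<in> Q"
  then have z: "z \<in> ball 0 1" "\<bar>x1 z\<bar> \<le> c * x0 z" "\<bar>x2 z\<bar> \<le> s * x0 z" by (auto simp: Q_def)
  have p: "x0 z > 0" using x0_pos z by blast
  show "z \<in> C"
  proof (cases "\<bar>x2 z\<bar> = s * x0 z")
    case True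
    then have "z \<in> hgeo V2 V3 \<or> z \<in> hgeo V4 V1" unfolding side23_eq side41_eq using z(1) by auto
    then show ?thesis using sub by auto
  next
    case False
    define k1 k2 where k: "k1 = x1 z / x0 z" "k2 = x2 z / x0 z"
    have k2: "\<bar>k2\<bar> < s" and k1: "\<bar>k1\<bar> \<le> c" using False z p by (simp_all add: k field_simps)
    define D where "D = sqrt (s * s - k2 * k2)"
    have "k2 * k2 < s * s" using k2 by (metis abs_mult_less abs_mult_self_eq abs_of_pos s_pos)
    then have D: "D > 0" "D * D = s * s - k2 * k2" by (simp_all add: D_def)
    have pts: "(1 / D)\<^sup>2 = 1 + (c / D)\<^sup>2 + (k2 / D)\<^sup>2" "(1 / D)\<^sup>2 = 1 + (- (c / D))\<^sup>2 + (k2 / D)\<^sup>2" "1 / D > 0"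
    proof -
      have "1 = D * D + c * c + k2 * k2" using D cs by simp
      then have "1 / (D * D) = (D * D + c * c + k2 * k2) / (D * D)" by simp
      also have "\<dots> = 1 + c * c / (D * D) + k2 * k2 / (D * D)" using D(1) by (simp add: add_divide_distrib)
      finally show "(1 / D)\<^sup>2 = 1 + (c / D)\<^sup>2 + (k2 / D)\<^sup>2" by (simp add: power2_eq_square)
      then show "(1 / D)\<^sup>2 = 1 + (- (c / D))\<^sup>2 + (k2 / D)\<^sup>2" by simp
    qed (use D in simp)
    note w = pt[OF pts(1,3)] and w' = pt[OF pts(2,3)]
    have "pt (1/D) (c/D) (k2/D) \<in> C" using sub(1) w unfolding side12_eq by auto
    moreover have "pt (1/D) (- (c/D)) (k2/D) \<in> C" using sub(3) w' unfolding side34_eq by auto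
    moreover have "hdist (pt (1/D) (c/D) (k2/D)) z + hdist z (pt (1/D) (- (c/D)) (k2/D))
        = hdist (pt (1/D) (c/D) (k2/D)) (pt (1/D) (- (c/D)) (k2/D))"
    proof (subst hdist_between_iff[OF w(1) w'(1) z(1)], intro exI conjI)
      have eq: "x0 z * D * (c + k1) / (2 * c) * (1 / D) + x0 z * D * (c - k1) / (2 * c) * (1 / D) = x0 z"
        "x0 z * D * (c + k1) / (2 * c) * (c / D) + x0 z * D * (c - k1) / (2 * c) * (- (c / D)) = x1 z"
        "x0 z * D * (c + k1) / (2 * c) * (k2 / D) + x0 z * D * (c - k1) / (2 * c) * (k2 / D) = x2 z"
        using D c_pos p by (simp_all add: k field_simps)
      show "hlift z = (x0 z * D * (c + k1) / (2 * c)) *\<^sub>R hlift (pt (1/D) (c/D) (k2/D))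
         + (x0 z * D * (c - k1) / (2 * c)) *\<^sub>R hlift (pt (1/D) (- (c/D)) (k2/D))"
      proof -
        have "\<alpha> *\<^sub>R (p *\<^sub>R e0 + q *\<^sub>R e1 + r *\<^sub>R e2) + \<beta> *\<^sub>R (p *\<^sub>R e0 + q' *\<^sub>R e1 + r *\<^sub>R e2)
          = (\<alpha> * p + \<beta> * p) *\<^sub>R e0 + (\<alpha> * q + \<beta> * q') *\<^sub>R e1 + (\<alpha> * r + \<beta> * r) *\<^sub>R e2" for \<alpha> \<beta> p q r q'
          by (simp add: scaleR_add_left scaleR_add_right)
        then show ?thesis unfolding w(5) w'(5) by (simp only: eq hlift_coords[of z])
      qed
    qed (use k1 p D c_pos in \<open>auto intro!: divide_nonneg_pos mult_nonneg_nonneg\<close>)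
    ultimately show ?thesis using C z(1) unfolding hyp_convex_def by blast
  qed
qed

lemma ideal_hull_eq: "ideal_hull vertices = Q"
proof -
  have U: "(\<Union>E\<in>{E. E \<subseteq> vertices \<and> card E = 2}. geodesic_with_ends E)
     = hgeo V1 V2 \<union> hgeo V1 V3 \<union> hgeo V1 V4 \<union> hgeo V2 V3 \<union> hgeo V2 V4 \<union> hgeo V3 V4"
    unfolding two_element_subsets by (auto simp: geodesic_with_ends_vertices)
  show ?thesis unfolding ideal_hull_def U
  proof (rule hull_unique)
    show "hgeo V1 V2 \<union> hgeo V1 V3 \<union> hgeo V1 V4 \<union> hgeo V2 V3 \<union> hgeo V2 V4 \<union> hgeo V3 V4 \<subseteq> Q"
      by (intro Un_least hgeo_subset_Q) auto
    show "hyp_convex Q" by (rule hyp_convex_Q)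
    fix C assume "hgeo V1 V2 \<union> hgeo V1 V3 \<union> hgeo V1 V4 \<union> hgeo V2 V3 \<union> hgeo V2 V4 \<union> hgeo V3 V4 \<subseteq> C" "hyp_convex C"
    then show "Q \<subseteq> C" by (intro Q_subset_convex) (auto simp: hgeo_commute[of V4])
  qed
qed

lemma continuous_on_coords: "continuous_on (ball 0 1) x0" "continuous_on (ball 0 1) x1" "continuous_on (ball 0 1) x2"
  unfolding x0_def x1_def x2_def by (intro continuous_intros; auto)+

text \<open>Along the geodesic that leaves \<open>z\<close> perpendicularly to the side,
  \<open>c * x0 - x1 = - s * sinh t\<close>, so it is outside \<open>Q\<close> for every
  \<open>t > 0\<close>.\<close>

lemma side_frontier: "hgeo V1 V2 \<subseteq> frontier Q"
proof
  fix z assume z12: "z \<in> hgeo V1 V2"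
  then have z: "z \<in> ball 0 1" "x1 z = c * x0 z" by (auto simp: side12_eq)
  have "z \<in> Q" using hgeo_subset_Q[of V1 V2] z12 by auto
  moreover have "z \<notin> interior Q"
  proof
    assume int: "z \<in> interior Q"
    define P U where "P = hlift z" and "U = (1 / s) *\<^sub>R (c *\<^sub>R e0 + e1)"
    have P0: "mink e0 P = x0 z" "mink e1 P = - x1 z" "mink P e0 = x0 z" "mink P e1 = - x1 z"
      by (simp_all add: P_def x0_def x1_def mink_commute)
    have cc: "c * c - 1 = - (s * s)" using cs by simp
    define W where "W = c *\<^sub>R e0 + e1"
    have "mink W W = - (s * s)" "mink P W = 0" using cc z by (simp_all add: W_def P0)
    then have fr: "hline_frame P U"
      using z s_pos unfolding hline_frame_def U_def W_def[symmetric] by (simp add: P_def)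
    have "((hline P U) \<longlongrightarrow> hline P U 0) (at_right 0)"
      using continuous_on_hline[OF fr] by (metis UNIV_I continuous_on_eq_continuous_at isCont_def open_UNIV tendsto_mono at_le subset_UNIV)
    moreover have "hline P U 0 = z" using z by (simp add: hline_def P_def)
    ultimately have "eventually (\<lambda>t. hline P U t \<in> interior Q) (at_right 0)"
      using int by (metis open_interior topological_tendstoD)
    moreover have "eventually (\<lambda>t. t > (0::real)) (at_right 0)" by (rule eventually_at_right_less)
    ultimately have "eventually (\<lambda>t. t > 0 \<and> hline P U t \<in> interior Q) (at_right 0)" by eventually_elim auto
    then obtain t where t: "t > 0" "hline P U t \<in> Q"
      using eventually_happens interior_subset by (metis (no_types, lifting) subsetD trivial_limit_at_right_real)
    have "c * x0 (hline P U t) - x1 (hline P U t) = sinh t * ((c * c - 1) / s)"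
      unfolding x0_def x1_def hlift_hline[OF fr]
      using s_pos z by (simp add: P0 U_def field_simps)
    also have "\<dots> = - (sinh t * s)" unfolding cc using s_pos by simp
    also have "\<dots> < 0" using t s_pos by simp
    finally have "c * x0 (hline P U t) < x1 (hline P U t)" by simp
    moreover have "\<bar>x1 (hline P U t)\<bar> \<le> c * x0 (hline P U t)" using t(2) unfolding Q_def by blast
    ultimately show False by linarith
  qed
  ultimately show "z \<in> frontier Q" unfolding frontier_def using closure_subset by auto
qed

text \<open>The diagonal passes through the centre \<open>hproj e0\<close>, which is an interior
  point.\<close>

lemma diagonal_not_frontier: "\<not> hgeo V1 V3 \<subseteq> frontier Q"
proof
  assume sub: "hgeo V1 V3 \<subseteq> frontier Q"
  define o' where "o' = hproj e0"
  have o: "o' \<in> ball 0 1" "hlift o' = e0" using e0_in by (simp_all add: o'_def)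
  have "hlift o' = (1/2) *\<^sub>R V1 + (1/2) *\<^sub>R V3" unfolding o(2) unfolding e0_def scaleR_add_right ..
  then have "o' \<in> hgeo V1 V3"
    unfolding hgeo_def using o(1) by (intro CollectI conjI exI[of _ "1/2"]) simp_all
  moreover have "o' \<in> interior Q"
  proof (rule interiorI)
    let ?S = "ball 0 1 \<inter> (\<lambda>z. min (c * x0 z - \<bar>x1 z\<bar>) (s * x0 z - \<bar>x2 z\<bar>)) -` {0<..}"
    show "open ?S"
      by (intro continuous_open_preimage continuous_intros continuous_on_coords) auto
    show "o' \<in> ?S" using o c_pos s_pos by (simp add: x0_def x1_def x2_def)
    show "?S \<subseteq> Q" by (auto simp: Q_def)
  qed
  ultimately show False using sub by (auto simp: frontier_def)
qed

lemma sides_eq: "sides vertices = {{a1, a2}, {a2, a3}, {a3, a4}, {a1, a4}}"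
proof -
  interpret r: quad V2 V3 V4 V1 by (rule quad_rotate)
  interpret r2: quad V3 V4 V1 V2 by (rule quad_rotate2)
  interpret r3: quad V4 V1 V2 V3 by (rule quad_rotate3)
  have Qr: "r.Q = Q" "r2.Q = Q" "r3.Q = Q" using Q_rotate r.Q_rotate r2.Q_rotate by auto
  have S: "E \<in> sides vertices \<longleftrightarrow>
      E \<in> {{a1, a2}, {a1, a3}, {a1, a4}, {a2, a3}, {a2, a4}, {a3, a4}} \<and> geodesic_with_ends E \<subseteq> frontier Q" for E
    unfolding two_element_subsets[symmetric] sides_def ideal_hull_eq by simp
  have f: "geodesic_with_ends {a1, a2} \<subseteq> frontier Q" "geodesic_with_ends {a2, a3} \<subseteq> frontier Q"
    "geodesic_with_ends {a3, a4} \<subseteq> frontier Q" "geodesic_with_ends {a1, a4} \<subseteq> frontier Q"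
    using side_frontier r.side_frontier r2.side_frontier r3.side_frontier unfolding Qr geodesic_with_ends_vertices hgeo_commute[of V4 V1] by auto
  have d: "\<not> geodesic_with_ends {a1, a3} \<subseteq> frontier Q" "\<not> geodesic_with_ends {a2, a4} \<subseteq> frontier Q"
    using diagonal_not_frontier r.diagonal_not_frontier unfolding Qr geodesic_with_ends_vertices by auto
  show ?thesis
  proof (intro subset_antisym subsetI)
    fix E assume "E \<in> sides vertices"
    then show "E \<in> {{a1, a2}, {a2, a3}, {a3, a4}, {a1, a4}}"
      unfolding S using d by (elim conjE insertE emptyE) simp_all
  next
    fix E assume "E \<in> {{a1, a2}, {a2, a3}, {a3, a4}, {a1, a4}}"
    then show "E \<in> sides vertices" unfolding S using f by (elim insertE emptyE) simp_all
  qed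
qed

end

section \<open>The side pairings and the gluing relation in coordinates\<close>

context quad
begin

text \<open>\<open>foot\<close> and \<open>foot'\<close> are the feet of the common perpendicular \<open>x2 = 0\<close> of the sides \<open>x1 = c x0\<close> and
  \<open>x1 = - c x0\<close>, and \<open>\<tau>\<close> is the side pairing.  The other pairing follows from the cyclic rotation of
  the vertices, which exchanges \<open>c\<close> with \<open>s\<close> and \<open>x1\<close> with \<open>x2\<close>.\<close>

definition "foot = pt (1 / s) (c / s) 0"
definition "foot' = pt (1 / s) (- (c / s)) 0"
definition "\<tau> = htrans (hlift foot) e0"

lemma foot: "foot \<in> ball 0 1" "x0 foot = 1 / s" "x1 foot = c / s" "x2 foot = 0"
  "hlift foot = (1 / s) *\<^sub>R e0 + (c / s) *\<^sub>R e1"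
  and foot': "foot' \<in> ball 0 1" "x0 foot' = 1 / s" "x1 foot' = - (c / s)" "x2 foot' = 0"
proof -
  have "1 / (s * s) = (s * s + c * c) / (s * s)" using cs by (simp add: add.commute)
  also have "\<dots> = 1 + c * c / (s * s)" using s_pos by (simp add: add_divide_distrib)
  finally have *: "(1 / s)\<^sup>2 = 1 + (c / s)\<^sup>2 + 0\<^sup>2" "(1 / s)\<^sup>2 = 1 + (- (c / s))\<^sup>2 + 0\<^sup>2" "1 / s > 0"
    using s_pos by (simp_all add: power2_eq_square)
  show "foot \<in> ball 0 1" "x0 foot = 1 / s" "x1 foot = c / s" "x2 foot = 0"
    "hlift foot = (1 / s) *\<^sub>R e0 + (c / s) *\<^sub>R e1"
    "foot' \<in> ball 0 1" "x0 foot' = 1 / s" "x1 foot' = - (c / s)" "x2 foot' = 0"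
    using pt[OF *(1,3)] pt[OF *(2,3)] by (simp_all add: foot_def foot'_def)
qed

text \<open>\<open>\<tau>\<close> is the half-turn about \<open>foot\<close> followed by the
  half-turn about the centre. Both points lie on \<open>x2 = 0\<close>, so each half-turn changes
  the sign of \<open>x2\<close> and the product keeps it.\<close>

lemma tau_coords:
  assumes z: "z \<in> ball 0 1"
  shows "\<tau> z \<in> ball 0 1" "x0 (\<tau> z) = 2 * (x0 z - c * x1 z) / (s * s) - x0 z"
    "x1 (\<tau> z) = x1 z - 2 * c * (x0 z - c * x1 z) / (s * s)" "x2 (\<tau> z) = x2 z"
proof -
  note t = hlift_htrans[OF hlift_in[OF foot(1)] e0_in z, folded \<tau>_def]
  show "\<tau> z \<in> ball 0 1" by (rule t)
  have m: "mink (hlift foot) (hlift z) = (x0 z - c * x1 z) / s"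
    unfolding foot(5) using s_pos by (simp add: x0_def x1_def field_simps)
  show "x0 (\<tau> z) = 2 * (x0 z - c * x1 z) / (s * s) - x0 z"
    "x1 (\<tau> z) = x1 z - 2 * c * (x0 z - c * x1 z) / (s * s)" "x2 (\<tau> z) = x2 z"
    unfolding x0_def[of "\<tau> z"] x1_def[of "\<tau> z"] x2_def[of "\<tau> z"] t(2) m
    unfolding foot(5) by (simp_all add: x0_def x1_def x2_def)
qed

lemma tau_side:
  assumes z: "z \<in> ball 0 1" "x1 z = c * x0 z"
  shows "x0 (\<tau> z) = x0 z" "x1 (\<tau> z) = - x1 z" "x2 (\<tau> z) = x2 z"
proof -
  have "x0 z - c * x1 z = (1 - c * c) * x0 z" by (simp add: z algebra_simps)
  also have "1 - c * c = s * s" using cs by simp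
  finally have e: "x0 z - c * x1 z = s * s * x0 z" .
  show "x0 (\<tau> z) = x0 z" "x1 (\<tau> z) = - x1 z" "x2 (\<tau> z) = x2 z"
    unfolding tau_coords[OF z(1)] e using z(2) s_pos by simp_all
qed

lemma axis_line: "geodesic_line {z \<in> ball 0 1. x2 z = 0}"
proof -
  have fr: "hline_frame e0 e1" by (simp add: hline_frame_def e0_in)
  have "x2 (hline e0 e1 t) = 0" for t by (simp add: x2_def hlift_hline[OF fr])
  moreover have "\<exists>t. z = hline e0 e1 t" if z: "z \<in> ball 0 1" "x2 z = 0" for z
  proof
    show "z = hline e0 e1 (arsinh (x1 z))"
      by (rule coords_inject[OF z(1) hline_in_ball[OF fr]])
        (simp_all add: z x1_def[of "hline _ _ _"] x2_def[of "hline _ _ _"] hlift_hline[OF fr] sinh_arsinh_real)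
  qed
  ultimately have "{z \<in> ball 0 1. x2 z = 0} = range (hline e0 e1)"
    using hline_in_ball[OF fr] by blast
  then show ?thesis using geodesic_line_hline[OF fr] by simp
qed

lemma tau_translation: "translation_along {z \<in> ball 0 1. x2 z = 0} \<tau>"
  unfolding translation_along_def
proof (intro conjI ballI)
  show iso: "orientation_preserving_isometry \<tau>"
    unfolding \<tau>_def by (intro htrans_isometry hlift_in foot e0_in)
  show "\<tau> ` {z \<in> ball 0 1. x2 z = 0} = {z \<in> ball 0 1. x2 z = 0}"
  proof (intro subset_antisym subsetI)
    fix w assume w: "w \<in> {z \<in> ball 0 1. x2 z = 0}"
    then obtain z where "z \<in> ball 0 1" "w = \<tau> z"
      using iso unfolding orientation_preserving_isometry_def by blast
    then show "w \<in> \<tau> ` {z \<in> ball 0 1. x2 z = 0}" using w tau_coords(4)[of z] by simp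
  qed (auto simp: tau_coords)
  fix z :: complex assume z: "z \<in> ball 0 1"
  show "\<tau> z \<noteq> z"
  proof
    assume "\<tau> z = z"
    then have "2 * (x0 z - c * x1 z) / (s * s) = 2 * x0 z" "2 * c * (x0 z - c * x1 z) / (s * s) = 0"
      using tau_coords(2,3)[OF z] by auto
    then have "x0 z = 0" using c_pos s_pos by auto
    then show False using x0_pos[OF z] by simp
  qed
qed (rule axis_line)

text \<open>On these sides \<open>(s * x0)^2 = 1 + x2^2\<close>, so \<open>s * x0\<close> and
  \<open>x2\<close> are a hyperbolic cosine and sine and \<open>a * b >= 1 + x2 x * x2 y\<close>.
  This bounds the excess of \<open>cosh (hdist x y)\<close> over its value at the feet from below by
  a positive multiple of \<open>a * b - 1\<close>. The equality case matters because
  \<open>side_pairing\<close> allows any pair of closest points.\<close>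

lemma closest_ineq:
  assumes x: "x \<in> hgeo V1 V2" and y: "y \<in> hgeo V3 V4"
  shows "hdist foot foot' \<le> hdist x y"
    "hdist x y \<le> hdist foot foot' \<Longrightarrow> x = foot \<and> y = foot'"
proof -
  have x': "x \<in> ball 0 1" "x1 x = c * x0 x" and y': "y \<in> ball 0 1" "x1 y = - (c * x0 y)"
    using x y by (auto simp: side12_eq side34_eq)
  define a b where ab: "a = s * x0 x" "b = s * x0 y"
  have ss: "s * s = 1 - c * c" using cs by simp
  have key: "(s * x0 w)\<^sup>2 = 1 + (x2 w)\<^sup>2" if "w \<in> ball 0 1" "(x1 w)\<^sup>2 = (c * x0 w)\<^sup>2" for w
  proof -
    have "(s * x0 w)\<^sup>2 + (c * x0 w)\<^sup>2 = (c * c + s * s) * (x0 w)\<^sup>2"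
      by (simp add: power2_eq_square algebra_simps)
    then show ?thesis using coords_norm[OF that(1)] that(2) unfolding cs by linarith
  qed
  have a2: "a * a = 1 + x2 x * x2 x" and b2: "b * b = 1 + x2 y * x2 y"
    using key[OF x'(1)] key[OF y'(1)] x'(2) y'(2) by (simp_all add: ab flip: power2_eq_square)
  have pos: "a > 0" "b > 0" using x0_pos x' y' s_pos by (auto simp: ab)
  have a1: "a \<ge> 1" "b \<ge> 1"
    using a2 b2 pos by (smt (verit) mult_less_cancel_right2 zero_le_square)+
  have "(1 + x2 x * x2 y)\<^sup>2 \<le> (a * b)\<^sup>2"
  proof -
    have "(a * b)\<^sup>2 = (a * a) * (b * b)" by (simp add: power2_eq_square)
    also have "\<dots> = (1 + x2 x * x2 y)\<^sup>2 + (x2 x - x2 y)\<^sup>2" unfolding a2 b2 by (simp add: power2_eq_square algebra_simps)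
    finally show ?thesis by simp
  qed
  then have ge: "1 + x2 x * x2 y \<le> a * b" using pos by (meson mult_pos_pos less_imp_le power2_le_imp_le)
  have "cosh (hdist x y) = (x0 x * x0 y) * (1 + c * c) - x2 x * x2 y"
    using x' y' by (simp add: cosh_hdist_coords algebra_simps)
  moreover have xy: "x0 x * x0 y = a * b / (s * s)" using s_pos by (simp add: ab)
  ultimately have ch: "cosh (hdist x y) = a * b * (1 + c * c) / (s * s) - x2 x * x2 y" by simp
  have cf: "cosh (hdist foot foot') = (1 + c * c) / (s * s)"
    using s_pos by (simp add: cosh_hdist_coords foot foot' add_divide_distrib)
  have r: "(1 + c * c) / (s * s) - 1 = 2 * (c * c) / (s * s)"
    using s_pos by (simp add: divide_simps) (simp add: ss)
  have d: "cosh (hdist x y) - cosh (hdist foot foot') \<ge> (a * b - 1) * (2 * (c * c) / (s * s))"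
  proof -
    have "cosh (hdist x y) - cosh (hdist foot foot') = (a * b - 1) * ((1 + c * c) / (s * s) - 1) + (a * b - (1 + x2 x * x2 y))"
      unfolding ch cf by (simp add: algebra_simps diff_divide_distrib add_divide_distrib)
    then show ?thesis unfolding r using ge by simp
  qed
  have ab1: "a * b \<ge> 1" using a1 by (metis mult_mono' mult_1 zero_le_one)
  have k: "2 * (c * c) / (s * s) > 0" using c_pos s_pos by simp
  have "cosh (hdist foot foot') \<le> cosh (hdist x y)" using d mult_nonneg_nonneg[of "a * b - 1" "2 * (c * c) / (s * s)"] ab1 k by linarith
  then show "hdist foot foot' \<le> hdist x y"
    using hdist_nonneg x' y' foot foot' cosh_real_nonneg_le_iff by metis
  assume "hdist x y \<le> hdist foot foot'"
  then have "cosh (hdist x y) \<le> cosh (hdist foot foot')"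
    using hdist_nonneg x' y' foot foot' cosh_real_nonneg_le_iff by metis
  then have "(a * b - 1) * (2 * (c * c) / (s * s)) \<le> 0" using d by linarith
  then have "\<not> a * b - 1 > 0" using mult_pos_pos[OF _ k, of "a * b - 1"] by (meson not_le)
  then have "a * b = 1" using ab1 by linarith
  then have ab11: "a = 1" "b = 1" using a1 by (smt (verit) mult_le_cancel_left1 mult_le_cancel_right1)+
  then have "x2 x = 0" "x2 y = 0" using a2 b2 by auto
  moreover have "x0 x = 1 / s" "x0 y = 1 / s" using ab11 s_pos by (auto simp: ab field_simps)
  ultimately show "x = foot \<and> y = foot'"
    using coords_inject[OF x'(1) foot(1)] coords_inject[OF y'(1) foot'(1)] x' y' foot foot' by simp
qed

lemma feet_in: "foot \<in> hgeo V1 V2" "foot' \<in> hgeo V3 V4"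
  by (simp_all add: side12_eq side34_eq foot foot')

lemma tau_foot: "\<tau> foot = foot'"
  using tau_side[of foot] foot foot' coords_inject[OF tau_coords(1)[OF foot(1)] foot'(1)] by simp

lemma opposite_side: "vertices - {a1, a2} = {a3, a4}"
  using vertices_distinct by (auto simp: vertices_def)

lemma side_pairing_tau: "side_pairing vertices {a1, a2} \<tau>"
  unfolding side_pairing_def opposite_side geodesic_with_ends_vertices
proof (intro conjI exI)
  show "{a1, a2} \<in> sides vertices" by (simp add: sides_eq)
  show "\<tau> ` hgeo V1 V2 = hgeo V3 V4"
  proof (intro subset_antisym subsetI)
    fix w assume "w \<in> hgeo V3 V4"
    then have w: "w \<in> ball 0 1" "x1 w = - (c * x0 w)" by (auto simp: side34_eq)
    have n: "(x0 w)\<^sup>2 = 1 + (- x1 w)\<^sup>2 + (x2 w)\<^sup>2" using coords_norm[OF w(1)] by simp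
    note z = pt[OF n x0_pos[OF w(1)]]
    have "w = \<tau> (pt (x0 w) (- x1 w) (x2 w))"
      using coords_inject[OF w(1) tau_coords(1)[OF z(1)]] tau_side[OF z(1)] z w by simp
    moreover have "pt (x0 w) (- x1 w) (x2 w) \<in> hgeo V1 V2" using z w by (simp add: side12_eq)
    ultimately show "w \<in> \<tau> ` hgeo V1 V2" by blast
  qed (auto simp: side12_eq side34_eq tau_side tau_coords(1))
  show "closest_points (hgeo V1 V2) (hgeo V3 V4) foot foot'"
    unfolding closest_points_def using feet_in closest_ineq(1) by blast
  show "translation_along {z \<in> ball 0 1. x2 z = 0} \<tau>" by (rule tau_translation)
qed (simp_all add: foot foot' tau_foot)

text \<open>The closest points are unique, the line through them is the axis, and a translation
  along it is determined by one value.\<close>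

lemma side_pairing_eq_tau:
  assumes g: "side_pairing vertices {a1, a2} g" and z: "z \<in> ball 0 1"
  shows "g z = \<tau> z"
proof -
  obtain p q L where h: "closest_points (hgeo V1 V2) (hgeo V3 V4) p q" "p \<in> L" "q \<in> L"
    "translation_along L g" "g p = q"
    using g unfolding side_pairing_def opposite_side geodesic_with_ends_vertices by blast
  then have pq: "p \<in> hgeo V1 V2" "q \<in> hgeo V3 V4" "hdist p q \<le> hdist foot foot'"
    using feet_in unfolding closest_points_def by auto
  then have e: "p = foot" "q = foot'" using closest_ineq(2) by auto
  have "foot \<noteq> foot'"
  proof
    assume "foot = foot'"
    then have "c / s = - (c / s)" using foot(3) foot'(3) by metis
    then show False using c_pos s_pos by simp
  qed
  moreover have "geodesic_line L" using h by (simp add: translation_along_def)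
  ultimately have "L = {z \<in> ball 0 1. x2 z = 0}"
    using h e axis_line by (intro geodesic_line_unique[of _ _ foot foot']) (auto simp: foot foot')
  then show ?thesis
    using translation_unique[OF h(4), of \<tau> p z] tau_translation h e tau_foot z by simp
qed

lemma side_pairing_iff:
  assumes x: "x \<in> ball 0 1" "x1 x = c * x0 x"
  shows "(\<exists>g. side_pairing vertices {a1, a2} g \<and> y = g x) \<longleftrightarrow> y \<in> ball 0 1 \<and> x1 y = - x1 x \<and> x2 y = x2 x"
    (is "?L \<longleftrightarrow> ?R")
proof
  assume ?L
  then have "y = \<tau> x" using side_pairing_eq_tau x by metis
  then show ?R using tau_side[OF x] tau_coords(1)[OF x(1)] by simp
next
  assume R: ?R
  then have "y = \<tau> x" using tau_side[OF x] tau_coords(1)[OF x(1)] by (intro coords_inject) auto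
  then show ?L using side_pairing_tau by blast
qed

lemma side_pairing_iff2:
  assumes "x \<in> ball 0 1" "x2 x = - (s * x0 x)"
  shows "(\<exists>g. side_pairing vertices {a2, a3} g \<and> y = g x) \<longleftrightarrow> y \<in> ball 0 1 \<and> x1 y = x1 x \<and> x2 y = - x2 x"
proof -
  interpret r: quad V2 V3 V4 V1 by (rule quad_rotate)
  have "r.a1 = a2" "r.a2 = a3" by (simp_all add: r.a1_def r.a2_def a2_def a3_def)
  then show ?thesis
    using r.side_pairing_iff[of x y] assms by (auto simp: coords_rotate c_rotate vertices_rotate)
qed

lemma side_pairing_iff3:
  assumes "x \<in> ball 0 1" "x1 x = - (c * x0 x)"
  shows "(\<exists>g. side_pairing vertices {a3, a4} g \<and> y = g x) \<longleftrightarrow> y \<in> ball 0 1 \<and> x1 y = - x1 x \<and> x2 y = x2 x"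
proof -
  interpret r: quad V2 V3 V4 V1 by (rule quad_rotate)
  have "r.a2 = a3" "r.a3 = a4" by (simp_all add: r.a2_def r.a3_def a3_def a4_def)
  then show ?thesis
    using r.side_pairing_iff2[of x y] assms by (auto simp: coords_rotate s_rotate vertices_rotate)
qed

lemma side_pairing_iff4:
  assumes "x \<in> ball 0 1" "x2 x = s * x0 x"
  shows "(\<exists>g. side_pairing vertices {a1, a4} g \<and> y = g x) \<longleftrightarrow> y \<in> ball 0 1 \<and> x1 y = x1 x \<and> x2 y = - x2 x"
proof -
  interpret r: quad V2 V3 V4 V1 by (rule quad_rotate)
  have "{r.a3, r.a4} = {a1, a4}" by (auto simp: r.a3_def r.a4_def a1_def a4_def)
  then show ?thesis
    using r.side_pairing_iff3[of x y] assms by (auto simp: coords_rotate c_rotate vertices_rotate)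
qed

lemma glued_iff:
  "(x, y) \<in> glued vertices \<longleftrightarrow> x \<in> Q \<and> y \<in> Q \<and>
     (x = y \<or> (\<bar>x1 x\<bar> = c * x0 x \<and> x1 y = - x1 x \<and> x2 y = x2 x)
       \<or> (\<bar>x2 x\<bar> = s * x0 x \<and> x1 y = x1 x \<and> x2 y = - x2 x))"
proof -
  have "(\<exists>E g. side_pairing vertices E g \<and> x \<in> geodesic_with_ends E \<and> y = g x) \<longleftrightarrow>
     (\<exists>E\<in>sides vertices. x \<in> geodesic_with_ends E \<and> (\<exists>g. side_pairing vertices E g \<and> y = g x))"
    using side_pairing_def[of vertices] by blast
  also have "\<dots> \<longleftrightarrow> (x \<in> hgeo V1 V2 \<and> (\<exists>g. side_pairing vertices {a1, a2} g \<and> y = g x)) \<or>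
     (x \<in> hgeo V2 V3 \<and> (\<exists>g. side_pairing vertices {a2, a3} g \<and> y = g x)) \<or>
     (x \<in> hgeo V3 V4 \<and> (\<exists>g. side_pairing vertices {a3, a4} g \<and> y = g x)) \<or>
     (x \<in> hgeo V4 V1 \<and> (\<exists>g. side_pairing vertices {a1, a4} g \<and> y = g x))"
    unfolding sides_eq by (simp add: geodesic_with_ends_vertices hgeo_commute[of V4 V1])
  also have "\<dots> \<longleftrightarrow> x \<in> ball 0 1 \<and> y \<in> ball 0 1 \<and>
     ((\<bar>x1 x\<bar> = c * x0 x \<and> x1 y = - x1 x \<and> x2 y = x2 x)
       \<or> (\<bar>x2 x\<bar> = s * x0 x \<and> x1 y = x1 x \<and> x2 y = - x2 x))" (is "?L \<longleftrightarrow> ?R")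
  proof (cases "x \<in> ball 0 1")
    case True
    have ab: "\<bar>u\<bar> = k * x0 x \<longleftrightarrow> u = k * x0 x \<or> u = - (k * x0 x)" if "k > 0" for u k
      using mult_pos_pos[OF that x0_pos[OF True]] by (simp add: abs_eq_iff')
    have m: "x \<in> {z \<in> ball 0 1. p z} \<and> r \<longleftrightarrow> p x \<and> r" for p r using True by simp
    have s: "(x1 x = c * x0 x \<and> (\<exists>g. side_pairing vertices {a1, a2} g \<and> y = g x)) \<longleftrightarrow>
        (x1 x = c * x0 x \<and> y \<in> ball 0 1 \<and> x1 y = - x1 x \<and> x2 y = x2 x)"
      "(x2 x = - (s * x0 x) \<and> (\<exists>g. side_pairing vertices {a2, a3} g \<and> y = g x)) \<longleftrightarrow>
        (x2 x = - (s * x0 x) \<and> y \<in> ball 0 1 \<and> x1 y = x1 x \<and> x2 y = - x2 x)"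
      "(x1 x = - (c * x0 x) \<and> (\<exists>g. side_pairing vertices {a3, a4} g \<and> y = g x)) \<longleftrightarrow>
        (x1 x = - (c * x0 x) \<and> y \<in> ball 0 1 \<and> x1 y = - x1 x \<and> x2 y = x2 x)"
      "(x2 x = s * x0 x \<and> (\<exists>g. side_pairing vertices {a1, a4} g \<and> y = g x)) \<longleftrightarrow>
        (x2 x = s * x0 x \<and> y \<in> ball 0 1 \<and> x1 y = x1 x \<and> x2 y = - x2 x)"
      by (rule conj_cong[OF refl], rule side_pairing_iff[OF True] side_pairing_iff2[OF True]
          side_pairing_iff3[OF True] side_pairing_iff4[OF True], assumption)+
    show ?thesis unfolding ab[OF c_pos] ab[OF s_pos] side12_eq side23_eq side34_eq side41_eq m s
      using True by argo
  qed (auto simp: hgeo_def)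
  finally have "(\<exists>E g. side_pairing vertices E g \<and> x \<in> geodesic_with_ends E \<and> y = g x) \<longleftrightarrow> ?R" .
  moreover have "Q \<subseteq> ball 0 1" by (auto simp: Q_def)
  ultimately show ?thesis unfolding glued_def ideal_hull_eq by auto
qed

end

section \<open>Lower bounds for the torus metric\<close>

lemma locally_1_Lipschitz_imp:
  fixes f :: "real \<Rightarrow> real"
  assumes loc: "\<And>t. \<exists>e>0. \<forall>r\<in>ball t e. \<forall>s\<in>ball t e. \<bar>f r - f s\<bar> \<le> \<bar>r - s\<bar>"
  shows "\<bar>f a - f b\<bar> \<le> \<bar>a - b\<bar>"
proof -
  have main: "\<bar>f a - f b\<bar> \<le> b - a" if "a \<le> b" for a b
    using that
  proof (induction rule: Bolzano)
    case (trans a b c)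
    then show ?case by linarith
  next
    case (local x)
    obtain e where e: "e > 0" "\<And>r s. r \<in> ball x e \<Longrightarrow> s \<in> ball x e \<Longrightarrow> \<bar>f r - f s\<bar> \<le> \<bar>r - s\<bar>"
      using loc[of x] by blast
    have "\<bar>f u - f v\<bar> \<le> v - u" if "u \<le> x" "x \<le> v" "v - u < e" for u v
      using e(2)[of u v] that by (simp add: ball_def dist_real_def)
    then show ?case using e(1) by blast
  qed
  show ?thesis using main[of a b] main[of b a] by (cases "a \<le> b") auto
qed

lemma periodic_of_int:
  fixes C :: "real \<Rightarrow> 'a"
  assumes "\<And>t. C (t + l) = C t"
  shows "C (t + of_int k * l) = C t"
proof -
  have n: "C (t + real n * l) = C t" for n t
  proof (induction n)
    case (Suc n)
    have "C (t + real (Suc n) * l) = C ((t + real n * l) + l)" by (simp add: algebra_simps)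
    then show ?case using assms Suc by simp
  qed simp
  show ?thesis
  proof (cases "k \<ge> 0")
    case True
    then show ?thesis using n[of t "nat k"] by simp
  next
    case False
    then show ?thesis using n[of "t + of_int k * l" "nat (- k)"] by (simp add: algebra_simps)
  qed
qed

context quad
begin

abbreviation "T \<equiv> torus_points vertices"
abbreviation "d \<equiv> torus_dist vertices"
abbreviation "cls x \<equiv> glued vertices `` {x}"

definition "invariant \<phi> \<longleftrightarrow> (\<forall>x y. (x, y) \<in> glued vertices \<longrightarrow> \<phi> x = (\<phi> y :: real))"
definition "Lip \<phi> \<longleftrightarrow> (\<forall>x\<in>Q. \<forall>y\<in>Q. \<bar>\<phi> x - (\<phi> y :: real)\<bar> \<le> hdist x y)"

lemma Q_ball: "x \<in> Q \<Longrightarrow> x \<in> ball 0 1"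
  by (simp add: Q_def)

lemma torus_points_cases: "A \<in> T \<Longrightarrow> \<exists>w\<in>Q. A = cls w \<and> w \<in> A"
proof -
  assume "A \<in> T"
  then obtain w where "w \<in> Q" "A = cls w"
    unfolding torus_points_def ideal_hull_eq by (rule quotientE)
  then show ?thesis using glued_iff by auto
qed

lemma cls_in_T: "x \<in> Q \<Longrightarrow> cls x \<in> T"
  unfolding torus_points_def ideal_hull_eq by (rule quotientI)

lemma self_in_cls: "x \<in> Q \<Longrightarrow> x \<in> cls x"
  using glued_iff by simp

lemma T_subset_Q: "A \<in> T \<Longrightarrow> a \<in> A \<Longrightarrow> a \<in> Q"
  using torus_points_cases glued_iff by (metis Image_singleton_iff)

lemma invariant_class: "invariant \<phi> \<Longrightarrow> A \<in> T \<Longrightarrow> a \<in> A \<Longrightarrow> b \<in> A \<Longrightarrow> \<phi> a = \<phi> b"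
  using torus_points_cases unfolding invariant_def by (metis Image_singleton_iff)

lemma chain_sum_ge:
  assumes "Lip \<phi>" "invariant \<phi>" "\<And>i. i \<le> n \<Longrightarrow> x i \<in> Q \<and> y i \<in> Q"
    "\<And>i. i < n \<Longrightarrow> (y i, x (Suc i)) \<in> glued vertices"
  shows "\<bar>\<phi> (x 0) - \<phi> (y n)\<bar> \<le> (\<Sum>i\<le>n. hdist (x i) (y i))"
  using assms(3,4)
proof (induction n)
  case 0
  then show ?case using assms(1) by (simp add: Lip_def)
next
  case (Suc n)
  have "\<bar>\<phi> (x 0) - \<phi> (y n)\<bar> \<le> (\<Sum>i\<le>n. hdist (x i) (y i))" using Suc by simp
  moreover have "\<phi> (y n) = \<phi> (x (Suc n))" using assms(2) Suc.prems(2)[of n] by (simp add: invariant_def)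
  moreover have "\<bar>\<phi> (x (Suc n)) - \<phi> (y (Suc n))\<bar> \<le> hdist (x (Suc n)) (y (Suc n))"
    using assms(1) Suc.prems(1)[of "Suc n"] by (simp add: Lip_def)
  ultimately show ?case by simp
qed

definition chains :: "complex set \<Rightarrow> complex set \<Rightarrow> real set" where
  "chains A B = {\<Sum>i\<le>n. hdist (x i) (y i) | (n::nat) x y.
     x 0 \<in> A \<and> y n \<in> B \<and> (\<forall>i\<le>n. x i \<in> Q \<and> y i \<in> Q) \<and> (\<forall>i<n. (y i, x (Suc i)) \<in> glued vertices)}"

lemma torus_dist_eq: "d A B = Inf (chains A B)"
  unfolding torus_dist_def chains_def ideal_hull_eq ..

lemma hdist_in_chains:
  assumes "A \<in> T" "B \<in> T" "a \<in> A" "b \<in> B"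
  shows "hdist a b \<in> chains A B"
proof -
  have "a \<in> Q" "b \<in> Q" using assms T_subset_Q by auto
  then show ?thesis unfolding chains_def using assms
    by (intro CollectI exI[of _ "0::nat"] exI[of _ "\<lambda>_. a"] exI[of _ "\<lambda>_. b"]) simp
qed

lemma hdist_hdist_in_chains:
  assumes "A \<in> T" "B \<in> T" "a \<in> A" "b \<in> B" "(u, v) \<in> glued vertices"
  shows "hdist a u + hdist v b \<in> chains A B"
proof -
  have "a \<in> Q" "b \<in> Q" "u \<in> Q" "v \<in> Q" using assms T_subset_Q glued_iff by auto
  then show ?thesis unfolding chains_def using assms
    by (intro CollectI exI[of _ "1::nat"] exI[of _ "\<lambda>i. if i = 0 then a else v"] exI[of _ "\<lambda>i. if i = 0 then u else b"])
      (simp add: le_Suc_eq)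
qed

lemma bdd_chains: "bdd_below (chains A B)"
  unfolding chains_def
  by (rule bdd_belowI[of _ 0]) (auto intro!: sum_nonneg hdist_nonneg Q_ball)

lemma torus_dist_le: "A \<in> T \<Longrightarrow> B \<in> T \<Longrightarrow> a \<in> A \<Longrightarrow> b \<in> B \<Longrightarrow> d A B \<le> hdist a b"
  unfolding torus_dist_eq by (intro cInf_lower hdist_in_chains bdd_chains)

lemma torus_dist_le_glued:
  "A \<in> T \<Longrightarrow> B \<in> T \<Longrightarrow> a \<in> A \<Longrightarrow> b \<in> B \<Longrightarrow> (u, v) \<in> glued vertices \<Longrightarrow> d A B \<le> hdist a u + hdist v b"
  unfolding torus_dist_eq by (intro cInf_lower hdist_hdist_in_chains bdd_chains)

text \<open>The one source of lower bounds for the metric: along a chain an invariant function is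
  unchanged at the jumps and changes on each segment by at most its length.\<close>

lemma torus_dist_ge:
  assumes "Lip \<phi>" "invariant \<phi>" "A \<in> T" "B \<in> T" "a \<in> A" "b \<in> B"
  shows "\<bar>\<phi> a - \<phi> b\<bar> \<le> d A B"
  unfolding torus_dist_eq
proof (rule cInf_greatest)
  show "chains A B \<noteq> {}" using hdist_in_chains assms by blast
  fix r assume "r \<in> chains A B"
  then obtain n x y where r: "r = (\<Sum>i\<le>n. hdist (x i) (y i))" and c: "x 0 \<in> A" "y n \<in> B"
    "\<forall>i\<le>n. x i \<in> Q \<and> y i \<in> Q" "\<forall>i<n. (y i, x (Suc i)) \<in> glued vertices"
    unfolding chains_def by blast
  have "\<bar>\<phi> (x 0) - \<phi> (y n)\<bar> \<le> r" unfolding r using c by (intro chain_sum_ge assms) auto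
  moreover have "\<phi> (x 0) = \<phi> a" "\<phi> (y n) = \<phi> b" using invariant_class assms c by blast+
  ultimately show "\<bar>\<phi> a - \<phi> b\<bar> \<le> r" by simp
qed

definition "class_value \<phi> A = (\<phi> (SOME a. a \<in> A) :: real)"

lemma class_value: "invariant \<phi> \<Longrightarrow> A \<in> T \<Longrightarrow> a \<in> A \<Longrightarrow> class_value \<phi> A = \<phi> a"
  unfolding class_value_def by (rule invariant_class) (auto intro: someI)

lemma x1_Lip: "z \<in> ball 0 1 \<Longrightarrow> w \<in> ball 0 1 \<Longrightarrow> \<bar>arsinh (x1 z) - arsinh (x1 w)\<bar> \<le> hdist z w"
  using arsinh_mink_Lipschitz[of "- e1" z w] by (simp add: x1_def)

lemma x2_Lip: "z \<in> ball 0 1 \<Longrightarrow> w \<in> ball 0 1 \<Longrightarrow> \<bar>arsinh (x2 z) - arsinh (x2 w)\<bar> \<le> hdist z w"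
  using arsinh_mink_Lipschitz[of "- e2" z w] by (simp add: x2_def)

text \<open>\<open>N / s\<close> is the unit normal of the side
  \<open>x1 = \<epsilon> * c * x0\<close>, so the argument of \<open>arsinh\<close> is the
  hyperbolic sine of the signed distance to that side.\<close>

lemma side1_Lip:
  assumes "\<epsilon> = 1 \<or> \<epsilon> = -1" "z \<in> ball 0 1" "w \<in> ball 0 1"
  shows "\<bar>arsinh ((c * x0 z - \<epsilon> * x1 z) / s) - arsinh ((c * x0 w - \<epsilon> * x1 w) / s)\<bar> \<le> hdist z w"
proof -
  define N where "N = c *\<^sub>R e0 + \<epsilon> *\<^sub>R e1"
  have "c * c - 1 = - (s * s)" using cs by simp
  then have "mink N N = - (s * s)" using assms(1) by (auto simp: N_def)
  then have "mink ((1 / s) *\<^sub>R N) ((1 / s) *\<^sub>R N) = -1" using s_pos by (simp add: field_simps)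
  note Lipschitz = arsinh_mink_Lipschitz[OF this assms(2,3)]
  have m: "mink ((1 / s) *\<^sub>R N) (hlift v) = (c * x0 v - \<epsilon> * x1 v) / s" for v
    by (simp add: N_def x0_def x1_def)
  show ?thesis using Lipschitz unfolding m .
qed

lemma side2_Lip:
  assumes "\<epsilon> = 1 \<or> \<epsilon> = -1" "z \<in> ball 0 1" "w \<in> ball 0 1"
  shows "\<bar>arsinh ((s * x0 z - \<epsilon> * x2 z) / c) - arsinh ((s * x0 w - \<epsilon> * x2 w) / c)\<bar> \<le> hdist z w"
  using quad.side1_Lip[OF quad_rotate, of "- \<epsilon>" z w] assms by (auto simp: coords_rotate s_rotate c_rotate)

lemma glued_neq:
  assumes "(x, y) \<in> glued vertices" "x \<noteq> y"
  shows "(\<bar>x1 x\<bar> = c * x0 x \<and> x1 y = - x1 x \<and> x2 y = x2 x \<and> x0 y = x0 x) \<or>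
    (\<bar>x2 x\<bar> = s * x0 x \<and> x1 y = x1 x \<and> x2 y = - x2 x \<and> x0 y = x0 x)"
proof -
  have q: "x \<in> ball 0 1" "y \<in> ball 0 1" using assms glued_iff Q_ball by auto
  have "x0 y = x0 x" if "(x1 y)\<^sup>2 = (x1 x)\<^sup>2" "(x2 y)\<^sup>2 = (x2 x)\<^sup>2"
  proof -
    have "(x0 y)\<^sup>2 = (x0 x)\<^sup>2" using that coords_norm q by simp
    then show ?thesis using x0_pos[OF q(1)] x0_pos[OF q(2)] by (simp add: power2_eq_iff_nonneg)
  qed
  then show ?thesis using assms glued_iff[of x y] by auto
qed

lemma glued_abs:
  assumes "(x, y) \<in> glued vertices"
  shows "x0 y = x0 x" "\<bar>x1 y\<bar> = \<bar>x1 x\<bar>" "\<bar>x2 y\<bar> = \<bar>x2 x\<bar>"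
  using glued_neq[OF assms] by (cases "x = y"; auto)+

text \<open>The corners of the rectangle are the ideal vertices, which are no points of the disk. A
  boundary point therefore lies on one side only.\<close>

lemma no_corner: "z \<in> ball 0 1 \<Longrightarrow> \<bar>x1 z\<bar> = c * x0 z \<Longrightarrow> \<bar>x2 z\<bar> \<noteq> s * x0 z"
proof
  assume z: "z \<in> ball 0 1" "\<bar>x1 z\<bar> = c * x0 z" "\<bar>x2 z\<bar> = s * x0 z"
  have "(x0 z)\<^sup>2 = 1 + \<bar>x1 z\<bar>\<^sup>2 + \<bar>x2 z\<bar>\<^sup>2" using coords_norm[OF z(1)] by simp
  also have "\<dots> = 1 + (c * c + s * s) * (x0 z)\<^sup>2" unfolding z(2,3) by (simp add: power2_eq_square algebra_simps)
  finally show False by (simp add: cs)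
qed

text \<open>The distance from the centre to \<open>foot\<close>, which is half the length of the
  core curve on \<open>x2 = 0\<close>.\<close>

definition "L = arsinh (c / s)"

lemma L_pos: "L > 0" and sinh_L: "sinh L = c / s" and cosh_L: "cosh L = 1 / s"
proof -
  have cs0: "c / s > 0" using c_pos s_pos by simp
  then have "arsinh (c / s) > arsinh 0" by (simp only: arsinh_less_iff_real)
  then show "L > 0" by (simp add: L_def)
  show sh: "sinh L = c / s" by (simp add: L_def sinh_arsinh_real)
  have "1 / (s * s) = (s * s + c * c) / (s * s)" using cs by (simp add: add.commute)
  also have "\<dots> = 1 + c * c / (s * s)" using s_pos by (simp add: add_divide_distrib)
  finally have "(cosh L)\<^sup>2 = (1 / s)\<^sup>2" unfolding cosh_square_eq sh by (simp add: power2_eq_square)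
  then show "cosh L = 1 / s" using s_pos by (simp add: power2_eq_iff_nonneg)
qed

text \<open>\<open>foot\<close> is the point of the side nearest to the axis \<open>x1 = 0\<close>,
  since \<open>(s * x0)^2 = 1 + x2^2 >= 1\<close> on the side.\<close>

lemma side_x1_ge:
  assumes "z \<in> ball 0 1" "\<bar>x1 z\<bar> = c * x0 z"
  shows "L \<le> arsinh \<bar>x1 z\<bar>"
proof -
  have "(x0 z)\<^sup>2 = 1 + (c * x0 z)\<^sup>2 + (x2 z)\<^sup>2" using coords_norm[OF assms(1)] assms(2)[symmetric] by simp
  moreover have "(s * x0 z)\<^sup>2 + (c * x0 z)\<^sup>2 = (c * c + s * s) * (x0 z)\<^sup>2"
    by (simp add: power2_eq_square algebra_simps)
  ultimately have "(s * x0 z)\<^sup>2 \<ge> 1\<^sup>2" unfolding cs using zero_le_power2[of "x2 z"] by simp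
  then have "1 \<le> s * x0 z" using power2_le_imp_le[of 1 "s * x0 z"] s_pos x0_pos[OF assms(1)] by simp
  then have "1 / s \<le> x0 z" using s_pos by (simp add: field_simps)
  then have "c * (1 / s) \<le> c * x0 z" using c_pos by (simp only: mult_le_cancel_left_pos)
  then have "c / s \<le> \<bar>x1 z\<bar>" using assms(2) by simp
  then show ?thesis unfolding L_def using arsinh_less_iff_real[of "\<bar>x1 z\<bar>" "c / s"] by linarith
qed

lemma arsinh_abs: "arsinh \<bar>x\<bar> = \<bar>arsinh (x::real)\<bar>"
  by (cases "x \<ge> 0") (auto simp: abs_if arsinh_minus_real)

text \<open>The function \<open>arsinh |x1|\<close> is glue-invariant and 1-Lipschitz, vanishes on the axis and is at least
  \<open>L\<close> on the side, and a closed curve runs from the axis to the side and back.\<close>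

lemma crossing_length:
  assumes cg: "closed_geodesic T d l C"
    and M: "z \<in> C t1" "x1 z = 0" and S: "w \<in> C t2" "\<bar>x1 w\<bar> = c * x0 w"
  shows "l \<ge> 2 * L"
proof -
  define \<phi> where "\<phi> z = arsinh \<bar>x1 z\<bar>" for z
  have l: "l > 0" and CT: "C t \<in> T" and per: "C (t + l) = C t" for t
    using cg by (auto simp: closed_geodesic_def)
  have lip: "Lip \<phi>" unfolding Lip_def \<phi>_def arsinh_abs
  proof (intro ballI)
    fix x y assume "x \<in> Q" "y \<in> Q"
    then have "\<bar>arsinh (x1 x) - arsinh (x1 y)\<bar> \<le> hdist x y" using x1_Lip Q_ball by blast
    then show "\<bar>\<bar>arsinh (x1 x)\<bar> - \<bar>arsinh (x1 y)\<bar>\<bar> \<le> hdist x y" by linarith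
  qed
  have inv: "invariant \<phi>" unfolding invariant_def \<phi>_def using glued_abs by metis
  define \<Phi> where "\<Phi> t = class_value \<phi> (C t)" for t
  have "\<exists>e>0. \<forall>r\<in>ball t e. \<forall>s\<in>ball t e. \<bar>\<Phi> r - \<Phi> s\<bar> \<le> \<bar>r - s\<bar>" for t
  proof -
    obtain e where e: "e > 0" "\<And>r s. r \<in> ball t e \<Longrightarrow> s \<in> ball t e \<Longrightarrow> d (C r) (C s) = \<bar>r - s\<bar>"
      using cg unfolding closed_geodesic_def by blast
    have "\<bar>\<Phi> r - \<Phi> s\<bar> \<le> d (C r) (C s)" for r s
    proof -
      obtain a b where "a \<in> C r" "b \<in> C s" using torus_points_cases[OF CT] by metis
      then show ?thesis using torus_dist_ge[OF lip inv CT CT] class_value[OF inv CT] by (simp add: \<Phi>_def)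
    qed
    then show ?thesis using e by metis
  qed
  then have \<Phi>: "\<bar>\<Phi> a - \<Phi> b\<bar> \<le> \<bar>a - b\<bar>" for a b by (rule locally_1_Lipschitz_imp)
  have 1: "\<Phi> t1 = 0" using class_value[OF inv CT M(1)] M(2) by (simp add: \<Phi>_def \<phi>_def)
  have 2: "\<Phi> t2 \<ge> L"
    using class_value[OF inv CT S(1)] side_x1_ge[OF Q_ball[OF T_subset_Q[OF CT S(1)]] S(2)] by (simp add: \<Phi>_def \<phi>_def)
  \<comment> \<open>Shifts \<open>t2\<close> by periods to a parameter \<open>t\<close> between
    \<open>t1\<close> and \<open>t1 + l\<close>. On each of the two arcs \<open>\<Phi>\<close>
    changes by at least \<open>L\<close>.\<close>
  define k where "k = - \<lfloor>(t2 - t1) / l\<rfloor>"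
  define t where "t = t2 + of_int k * l"
  have "of_int \<lfloor>(t2 - t1) / l\<rfloor> \<le> (t2 - t1) / l" "(t2 - t1) / l < of_int \<lfloor>(t2 - t1) / l\<rfloor> + 1" by linarith+
  then have "of_int \<lfloor>(t2 - t1) / l\<rfloor> * l \<le> t2 - t1" "t2 - t1 < (of_int \<lfloor>(t2 - t1) / l\<rfloor> + 1) * l"
    using l by (simp_all only: pos_le_divide_eq pos_divide_less_eq)
  then have t: "t1 \<le> t" "t < t1 + l" by (simp_all add: t_def k_def algebra_simps)
  have "\<Phi> t = \<Phi> t2" unfolding \<Phi>_def t_def using periodic_of_int[of C l, OF per] by simp
  moreover have "\<Phi> (t1 + l) = \<Phi> t1" by (simp add: \<Phi>_def per)
  ultimately show ?thesis using \<Phi>[of t t1] \<Phi>[of t "t1 + l"] 1 2 t by linarith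
qed

end

section \<open>Maxima of \<open>tent\<close> along a closed geodesic\<close>

context quad
begin

lemma Lip_dist: "X \<in> ball 0 1 \<Longrightarrow> Lip (\<lambda>w. hdist X w)"
  unfolding Lip_def
proof (intro ballI)
  fix x y assume X: "X \<in> ball 0 1" and "x \<in> Q" "y \<in> Q"
  then have "x \<in> ball 0 1" "y \<in> ball 0 1" using Q_ball by auto
  then show "\<bar>hdist X x - hdist X y\<bar> \<le> hdist x y"
    using hdist_triangle[OF X, of x y] hdist_triangle[OF X, of y x] hdist_commute[of x y] by linarith
qed

lemma Lip_min: "Lip f \<Longrightarrow> Lip g \<Longrightarrow> Lip (\<lambda>w. min (f w) (g w))"
  unfolding Lip_def
proof (intro ballI)
  fix x y assume "\<forall>x\<in>Q. \<forall>y\<in>Q. \<bar>f x - f y\<bar> \<le> hdist x y" "\<forall>x\<in>Q. \<forall>y\<in>Q. \<bar>g x - g y\<bar> \<le> hdist x y" "x \<in> Q" "y \<in> Q"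
  then have "\<bar>f x - f y\<bar> \<le> hdist x y" "\<bar>g x - g y\<bar> \<le> hdist x y" by auto
  then show "\<bar>min (f x) (g x) - min (f y) (g y)\<bar> \<le> hdist x y" by linarith
qed

lemma Lip_const: "Lip (\<lambda>w. k)"
  by (simp add: Lip_def hdist_nonneg Q_ball)

text \<open>Lower bounds for the distance of \<open>z\<close> to the two sides \<open>|x1| = c x0\<close> and to the two sides
  \<open>|x2| = s x0\<close>.\<close>

definition "gap1 z = min (arsinh ((c * x0 z - x1 z) / s)) (arsinh ((c * x0 z + x1 z) / s))"
definition "gap2 z = min (arsinh ((s * x0 z - x2 z) / c)) (arsinh ((s * x0 z + x2 z) / c))"

lemma gap1:
  assumes X: "X \<in> ball 0 1" and w: "w \<in> ball 0 1" "\<bar>x1 w\<bar> = c * x0 w"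
  shows "gap1 X \<le> hdist X w"
proof -
  consider "c * x0 w - x1 w = 0" | "c * x0 w + x1 w = 0" using w(2) by linarith
  then show ?thesis
  proof cases
    case 1
    then show ?thesis using side1_Lip[of 1 X w] X w(1) abs_le_D1[of "arsinh ((c * x0 X - x1 X) / s)" "hdist X w"]
      by (simp add: gap1_def min_le_iff_disj)
  next
    case 2
    then show ?thesis using side1_Lip[of "-1" X w] X w(1) abs_le_D1[of "arsinh ((c * x0 X + x1 X) / s)" "hdist X w"]
      by (simp add: gap1_def min_le_iff_disj)
  qed
qed

lemma gap2:
  assumes X: "X \<in> ball 0 1" and w: "w \<in> ball 0 1" "\<bar>x2 w\<bar> = s * x0 w"
  shows "gap2 X \<le> hdist X w"
proof -
  consider "s * x0 w - x2 w = 0" | "s * x0 w + x2 w = 0" using w(2) by linarith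
  then show ?thesis
  proof cases
    case 1
    then show ?thesis using side2_Lip[of 1 X w] X w(1) abs_le_D1[of "arsinh ((s * x0 X - x2 X) / c)" "hdist X w"]
      by (simp add: gap2_def min_le_iff_disj)
  next
    case 2
    then show ?thesis using side2_Lip[of "-1" X w] X w(1) abs_le_D1[of "arsinh ((s * x0 X + x2 X) / c)" "hdist X w"]
      by (simp add: gap2_def min_le_iff_disj)
  qed
qed

lemma gap_pos:
  assumes "z \<in> Q"
  shows "\<bar>x1 z\<bar> \<noteq> c * x0 z \<Longrightarrow> gap1 z > 0" "\<bar>x2 z\<bar> \<noteq> s * x0 z \<Longrightarrow> gap2 z > 0"
proof -
  have a: "arsinh u > 0" if "u > 0" for u :: real
    using that arsinh_less_iff_real[of 0 u] by simp
  have q: "\<bar>x1 z\<bar> \<le> c * x0 z" "\<bar>x2 z\<bar> \<le> s * x0 z" using assms by (auto simp: Q_def)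
  show "gap1 z > 0" if "\<bar>x1 z\<bar> \<noteq> c * x0 z"
  proof -
    have "c * x0 z - x1 z > 0" "c * x0 z + x1 z > 0" using q that by linarith+
    then show ?thesis using s_pos by (simp add: gap1_def a)
  qed
  show "gap2 z > 0" if "\<bar>x2 z\<bar> \<noteq> s * x0 z"
  proof -
    have "s * x0 z - x2 z > 0" "s * x0 z + x2 z > 0" using q that by linarith+
    then show ?thesis using c_pos by (simp add: gap2_def a)
  qed
qed

text \<open>The torus metric yields only inequalities for these three distances. The triangle
  inequality turns them into equalities, so \<open>X\<close> is the midpoint of \<open>Y\<close> and
  \<open>Z\<close>.\<close>

lemma midpoint_combination:
  assumes b: "X \<in> ball 0 1" "Y \<in> ball 0 1" "Z \<in> ball 0 1" and r: "r > 0"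
    and XY: "hdist X Y \<le> r" and XZ: "hdist X Z \<le> r" and YZ: "hdist Y Z \<ge> 2 * r"
  shows "hlift Y + hlift Z = (2 * cosh r) *\<^sub>R hlift X"
proof -
  have t: "hdist Y Z \<le> hdist X Y + hdist X Z" using hdist_triangle[OF b(2,1,3)] hdist_commute[of X Y] by simp
  have e: "hdist X Y = r" "hdist X Z = r" "hdist Y Z = 2 * r" using t XY XZ YZ by linarith+
  have "hdist Y X + hdist X Z = hdist Y Z" using e hdist_commute[of X Y] by simp
  then have "sinh (2 * r) *\<^sub>R hlift X = sinh r *\<^sub>R hlift Y + sinh r *\<^sub>R hlift Z"
    using hdist_between[OF b(2,3,1)] e by simp
  then have "sinh r *\<^sub>R ((2 * cosh r) *\<^sub>R hlift X) = sinh r *\<^sub>R (hlift Y + hlift Z)"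
    unfolding sinh_double by (simp add: scaleR_add_right mult_ac)
  moreover have "sinh r \<noteq> 0" using r by simp
  ultimately show ?thesis by (metis real_vector.scale_left_imp_eq)
qed

definition "\<psi> \<kappa> \<kappa>' z = x0 z - \<kappa> * x1 z - \<kappa>' * x2 z"

text \<open>The linear function \<open>\<psi>\<close> satisfies \<open>\<psi> Y + \<psi> Z = 2 cosh r \<psi> X\<close> at the midpoint \<open>X\<close> of a segment of length
  \<open>2 r\<close>, so it has no positive local maximum on a geodesic.\<close>

lemma midpoint_psi:
  assumes "X \<in> ball 0 1" "Y \<in> ball 0 1" "Z \<in> ball 0 1" "r > 0"
    "hdist X Y \<le> r" "hdist X Z \<le> r" "hdist Y Z \<ge> 2 * r" "\<psi> \<kappa> \<kappa>' X > 0"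
  shows "\<psi> \<kappa> \<kappa>' Y + \<psi> \<kappa> \<kappa>' Z > 2 * \<psi> \<kappa> \<kappa>' X"
proof -
  define V where "V = e0 + \<kappa> *\<^sub>R e1 + \<kappa>' *\<^sub>R e2"
  have V: "\<psi> \<kappa> \<kappa>' z = mink V (hlift z)" for z
    by (simp add: V_def \<psi>_def x0_def x1_def x2_def)
  have "\<psi> \<kappa> \<kappa>' Y + \<psi> \<kappa> \<kappa>' Z = 2 * cosh r * \<psi> \<kappa> \<kappa>' X"
    using arg_cong[OF midpoint_combination[OF assms(1-7)], of "mink V"] by (simp add: V)
  moreover have "cosh r > cosh 0" using assms(4) cosh_real_nonneg_less_iff[of 0 r] by simp
  then have "2 * cosh r * \<psi> \<kappa> \<kappa>' X > 2 * 1 * \<psi> \<kappa> \<kappa>' X" using assms(8) by (intro mult_strict_right_mono) auto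
  ultimately show ?thesis by simp
qed

text \<open>The absolute values make it invariant under the gluing. For coefficients
  \<open>(0, 0)\<close> it is the hyperbolic cosine of the distance to the centre, for
  \<open>(c, 0)\<close> and \<open>(0, s)\<close> a multiple of the hyperbolic cosine of the
  distance to the nearer foot on the corresponding pair of sides, and for \<open>(c, s)\<close> the
  pairing with the null vector of the nearest vertex, the exponential of a Busemann function at the
  cusp.\<close>

definition "tent \<kappa> \<kappa>' z = x0 z - \<kappa> * \<bar>x1 z\<bar> - \<kappa>' * \<bar>x2 z\<bar>"

text \<open>\<open>arsinh |x1 X|\<close> is the distance of \<open>X\<close> to the axis
  \<open>x1 = 0\<close>, where \<open>|x1|\<close> has its kink. Within a smaller distance the sign
  of \<open>x1\<close> stays that of \<open>x1 X\<close>.\<close>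

lemma tent_eq_psi:
  assumes XY: "X \<in> ball 0 1" "Y \<in> ball 0 1" "hdist X Y \<le> r"
    and 1: "\<kappa> \<noteq> 0 \<Longrightarrow> r < arsinh \<bar>x1 X\<bar>" and 2: "\<kappa>' \<noteq> 0 \<Longrightarrow> r < arsinh \<bar>x2 X\<bar>"
  shows "tent \<kappa> \<kappa>' Y = \<psi> (\<kappa> * sgn (x1 X)) (\<kappa>' * sgn (x2 X)) Y"
proof -
  have sg: "sgn u * v = \<bar>v\<bar>" if "\<bar>arsinh u - arsinh v\<bar> \<le> r" "r < arsinh \<bar>u\<bar>" for u v :: real
  proof -
    have a: "\<bar>arsinh u - arsinh v\<bar> < \<bar>arsinh u\<bar>" using that by (simp add: arsinh_abs)
    have pos: "arsinh x > 0 \<longleftrightarrow> x > 0" "arsinh x < 0 \<longleftrightarrow> x < 0" for x :: real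
      using arsinh_less_iff_real[of 0 x] arsinh_less_iff_real[of x 0] by simp_all
    consider "arsinh u > 0" "arsinh v > 0" | "arsinh u < 0" "arsinh v < 0" using a by linarith
    then show ?thesis unfolding pos by cases auto
  qed
  have "\<kappa> * (sgn (x1 X) * x1 Y) = \<kappa> * \<bar>x1 Y\<bar>"
    using sg[OF order.trans[OF x1_Lip[OF XY(1,2)] XY(3)] 1] by (cases "\<kappa> = 0") auto
  moreover have "\<kappa>' * (sgn (x2 X) * x2 Y) = \<kappa>' * \<bar>x2 Y\<bar>"
    using sg[OF order.trans[OF x2_Lip[OF XY(1,2)] XY(3)] 2] by (cases "\<kappa>' = 0") auto
  ultimately show ?thesis by (simp only: tent_def \<psi>_def mult.assoc)
qed

lemma cs_Cauchy_Schwarz: "(c * a + s * b)\<^sup>2 \<le> (c * c + s * s) * (a\<^sup>2 + b\<^sup>2)"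
proof -
  have "(c * c + s * s) * (a\<^sup>2 + b\<^sup>2) - (c * a + s * b)\<^sup>2 = (c * b - s * a)\<^sup>2"
    by (simp add: power2_eq_square algebra_simps)
  then show ?thesis using zero_le_power2[of "c * b - s * a"] by linarith
qed

text \<open>By Cauchy-Schwarz, because the squares of the coefficients add up to at most
  \<open>c^2 + s^2 = 1\<close>.\<close>

lemma tent_pos:
  assumes z: "z \<in> ball 0 1" and k: "0 \<le> \<kappa>" "\<kappa> \<le> c" "0 \<le> \<kappa>'" "\<kappa>' \<le> s"
  shows "tent \<kappa> \<kappa>' z > 0"
proof -
  have "(\<kappa> * \<bar>x1 z\<bar> + \<kappa>' * \<bar>x2 z\<bar>)\<^sup>2 \<le> (c * \<bar>x1 z\<bar> + s * \<bar>x2 z\<bar>)\<^sup>2"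
    using k by (intro power_mono add_mono mult_right_mono add_nonneg_nonneg mult_nonneg_nonneg) auto
  also have "\<dots> \<le> (c * c + s * s) * ((x1 z)\<^sup>2 + (x2 z)\<^sup>2)"
    using cs_Cauchy_Schwarz[of "\<bar>x1 z\<bar>" "\<bar>x2 z\<bar>"] by simp
  also have "\<dots> < (x0 z)\<^sup>2" unfolding cs using coords_norm[OF z] by simp
  finally have "\<kappa> * \<bar>x1 z\<bar> + \<kappa>' * \<bar>x2 z\<bar> < x0 z"
    using power2_less_imp_less x0_pos[OF z] less_imp_le by blast
  then show ?thesis by (simp add: tent_def)
qed

text \<open>The factor \<open>E = exp (hdist z w)\<close> makes \<open>E * hlift w - hlift z\<close>
  a null vector pointing to the future, as \<open>E^2 + 1 = 2 * E * cosh (hdist z w)\<close>. On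
  such a vector \<open>x0\<close> dominates the two other terms. In effect \<open>ln\<close> of
  \<open>tent\<close> is 1-Lipschitz.\<close>

lemma tent_Lip:
  assumes z: "z \<in> ball 0 1" and w: "w \<in> ball 0 1" and k: "0 \<le> \<kappa>" "\<kappa> \<le> c" "0 \<le> \<kappa>'" "\<kappa>' \<le> s"
  shows "tent \<kappa> \<kappa>' z \<le> exp (hdist z w) * tent \<kappa> \<kappa>' w"
proof -
  define E where "E = exp (hdist z w)"
  have h0: "hdist z w \<ge> 0" by (rule hdist_nonneg[OF z w])
  have ch: "2 * cosh (hdist z w) * E = E * E + 1"
    by (simp add: E_def cosh_def exp_minus algebra_simps)
  define D0 D1 D2 where D: "D0 = E * x0 w - x0 z" "D1 = E * x1 w - x1 z" "D2 = E * x2 w - x2 z"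
  have "D0 \<ge> 0"
  proof -
    define o' where "o' = hproj e0"
    have o: "o' \<in> ball 0 1" "hlift o' = e0" using e0_in by (simp_all add: o'_def)
    have x0: "x0 v = cosh (hdist o' v)" if "v \<in> ball 0 1" for v
      using cosh_hdist[OF o(1) that] o(2) by (simp add: x0_def)
    have "x0 z \<le> cosh (hdist o' w + hdist z w)"
    proof -
      have "hdist o' z \<le> hdist o' w + hdist z w" using hdist_triangle[OF o(1) w z] by (simp add: hdist_commute)
      then show ?thesis unfolding x0[OF z] using hdist_nonneg[OF o(1) z] by (subst cosh_real_nonneg_le_iff) auto
    qed
    also have "\<dots> = cosh (hdist o' w) * cosh (hdist z w) + sinh (hdist o' w) * sinh (hdist z w)" by (rule cosh_add)
    also have "\<dots> \<le> cosh (hdist o' w) * cosh (hdist z w) + cosh (hdist o' w) * sinh (hdist z w)"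
      using h0 sinh_less_cosh_real[of "hdist o' w"] by (intro add_left_mono mult_right_mono) auto
    also have "\<dots> = x0 w * E" unfolding x0[OF w] E_def by (simp add: distrib_left[symmetric] cosh_plus_sinh)
    finally show ?thesis by (simp add: D mult.commute)
  qed
  have "D0\<^sup>2 - (D1\<^sup>2 + D2\<^sup>2) = E * E * ((x0 w)\<^sup>2 - (x1 w)\<^sup>2 - (x2 w)\<^sup>2) + ((x0 z)\<^sup>2 - (x1 z)\<^sup>2 - (x2 z)\<^sup>2)
      - 2 * E * (x0 z * x0 w - x1 z * x1 w - x2 z * x2 w)"
    unfolding D by (simp add: power2_eq_square algebra_simps)
  also have "\<dots> = E * E * 1 + 1 - 2 * E * cosh (hdist z w)"
    using coords_norm[OF z] coords_norm[OF w] cosh_hdist_coords[OF z w] by simp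
  finally have D2: "D1\<^sup>2 + D2\<^sup>2 = D0\<^sup>2" using ch by (simp add: mult_ac)
  have "(\<kappa> * \<bar>D1\<bar> + \<kappa>' * \<bar>D2\<bar>)\<^sup>2 \<le> (c * \<bar>D1\<bar> + s * \<bar>D2\<bar>)\<^sup>2"
    using k by (intro power_mono add_mono mult_right_mono add_nonneg_nonneg mult_nonneg_nonneg) auto
  also have "\<dots> \<le> (c * c + s * s) * (D1\<^sup>2 + D2\<^sup>2)"
    using cs_Cauchy_Schwarz[of "\<bar>D1\<bar>" "\<bar>D2\<bar>"] by simp
  finally have "(\<kappa> * \<bar>D1\<bar> + \<kappa>' * \<bar>D2\<bar>)\<^sup>2 \<le> D0\<^sup>2" by (simp only: cs D2 mult_1_left)
  from power2_le_imp_le[OF this \<open>D0 \<ge> 0\<close>] have "\<kappa> * \<bar>D1\<bar> + \<kappa>' * \<bar>D2\<bar> \<le> D0" .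
  moreover have "\<kappa> * (E * \<bar>x1 w\<bar> - \<bar>x1 z\<bar>) \<le> \<kappa> * \<bar>D1\<bar>" "\<kappa>' * (E * \<bar>x2 w\<bar> - \<bar>x2 z\<bar>) \<le> \<kappa>' * \<bar>D2\<bar>"
  proof -
    have "E * \<bar>a\<bar> - \<bar>b\<bar> \<le> \<bar>E * a - b\<bar>" for a b
      using abs_triangle_ineq2[of "E * a" b] by (simp add: abs_mult E_def)
    then show "\<kappa> * (E * \<bar>x1 w\<bar> - \<bar>x1 z\<bar>) \<le> \<kappa> * \<bar>D1\<bar>" "\<kappa>' * (E * \<bar>x2 w\<bar> - \<bar>x2 z\<bar>) \<le> \<kappa>' * \<bar>D2\<bar>"
      unfolding D using k by (auto intro: mult_left_mono)
  qed
  ultimately have "\<kappa> * (E * \<bar>x1 w\<bar> - \<bar>x1 z\<bar>) + \<kappa>' * (E * \<bar>x2 w\<bar> - \<bar>x2 z\<bar>) \<le> E * x0 w - x0 z"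
    unfolding D(1) by linarith
  then show ?thesis unfolding tent_def E_def[symmetric] by (simp add: algebra_simps)
qed

text \<open>Near an interior point the torus is the plane. The distance to \<open>X\<close>, cut off
  at \<open>\<rho>\<close>, is constant on all sides and hence invariant, so it shows that the
  points of the curve at parameter distance \<open>r\<close> are within \<open>r\<close> of
  \<open>X\<close> in the plane. Then \<open>X\<close> is a midpoint, and the convexity of the
  linear function contradicts the maximum.\<close>

lemma no_interior_maximum:
  assumes cg: "closed_geodesic T d l C" and X: "X \<in> C t0"
    and k: "0 \<le> \<kappa>" "\<kappa> \<le> c" "0 \<le> \<kappa>'" "\<kappa>' \<le> s"
    and kX: "\<kappa> \<noteq> 0 \<Longrightarrow> x1 X \<noteq> 0" "\<kappa>' \<noteq> 0 \<Longrightarrow> x2 X \<noteq> 0"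
    and int: "\<bar>x1 X\<bar> \<noteq> c * x0 X" "\<bar>x2 X\<bar> \<noteq> s * x0 X"
    and max: "\<And>t z. z \<in> C t \<Longrightarrow> tent \<kappa> \<kappa>' z \<le> tent \<kappa> \<kappa>' X"
  shows False
proof -
  have CT: "C t \<in> T" for t using cg by (simp add: closed_geodesic_def)
  have XQ: "X \<in> Q" "X \<in> ball 0 1" using X CT T_subset_Q Q_ball by blast+
  obtain e where e: "e > 0" "\<And>r s. r \<in> ball t0 e \<Longrightarrow> s \<in> ball t0 e \<Longrightarrow> d (C r) (C s) = \<bar>r - s\<bar>"
    using cg unfolding closed_geodesic_def by blast
  define \<rho> where "\<rho> = min (gap1 X) (gap2 X)"
  have \<rho>: "\<rho> > 0" using gap_pos[OF XQ(1)] int by (simp add: \<rho>_def)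
  \<comment> \<open>The distance to the kink of \<open>|x1|\<close>. With coefficient 0 there is no
    kink and any positive number serves.\<close>
  define b1 where "b1 = (if \<kappa> = 0 then 1 else arsinh \<bar>x1 X\<bar>)"
  define b2 where "b2 = (if \<kappa>' = 0 then 1 else arsinh \<bar>x2 X\<bar>)"
  have b: "b1 > 0" "b2 > 0"
    using kX by (auto simp: b1_def b2_def arsinh_abs)
  define r where "r = min (min e \<rho>) (min b1 b2) / 2"
  have r: "r > 0" "r < e" "r < \<rho>" "r < b1" "r < b2" using e(1) \<rho> b by (auto simp: r_def min_def)
  define \<phi> where "\<phi> w = min (hdist X w) \<rho>" for w
  have lip: "Lip \<phi>" unfolding \<phi>_def by (intro Lip_min Lip_dist XQ Lip_const)
  have bd: "\<phi> w = \<rho>" if "w \<in> Q" "\<bar>x1 w\<bar> = c * x0 w \<or> \<bar>x2 w\<bar> = s * x0 w" for w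
    using that gap1[OF XQ(2) Q_ball] gap2[OF XQ(2) Q_ball] by (fastforce simp: \<phi>_def \<rho>_def min_def)
  have inv: "invariant \<phi>" unfolding invariant_def
  proof (intro allI impI)
    fix x y assume g: "(x, y) \<in> glued vertices"
    show "\<phi> x = \<phi> y"
    proof (cases "x = y")
      case False
      have "x \<in> Q" "y \<in> Q" using g glued_iff by auto
      moreover have "\<bar>x1 y\<bar> = c * x0 y \<or> \<bar>x2 y\<bar> = s * x0 y" "\<bar>x1 x\<bar> = c * x0 x \<or> \<bar>x2 x\<bar> = s * x0 x"
        using glued_neq[OF g False] by auto
      ultimately show ?thesis using bd by simp
    qed simp
  qed
  have near: "hdist X Y \<le> r" if "Y \<in> C t" "\<bar>t - t0\<bar> = r" for Y t
  proof -
    have "\<bar>\<phi> X - \<phi> Y\<bar> \<le> d (C t0) (C t)" by (rule torus_dist_ge[OF lip inv CT CT X that(1)])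
    also have "\<dots> = r" using e that(2) r by (subst e(2)) (auto simp: ball_def dist_real_def)
    finally have "\<bar>min (hdist X X) \<rho> - min (hdist X Y) \<rho>\<bar> \<le> r" by (simp add: \<phi>_def)
    moreover have "hdist X X = 0" using hdist_eq_0 XQ by blast
    ultimately show ?thesis using r \<rho> by (auto simp: min_def split: if_splits)
  qed
  obtain Y Z where Y: "Y \<in> C (t0 + r)" and Z: "Z \<in> C (t0 - r)" using torus_points_cases[OF CT] by metis
  have YQ: "Y \<in> ball 0 1" "Z \<in> ball 0 1" using Y Z CT T_subset_Q Q_ball by blast+
  have XY: "hdist X Y \<le> r" "hdist X Z \<le> r" using near[OF Y] near[OF Z] r by auto
  have "2 * r = d (C (t0 + r)) (C (t0 - r))" using r by (subst e(2)) (auto simp: ball_def dist_real_def)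
  also have "\<dots> \<le> hdist Y Z" by (rule torus_dist_le[OF CT CT Y Z])
  finally have YZ: "2 * r \<le> hdist Y Z" .
  have f: "tent \<kappa> \<kappa>' w = \<psi> (\<kappa> * sgn (x1 X)) (\<kappa>' * sgn (x2 X)) w" if "w \<in> ball 0 1" "hdist X w \<le> r" for w
    using that r by (intro tent_eq_psi[OF XQ(2)]) (auto simp: b1_def b2_def)
  have "hdist X X \<le> r" using hdist_eq_0[of X X] XQ(2) r(1) by simp
  then have fX: "tent \<kappa> \<kappa>' X = \<psi> (\<kappa> * sgn (x1 X)) (\<kappa>' * sgn (x2 X)) X" by (rule f[OF XQ(2)])
  have "tent \<kappa> \<kappa>' Y + tent \<kappa> \<kappa>' Z > 2 * tent \<kappa> \<kappa>' X"
    unfolding f[OF YQ(1) XY(1)] f[OF YQ(2) XY(2)] fX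
    using tent_pos[OF XQ(2) k] by (intro midpoint_psi[OF XQ(2) YQ r(1) XY YZ]) (simp add: fX)
  then show False using max[OF Y] max[OF Z] by linarith
qed

text \<open>By the first identity a point beyond the side \<open>x1 = c x0\<close> is carried to the
  inner side of \<open>x1 = - c x0\<close>. The second rests on
  \<open>1 - c^2 = s^2\<close>.\<close>

lemma tau_opposite:
  assumes w: "w \<in> ball 0 1"
  shows "c * x0 (\<tau> w) + x1 (\<tau> w) = - (c * x0 w - x1 w)" "\<psi> (- c) \<kappa> (\<tau> w) = \<psi> c \<kappa> w"
proof -
  define F where "F = (x0 w - c * x1 w) / (s * s)"
  have F: "F * (s * s) = x0 w - c * x1 w" using s_pos by (simp add: F_def)
  have t: "x0 (\<tau> w) = 2 * F - x0 w" "x1 (\<tau> w) = x1 w - 2 * c * F" "x2 (\<tau> w) = x2 w"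
    using tau_coords(2-4)[OF w] by (simp_all add: F_def)
  show "c * x0 (\<tau> w) + x1 (\<tau> w) = - (c * x0 w - x1 w)" unfolding t by (simp add: algebra_simps)
  have "\<psi> (- c) \<kappa> (\<tau> w) = 2 * (F * (1 - c * c)) - x0 w + c * x1 w - \<kappa> * x2 w"
    unfolding \<psi>_def t by (simp add: algebra_simps)
  also have "1 - c * c = s * s" using cs by simp
  finally show "\<psi> (- c) \<kappa> (\<tau> w) = \<psi> c \<kappa> w" unfolding F by (simp add: \<psi>_def)
qed

text \<open>Since \<open>\<tau> b\<close> is in the quadrilateral, \<open>b\<close> lies on or
  beyond the side \<open>x1 = c x0\<close>. The segment from \<open>a\<close> to \<open>b\<close>
  meets this side in \<open>W\<close>, and the chain from \<open>a\<close> to \<open>W\<close>,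
  glued to \<open>\<tau> W\<close>, and on to \<open>\<tau> b\<close> has the length of the
  segment.\<close>

lemma torus_dist_le_across:
  assumes AB: "A \<in> T" "B \<in> T" "a \<in> A" "\<tau> b \<in> B" and b: "b \<in> ball 0 1"
  shows "d A B \<le> hdist a b"
proof -
  have aQ: "a \<in> Q" "\<tau> b \<in> Q" using AB T_subset_Q by auto
  then have ab: "a \<in> ball 0 1" by (simp add: Q_ball)
  define f where "f w = c * x0 w - x1 w" for w
  have fa: "f a \<ge> 0" using aQ(1) by (auto simp: Q_def f_def abs_le_iff)
  have fb: "f b \<le> 0" using aQ(2) tau_opposite(1)[OF b] by (auto simp: Q_def f_def abs_le_iff)
  obtain W where W: "W \<in> ball 0 1" "f W = 0" "hdist a W + hdist W b = hdist a b"
  proof (cases "f a = 0")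
    case True
    have "hdist a a + hdist a b = hdist a b" using hdist_eq_0 ab by simp
    then show thesis using that[of a] ab True by blast
  next
    case False
    define \<alpha> \<beta> where "\<alpha> = f a" "\<beta> = - f b"
    have p: "\<alpha> > 0" "\<beta> \<ge> 0" using fa fb False by (auto simp: \<alpha>_\<beta>_def)
    \<comment> \<open>The weights are chosen so that \<open>f\<close> cancels; the normalized vector
      is the crossing point. The case \<open>f a = 0\<close>, where \<open>a\<close> itself is on
      the side, was split off to have \<open>\<alpha> > 0\<close>.\<close>
    define V where "V = \<beta> *\<^sub>R hlift a + \<alpha> *\<^sub>R hlift b"
    have m: "mink (hlift a) (hlift b) > 0" "mink (hlift b) (hlift a) > 0"
      using mink_hyperboloid_pos ab b by auto
    have VV: "mink V V > 0"
    proof -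
      have "mink V V = \<beta> * \<beta> + \<alpha> * \<alpha> + 2 * \<alpha> * \<beta> * mink (hlift a) (hlift b)"
        using ab b by (simp add: V_def mink_commute[of "hlift b" "hlift a"] algebra_simps)
      also have "\<dots> > 0" using p m by (intro add_pos_nonneg add_nonneg_pos) auto
      finally show ?thesis .
    qed
    define k where "k = 1 / sqrt (mink V V)"
    have k: "k > 0" "k * k * mink V V = 1" using VV by (auto simp: k_def)
    have h: "k *\<^sub>R V \<in> hyperboloid"
    proof (rule hyperboloidI)
      show "mink (k *\<^sub>R V) (k *\<^sub>R V) = 1" using k by (simp add: mult.assoc)
      have "mink V (hlift a) > 0" using p m ab by (auto simp: V_def intro: add_nonneg_pos)
      then show "mink (k *\<^sub>R V) (hlift a) > 0" using k by simp
    qed (use ab in simp)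
    define W where "W = hproj (k *\<^sub>R V)"
    have W: "W \<in> ball 0 1" "hlift W = (k * \<beta>) *\<^sub>R hlift a + (k * \<alpha>) *\<^sub>R hlift b"
      using h by (simp_all add: W_def) (simp add: V_def scaleR_add_right)
    have "f W = k * \<beta> * f a + k * \<alpha> * f b"
      unfolding f_def x0_def x1_def W(2) by (simp add: algebra_simps)
    then have "f W = 0" by (simp add: \<alpha>_\<beta>_def)
    moreover have "hdist a W + hdist W b = hdist a b"
      using p k by (intro mink_combination_between[OF ab b W(1) _ _ W(2)]) auto
    ultimately show thesis using that W(1) by blast
  qed
  have W': "x1 W = c * x0 W" using W(2) by (simp add: f_def)
  have "W \<in> hgeo V1 V2" using W(1) W' by (simp add: side12_eq)
  then have WQ: "W \<in> Q" using hgeo_subset_Q[of V1 V2] by auto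
  have "\<tau> W \<in> hgeo V3 V4" using tau_side[OF W(1) W'] tau_coords(1)[OF W(1)] W' by (simp add: side34_eq)
  then have tWQ: "\<tau> W \<in> Q" using hgeo_subset_Q[of V3 V4] by auto
  have "(W, \<tau> W) \<in> glued vertices"
    unfolding glued_iff using WQ tWQ tau_side[OF W(1) W'] W' x0_pos[OF W(1)] c_pos by simp
  then have "d A B \<le> hdist a W + hdist (\<tau> W) (\<tau> b)" using torus_dist_le_glued AB by blast
  also have "hdist (\<tau> W) (\<tau> b) = hdist W b"
    using tau_translation W(1) b unfolding translation_along_def orientation_preserving_isometry_def by blast
  finally show ?thesis using W(3) by simp
qed

end

context quad
begin

text \<open>Moves a point on one of the two sides to \<open>x1 = c x0\<close>, the side on which
  \<open>\<tau>\<close> acts as the pairing. The representative \<open>w\<close> of the class is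
  either \<open>z\<close>, whose mirror image is then taken, or already the mirror image.\<close>

lemma other_side_member:
  assumes A: "A \<in> T" "z \<in> A" and z: "\<bar>x1 z\<bar> = c * x0 z"
  obtains z' where "z' \<in> A" "x1 z' = c * x0 z'" "x0 z' = x0 z" "\<bar>x2 z'\<bar> = \<bar>x2 z\<bar>"
proof (cases "x1 z = c * x0 z")
  case True
  then show thesis using that A by blast
next
  case False
  have zQ: "z \<in> Q" "z \<in> ball 0 1" using A T_subset_Q Q_ball by blast+
  have neg: "x1 z = - (c * x0 z)" using z False by linarith
  obtain w where w: "w \<in> Q" "A = cls w" using torus_points_cases[OF A(1)] by blast
  then have wz: "(w, z) \<in> glued vertices" using A(2) by simp
  have ww: "(w, w) \<in> glued vertices" using w glued_iff[of w w] by simp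
  show thesis
  proof (cases "w = z")
    case True
    have n: "(x0 z)\<^sup>2 = 1 + (- x1 z)\<^sup>2 + (x2 z)\<^sup>2" using coords_norm[OF zQ(2)] by simp
    note z' = pt[OF n x0_pos[OF zQ(2)]]
    let ?z' = "pt (x0 z) (- x1 z) (x2 z)"
    have "?z' \<in> Q" unfolding Q_def using z' zQ(1) by (simp add: Q_def)
    then have "(z, ?z') \<in> glued vertices" unfolding glued_iff using zQ z z' by simp
    then have "?z' \<in> A" using True w by simp
    then show thesis using that[of ?z'] z' neg by simp
  next
    case False
    have "w \<in> A" using w ww by simp
    moreover have "\<bar>x2 z\<bar> \<noteq> s * x0 z" using no_corner zQ z by blast
    then have "x1 w = - x1 z \<and> x2 w = x2 z \<and> x0 w = x0 z"
      using glued_neq[OF wz False] by auto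
    ultimately show thesis using that[of w] neg by simp
  qed
qed

text \<open>At a side, the part of the geodesic that lies beyond the side is moved by \<open>\<tau>\<close> next to the first part.
  There \<open>tent c \<kappa>\<close> continues as a linear function, because \<open>\<tau>\<close> carries \<open>\<psi> c \<kappa>\<close> to
  \<open>\<psi> (- c) \<kappa>\<close>: this is where the coefficient \<open>c\<close> is needed.\<close>

lemma no_side_maximum:
  assumes cg: "closed_geodesic T d l C" and X0: "X0 \<in> C t0" "\<bar>x1 X0\<bar> = c * x0 X0"
    and k: "0 \<le> \<kappa>" "\<kappa> \<le> s" and kX0: "\<kappa> \<noteq> 0 \<Longrightarrow> x2 X0 \<noteq> 0"
    and max0: "\<And>t z. z \<in> C t \<Longrightarrow> tent c \<kappa> z \<le> tent c \<kappa> X0"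
  shows False
proof -
  have CT: "C t \<in> T" for t using cg by (simp add: closed_geodesic_def)
  obtain X where X: "X \<in> C t0" "x1 X = c * x0 X" "x0 X = x0 X0" "\<bar>x2 X\<bar> = \<bar>x2 X0\<bar>"
    using other_side_member[OF CT X0] by metis
  have XQ: "X \<in> Q" "X \<in> ball 0 1" using X(1) CT T_subset_Q Q_ball by blast+
  have aX: "\<bar>x1 X\<bar> = c * x0 X" using X(2) x0_pos[OF XQ(2)] c_pos by simp
  have max: "tent c \<kappa> z \<le> tent c \<kappa> X" if "z \<in> C t" for z t
    using max0[OF that] X X0(2) aX by (simp add: tent_def)
  have kX: "x2 X \<noteq> 0" if "\<kappa> \<noteq> 0" using kX0[OF that] X(4) by auto
  obtain e where e: "e > 0" "\<And>r s. r \<in> ball t0 e \<Longrightarrow> s \<in> ball t0 e \<Longrightarrow> d (C r) (C s) = \<bar>r - s\<bar>"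
    using cg unfolding closed_geodesic_def by blast
  define X' where "X' = \<tau> X"
  have X': "X' \<in> ball 0 1" "x0 X' = x0 X" "x1 X' = - x1 X" "x2 X' = x2 X"
    unfolding X'_def using tau_side[OF XQ(2) X(2)] tau_coords(1)[OF XQ(2)] by auto
  define \<rho> where "\<rho> = gap2 X"
  have \<rho>: "\<rho> > 0" using gap_pos(2)[OF XQ(1)] no_corner[OF XQ(2) aX] by (simp add: \<rho>_def)
  have \<rho>': "gap2 X' = \<rho>" by (simp add: \<rho>_def gap2_def X')
  define b1 where "b1 = arsinh \<bar>x1 X\<bar>"
  define b2 where "b2 = (if \<kappa> = 0 then 1 else arsinh \<bar>x2 X\<bar>)"
  have x1p: "x1 X > 0" using X(2) x0_pos[OF XQ(2)] c_pos by simp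
  have b: "b1 > 0" "b2 > 0" using kX x1p by (auto simp: b1_def b2_def arsinh_abs)
  define r where "r = min (min e \<rho>) (min b1 b2) / 2"
  have r: "r > 0" "r < e" "r < \<rho>" "r < b1" "r < b2" using e(1) \<rho> b by (auto simp: r_def min_def)
  \<comment> \<open>The pairing exchanges the roles of \<open>X\<close> and its glued copy
    \<open>X'\<close>, so the minimum of the two distances is invariant on the sides
    \<open>|x1| = c x0\<close>. On the other two sides the cut-off at \<open>\<rho>\<close> makes
    the function constant.\<close>
  define \<phi> where "\<phi> w = min (min (hdist X w) (hdist X' w)) \<rho>" for w
  have lip: "Lip \<phi>" unfolding \<phi>_def by (intro Lip_min Lip_dist XQ X' Lip_const)
  have bd: "\<phi> w = \<rho>" if "w \<in> Q" "\<bar>x2 w\<bar> = s * x0 w" for w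
    using gap2[OF XQ(2) Q_ball[OF that(1)] that(2)] gap2[OF X'(1) Q_ball[OF that(1)] that(2)]
    unfolding \<rho>' by (simp add: \<phi>_def \<rho>_def min_def)
  have flip: "hdist X y = hdist X' x" "hdist X' y = hdist X x"
    if "x \<in> ball 0 1" "y \<in> ball 0 1" "x0 y = x0 x" "x1 y = - x1 x" "x2 y = x2 x" for x y
    using that XQ(2) X' by (simp_all add: hdist_mink mink_coords)
  have inv: "invariant \<phi>" unfolding invariant_def
  proof (intro allI impI)
    fix x y assume g: "(x, y) \<in> glued vertices"
    have xy: "x \<in> Q" "y \<in> Q" using g glued_iff by auto
    show "\<phi> x = \<phi> y"
    proof (cases "x = y")
      case False
      from glued_neq[OF g False] show ?thesis
      proof
        assume "\<bar>x1 x\<bar> = c * x0 x \<and> x1 y = - x1 x \<and> x2 y = x2 x \<and> x0 y = x0 x"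
        then have "hdist X y = hdist X' x" "hdist X' y = hdist X x" using flip[of x y] xy Q_ball by auto
        then show ?thesis by (simp add: \<phi>_def min.commute)
      next
        assume "\<bar>x2 x\<bar> = s * x0 x \<and> x1 y = x1 x \<and> x2 y = - x2 x \<and> x0 y = x0 x"
        then show ?thesis using bd[of x] bd[of y] xy by simp
      qed
    qed simp
  qed
  have "\<tau> ` ball 0 1 = ball 0 1"
    using tau_translation unfolding translation_along_def orientation_preserving_isometry_def by (elim conjE)
  then have onto: "\<exists>b\<in>ball 0 1. \<tau> b = w" if "w \<in> ball 0 1" for w
    using that by (metis imageE)
  have "\<forall>z\<in>ball 0 1. \<forall>w\<in>ball 0 1. hdist (\<tau> z) (\<tau> w) = hdist z w"
    using tau_translation unfolding translation_along_def orientation_preserving_isometry_def by (elim conjE)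
  then have iso: "hdist (\<tau> a) (\<tau> b) = hdist a b" if "a \<in> ball 0 1" "b \<in> ball 0 1" for a b
    using that by simp
  have XX: "hdist X X = 0" using hdist_eq_0 XQ by blast
  let ?\<kappa> = "\<kappa> * sgn (x2 X)"
  have sg: "sgn (x1 X) = 1" "sgn (x1 X') = -1" "sgn (x2 X') = sgn (x2 X)" using x1p X' by auto
  have near: "\<exists>Y'\<in>ball 0 1. hdist X Y' \<le> r \<and> (Y' = Y \<or> \<tau> Y' = Y) \<and> \<psi> c ?\<kappa> Y' = tent c \<kappa> Y"
    if Y: "Y \<in> C t" "\<bar>t - t0\<bar> = r" for Y t
  proof -
    have Yb: "Y \<in> ball 0 1" using Y(1) CT T_subset_Q Q_ball by blast
    have "\<bar>\<phi> X - \<phi> Y\<bar> \<le> d (C t0) (C t)" by (rule torus_dist_ge[OF lip inv CT CT X(1) Y(1)])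
    also have "\<dots> = r" using e Y(2) r by (subst e(2)) (auto simp: ball_def dist_real_def)
    finally have "\<bar>min (min (hdist X X) (hdist X' X)) \<rho> - min (min (hdist X Y) (hdist X' Y)) \<rho>\<bar> \<le> r"
      by (simp add: \<phi>_def)
    moreover have "min (min (hdist X X) (hdist X' X)) \<rho> = 0"
      using XX \<rho> hdist_nonneg[OF X'(1) XQ(2)] by (simp add: min_def)
    ultimately have "min (min (hdist X Y) (hdist X' Y)) \<rho> \<le> r" by linarith
    then consider "hdist X Y \<le> r" | "hdist X' Y \<le> r" using r(3) by (auto simp: min_def split: if_splits)
    then show ?thesis
    proof cases
      case 1
      have "tent c \<kappa> Y = \<psi> (c * sgn (x1 X)) ?\<kappa> Y"
        using r by (intro tent_eq_psi[OF XQ(2) Yb 1]) (auto simp: b1_def b2_def)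
      then show ?thesis using 1 Yb sg by auto
    next
      case 2
      obtain b where bb: "b \<in> ball 0 1" "\<tau> b = Y" using onto[OF Yb] by blast
      have "hdist X b \<le> r" using 2 iso[OF XQ(2) bb(1)] bb(2) by (simp add: X'_def)
      moreover have "tent c \<kappa> Y = \<psi> (c * sgn (x1 X')) (\<kappa> * sgn (x2 X')) Y"
        using r by (intro tent_eq_psi[OF X'(1) Yb 2]) (auto simp: b1_def b2_def X')
      then have "tent c \<kappa> Y = \<psi> c ?\<kappa> b"
        unfolding sg using tau_opposite(2)[OF bb(1), of ?\<kappa>] bb(2) by simp
      ultimately show ?thesis using bb by auto
    qed
  qed
  obtain Y Z where Y: "Y \<in> C (t0 + r)" and Z: "Z \<in> C (t0 - r)" using torus_points_cases[OF CT] by metis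
  obtain Y' where Y': "Y' \<in> ball 0 1" "hdist X Y' \<le> r" "Y' = Y \<or> \<tau> Y' = Y" "\<psi> c ?\<kappa> Y' = tent c \<kappa> Y"
    using near[OF Y] r by auto
  obtain Z' where Z': "Z' \<in> ball 0 1" "hdist X Z' \<le> r" "Z' = Z \<or> \<tau> Z' = Z" "\<psi> c ?\<kappa> Z' = tent c \<kappa> Z"
    using near[OF Z] r by auto
  have d2: "d (C (t0 + r)) (C (t0 - r)) = 2 * r" "d (C (t0 - r)) (C (t0 + r)) = 2 * r"
    using r by (subst e(2); auto simp: ball_def dist_real_def)+
  have YZ: "2 * r \<le> hdist Y' Z'"
  proof -
    \<comment> \<open>If both points are on the same side of the seam, the plane distance bounds the
      torus distance directly. In the mixed cases the segment crosses the seam.\<close>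
    consider "Y' = Y" "Z' = Z" | "\<tau> Y' = Y" "\<tau> Z' = Z" | "Y' = Y" "\<tau> Z' = Z" | "\<tau> Y' = Y" "Z' = Z"
      using Y'(3) Z'(3) by blast
    then show ?thesis
    proof cases
      case 1
      then show ?thesis using torus_dist_le[OF CT CT Y Z] d2 by simp
    next
      case 2
      then show ?thesis using torus_dist_le[OF CT CT Y Z] d2 iso[OF Y'(1) Z'(1)] by simp
    next
      case 3
      then show ?thesis using torus_dist_le_across[OF CT CT Y _ Z'(1), of "t0 - r"] Z d2 by simp
    next
      case 4
      then show ?thesis using torus_dist_le_across[OF CT CT Z _ Y'(1), of "t0 + r"] Y d2 by (simp add: hdist_commute)
    qed
  qed
  have fX: "tent c \<kappa> X = \<psi> c ?\<kappa> X"
    using X(2) aX by (simp add: tent_def \<psi>_def mult.assoc sgn_mult_self_eq abs_sgn[symmetric] mult.commute[of "sgn _"])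
  have "tent c \<kappa> Y + tent c \<kappa> Z > 2 * tent c \<kappa> X"
    unfolding Y'(4)[symmetric] Z'(4)[symmetric] fX
    using tent_pos[OF XQ(2), of c \<kappa>] k c_pos
    by (intro midpoint_psi[OF XQ(2) Y'(1) Z'(1) r(1) Y'(2) Z'(2) YZ]) (simp flip: fX)
  then show False using max[OF Y] max[OF Z] by linarith
qed

lemma tent_rotate: "quad.tent V2 V3 V4 V1 \<kappa> \<kappa>' z = tent \<kappa>' \<kappa> z"
proof -
  interpret r: quad V2 V3 V4 V1 by (rule quad_rotate)
  show ?thesis by (simp add: r.tent_def tent_def coords_rotate)
qed

lemma no_side_maximum_rotated:
  assumes "closed_geodesic T d l C" "X0 \<in> C t0" "\<bar>x2 X0\<bar> = s * x0 X0"
    and "0 \<le> \<kappa>" "\<kappa> \<le> c" "\<kappa> \<noteq> 0 \<Longrightarrow> x1 X0 \<noteq> 0"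
    and "\<And>t z. z \<in> C t \<Longrightarrow> tent \<kappa> s z \<le> tent \<kappa> s X0"
  shows False
proof -
  interpret r: quad V2 V3 V4 V1 by (rule quad_rotate)
  show ?thesis
    by (rule r.no_side_maximum[of l C X0 t0 \<kappa>])
      (use assms in \<open>auto simp: coords_rotate s_rotate c_rotate vertices_rotate tent_rotate\<close>)
qed

lemma L_rotate: "quad.L V2 V3 V1 = arsinh (s / c)"
proof -
  interpret r: quad V2 V3 V4 V1 by (rule quad_rotate)
  show ?thesis by (simp add: r.L_def s_rotate c_rotate)
qed

lemma crossing_length_rotated:
  assumes "closed_geodesic T d l C" "z \<in> C t1" "x2 z = 0" "w \<in> C t2" "\<bar>x2 w\<bar> = s * x0 w"
  shows "l \<ge> 2 * arsinh (s / c)"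
proof -
  interpret r: quad V2 V3 V4 V1 by (rule quad_rotate)
  show ?thesis
    using r.crossing_length[of l C z t1 w t2] assms
    by (simp add: coords_rotate s_rotate c_rotate vertices_rotate L_rotate)
qed

text \<open>For a curve below the bound the coefficients can be adapted so that the maximum of
  \<open>tent\<close> along it is neither on a kink nor on a side where the function folds. Such a
  maximum is excluded in the interior and on both kinds of sides.\<close>

lemma closed_geodesic_length_ge:
  assumes cg: "closed_geodesic T d l C"
  shows "l \<ge> min (2 * arsinh (c / s)) (2 * arsinh (s / c))"
proof (rule ccontr)
  assume short: "\<not> l \<ge> min (2 * arsinh (c / s)) (2 * arsinh (s / c))"
  have CT: "C t \<in> T" and l: "l > 0" and per: "C (t + l) = C t" for t
    using cg by (auto simp: closed_geodesic_def)
  \<comment> \<open>If the curve reaches \<open>|x1| = c x0\<close>, being short it avoids the axis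
    \<open>x1 = 0\<close>, and the kink of \<open>|x1|\<close> is not met. If it does not reach
    these sides, the coefficient 0 removes the kink and the fold is not met.\<close>
  define \<kappa>1 where "\<kappa>1 = (if \<exists>t. \<exists>z\<in>C t. \<bar>x1 z\<bar> = c * x0 z then c else 0)"
  define \<kappa>2 where "\<kappa>2 = (if \<exists>t. \<exists>z\<in>C t. \<bar>x2 z\<bar> = s * x0 z then s else 0)"
  have 1: "x1 z \<noteq> 0" if "\<kappa>1 \<noteq> 0" "z \<in> C t" for z t
  proof -
    have "\<exists>t. \<exists>z\<in>C t. \<bar>x1 z\<bar> = c * x0 z" using that(1) unfolding \<kappa>1_def by meson
    then obtain u w where "w \<in> C u" "\<bar>x1 w\<bar> = c * x0 w" by blast
    then show ?thesis using crossing_length[OF cg that(2) _ \<open>w \<in> C u\<close>] short by (auto simp: L_def)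
  qed
  have 2: "x2 z \<noteq> 0" if "\<kappa>2 \<noteq> 0" "z \<in> C t" for z t
  proof -
    have "\<exists>t. \<exists>z\<in>C t. \<bar>x2 z\<bar> = s * x0 z" using that(1) unfolding \<kappa>2_def by meson
    then obtain u w where "w \<in> C u" "\<bar>x2 w\<bar> = s * x0 w" by blast
    then show ?thesis using crossing_length_rotated[OF cg that(2) _ \<open>w \<in> C u\<close>] short by auto
  qed
  have k: "0 \<le> \<kappa>1" "\<kappa>1 \<le> c" "0 \<le> \<kappa>2" "\<kappa>2 \<le> s" using c_pos s_pos by (auto simp: \<kappa>1_def \<kappa>2_def)
  \<comment> \<open>The logarithm makes the function 1-Lipschitz, so its values along the curve are
    well-defined and continuous; by periodicity they attain a maximum.\<close>
  define g where "g z = ln (tent \<kappa>1 \<kappa>2 z)" for z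
  have fp: "tent \<kappa>1 \<kappa>2 z > 0" if "z \<in> Q" for z using tent_pos[OF Q_ball[OF that] k] .
  have lip: "Lip g" unfolding Lip_def
  proof (intro ballI)
    have one: "g x - g y \<le> hdist x y" if "x \<in> Q" "y \<in> Q" for x y
    proof -
      have "ln (tent \<kappa>1 \<kappa>2 x) \<le> ln (exp (hdist x y) * tent \<kappa>1 \<kappa>2 y)"
        using tent_Lip[OF Q_ball[OF that(1)] Q_ball[OF that(2)] k] fp[OF that(1)] fp[OF that(2)] by simp
      also have "\<dots> = hdist x y + ln (tent \<kappa>1 \<kappa>2 y)" using fp[OF that(2)] by (simp add: ln_mult)
      finally show ?thesis by (simp add: g_def)
    qed
    fix x y assume "x \<in> Q" "y \<in> Q"
    then show "\<bar>g x - g y\<bar> \<le> hdist x y" using one[of x y] one[of y x] hdist_commute[of x y] by linarith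
  qed
  have inv: "invariant g" unfolding invariant_def
  proof (intro allI impI)
    fix x y assume "(x, y) \<in> glued vertices"
    then show "g x = g y" using glued_abs[of x y] by (simp add: g_def tent_def)
  qed
  define G where "G t = class_value g (C t)" for t
  have G: "G t = g z" if "z \<in> C t" for t z using class_value[OF inv CT that] by (simp add: G_def)
  have "\<exists>e>0. \<forall>r\<in>ball t e. \<forall>s\<in>ball t e. \<bar>G r - G s\<bar> \<le> \<bar>r - s\<bar>" for t
  proof -
    obtain e where e: "e > 0" "\<And>r s. r \<in> ball t e \<Longrightarrow> s \<in> ball t e \<Longrightarrow> d (C r) (C s) = \<bar>r - s\<bar>"
      using cg unfolding closed_geodesic_def by blast
    have "\<bar>G r - G s\<bar> \<le> d (C r) (C s)" for r s
    proof -
      obtain a b where "a \<in> C r" "b \<in> C s" using torus_points_cases[OF CT] by metis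
      then show ?thesis using torus_dist_ge[OF lip inv CT CT] G by simp
    qed
    then show ?thesis using e by metis
  qed
  then have GL: "\<bar>G a - G b\<bar> \<le> \<bar>a - b\<bar>" for a b by (rule locally_1_Lipschitz_imp)
  have "continuous_on {0..l} G"
    by (rule continuous_on_iff[THEN iffD2]) (use GL in \<open>metis dist_real_def le_less_trans\<close>)
  then obtain t0 where t0: "t0 \<in> {0..l}" "\<And>t. t \<in> {0..l} \<Longrightarrow> G t \<le> G t0"
    using continuous_attains_sup[of "{0..l}" G] l by auto
  have Gmax: "G t \<le> G t0" for t
  proof -
    define n where "n = \<lfloor>t / l\<rfloor>"
    have "of_int n \<le> t / l" "t / l < of_int n + 1" unfolding n_def by linarith+
    then have "of_int n * l \<le> t" "t < (of_int n + 1) * l"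
      using l by (simp_all only: pos_le_divide_eq pos_divide_less_eq)
    then have "t + of_int (- n) * l \<in> {0..l}" by (simp add: algebra_simps)
    moreover have "G (t + of_int (- n) * l) = G t"
      unfolding G_def by (subst periodic_of_int[of C l, OF per]) simp
    ultimately show ?thesis using t0(2) by metis
  qed
  obtain X where X: "X \<in> C t0" using torus_points_cases[OF CT] by metis
  have XQ: "X \<in> Q" using X CT T_subset_Q by blast
  have max: "tent \<kappa>1 \<kappa>2 z \<le> tent \<kappa>1 \<kappa>2 X" if z: "z \<in> C t" for t z
  proof -
    have "z \<in> Q" using z CT T_subset_Q by blast
    then show ?thesis using Gmax[of t] G[OF X] G[OF z] fp XQ by (simp add: g_def)
  qed
  consider "\<bar>x1 X\<bar> = c * x0 X" | "\<bar>x2 X\<bar> = s * x0 X" | "\<bar>x1 X\<bar> \<noteq> c * x0 X" "\<bar>x2 X\<bar> \<noteq> s * x0 X" by blast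
  then show False
  proof cases
    case 1
    then have "\<kappa>1 = c" using X by (auto simp: \<kappa>1_def)
    then show False using no_side_maximum[OF cg X 1 k(3,4)] 2[OF _ X] max by metis
  next
    case 2
    then have "\<kappa>2 = s" using X by (auto simp: \<kappa>2_def)
    then show False using no_side_maximum_rotated[OF cg X 2 k(1,2)] 1[OF _ X] max by metis
  next
    case 3
    then show False using no_interior_maximum[OF cg X k] 1[OF _ X] 2[OF _ X] max by metis
  qed
qed

section \<open>The core curves are closed geodesics\<close>

definition "core t = hline e0 e1 t"
definition "wrap t = t - 2 * L * of_int \<lfloor>(t + L) / (2 * L)\<rfloor>"

lemma core: "core t \<in> ball 0 1" "x0 (core t) = cosh t" "x1 (core t) = sinh t" "x2 (core t) = 0"
  "hdist (core t) (core u) = \<bar>t - u\<bar>"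
proof -
  have fr: "hline_frame e0 e1" by (simp add: hline_frame_def e0_in)
  show "core t \<in> ball 0 1" "x0 (core t) = cosh t" "x1 (core t) = sinh t" "x2 (core t) = 0"
    "hdist (core t) (core u) = \<bar>t - u\<bar>"
    by (simp_all add: core_def hline_in_ball[OF fr] x0_def x1_def x2_def hlift_hline[OF fr] hdist_hline[OF fr])
qed

lemma axis_in_Q:
  assumes "-L \<le> t" "t \<le> L"
  shows "core t \<in> Q"
proof -
  have "sinh (L - t) \<ge> 0" "sinh (L + t) \<ge> 0" using assms by auto
  then have "(c * cosh t - sinh t) / s \<ge> 0" "(c * cosh t + sinh t) / s \<ge> 0"
    by (simp_all add: sinh_diff sinh_add sinh_L cosh_L diff_divide_distrib add_divide_distrib)
  then have "c * cosh t - sinh t \<ge> 0" "c * cosh t + sinh t \<ge> 0"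
    using s_pos by (auto simp: zero_le_divide_iff)
  then show ?thesis using s_pos by (auto simp: Q_def core abs_le_iff)
qed

lemma axis_ends_glued: "(core L, core (- L)) \<in> glued vertices" "(core (- L), core L) \<in> glued vertices"
  unfolding glued_iff using axis_in_Q[of L] axis_in_Q[of "- L"] L_pos s_pos c_pos
  by (auto simp: core sinh_L cosh_L)

lemma wrap: "- L \<le> wrap t" "wrap t < L"
proof -
  define n where "n = \<lfloor>(t + L) / (2 * L)\<rfloor>"
  have L2: "0 < 2 * L" using L_pos by simp
  have "of_int n \<le> (t + L) / (2 * L)" "(t + L) / (2 * L) < of_int n + 1" unfolding n_def by linarith+
  then have "of_int n * (2 * L) \<le> t + L" "t + L < (of_int n + 1) * (2 * L)"
    using L2 by (simp_all only: pos_le_divide_eq pos_divide_less_eq)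
  then show "- L \<le> wrap t" "wrap t < L" unfolding wrap_def n_def[symmetric] by (simp_all add: algebra_simps)
qed

lemma wrap_cases:
  assumes "r \<le> t" "t - r < L"
  shows "wrap t = wrap r + (t - r) \<or> wrap t = wrap r + (t - r) - 2 * L"
proof -
  define k where "k = \<lfloor>(t + L) / (2 * L)\<rfloor> - \<lfloor>(r + L) / (2 * L)\<rfloor>"
  have e: "wrap t = wrap r + (t - r) - 2 * L * of_int k"
    by (simp add: wrap_def k_def algebra_simps)
  define K where "K = of_int k * (2 * L)"
  have "K = wrap r + (t - r) - wrap t" using e by (simp add: K_def)
  then have "K < 2 * (2 * L)" "K > (-1) * (2 * L)" using wrap[of t] wrap[of r] assms L_pos by linarith+
  moreover have "0 < 2 * L" using L_pos by simp
  ultimately have "of_int k < (2::real)" "(-1::real) < of_int k"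
    unfolding K_def by (simp_all only: mult_less_cancel_right_pos)
  then have "k < 2" "k > -1" by linarith+
  then have "k = 0 \<or> k = 1" by linarith
  then show ?thesis using e by auto
qed

text \<open>\<open>\<phi>\<close> is the distance to \<open>a\<close> on a circle of length
  \<open>2 * L\<close>. \<open>arsinh |x1|\<close> is not constant along a side but at least
  \<open>L\<close> there, so clamping to the interval from \<open>- L\<close> to \<open>L\<close>
  gives opposite sides the values \<open>L\<close> and \<open>- L\<close>, which are the same point
  of the circle.\<close>

lemma axis_dist_lower:
  assumes a: "- L \<le> a" "a \<le> L" and b: "- L \<le> b" "b \<le> L"
  shows "min \<bar>a - b\<bar> (2 * L - \<bar>a - b\<bar>) \<le> d (cls (core a)) (cls (core b))"
proof -
  define f where "f w = max (- L) (min L (arsinh (x1 w)))" for w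
  define \<phi> where "\<phi> w = min \<bar>f w - a\<bar> (2 * L - \<bar>f w - a\<bar>)" for w
  have fL: "- L \<le> f w" "f w \<le> L" for w using L_pos by (auto simp: f_def)
  have lip: "Lip \<phi>" unfolding Lip_def
  proof (intro ballI)
    fix x y assume "x \<in> Q" "y \<in> Q"
    then have "\<bar>arsinh (x1 x) - arsinh (x1 y)\<bar> \<le> hdist x y" using x1_Lip Q_ball by blast
    then have "\<bar>f x - f y\<bar> \<le> hdist x y" unfolding f_def by linarith
    then show "\<bar>\<phi> x - \<phi> y\<bar> \<le> hdist x y" unfolding \<phi>_def by linarith
  qed
  have inv: "invariant \<phi>" unfolding invariant_def
  proof (intro allI impI)
    fix x y assume g: "(x, y) \<in> glued vertices"
    show "\<phi> x = \<phi> y"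
    proof (cases "x = y")
      case False
      from glued_neq[OF g False] show ?thesis
      proof
        assume h: "\<bar>x1 x\<bar> = c * x0 x \<and> x1 y = - x1 x \<and> x2 y = x2 x \<and> x0 y = x0 x"
        have "x \<in> ball 0 1" using g glued_iff Q_ball by blast
        moreover have "\<bar>x1 x\<bar> = c * x0 x" using h by blast
        ultimately have "L \<le> \<bar>arsinh (x1 x)\<bar>" unfolding arsinh_abs[symmetric] by (rule side_x1_ge)
        moreover have "arsinh (x1 y) = - arsinh (x1 x)" using h by simp
        ultimately have "(f x = L \<and> f y = - L) \<or> (f x = - L \<and> f y = L)"
          using L_pos unfolding f_def by linarith
        then show ?thesis using a unfolding \<phi>_def by auto
      next
        assume "\<bar>x2 x\<bar> = s * x0 x \<and> x1 y = x1 x \<and> x2 y = - x2 x \<and> x0 y = x0 x"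
        then show ?thesis by (simp add: \<phi>_def f_def)
      qed
    qed simp
  qed
  have fa: "f (core a) = a" "f (core b) = b" using a b by (auto simp: f_def core arsinh_sinh_real)
  have "\<bar>\<phi> (core a) - \<phi> (core b)\<bar> \<le> d (cls (core a)) (cls (core b))"
    using axis_in_Q a b by (intro torus_dist_ge[OF lip inv] cls_in_T self_in_cls) auto
  then show ?thesis using a b L_pos by (simp add: \<phi>_def fa abs_minus_commute)
qed

lemma axis_closed_geodesic: "closed_geodesic T d (2 * L) (\<lambda>t. cls (core (wrap t)))"
  unfolding closed_geodesic_def
proof (intro conjI allI)
  have wQ: "core (wrap t) \<in> Q" for t using axis_in_Q wrap[of t] by simp
  show "2 * L > 0" using L_pos by simp
  show "cls (core (wrap t)) \<in> T" for t using wQ by (rule cls_in_T)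
  show "cls (core (wrap (t + 2 * L))) = cls (core (wrap t))" for t
  proof -
    have "(t + 2 * L + L) / (2 * L) = (t + L) / (2 * L) + 1" using L_pos by (simp add: field_simps)
    then have "wrap (t + 2 * L) = wrap t" by (simp add: wrap_def algebra_simps)
    then show ?thesis by simp
  qed
  have key: "d (cls (core (wrap r))) (cls (core (wrap t))) = t - r"
    "d (cls (core (wrap t))) (cls (core (wrap r))) = t - r" if rt: "r \<le> t" "t - r < L" for r t
  proof -
    have low: "min \<bar>wrap r - wrap t\<bar> (2 * L - \<bar>wrap r - wrap t\<bar>) \<le> d (cls (core (wrap r))) (cls (core (wrap t)))"
      "min \<bar>wrap t - wrap r\<bar> (2 * L - \<bar>wrap t - wrap r\<bar>) \<le> d (cls (core (wrap t))) (cls (core (wrap r)))"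
      using wrap[of r] wrap[of t] by (intro axis_dist_lower; simp)+
    have T: "cls (core (wrap r)) \<in> T" "cls (core (wrap t)) \<in> T" and m: "core (wrap r) \<in> cls (core (wrap r))"
      "core (wrap t) \<in> cls (core (wrap t))" using wQ cls_in_T self_in_cls by auto
    from wrap_cases[OF rt] show "d (cls (core (wrap r))) (cls (core (wrap t))) = t - r"
      "d (cls (core (wrap t))) (cls (core (wrap r))) = t - r"
    proof (atomize(full), elim disjE)
      assume w: "wrap t = wrap r + (t - r)"
      have "d (cls (core (wrap r))) (cls (core (wrap t))) \<le> t - r" "d (cls (core (wrap t))) (cls (core (wrap r))) \<le> t - r"
        using torus_dist_le[OF T(1,2) m(1,2)] torus_dist_le[OF T(2,1) m(2,1)] rt by (simp_all add: core(5) w)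
      then show "d (cls (core (wrap r))) (cls (core (wrap t))) = t - r \<and> d (cls (core (wrap t))) (cls (core (wrap r))) = t - r"
        using low w rt by linarith
    next
      assume w: "wrap t = wrap r + (t - r) - 2 * L"
      have up: "d (cls (core (wrap r))) (cls (core (wrap t))) \<le> \<bar>wrap r - L\<bar> + \<bar>- L - wrap t\<bar>"
        using torus_dist_le_glued[OF T(1,2) m(1,2) axis_ends_glued(1)] by (simp only: core(5))
      have up': "d (cls (core (wrap t))) (cls (core (wrap r))) \<le> \<bar>wrap t - - L\<bar> + \<bar>L - wrap r\<bar>"
        using torus_dist_le_glued[OF T(2,1) m(2,1) axis_ends_glued(2)] by (simp only: core(5))
      have s: "\<bar>wrap r - L\<bar> + \<bar>- L - wrap t\<bar> = t - r" "\<bar>wrap t - - L\<bar> + \<bar>L - wrap r\<bar> = t - r"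
        using w wrap[of r] wrap[of t] by simp_all
      have a: "\<bar>wrap r - wrap t\<bar> = 2 * L - (t - r)" "\<bar>wrap t - wrap r\<bar> = 2 * L - (t - r)"
        using w rt L_pos by simp_all
      have m: "min (2 * L - (t - r)) (2 * L - (2 * L - (t - r))) = t - r" using rt by simp
      show "d (cls (core (wrap r))) (cls (core (wrap t))) = t - r \<and> d (cls (core (wrap t))) (cls (core (wrap r))) = t - r"
        using up[unfolded s] up'[unfolded s] low[unfolded a m] by linarith
    qed
  qed
  show "\<exists>e>0. \<forall>r\<in>ball t e. \<forall>u\<in>ball t e. d (cls (core (wrap r))) (cls (core (wrap u))) = \<bar>r - u\<bar>" for t
  \<comment> \<open>Two parameters within \<open>L / 2\<close> of \<open>t\<close> differ by less
    than \<open>L\<close>, half the length of the curve, so the arc between them is the shorter of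
    the two.\<close>
  proof (intro exI[of _ "L / 2"] conjI ballI)
    show "L / 2 > 0" using L_pos by simp
    fix r u assume "r \<in> ball t (L / 2)" "u \<in> ball t (L / 2)"
    then have "\<bar>t - r\<bar> < L / 2" "\<bar>t - u\<bar> < L / 2" by (simp_all add: ball_def dist_real_def)
    then have "\<bar>r - u\<bar> < L" by linarith
    then show "d (cls (core (wrap r))) (cls (core (wrap u))) = \<bar>r - u\<bar>"
      using key(1)[of r u] key(2)[of u r] by (cases "r \<le> u") auto
  qed
qed

theorem shortest_geodesic_length_eq:
  "shortest_geodesic_length vertices = min (2 * arsinh (c / s)) (2 * arsinh (s / c))"
proof -
  interpret r: quad V2 V3 V4 V1 by (rule quad_rotate)
  have "\<exists>C. closed_geodesic T d (2 * arsinh (c / s)) C"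
    using axis_closed_geodesic unfolding L_def by blast
  moreover have "\<exists>C. closed_geodesic T d (2 * arsinh (s / c)) C"
    using r.axis_closed_geodesic unfolding L_rotate vertices_rotate by blast
  ultimately have "\<exists>C. closed_geodesic T d (min (2 * arsinh (c / s)) (2 * arsinh (s / c))) C"
    by (simp add: min_def)
  then have "(LEAST l. \<exists>C. closed_geodesic T d l C) = min (2 * arsinh (c / s)) (2 * arsinh (s / c))"
    by (rule Least_equality) (use closed_geodesic_length_ge in blast)
  then show ?thesis unfolding shortest_geodesic_length_def using vertices_ideal by simp
qed

end

section \<open>The length in terms of the vertices\<close>

text \<open>By Ptolemy's theorem the largest of the three products of distances is the sum of the two others;
  their ratio \<open>min / mid\<close> is the square of \<open>c / s\<close> or of \<open>s / c\<close>.  When the middle value vanishes the result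
  is \<open>0\<close>, in accordance with the convention for degenerate quadrilaterals.\<close>

definition mid_ratio :: "real \<Rightarrow> real \<Rightarrow> real \<Rightarrow> real" where
  "mid_ratio p q r = min p (min q r) / (p + q + r - min p (min q r) - max p (max q r))"

lemma mid_ratio_commute: "mid_ratio p q r = mid_ratio q p r" "mid_ratio p q r = mid_ratio p r q"
  by (simp_all add: mid_ratio_def min.left_commute max.left_commute min.commute max.commute add_ac)

lemma mid_ratio_scale: "k > 0 \<Longrightarrow> mid_ratio (k * p) (k * q) (k * r) = mid_ratio p q r"
proof -
  assume k: "k > 0"
  have m: "min (k * p) (min (k * q) (k * r)) = k * min p (min q r)" "max (k * p) (max (k * q) (k * r)) = k * max p (max q r)"
    using k by (simp_all add: min_mult_distrib_left max_mult_distrib_left)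
  have d: "k * p + k * q + k * r - k * x - k * y = k * (p + q + r - x - y)" for x y
    by (simp add: algebra_simps)
  show ?thesis unfolding mid_ratio_def m d using k by (intro mult_divide_mult_cancel_left) simp
qed

lemma mink_ideal_unit:
  assumes "norm a = 1" "norm b = 1"
  shows "mink (1, a) (1, b) = (norm (a - b))\<^sup>2 / 2"
proof -
  have "(norm (a - b))\<^sup>2 = (norm a)\<^sup>2 + (norm b)\<^sup>2 - 2 * (a \<bullet> b)"
    by (simp add: power2_norm_eq_inner inner_diff_left inner_diff_right inner_commute)
  then show ?thesis using assms by (simp add: mink_def)
qed

context quad
begin

lemma cross_ratio_formula:
  "shortest_geodesic_length vertices =
    2 * arsinh (sqrt (mid_ratio (norm (a1 - a2) * norm (a3 - a4)) (norm (a1 - a3) * norm (a2 - a4)) (norm (a1 - a4) * norm (a2 - a3))))"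
proof -
  have f: "fst V1 > 0" "fst V2 > 0" "fst V3 > 0" "fst V4 > 0" using ideal by (auto simp: ideal_def)
  have V: "V1 = fst V1 *\<^sub>R (1, a1)" "V2 = fst V2 *\<^sub>R (1, a2)" "V3 = fst V3 *\<^sub>R (1, a3)" "V4 = fst V4 *\<^sub>R (1, a4)"
    using f by (simp_all add: a1_def a2_def a3_def a4_def prod_eq_iff)
  have n: "norm a1 = 1" "norm a2 = 1" "norm a3 = 1" "norm a4 = 1"
    using vertices_ideal by (auto simp: ideal_vertices_def vertices_def)
  have nn: "norm (a - b) = sqrt (2 * mink A B) / sqrt (fst A * fst B)"
    if "A = fst A *\<^sub>R (1, a)" "B = fst B *\<^sub>R (1, b)" "fst A > 0" "fst B > 0" "norm a = 1" "norm b = 1" for A B a b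
  proof -
    have "mink A B = fst A * fst B * ((norm (a - b))\<^sup>2 / 2)"
      using arg_cong2[OF that(1,2), of mink] mink_ideal_unit[OF that(5,6)] by (simp del: scaleR_Pair)
    then have "2 * mink A B = (fst A * fst B) * (norm (a - b))\<^sup>2" by simp
    then show ?thesis using that(3,4) by (simp add: real_sqrt_mult)
  qed
  \<comment> \<open>The distance of two vertices is the root of a Minkowski product divided by one
    factor for each of them. Each product of two disjoint pairs contains every vertex once, so the
    three products are \<open>s^2\<close>, \<open>1\<close> and \<open>c^2\<close> times the same
    \<open>K\<close>.\<close>
  define K where "K = 4 / sqrt ((fst V1 * fst V2) * (fst V3 * fst V4))"
  have K: "K > 0" using f by (simp add: K_def)
  have ss: "sqrt (2 * (2 * (s * s))) = 2 * s" "sqrt (2 * (2 * (c * c))) = 2 * c" "sqrt (2 * 2) = (2::real)"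
    using s_pos c_pos by (simp_all add: real_sqrt_mult)
  have p: "norm (a1 - a2) * norm (a3 - a4) = K * (s * s)"
    unfolding nn[OF V(1,2) f(1,2) n(1,2)] nn[OF V(3,4) f(3,4) n(3,4)] mink_V_values ss K_def
    by (simp add: real_sqrt_mult)
  have q: "norm (a1 - a3) * norm (a2 - a4) = K * 1"
    unfolding nn[OF V(1,3) f(1,3) n(1,3)] nn[OF V(2,4) f(2,4) n(2,4)] mink_V_values m13 ss K_def
    by (simp add: real_sqrt_mult mult_ac)
  have r: "norm (a1 - a4) * norm (a2 - a3) = K * (c * c)"
    unfolding nn[OF V(1,4) f(1,4) n(1,4)] nn[OF V(2,3) f(2,3) n(2,3)] mink_V_values ss K_def
    by (simp add: real_sqrt_mult mult_ac)
  have lt: "s * s \<le> 1" "c * c \<le> 1" using cs zero_le_square[of c] zero_le_square[of s] by linarith+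
  have m: "mid_ratio (s * s) 1 (c * c) = min (s * s) (c * c) / max (s * s) (c * c)"
  proof -
    have den: "s * s + 1 + c * c - min (s * s) (min 1 (c * c)) - max (s * s) (max 1 (c * c)) = max (s * s) (c * c)"
    proof -
      have "max (s * s) (max 1 (c * c)) = 1" "min (s * s) (min 1 (c * c)) = min (s * s) (c * c)" using lt by simp_all
      then show ?thesis by (simp add: min_def max_def)
    qed
    have num: "min (s * s) (min 1 (c * c)) = min (s * s) (c * c)" using lt by (simp add: min_def)
    show ?thesis unfolding mid_ratio_def den unfolding num ..
  qed
  have "sqrt (min (s * s) (c * c) / max (s * s) (c * c)) = min (c / s) (s / c)"
  proof (cases "s \<le> c")
    case True
    then have "s * s \<le> c * c" "s / c \<le> c / s" using s_pos c_pos
      by (auto intro!: mult_mono simp: divide_simps) 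
    then show ?thesis using s_pos c_pos by (simp add: min_def max_def real_sqrt_divide)
  next
    case False
    then have "c * c \<le> s * s" "c / s \<le> s / c" using s_pos c_pos
      by (auto intro!: mult_mono simp: divide_simps) 
    then show ?thesis using s_pos c_pos by (simp add: min_def max_def real_sqrt_divide)
  qed
  then have "sqrt (mid_ratio (K * (s * s)) (K * 1) (K * (c * c))) = min (c / s) (s / c)"
    unfolding mid_ratio_scale[OF K] m .
  moreover have "min (2 * arsinh (c / s)) (2 * arsinh (s / c)) = 2 * arsinh (min (c / s) (s / c))"
  proof -
    have "arsinh x \<le> arsinh y \<longleftrightarrow> x \<le> y" for x y :: real by (meson not_le arsinh_less_iff_real)
    then show ?thesis by (simp only: min_def mult_le_cancel_left_pos zero_less_numeral if_distrib[of "\<lambda>x. 2 * x"] if_distrib[of arsinh])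
  qed
  ultimately show ?thesis unfolding shortest_geodesic_length_eq p q r by simp
qed

end

lemma mink_ideal_unit_pos: "norm a = 1 \<Longrightarrow> norm b = 1 \<Longrightarrow> a \<noteq> b \<Longrightarrow> mink (1, a) (1, b) > 0"
  by (simp add: mink_ideal_unit)

text \<open>The relation with positive coefficients says that the chords from \<open>a\<close> to
  \<open>c\<close> and from \<open>b\<close> to \<open>d\<close> cross. The factor \<open>k\<close>
  scales it to the normal form of \<open>quad\<close>.\<close>

lemma shortest_geodesic_length_crossing:
  assumes n: "norm a = 1" "norm b = 1" "norm c = 1" "norm d = 1" and dist: "distinct [a, b, c, d]"
    and u: "u1 > 0" "u2 > 0" "u3 > 0" "u4 > 0"
    and rel: "u1 *\<^sub>R (1::real, a) + u3 *\<^sub>R (1, c) = u2 *\<^sub>R (1, b) + u4 *\<^sub>R (1, d)"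
  shows "shortest_geodesic_length {a, b, c, d} =
    2 * arsinh (sqrt (mid_ratio (norm (a - b) * norm (c - d)) (norm (a - c) * norm (b - d)) (norm (a - d) * norm (b - c))))"
proof -
  have ac: "mink (1, a) (1, c) > 0" using mink_ideal_unit_pos n dist by simp
  define k where "k = sqrt (2 / (u1 * u3 * mink (1, a) (1, c)))"
  have k: "k > 0" "k * k * (u1 * u3 * mink (1, a) (1, c)) = 2" using u ac by (simp_all add: k_def)
  have id: "ideal (v *\<^sub>R (1, w))" if "v > 0" "norm w = 1" for v w
    using that mink_ideal_unit[of w w] by (simp add: ideal_def del: scaleR_Pair)
  interpret q: quad "(k * u1) *\<^sub>R (1, a)" "(k * u2) *\<^sub>R (1, b)" "(k * u3) *\<^sub>R (1, c)" "(k * u4) *\<^sub>R (1, d)"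
  proof
    show "(k * u1) *\<^sub>R (1, a) + (k * u3) *\<^sub>R (1, c) = (k * u2) *\<^sub>R (1, b) + (k * u4) *\<^sub>R (1::real, d)"
      using arg_cong[OF rel, of "scaleR k"] by (simp only: scaleR_add_right scaleR_scaleR)
    show "mink ((k * u1) *\<^sub>R (1, a)) ((k * u3) *\<^sub>R (1, c)) = 2"
      unfolding mink_scaleR_left mink_scaleR_right using k(2) by (simp add: mult_ac)
    show "mink ((k * u1) *\<^sub>R (1, a)) ((k * u2) *\<^sub>R (1, b)) > 0" "mink ((k * u1) *\<^sub>R (1, a)) ((k * u4) *\<^sub>R (1, d)) > 0"
      unfolding mink_scaleR_left mink_scaleR_right using k u dist mink_ideal_unit_pos n by simp_all
  qed (use id k u n in \<open>simp_all del: scaleR_Pair\<close>)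
  have "q.a1 = a" "q.a2 = b" "q.a3 = c" "q.a4 = d"
  proof -
    have e: "snd (v *\<^sub>R (1::real, w)) /\<^sub>R fst (v *\<^sub>R (1::real, w)) = w" if "v > 0" for v w using that by simp
    show "q.a1 = a" "q.a2 = b" "q.a3 = c" "q.a4 = d"
      unfolding q.a1_def q.a2_def q.a3_def q.a4_def using k u by (simp_all only: e mult_pos_pos)
  qed
  then show ?thesis using q.cross_ratio_formula unfolding q.vertices_def by simp
qed

text \<open>Four null vectors in a three-dimensional space are linearly dependent.  The signs of the coefficients
  tell which of the points are opposite vertices.\<close>

lemma sign_patterns:
  fixes k1 k2 k3 k4 :: real
  assumes m: "m12 > 0" "m13 > 0" "m14 > 0" "m23 > 0" "m24 > 0" "m34 > 0"
    and r: "k2 * m12 + k3 * m13 + k4 * m14 = 0" "k1 * m12 + k3 * m23 + k4 * m24 = 0"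
      "k1 * m13 + k2 * m23 + k4 * m34 = 0" "k1 * m14 + k2 * m24 + k3 * m34 = 0"
    and s: "k1 + k2 + k3 + k4 = 0" and nz: "k1 \<noteq> 0 \<or> k2 \<noteq> 0 \<or> k3 \<noteq> 0 \<or> k4 \<noteq> 0"
  shows "\<exists>e. (e = 1 \<or> e = -1) \<and>
     ((e * k1 > 0 \<and> e * k2 > 0 \<and> e * k3 < 0 \<and> e * k4 < 0) \<or>
      (e * k1 > 0 \<and> e * k3 > 0 \<and> e * k2 < 0 \<and> e * k4 < 0) \<or>
      (e * k1 > 0 \<and> e * k4 > 0 \<and> e * k2 < 0 \<and> e * k3 < 0))"
proof -
  \<comment> \<open>Pairing the relation with one null vector removes its own coefficient and gives
    the other three positive weights, so these cannot all have the same weak sign unless they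
    vanish. With sum 0 this leaves two positive and two negative coefficients.\<close>
  have z: "x = 0 \<and> y = 0 \<and> w = 0" if "x \<le> 0" "y \<le> 0" "w \<le> 0" "x * p + y * q + w * r = 0" "p > 0" "q > 0" "r > 0"
    for x y w p q r :: real
  proof -
    have "x * p \<le> 0" "y * q \<le> 0" "w * r \<le> 0" using that by (simp_all add: mult_le_0_iff)
    then have "x * p = 0" "y * q = 0" "w * r = 0" using that(4) by linarith+
    then show ?thesis using that by simp
  qed
  have z': "x = 0 \<and> y = 0 \<and> w = 0" if "x \<ge> 0" "y \<ge> 0" "w \<ge> 0" "x * p + y * q + w * r = 0" "p > 0" "q > 0" "r > 0"
    for x y w p q r :: real
    using z[of "-x" "-y" "-w" p q r] that by simp
  note f = z[OF _ _ _ r(1) m(1,2,3)] z[OF _ _ _ r(2) m(1,4,5)] z[OF _ _ _ r(3) m(2,4,6)] z[OF _ _ _ r(4) m(3,5,6)]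
    z'[OF _ _ _ r(1) m(1,2,3)] z'[OF _ _ _ r(2) m(1,4,5)] z'[OF _ _ _ r(3) m(2,4,6)] z'[OF _ _ _ r(4) m(3,5,6)]
  have "(k1 > 0 \<and> k2 > 0 \<and> k3 < 0 \<and> k4 < 0) \<or> (k1 > 0 \<and> k3 > 0 \<and> k2 < 0 \<and> k4 < 0) \<or> (k1 > 0 \<and> k4 > 0 \<and> k2 < 0 \<and> k3 < 0) \<or>
     (k1 < 0 \<and> k2 < 0 \<and> k3 > 0 \<and> k4 > 0) \<or> (k1 < 0 \<and> k3 < 0 \<and> k2 > 0 \<and> k4 > 0) \<or> (k1 < 0 \<and> k4 < 0 \<and> k2 > 0 \<and> k3 > 0)"
    using f nz s by (smt (verit))
  then consider "(k1 > 0 \<and> k2 > 0 \<and> k3 < 0 \<and> k4 < 0) \<or> (k1 > 0 \<and> k3 > 0 \<and> k2 < 0 \<and> k4 < 0) \<or> (k1 > 0 \<and> k4 > 0 \<and> k2 < 0 \<and> k3 < 0)" |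
     "(k1 < 0 \<and> k2 < 0 \<and> k3 > 0 \<and> k4 > 0) \<or> (k1 < 0 \<and> k3 < 0 \<and> k2 > 0 \<and> k4 > 0) \<or> (k1 < 0 \<and> k4 < 0 \<and> k2 > 0 \<and> k3 > 0)" by blast
  then show ?thesis
  proof cases
    case 1
    then show ?thesis by (intro exI[of _ 1]) simp
  next
    case 2
    then show ?thesis by (intro exI[of _ "-1"]) simp
  qed
qed

theorem shortest_geodesic_length_circle:
  assumes n: "norm a = 1" "norm b = 1" "norm c = 1" "norm d = 1" and dist: "distinct [a, b, c, d]"
  shows "shortest_geodesic_length {a, b, c, d} =
    2 * arsinh (sqrt (mid_ratio (norm (a - b) * norm (c - d)) (norm (a - c) * norm (b - d)) (norm (a - d) * norm (b - c))))"
proof -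
  define A B C D where v: "A = (1::real, a)" "B = (1::real, b)" "C = (1::real, c)" "D = (1::real, d)"
  have neq: "A \<noteq> B" "A \<noteq> C" "A \<noteq> D" "B \<noteq> C" "B \<noteq> D" "C \<noteq> D" using dist by (auto simp: v)
  have "dependent {A, B, C, D}"
    by (rule dependent_biggerset) (use neq in simp_all)
  then obtain u where u: "(\<Sum>x\<in>{A, B, C, D}. u x *\<^sub>R x) = 0" "\<exists>x\<in>{A, B, C, D}. u x \<noteq> 0"
    using real_vector.dependent_finite[of "{A, B, C, D}"] by auto
  have rel: "u A *\<^sub>R A + u B *\<^sub>R B + u C *\<^sub>R C + u D *\<^sub>R D = 0" using u(1) neq by (simp add: add.assoc)
  have m: "mink X X = 0" if "X \<in> {A, B, C, D}" for X    using that n mink_ideal_unit[of a a] mink_ideal_unit[of b b] mink_ideal_unit[of c c] mink_ideal_unit[of d d] by (auto simp: v)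
  have mp: "mink A B > 0" "mink A C > 0" "mink A D > 0" "mink B C > 0" "mink B D > 0" "mink C D > 0"
    using dist n by (auto simp: v intro!: mink_ideal_unit_pos)
  have r: "mink X (u A *\<^sub>R A + u B *\<^sub>R B + u C *\<^sub>R C + u D *\<^sub>R D) = 0" for X unfolding rel by simp
  have "\<exists>e. (e = 1 \<or> e = -1) \<and>
     ((e * u A > 0 \<and> e * u B > 0 \<and> e * u C < 0 \<and> e * u D < 0) \<or>
      (e * u A > 0 \<and> e * u C > 0 \<and> e * u B < 0 \<and> e * u D < 0) \<or>
      (e * u A > 0 \<and> e * u D > 0 \<and> e * u B < 0 \<and> e * u C < 0))"
  proof (rule sign_patterns[OF mp])
    show "u A + u B + u C + u D = 0" using arg_cong[OF rel, of fst] by (simp add: v)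
    show "u A \<noteq> 0 \<or> u B \<noteq> 0 \<or> u C \<noteq> 0 \<or> u D \<noteq> 0" using u(2) by auto
  qed (use r[of A] r[of B] r[of C] r[of D] m mink_commute[of B A] mink_commute[of C A] mink_commute[of D A]
      mink_commute[of C B] mink_commute[of D B] mink_commute[of D C] in simp_all)
  then obtain e where e: "e = 1 \<or> e = -1" and pat: 
     "(e * u A > 0 \<and> e * u B > 0 \<and> e * u C < 0 \<and> e * u D < 0) \<or>
      (e * u A > 0 \<and> e * u C > 0 \<and> e * u B < 0 \<and> e * u D < 0) \<or>
      (e * u A > 0 \<and> e * u D > 0 \<and> e * u B < 0 \<and> e * u C < 0)" by blast
  define p1 p2 p3 p4 where p: "p1 = e * u A" "p2 = e * u B" "p3 = e * u C" "p4 = e * u D"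
  have rel': "p1 *\<^sub>R A + p2 *\<^sub>R B + p3 *\<^sub>R C + p4 *\<^sub>R D = 0"
    using arg_cong[OF rel, of "scaleR e"] by (simp add: p scaleR_add_right)
  have move: "x + y = - z + - w" "x + z = - y + - w" "x + w = - y + - z"
    if "x + y + z + w = 0" for x y z w :: "real \<times> complex"
  proof -
    have "x + y = (x + y + z + w) + - z + - w" "x + z = (x + y + z + w) + - y + - w"
      "x + w = (x + y + z + w) + - y + - z" by simp_all
    then show "x + y = - z + - w" "x + z = - y + - w" "x + w = - y + - z" using that by simp_all
  qed
  have perm: "distinct [a, c, b, d]" "distinct [a, b, d, c]" using dist by auto
  from pat[folded p] show ?thesis
  proof (elim disjE conjE)
    assume s: "p1 > 0" "p2 > 0" "p3 < 0" "p4 < 0"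
    have "p1 *\<^sub>R (1::real, a) + p2 *\<^sub>R (1, b) = (- p3) *\<^sub>R (1, c) + (- p4) *\<^sub>R (1, d)"
      using move(1)[OF rel'] unfolding v scaleR_minus_left .
    from shortest_geodesic_length_crossing[OF n(1,3,2,4) perm(1) s(1) _ s(2) _ this] s
    show ?thesis by (simp add: insert_commute norm_minus_commute mid_ratio_commute[of "norm (a - c) * norm (b - d)"])
  next
    assume s: "p1 > 0" "p3 > 0" "p2 < 0" "p4 < 0"
    have "p1 *\<^sub>R (1::real, a) + p3 *\<^sub>R (1, c) = (- p2) *\<^sub>R (1, b) + (- p4) *\<^sub>R (1, d)"
      using move(2)[OF rel'] unfolding v scaleR_minus_left .
    from shortest_geodesic_length_crossing[OF n dist s(1) _ s(2) _ this] s
    show ?thesis by simp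
  next
    assume s: "p1 > 0" "p4 > 0" "p2 < 0" "p3 < 0"
    have "p1 *\<^sub>R (1::real, a) + p4 *\<^sub>R (1, d) = (- p2) *\<^sub>R (1, b) + (- p3) *\<^sub>R (1, c)"
      using move(3)[OF rel'] unfolding v scaleR_minus_left .
    from shortest_geodesic_length_crossing[OF n(1,2,4,3) perm(2) s(1) _ s(2) _ this] s
    show ?thesis by (simp add: insert_commute norm_minus_commute mid_ratio_commute(2))
  qed
qed

section \<open>Four random points on the circle\<close>

lemma nn_integral_absolutely_integrable:
  fixes g :: "real \<Rightarrow> real"
  assumes g: "g absolutely_integrable_on S" and nn: "\<And>x. x \<in> S \<Longrightarrow> g x \<ge> 0"
  shows "(\<integral>\<^sup>+x. ennreal (g x) * indicator S x \<partial>lborel) = ennreal (integral S g)"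
proof -
  have "(\<integral>\<^sup>+x. ennreal (indicator S x *\<^sub>R g x) \<partial>lebesgue) = ennreal (integral\<^sup>L lebesgue (\<lambda>x. indicator S x *\<^sub>R g x))"
    using g nn unfolding set_integrable_def
    by (intro nn_integral_eq_integral) (auto simp: indicator_def)
  also have "integral\<^sup>L lebesgue (\<lambda>x. indicator S x *\<^sub>R g x) = integral S g"
    using set_lebesgue_integral_eq_integral(2)[OF g] by (simp add: set_lebesgue_integral_def)
  also have "(\<integral>\<^sup>+x. ennreal (indicator S x *\<^sub>R g x) \<partial>lebesgue) = (\<integral>\<^sup>+x. ennreal (g x) * indicator S x \<partial>lborel)"
    unfolding nn_integral_completion by (intro nn_integral_cong) (auto simp: indicator_def)
  finally show ?thesis .
qed

text \<open>The finiteness \<open>fin\<close> makes \<open>f\<close> absolutely integrable on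
  \<open>T\<close>; the substitution is carried out there and read back as an identity of
  nonnegative integrals.\<close>

lemma nn_integral_change_of_variables:
  fixes \<phi> \<phi>' f :: "real \<Rightarrow> real"
  assumes S: "S \<in> sets borel" and T: "\<phi> ` S = T" "T \<in> sets borel"
    and der: "\<And>x. x \<in> S \<Longrightarrow> (\<phi> has_field_derivative \<phi>' x) (at x)" and inj: "inj_on \<phi> S"
    and f: "f \<in> borel_measurable borel" "\<And>x. x \<in> T \<Longrightarrow> f x \<ge> 0"
    and fin: "(\<integral>\<^sup>+x. ennreal (f x) * indicator T x \<partial>lborel) < \<infinity>"
  shows "(\<integral>\<^sup>+x. ennreal (\<bar>\<phi>' x\<bar> * f (\<phi> x)) * indicator S x \<partial>lborel) = (\<integral>\<^sup>+x. ennreal (f x) * indicator T x \<partial>lborel)"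
proof -
  have "integrable lborel (\<lambda>x. indicator T x *\<^sub>R f x)"
  proof (rule integrableI_nonneg)
    show "(\<lambda>x. indicator T x *\<^sub>R f x) \<in> borel_measurable lborel" using f T by measurable
    show "AE x in lborel. 0 \<le> indicator T x *\<^sub>R f x" using f by (auto simp: indicator_def)
    have "(\<integral>\<^sup>+x. ennreal (indicator T x *\<^sub>R f x) \<partial>lborel) = (\<integral>\<^sup>+x. ennreal (f x) * indicator T x \<partial>lborel)"
      by (intro nn_integral_cong) (auto simp: indicator_def)
    then show "(\<integral>\<^sup>+x. ennreal (indicator T x *\<^sub>R f x) \<partial>lborel) < \<infinity>" using fin by simp
  qed
  then have a: "f absolutely_integrable_on T"
    unfolding set_integrable_def by (rule integrable_completion[THEN iffD2, rotated]) (use f T in measurable)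
  have "S \<in> sets lebesgue" using S by simp
  moreover have "(\<phi> has_field_derivative \<phi>' x) (at x within S)" if "x \<in> S" for x
    using der[OF that] by (rule has_field_derivative_at_within)
  ultimately have b: "(\<lambda>x. \<bar>\<phi>' x\<bar> * f (\<phi> x)) absolutely_integrable_on S \<and>
      integral S (\<lambda>x. \<bar>\<phi>' x\<bar> * f (\<phi> x)) = integral T f"
    using has_absolute_integral_change_of_variables_1'[of S \<phi> \<phi>' f "integral T f"] inj a T(1) by blast
  show ?thesis
    using nn_integral_absolutely_integrable[OF a f(2)] nn_integral_absolutely_integrable[OF conjunct1[OF b]] b f(2) T(1)
    by auto
qed

lemma nn_integral_FTC_UNIV:
  fixes f F :: "real \<Rightarrow> real"
  assumes [measurable]: "f \<in> borel_measurable borel"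
    and F: "\<And>x. DERIV F x :> f x" and nn: "\<And>x. 0 \<le> f x"
    and top: "(F \<longlongrightarrow> t) at_top" and bot: "(F \<longlongrightarrow> b) at_bot"
  shows "(\<integral>\<^sup>+x. ennreal (f x) \<partial>lborel) = ennreal (t - b)"
proof -
  have mono: "F x \<le> F y" if "x \<le> y" for x y
    using DERIV_nonneg_imp_nondecreasing[OF that] F nn by blast
  have t: "F 0 \<le> t"
    using mono by (intro tendsto_lowerbound[OF top]) (auto intro: eventually_mono[OF eventually_ge_at_top[of 0]])
  have b: "b \<le> F 0"
    using mono by (intro tendsto_upperbound[OF bot]) (auto intro: eventually_mono[OF eventually_le_at_bot[of 0]])
  have 1: "(\<integral>\<^sup>+x. ennreal (f x) * indicator {0..} x \<partial>lborel) = ennreal (t - F 0)"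
    by (rule nn_integral_FTC_atLeast) (use F nn top in auto)
  have "(\<integral>\<^sup>+x. ennreal (f (- x)) * indicator {0..} x \<partial>lborel) = ennreal (- b - (- F (- 0)))"
  proof (rule nn_integral_FTC_atLeast)
    have "DERIV (\<lambda>x. F (- x)) x :> - f (- x)" for x
      using F[of "- x"] DERIV_mirror[of F "f (- x)" x] by simp
    from DERIV_minus[OF this] show "DERIV (\<lambda>x. - F (- x)) x :> f (- x)" for x by simp
    have "filterlim uminus at_bot (at_top :: real filter)" by (rule filterlim_uminus_at_bot_at_top)
    from filterlim_compose[OF bot this] show "((\<lambda>x. - F (- x)) \<longlongrightarrow> - b) at_top"
      by (intro tendsto_minus) 
  qed (use nn in auto)
  moreover have "(\<integral>\<^sup>+x. ennreal (f x) * indicator {..0} x \<partial>lborel) = (\<integral>\<^sup>+x. ennreal (f (- x)) * indicator {0..} x \<partial>lborel)"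
    by (subst nn_integral_real_affine[where c = "-1" and t = 0]) (auto intro!: nn_integral_cong simp: indicator_def)
  ultimately have 2: "(\<integral>\<^sup>+x. ennreal (f x) * indicator {..0} x \<partial>lborel) = ennreal (F 0 - b)" by simp
  have "(\<integral>\<^sup>+x. ennreal (f x) \<partial>lborel) = (\<integral>\<^sup>+x. ennreal (f x) * indicator {0..} x + ennreal (f x) * indicator {..0} x \<partial>lborel)"
    by (intro nn_integral_cong_AE eventually_mono[OF AE_lborel_singleton[of 0]]) (auto simp: indicator_def)
  also have "\<dots> = ennreal (t - F 0) + ennreal (F 0 - b)" by (subst nn_integral_add) (simp_all add: 1 2)
  also have "\<dots> = ennreal (t - b)" using t b by (simp flip: ennreal_plus)
  finally show ?thesis .
qed

section \<open>The Cauchy law and the Cayley coordinate of the circle\<close>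

definition cauchy_pdf :: "real \<Rightarrow> real" where
  "cauchy_pdf x = 1 / (pi * (1 + x\<^sup>2))"

definition cauchy :: "real measure" where
  "cauchy = density lborel (\<lambda>x. ennreal (cauchy_pdf x))"

lemma cauchy_pdf_nonneg: "cauchy_pdf x \<ge> 0"
  by (simp add: cauchy_pdf_def add_nonneg_nonneg)

lemma cauchy_pdf_measurable [measurable]: "cauchy_pdf \<in> borel_measurable borel"
  unfolding cauchy_pdf_def by measurable

lemma sets_cauchy [simp, measurable_cong]: "sets cauchy = sets borel"
  and space_cauchy [simp]: "space cauchy = UNIV"
  by (simp_all add: cauchy_def)

lemma nn_integral_cauchy:
  "f \<in> borel_measurable borel \<Longrightarrow> (\<integral>\<^sup>+x. f x \<partial>cauchy) = (\<integral>\<^sup>+x. ennreal (cauchy_pdf x) * f x \<partial>lborel)"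
  unfolding cauchy_def by (subst nn_integral_density) auto

lemma nn_integral_cauchy_pdf: "(\<integral>\<^sup>+x. ennreal (cauchy_pdf x) \<partial>lborel) = 1"
proof -
  have "(\<integral>\<^sup>+x. ennreal (cauchy_pdf x) \<partial>lborel) = ennreal (1 / pi * (pi / 2) - 1 / pi * (- (pi / 2)))"
  proof (rule nn_integral_FTC_UNIV[where F = "\<lambda>x. 1 / pi * arctan x"])
    show "DERIV (\<lambda>x. 1 / pi * arctan x) x :> cauchy_pdf x" for x
      by (auto intro!: derivative_eq_intros simp: cauchy_pdf_def divide_simps)
    show "((\<lambda>x. 1 / pi * arctan x) \<longlongrightarrow> 1 / pi * (pi / 2)) at_top"
      by (rule tendsto_mult_left[OF tendsto_arctan_at_top])
    show "((\<lambda>x. 1 / pi * arctan x) \<longlongrightarrow> 1 / pi * (- (pi / 2))) at_bot"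
      by (rule tendsto_mult_left[OF tendsto_arctan_at_bot])
  qed (simp_all add: cauchy_pdf_nonneg)
  then show ?thesis by simp
qed

lemma prob_space_cauchy: "prob_space cauchy"
proof
  have "emeasure cauchy UNIV = (\<integral>\<^sup>+x. ennreal (cauchy_pdf x) \<partial>lborel)"
    unfolding cauchy_def by (subst emeasure_density) auto
  then show "emeasure cauchy (space cauchy) = 1" by (simp add: nn_integral_cauchy_pdf)
qed

lemma emeasure_distr_cauchy:
  assumes "\<phi> \<in> borel_measurable borel" "B \<in> sets borel"
  shows "emeasure (distr cauchy borel \<phi>) B = (\<integral>\<^sup>+x. indicator B (\<phi> x) \<partial>cauchy)"
proof -
  have "emeasure (distr cauchy borel \<phi>) B = (\<integral>\<^sup>+y. indicator B y \<partial>distr cauchy borel \<phi>)"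
    using assms(2) by simp
  also have "\<dots> = (\<integral>\<^sup>+x. indicator B (\<phi> x) \<partial>cauchy)"
    using assms by (intro nn_integral_distr) auto
  finally show ?thesis .
qed

lemma AE_cauchy_neq: "AE x in cauchy. x \<noteq> t"
proof -
  have "AE x in lborel. x \<noteq> t" by (rule AE_lborel_singleton)
  then show ?thesis unfolding cauchy_def by (subst AE_density) auto
qed

text \<open>Up to the shift by \<open>pi\<close> the argument is the half-angle substitution. The
  shift makes the angle range over \<open>(0, 2 pi)\<close>, the interval of
  \<open>uniform_circle\<close> without its ends.\<close>

definition cay :: "real \<Rightarrow> complex" where
  "cay x = cis (pi + 2 * arctan x)"

lemma cay_measurable [measurable]: "cay \<in> borel_measurable borel"
  unfolding cay_def by (intro borel_measurable_continuous_onI continuous_intros)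

lemma cay_image: "(\<lambda>x. pi + 2 * arctan x) ` UNIV = {0<..<2 * pi}"
proof (intro subset_antisym subsetI)
  fix t assume "t \<in> {0<..<2 * pi}"
  then have "- (pi / 2) < (t - pi) / 2" "(t - pi) / 2 < pi / 2" by (auto simp: field_simps)
  then have "arctan (tan ((t - pi) / 2)) = (t - pi) / 2" by (rule arctan_tan)
  moreover have "t = pi + 2 * ((t - pi) / 2)" by (simp add: field_simps)
  ultimately have "t = pi + 2 * arctan (tan ((t - pi) / 2))" by simp
  then show "t \<in> (\<lambda>x. pi + 2 * arctan x) ` UNIV" by blast
next
  fix t assume "t \<in> (\<lambda>x. pi + 2 * arctan x) ` UNIV"
  then obtain x where "t = pi + 2 * arctan x" by blast
  then show "t \<in> {0<..<2 * pi}" using arctan_bounded[of x] by auto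
qed

lemma uniform_circle_eq_cauchy: "uniform_circle = distr cauchy borel cay"
proof (rule measure_eqI)
  show "sets uniform_circle = sets (distr cauchy borel cay)" by (simp add: uniform_circle_def)
  fix B assume "B \<in> sets uniform_circle"
  then have B [measurable]: "B \<in> sets borel" by (simp add: uniform_circle_def)
  have cis [measurable]: "cis \<in> borel_measurable borel" by (intro borel_measurable_continuous_onI continuous_intros)
  define f :: "real \<Rightarrow> real" where "f t = indicator (cis -` B) t / (2 * pi)" for t
  have cB [measurable]: "cis -` B \<in> sets borel" using measurable_sets[OF cis B] by simp
  have f: "f \<in> borel_measurable borel" unfolding f_def by measurable
  have le: "(\<integral>\<^sup>+t. ennreal (f t) * indicator {0<..<2 * pi} t \<partial>lborel) \<le> (\<integral>\<^sup>+t. ennreal (1 / (2 * pi)) * indicator {0<..<2 * pi} t \<partial>lborel)"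
    by (intro nn_integral_mono) (auto simp: f_def indicator_def)
  also have "\<dots> < \<infinity>" by (subst nn_integral_cmult_indicator) (auto simp: ennreal_mult_less_top)
  finally have fin: "(\<integral>\<^sup>+t. ennreal (f t) * indicator {0<..<2 * pi} t \<partial>lborel) < \<infinity>" .
  have "emeasure (distr cauchy borel cay) B = (\<integral>\<^sup>+x. indicator B (cay x) \<partial>cauchy)"
    by (rule emeasure_distr_cauchy) measurable
  also have "\<dots> = (\<integral>\<^sup>+x. ennreal (cauchy_pdf x) * indicator B (cay x) \<partial>lborel)"
    by (rule nn_integral_cauchy) measurable
  also have "\<dots> = (\<integral>\<^sup>+x. ennreal (\<bar>2 / (1 + x\<^sup>2)\<bar> * f (pi + 2 * arctan x)) * indicator UNIV x \<partial>lborel)"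
    by (intro nn_integral_cong) (auto simp: f_def cay_def cauchy_pdf_def indicator_def add_nonneg_nonneg)
  also have "\<dots> = (\<integral>\<^sup>+t. ennreal (f t) * indicator {0<..<2 * pi} t \<partial>lborel)"
  proof (rule nn_integral_change_of_variables[OF _ cay_image _ _ _ f _ fin])
    show "((\<lambda>x. pi + 2 * arctan x) has_real_derivative 2 / (1 + x\<^sup>2)) (at x)" for x
      by (auto intro!: derivative_eq_intros simp: divide_simps)
    show "inj (\<lambda>x. pi + 2 * arctan x)" by (auto simp: inj_def arctan_eq_iff)
  qed (auto simp: f_def)
  also have "\<dots> = (\<integral>\<^sup>+t. ennreal (1 / (2 * pi)) * indicator ({0..2 * pi} \<inter> cis -` B) t \<partial>lborel)"
    by (intro nn_integral_cong_AE, rule eventually_mono[OF eventually_conj[OF AE_lborel_singleton[of 0] AE_lborel_singleton[of "2 * pi"]]])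
      (auto simp: f_def indicator_def)
  also have "\<dots> = ennreal (1 / (2 * pi)) * emeasure lborel ({0..2 * pi} \<inter> cis -` B)"
    by (subst nn_integral_cmult_indicator) auto
  also have "\<dots> = emeasure uniform_circle B"
  proof -
    have "emeasure uniform_circle B = emeasure (uniform_measure lborel {0..2 * pi}) (cis -` B)"
      unfolding uniform_circle_def by (subst emeasure_distr) auto
    also have "\<dots> = emeasure lborel ({0..2 * pi} \<inter> cis -` B) / ennreal (2 * pi)"
      by (subst emeasure_uniform_measure) auto
    also have "\<dots> = emeasure lborel ({0..2 * pi} \<inter> cis -` B) * ennreal (1 / (2 * pi))"
      unfolding divide_ennreal_def using inverse_ennreal[of "2 * pi"] by (simp only: inverse_eq_divide) simp
    finally show ?thesis by (simp only: mult.commute)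
  qed
  finally show "emeasure uniform_circle B = emeasure (distr cauchy borel cay) B" by simp
qed

text \<open>The rotation of the circle that moves \<open>cay t\<close> to the point at infinity of the Cayley coordinate.\<close>

definition mob :: "real \<Rightarrow> real \<Rightarrow> real" where
  "mob t x = (1 + x * t) / (t - x)"

lemma mob_measurable [measurable]: "mob t \<in> borel_measurable borel"
  unfolding mob_def by measurable

lemma mob_image: "mob t ` (UNIV - {t}) = UNIV - {- t}"
proof (intro subset_antisym subsetI)
  have sq: "1 + t * t \<noteq> 0" using zero_le_square[of t] by linarith
  fix y assume "y \<in> UNIV - {- t}"
  then have y: "y + t \<noteq> 0" by auto
  have "(y * t - 1) / (y + t) \<noteq> t" using y sq by (auto simp: field_simps)
  moreover have "mob t ((y * t - 1) / (y + t)) = y"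
  proof -
    have "t - (y * t - 1) / (y + t) = (1 + t * t) / (y + t)" "1 + (y * t - 1) / (y + t) * t = y * (1 + t * t) / (y + t)"
      using y by (simp_all add: field_simps)
    then show ?thesis unfolding mob_def using y sq by simp
  qed
  ultimately show "y \<in> mob t ` (UNIV - {t})" by (metis DiffI UNIV_I image_eqI singletonD)
next
  have sq: "1 + t * t \<noteq> 0" using zero_le_square[of t] by linarith
  fix y assume "y \<in> mob t ` (UNIV - {t})"
  then obtain x where x: "x \<noteq> t" "y = mob t x" by blast
  have "mob t x \<noteq> - t"
  proof
    assume "mob t x = - t"
    then have "1 + x * t = - t * (t - x)" using x by (simp add: mob_def field_simps)
    then show False using sq by (simp add: algebra_simps)
  qed
  then show "y \<in> UNIV - {- t}" using x by simp
qed

lemma mob_diff: "x \<noteq> t \<Longrightarrow> y \<noteq> t \<Longrightarrow> mob t x - mob t y = (1 + t * t) * (x - y) / ((t - x) * (t - y))"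
  unfolding mob_def by (simp add: divide_simps) (simp add: algebra_simps)

lemma inj_on_mob: "inj_on (mob t) (UNIV - {t})"
proof (rule inj_onI)
  have sq: "1 + t * t \<noteq> 0" using zero_le_square[of t] by linarith
  fix x y assume "x \<in> UNIV - {t}" "y \<in> UNIV - {t}" "mob t x = mob t y"
  then have "(1 + t * t) * (x - y) / ((t - x) * (t - y)) = 0" "x \<noteq> t" "y \<noteq> t" using mob_diff[of x t y] by auto
  then show "x = y" using sq by simp
qed

lemma cauchy_pdf_mob:
  assumes "x \<noteq> t"
  shows "\<bar>(1 + t * t) / (t - x)\<^sup>2\<bar> * cauchy_pdf (mob t x) = cauchy_pdf x"
proof -
  have sq: "1 + t * t > 0" "1 + x\<^sup>2 > 0" using zero_le_square[of t] zero_le_power2[of x] by linarith+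
  have tx: "(t - x)\<^sup>2 > 0" using assms by simp
  have "1 + (mob t x)\<^sup>2 = 1 + (1 + x * t)\<^sup>2 / (t - x)\<^sup>2" by (simp only: mob_def power_divide)
  also have "\<dots> = ((t - x)\<^sup>2 + (1 + x * t)\<^sup>2) / (t - x)\<^sup>2"
    using tx by (simp add: add_divide_distrib)
  also have "(t - x)\<^sup>2 + (1 + x * t)\<^sup>2 = (1 + t * t) * (1 + x\<^sup>2)" by (simp add: power2_eq_square algebra_simps)
  finally have e: "1 + (mob t x)\<^sup>2 = (1 + t * t) * (1 + x\<^sup>2) / (t - x)\<^sup>2" .
  show ?thesis unfolding cauchy_pdf_def e using sq tx by (simp add: abs_of_pos)
qed

lemma distr_cauchy_mob: "distr cauchy borel (mob t) = cauchy"
proof (rule measure_eqI)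
  fix B assume "B \<in> sets (distr cauchy borel (mob t))"
  then have B [measurable]: "B \<in> sets borel" by simp
  define f :: "real \<Rightarrow> real" where "f y = indicator B y * cauchy_pdf y" for y
  have f: "f \<in> borel_measurable borel" unfolding f_def by measurable
  have fnn: "f y \<ge> 0" for y by (simp add: f_def cauchy_pdf_nonneg)
  have ae: "(\<integral>\<^sup>+y. ennreal (f y) * indicator (UNIV - {- t}) y \<partial>lborel) = (\<integral>\<^sup>+y. ennreal (cauchy_pdf y) * indicator B y \<partial>lborel)"
    by (intro nn_integral_cong_AE eventually_mono[OF AE_lborel_singleton[of "- t"]]) (auto simp: f_def indicator_def)
  have le: "(\<integral>\<^sup>+y. ennreal (cauchy_pdf y) * indicator B y \<partial>lborel) \<le> (\<integral>\<^sup>+y. ennreal (cauchy_pdf y) \<partial>lborel)"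
    by (intro nn_integral_mono) (auto simp: indicator_def)
  have "emeasure (distr cauchy borel (mob t)) B = (\<integral>\<^sup>+x. indicator B (mob t x) \<partial>cauchy)"
    by (rule emeasure_distr_cauchy) measurable
  also have "\<dots> = (\<integral>\<^sup>+x. ennreal (cauchy_pdf x) * indicator B (mob t x) \<partial>lborel)"
    by (rule nn_integral_cauchy) measurable
  also have "\<dots> = (\<integral>\<^sup>+x. ennreal (\<bar>(1 + t * t) / (t - x)\<^sup>2\<bar> * f (mob t x)) * indicator (UNIV - {t}) x \<partial>lborel)"
  proof (intro nn_integral_cong_AE eventually_mono[OF AE_lborel_singleton[of t]])
    fix x assume "x \<noteq> t"
    then show "ennreal (cauchy_pdf x) * indicator B (mob t x) = ennreal (\<bar>(1 + t * t) / (t - x)\<^sup>2\<bar> * f (mob t x)) * indicator (UNIV - {t}) x"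
      using cauchy_pdf_mob[of x t] by (auto simp: f_def indicator_def)
  qed
  also have "\<dots> = (\<integral>\<^sup>+y. ennreal (f y) * indicator (UNIV - {- t}) y \<partial>lborel)"
  proof (rule nn_integral_change_of_variables[OF _ mob_image _ _ inj_on_mob f fnn])
    show "(\<integral>\<^sup>+y. ennreal (f y) * indicator (UNIV - {- t}) y \<partial>lborel) < \<infinity>"
      unfolding ae using le unfolding nn_integral_cauchy_pdf by (simp add: order.strict_trans1)
    fix x assume "x \<in> UNIV - {t}"
    then have "t - x \<noteq> 0" by auto
    then show "(mob t has_real_derivative (1 + t * t) / (t - x)\<^sup>2) (at x)"
      unfolding mob_def by (auto intro!: derivative_eq_intros simp: power2_eq_square divide_simps) (simp add: algebra_simps)
  qed auto
  also have "\<dots> = emeasure cauchy B" unfolding ae cauchy_def by (subst emeasure_density) auto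
  finally show "emeasure (distr cauchy borel (mob t)) B = emeasure cauchy B" .
qed simp

lemma mid_ratio_measurable [measurable]:
  assumes [measurable]: "f \<in> borel_measurable M" "g \<in> borel_measurable M" "h \<in> borel_measurable M"
  shows "(\<lambda>x. mid_ratio (f x) (g x) (h x)) \<in> borel_measurable M"
  unfolding mid_ratio_def by measurable

definition ratio4 :: "real \<Rightarrow> real \<Rightarrow> real \<Rightarrow> real \<Rightarrow> real" where
  "ratio4 a b c d = mid_ratio (\<bar>a - b\<bar> * \<bar>c - d\<bar>) (\<bar>a - c\<bar> * \<bar>b - d\<bar>) (\<bar>a - d\<bar> * \<bar>b - c\<bar>)"

text \<open>The limit of \<open>ratio4\<close> as its first argument tends to infinity: by
  homogeneity the common size of the distances to \<open>a\<close> drops out.\<close>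

definition ratio3 :: "real \<Rightarrow> real \<Rightarrow> real \<Rightarrow> real" where
  "ratio3 b c d = mid_ratio \<bar>c - d\<bar> \<bar>b - d\<bar> \<bar>b - c\<bar>"

lemma ratio3_measurable [measurable]:
  assumes [measurable]: "f1 \<in> borel_measurable M" "f2 \<in> borel_measurable M" "f3 \<in> borel_measurable M"
  shows "(\<lambda>x. ratio3 (f1 x) (f2 x) (f3 x)) \<in> borel_measurable M"
  unfolding ratio3_def by measurable

lemma norm_cis_diff: "norm (cis (2 * a) - cis (2 * b)) = 2 * \<bar>sin (a - b)\<bar>"
proof -
  have "(norm (cis (2 * a) - cis (2 * b)))\<^sup>2 = (cos (2 * a) - cos (2 * b))\<^sup>2 + (sin (2 * a) - sin (2 * b))\<^sup>2"
    by (simp add: cmod_power2)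
  also have "\<dots> = ((sin (2 * a))\<^sup>2 + (cos (2 * a))\<^sup>2) + ((sin (2 * b))\<^sup>2 + (cos (2 * b))\<^sup>2) - 2 * (cos (2 * a) * cos (2 * b) + sin (2 * a) * sin (2 * b))"
    by (simp add: power2_eq_square algebra_simps)
  also have "\<dots> = 2 - 2 * cos (2 * a - 2 * b)" unfolding sin_cos_squared_add cos_diff by simp
  also have "2 * a - 2 * b = 2 * (a - b)" by simp
  also have "2 - 2 * cos (2 * (a - b)) = (2 * \<bar>sin (a - b)\<bar>)\<^sup>2"
    unfolding cos_double_sin by (simp add: power_mult_distrib)
  finally show ?thesis by (rule power2_eq_imp_eq) auto
qed

lemma norm_cay_diff: "norm (cay x - cay y) = 2 * \<bar>x - y\<bar> / (sqrt (1 + x\<^sup>2) * sqrt (1 + y\<^sup>2))"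
proof -
  have "cay x = - cis (2 * arctan x)" for x by (simp add: cay_def cis_mult[symmetric])
  then have "cay x - cay y = - (cis (2 * arctan x) - cis (2 * arctan y))" by simp
  then have "norm (cay x - cay y) = norm (cis (2 * arctan x) - cis (2 * arctan y))" by (simp only: norm_minus_cancel)
  also have "\<dots> = 2 * \<bar>sin (arctan x - arctan y)\<bar>" by (rule norm_cis_diff)
  also have "sin (arctan x - arctan y) = (x - y) / (sqrt (1 + x\<^sup>2) * sqrt (1 + y\<^sup>2))"
    by (simp add: sin_diff sin_arctan cos_arctan diff_divide_distrib)
  finally show ?thesis by (simp add: abs_mult)
qed

text \<open>A chord is \<open>|x - y|\<close> times one factor for each endpoint, and every product
  of two disjoint chords uses all four points once, so these factors combine to the common
  \<open>K\<close>.\<close>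

lemma mid_ratio_cay:
  "mid_ratio (norm (cay a - cay b) * norm (cay c - cay d)) (norm (cay a - cay c) * norm (cay b - cay d))
     (norm (cay a - cay d) * norm (cay b - cay c)) = ratio4 a b c d"
proof -
  have p: "sqrt (1 + x\<^sup>2) > 0" for x :: real by (simp add: add_pos_nonneg)
  define K where "K = 4 / (sqrt (1 + a\<^sup>2) * sqrt (1 + b\<^sup>2) * sqrt (1 + c\<^sup>2) * sqrt (1 + d\<^sup>2))"
  have "K > 0" unfolding K_def using p by (intro divide_pos_pos mult_pos_pos) auto
  have e: "norm (cay a - cay b) * norm (cay c - cay d) = K * (\<bar>a - b\<bar> * \<bar>c - d\<bar>)"
    "norm (cay a - cay c) * norm (cay b - cay d) = K * (\<bar>a - c\<bar> * \<bar>b - d\<bar>)"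
    "norm (cay a - cay d) * norm (cay b - cay c) = K * (\<bar>a - d\<bar> * \<bar>b - c\<bar>)"
    unfolding norm_cay_diff K_def by (simp_all add: mult_ac)
  show ?thesis unfolding e ratio4_def by (rule mid_ratio_scale) fact
qed

lemma ratio4_mob:
  assumes "b \<noteq> t" "c \<noteq> t" "d \<noteq> t"
  shows "ratio4 t b c d = ratio3 (mob t b) (mob t c) (mob t d)"
proof -
  have sq: "1 + t * t > 0" using zero_le_square[of t] by linarith
  define K where "K = \<bar>t - b\<bar> * \<bar>t - c\<bar> * \<bar>t - d\<bar> / (1 + t * t)"
  have K: "K > 0" unfolding K_def using assms sq by (intro divide_pos_pos mult_pos_pos) auto
  have m: "\<bar>mob t x - mob t y\<bar> = (1 + t * t) * \<bar>x - y\<bar> / (\<bar>t - x\<bar> * \<bar>t - y\<bar>)" if "x \<noteq> t" "y \<noteq> t" for x y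
    unfolding mob_diff[OF that] using sq by (simp add: abs_mult)
  have nz: "\<bar>t - b\<bar> \<noteq> 0" "\<bar>t - c\<bar> \<noteq> 0" "\<bar>t - d\<bar> \<noteq> 0" "1 + t * t \<noteq> 0" using assms sq by auto
  have canc: "X * Y * Z / S * (S * u / (Y * Z)) = X * u" if "Y \<noteq> 0" "Z \<noteq> 0" "S \<noteq> 0" for X Y Z S u :: real
    using that by simp
  have e: "\<bar>t - b\<bar> * \<bar>c - d\<bar> = K * \<bar>mob t c - mob t d\<bar>" "\<bar>t - c\<bar> * \<bar>b - d\<bar> = K * \<bar>mob t b - mob t d\<bar>"
    "\<bar>t - d\<bar> * \<bar>b - c\<bar> = K * \<bar>mob t b - mob t c\<bar>"
    unfolding K_def m[OF assms(2,3)] m[OF assms(1,3)] m[OF assms(1,2)]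
    using canc[OF nz(2,3,4), of "\<bar>t - b\<bar>" "\<bar>c - d\<bar>"] canc[OF nz(1,3,4), of "\<bar>t - c\<bar>" "\<bar>b - d\<bar>"]
      canc[OF nz(1,2,4), of "\<bar>t - d\<bar>" "\<bar>b - c\<bar>"] by (simp_all only: mult_ac)
  show ?thesis unfolding ratio4_def ratio3_def e by (rule mid_ratio_scale[OF K])
qed

lemma nn_integral_mob:
  assumes [measurable]: "f \<in> borel_measurable borel"
  shows "(\<integral>\<^sup>+x. f (mob t x) \<partial>cauchy) = (\<integral>\<^sup>+x. f x \<partial>cauchy)"
proof -
  have "(\<integral>\<^sup>+x. f x \<partial>distr cauchy borel (mob t)) = (\<integral>\<^sup>+x. f (mob t x) \<partial>cauchy)"
    by (rule nn_integral_distr) auto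
  then show ?thesis by (simp add: distr_cauchy_mob)
qed

text \<open>For a fixed first point \<open>t\<close> the map \<open>mob t\<close> moves
  \<open>t\<close> to infinity and preserves the law of the other three, so the inner integral does
  not depend on \<open>t\<close>.\<close>

lemma nn_integral_ratio4:
  assumes g [measurable]: "g \<in> borel_measurable borel"
  shows "(\<integral>\<^sup>+a. \<integral>\<^sup>+b. \<integral>\<^sup>+c. \<integral>\<^sup>+d. g (ratio4 a b c d) \<partial>cauchy \<partial>cauchy \<partial>cauchy \<partial>cauchy)
    = (\<integral>\<^sup>+b. \<integral>\<^sup>+c. \<integral>\<^sup>+d. g (ratio3 b c d) \<partial>cauchy \<partial>cauchy \<partial>cauchy)"
proof -
  interpret C: prob_space cauchy by (rule prob_space_cauchy)
  have "(\<integral>\<^sup>+b. \<integral>\<^sup>+c. \<integral>\<^sup>+d. g (ratio4 t b c d) \<partial>cauchy \<partial>cauchy \<partial>cauchy)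
     = (\<integral>\<^sup>+b. \<integral>\<^sup>+c. \<integral>\<^sup>+d. g (ratio3 b c d) \<partial>cauchy \<partial>cauchy \<partial>cauchy)" for t
  proof -
    have "(\<integral>\<^sup>+b. \<integral>\<^sup>+c. \<integral>\<^sup>+d. g (ratio4 t b c d) \<partial>cauchy \<partial>cauchy \<partial>cauchy)
      = (\<integral>\<^sup>+b. \<integral>\<^sup>+c. \<integral>\<^sup>+d. g (ratio3 (mob t b) (mob t c) (mob t d)) \<partial>cauchy \<partial>cauchy \<partial>cauchy)"
    proof (rule nn_integral_cong_AE, rule eventually_mono[OF AE_cauchy_neq[of t]],
        rule nn_integral_cong_AE, rule eventually_mono[OF AE_cauchy_neq[of t]],
        rule nn_integral_cong_AE, rule eventually_mono[OF AE_cauchy_neq[of t]])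
      fix b c d assume "b \<noteq> t" "c \<noteq> t" "d \<noteq> t"
      then show "g (ratio4 t b c d) = g (ratio3 (mob t b) (mob t c) (mob t d))" by (simp add: ratio4_mob)
    qed
    also have "\<dots> = (\<integral>\<^sup>+b. \<integral>\<^sup>+c. \<integral>\<^sup>+d. g (ratio3 b c d) \<partial>cauchy \<partial>cauchy \<partial>cauchy)"
    proof -
      have 1: "(\<integral>\<^sup>+d. g (ratio3 b c (mob t d)) \<partial>cauchy) = (\<integral>\<^sup>+d. g (ratio3 b c d) \<partial>cauchy)" for b c
        by (rule nn_integral_mob[of "\<lambda>d. g (ratio3 b c d)"]) measurable
      have 2: "(\<integral>\<^sup>+c. \<integral>\<^sup>+d. g (ratio3 b (mob t c) d) \<partial>cauchy \<partial>cauchy) = (\<integral>\<^sup>+c. \<integral>\<^sup>+d. g (ratio3 b c d) \<partial>cauchy \<partial>cauchy)" for b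
        by (rule nn_integral_mob[of "\<lambda>c. \<integral>\<^sup>+d. g (ratio3 b c d) \<partial>cauchy"]) measurable
      have 3: "(\<integral>\<^sup>+b. \<integral>\<^sup>+c. \<integral>\<^sup>+d. g (ratio3 (mob t b) c d) \<partial>cauchy \<partial>cauchy \<partial>cauchy) = (\<integral>\<^sup>+b. \<integral>\<^sup>+c. \<integral>\<^sup>+d. g (ratio3 b c d) \<partial>cauchy \<partial>cauchy \<partial>cauchy)"
        by (rule nn_integral_mob[of "\<lambda>b. \<integral>\<^sup>+c. \<integral>\<^sup>+d. g (ratio3 b c d) \<partial>cauchy \<partial>cauchy"]) measurable
      show ?thesis by (simp only: 1 2 3)
    qed
    finally show ?thesis .
  qed
  then show ?thesis using C.emeasure_space_1 by simp
qed

text \<open>The joint density of the differences \<open>b - d\<close> and \<open>c - d\<close> (up to sign) of three independent Cauchy variables.\<close>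

definition gap_pdf :: "real \<Rightarrow> real \<Rightarrow> real" where
  "gap_pdf u v = 2 * (u\<^sup>2 - u * v + v\<^sup>2 + 12) / (pi\<^sup>2 * ((u\<^sup>2 + 4) * (v\<^sup>2 + 4) * ((u - v)\<^sup>2 + 4)))"

lemma arctan_shift_limits:
  "((\<lambda>y. arctan (y + u)) \<longlongrightarrow> pi / 2) at_top" "((\<lambda>y. arctan (y + u)) \<longlongrightarrow> - (pi / 2)) at_bot"
proof -
  have 1: "filterlim (\<lambda>y. y + u) at_top at_top" "filterlim (\<lambda>y. y + u) at_bot at_bot"
    by real_asymp+
  show "((\<lambda>y. arctan (y + u)) \<longlongrightarrow> pi / 2) at_top" by (rule filterlim_compose[OF tendsto_arctan_at_top 1(1)])
  show "((\<lambda>y. arctan (y + u)) \<longlongrightarrow> - (pi / 2)) at_bot" by (rule filterlim_compose[OF tendsto_arctan_at_bot 1(2)])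
qed

lemma ln_shift_limits:
  fixes u :: real
  shows "((\<lambda>y. ln ((y + u)\<^sup>2 + 1) - ln (y\<^sup>2 + 1)) \<longlongrightarrow> 0) at_top"
    "((\<lambda>y. ln ((y + u)\<^sup>2 + 1) - ln (y\<^sup>2 + 1)) \<longlongrightarrow> 0) at_bot"
  by real_asymp+

text \<open>Partial fractions for the product of two Cauchy factors, with numerators
  \<open>1\<close> and \<open>y + u\<close>. In the limits only the arctangents survive; the
  difference of the logarithms tends to 0.\<close>

lemma product_antiderivatives:
  fixes u :: real
  assumes u: "u \<noteq> 0"
  defines "E \<equiv> \<lambda>y. (u * arctan y + u * arctan (y + u) + (ln ((y + u)\<^sup>2 + 1) - ln (y\<^sup>2 + 1))) / (u * (u\<^sup>2 + 4))"
    and "H \<equiv> \<lambda>y. ((u\<^sup>2 + 2) * arctan y - 2 * arctan (y + u) + u / 2 * (ln ((y + u)\<^sup>2 + 1) - ln (y\<^sup>2 + 1))) / (u * (u\<^sup>2 + 4))"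
  shows "DERIV E y :> 1 / ((y\<^sup>2 + 1) * ((y + u)\<^sup>2 + 1))"
    and "DERIV H y :> (y + u) / ((y\<^sup>2 + 1) * ((y + u)\<^sup>2 + 1))"
    and "(E \<longlongrightarrow> pi / (u\<^sup>2 + 4)) at_top" "(E \<longlongrightarrow> - (pi / (u\<^sup>2 + 4))) at_bot"
    and "(H \<longlongrightarrow> pi / 2 * u / (u\<^sup>2 + 4)) at_top" "(H \<longlongrightarrow> - (pi / 2 * u / (u\<^sup>2 + 4))) at_bot"
proof -
  define D where "D = u * (u\<^sup>2 + 4)"
  have D0: "u\<^sup>2 + 4 \<noteq> 0" using zero_le_power2[of u] by linarith
  have D: "D \<noteq> 0" using u D0 by (simp add: D_def)
  define p q where "p = y\<^sup>2 + 1" and "q = (y + u)\<^sup>2 + 1"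
  have pq: "p > 0" "q > 0" by (simp_all add: p_def q_def add_nonneg_pos)
  have da: "DERIV arctan y :> 1 / p" "DERIV (\<lambda>y. arctan (y + u)) y :> 1 / q"
    by (auto intro!: derivative_eq_intros simp: p_def q_def add.commute inverse_eq_divide)
  have dl: "DERIV (\<lambda>y. ln ((y + u)\<^sup>2 + 1) - ln (y\<^sup>2 + 1)) y :> 2 * (y + u) / q - 2 * y / p"
    using pq by (auto intro!: derivative_eq_intros simp: p_def q_def)
  have "DERIV E y :> (u * (1 / p) + u * (1 / q) + (2 * (y + u) / q - 2 * y / p)) / D"
    unfolding E_def D_def[symmetric] by (intro DERIV_cdivide DERIV_add DERIV_cmult da dl)
  also have "(u * (1 / p) + u * (1 / q) + (2 * (y + u) / q - 2 * y / p)) / D = 1 / (p * q)"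
  proof -
    have "u * (1 / p) + u * (1 / q) + (2 * (y + u) / q - 2 * y / p) = ((u - 2 * y) * q + (u + 2 * (y + u)) * p) / (p * q)"
      using pq by (simp add: field_simps)
    also have "(u - 2 * y) * q + (u + 2 * (y + u)) * p = D"
      unfolding p_def q_def D_def by (simp add: power2_eq_square algebra_simps)
    finally show ?thesis using D by simp
  qed
  finally show "DERIV E y :> 1 / ((y\<^sup>2 + 1) * ((y + u)\<^sup>2 + 1))" by (simp add: p_def q_def)
  have "DERIV H y :> ((u\<^sup>2 + 2) * (1 / p) - 2 * (1 / q) + u / 2 * (2 * (y + u) / q - 2 * y / p)) / D"
    unfolding H_def D_def[symmetric] by (intro DERIV_cdivide DERIV_add DERIV_diff DERIV_cmult da dl)
  also have "((u\<^sup>2 + 2) * (1 / p) - 2 * (1 / q) + u / 2 * (2 * (y + u) / q - 2 * y / p)) / D = (y + u) / (p * q)"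
  proof -
    have "(u\<^sup>2 + 2) * (1 / p) - 2 * (1 / q) + u / 2 * (2 * (y + u) / q - 2 * y / p)
       = ((u\<^sup>2 + 2 - u * y) * q + (u * (y + u) - 2) * p) / (p * q)"
      using pq by (simp add: field_simps)
    also have "(u\<^sup>2 + 2 - u * y) * q + (u * (y + u) - 2) * p = (y + u) * D"
      unfolding p_def q_def D_def by (simp add: power2_eq_square algebra_simps)
    finally show ?thesis using D by simp
  qed
  finally show "DERIV H y :> (y + u) / ((y\<^sup>2 + 1) * ((y + u)\<^sup>2 + 1))" by (simp add: p_def q_def)
  have "(E \<longlongrightarrow> (u * (pi / 2) + u * (pi / 2) + 0) / D) at_top"
    unfolding E_def D_def[symmetric]
    by (intro tendsto_divide tendsto_add tendsto_mult tendsto_const tendsto_arctan_at_top arctan_shift_limits ln_shift_limits D)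
  then show "(E \<longlongrightarrow> pi / (u\<^sup>2 + 4)) at_top" using u by (simp add: D_def)
  have "(E \<longlongrightarrow> (u * (- (pi / 2)) + u * (- (pi / 2)) + 0) / D) at_bot"
    unfolding E_def D_def[symmetric]
    by (intro tendsto_divide tendsto_add tendsto_mult tendsto_const tendsto_arctan_at_bot arctan_shift_limits ln_shift_limits D)
  then show "(E \<longlongrightarrow> - (pi / (u\<^sup>2 + 4))) at_bot" using u by (simp add: D_def)
  have e: "((u\<^sup>2 + 2) * x - 2 * x + u / 2 * 0) / D = x * u / (u\<^sup>2 + 4)" for x
  proof -
    have "(u\<^sup>2 + 2) * x - 2 * x + u / 2 * 0 = u * (x * u)" by (simp add: power2_eq_square algebra_simps)
    then show ?thesis unfolding D_def using u by simp
  qed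
  have "(H \<longlongrightarrow> ((u\<^sup>2 + 2) * (pi / 2) - 2 * (pi / 2) + u / 2 * 0) / D) at_top"
    unfolding H_def D_def[symmetric]
    by (intro tendsto_divide tendsto_add tendsto_diff tendsto_mult tendsto_const tendsto_arctan_at_top arctan_shift_limits ln_shift_limits D)
  then show "(H \<longlongrightarrow> pi / 2 * u / (u\<^sup>2 + 4)) at_top" unfolding e .
  have "(H \<longlongrightarrow> ((u\<^sup>2 + 2) * (- (pi / 2)) - 2 * (- (pi / 2)) + u / 2 * 0) / D) at_bot"
    unfolding H_def D_def[symmetric]
    by (intro tendsto_divide tendsto_add tendsto_diff tendsto_mult tendsto_const tendsto_arctan_at_bot arctan_shift_limits ln_shift_limits D)
  then show "(H \<longlongrightarrow> - (pi / 2 * u / (u\<^sup>2 + 4))) at_bot" unfolding e by simp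
qed

lemma nn_integral_cauchy_product:
  assumes u: "u \<noteq> 0" and v: "v \<noteq> 0" and uv: "u \<noteq> v"
  shows "(\<integral>\<^sup>+x. ennreal (cauchy_pdf x * cauchy_pdf (x + u) * cauchy_pdf (x + v)) \<partial>lborel) = ennreal (gap_pdf u v)"
proof -
  define E where "E u y = (u * arctan y + u * arctan (y + u) + (ln ((y + u)\<^sup>2 + 1) - ln (y\<^sup>2 + 1))) / (u * (u\<^sup>2 + 4))" for u y :: real
  define H where "H u y = ((u\<^sup>2 + 2) * arctan y - 2 * arctan (y + u) + u / 2 * (ln ((y + u)\<^sup>2 + 1) - ln (y\<^sup>2 + 1))) / (u * (u\<^sup>2 + 4))" for u y :: real
  note pu = product_antiderivatives[OF u, folded E_def H_def]
  note pv = product_antiderivatives[OF v, folded E_def H_def]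
  define w where "w = v - u"
  have w: "w \<noteq> 0" "w\<^sup>2 + 4 > 0" using uv by (simp_all add: w_def add_nonneg_pos)
  define Dw where "Dw = pi ^ 3 * (w * (w\<^sup>2 + 4))"
  have Dw: "Dw \<noteq> 0" using w by (simp add: Dw_def)
  define A where "A y = (w * E u y - 2 * H u y + w * E v y + 2 * H v y) / Dw" for y
  have "(\<integral>\<^sup>+x. ennreal (cauchy_pdf x * cauchy_pdf (x + u) * cauchy_pdf (x + v)) \<partial>lborel)
    = ennreal ((w * (pi / (u\<^sup>2 + 4)) - 2 * (pi / 2 * u / (u\<^sup>2 + 4)) + w * (pi / (v\<^sup>2 + 4)) + 2 * (pi / 2 * v / (v\<^sup>2 + 4))) / Dw
      - (w * (- (pi / (u\<^sup>2 + 4))) - 2 * (- (pi / 2 * u / (u\<^sup>2 + 4))) + w * (- (pi / (v\<^sup>2 + 4))) + 2 * (- (pi / 2 * v / (v\<^sup>2 + 4)))) / Dw)"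
  proof (rule nn_integral_FTC_UNIV[where F = A])
    show "(A \<longlongrightarrow> (w * (pi / (u\<^sup>2 + 4)) - 2 * (pi / 2 * u / (u\<^sup>2 + 4)) + w * (pi / (v\<^sup>2 + 4)) + 2 * (pi / 2 * v / (v\<^sup>2 + 4))) / Dw) at_top"
      unfolding A_def by (intro tendsto_divide tendsto_add tendsto_diff tendsto_mult tendsto_const pu pv Dw)
    show "(A \<longlongrightarrow> (w * (- (pi / (u\<^sup>2 + 4))) - 2 * (- (pi / 2 * u / (u\<^sup>2 + 4))) + w * (- (pi / (v\<^sup>2 + 4))) + 2 * (- (pi / 2 * v / (v\<^sup>2 + 4)))) / Dw) at_bot"
      unfolding A_def by (intro tendsto_divide tendsto_add tendsto_diff tendsto_mult tendsto_const pu pv Dw)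
    fix y
    define p q r where "p = y\<^sup>2 + 1" and "q = (y + u)\<^sup>2 + 1" and "r = (y + v)\<^sup>2 + 1"
    have pqr: "p > 0" "q > 0" "r > 0" by (simp_all add: p_def q_def r_def add_nonneg_pos)
    have "DERIV A y :> (w * (1 / (p * q)) - 2 * ((y + u) / (p * q)) + w * (1 / (p * r)) + 2 * ((y + v) / (p * r))) / Dw"
      unfolding A_def p_def q_def r_def by (intro DERIV_cdivide DERIV_add DERIV_diff DERIV_cmult pu pv)
    also have "(w * (1 / (p * q)) - 2 * ((y + u) / (p * q)) + w * (1 / (p * r)) + 2 * ((y + v) / (p * r))) / Dw
       = cauchy_pdf y * cauchy_pdf (y + u) * cauchy_pdf (y + v)"
    proof -
      have "w * (1 / (p * q)) - 2 * ((y + u) / (p * q)) + w * (1 / (p * r)) + 2 * ((y + v) / (p * r))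
        = ((w - 2 * (y + u)) * r + (w + 2 * (y + v)) * q) / (p * q * r)"
        using pqr by (simp add: field_simps)
      \<comment> \<open>This identity splits the product of three Cauchy factors into products of
        two, which \<open>E\<close> and \<open>H\<close> integrate.\<close>
      also have "(w - 2 * (y + u)) * r + (w + 2 * (y + v)) * q = w * (w\<^sup>2 + 4)"
        unfolding q_def r_def w_def by (simp add: power2_eq_square algebra_simps)
      finally have "(w * (1 / (p * q)) - 2 * ((y + u) / (p * q)) + w * (1 / (p * r)) + 2 * ((y + v) / (p * r))) / Dw
         = w * (w\<^sup>2 + 4) / (p * q * r) / Dw" by simp
      also have "\<dots> = 1 / (pi ^ 3 * (p * q * r))" using w pqr unfolding Dw_def by simp
      also have "\<dots> = cauchy_pdf y * cauchy_pdf (y + u) * cauchy_pdf (y + v)"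
        by (simp add: cauchy_pdf_def p_def q_def r_def power3_eq_cube add.commute mult_ac)
      finally show ?thesis .
    qed
    finally show "DERIV A y :> cauchy_pdf y * cauchy_pdf (y + u) * cauchy_pdf (y + v)" .
  qed (auto intro!: mult_nonneg_nonneg cauchy_pdf_nonneg)
  also have "(w * (pi / (u\<^sup>2 + 4)) - 2 * (pi / 2 * u / (u\<^sup>2 + 4)) + w * (pi / (v\<^sup>2 + 4)) + 2 * (pi / 2 * v / (v\<^sup>2 + 4))) / Dw
      - (w * (- (pi / (u\<^sup>2 + 4))) - 2 * (- (pi / 2 * u / (u\<^sup>2 + 4))) + w * (- (pi / (v\<^sup>2 + 4))) + 2 * (- (pi / 2 * v / (v\<^sup>2 + 4)))) / Dw
     = gap_pdf u v"
  proof -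
    define a b where "a = u\<^sup>2 + 4" and "b = v\<^sup>2 + 4"
    have ab: "a > 0" "b > 0" by (simp_all add: a_def b_def add_nonneg_pos)
    have "w * (pi / a) - 2 * (pi / 2 * u / a) + w * (pi / b) + 2 * (pi / 2 * v / b)
       - (w * (- (pi / a)) - 2 * (- (pi / 2 * u / a)) + w * (- (pi / b)) + 2 * (- (pi / 2 * v / b)))
       = 2 * pi * ((w - u) * b + (w + v) * a) / (a * b)"
      using ab by (simp add: field_simps)
    also have "(w - u) * b + (w + v) * a = w * (u\<^sup>2 - u * v + v\<^sup>2 + 12)"
      unfolding a_def b_def w_def by (simp add: power2_eq_square algebra_simps)
    finally have "(w * (pi / a) - 2 * (pi / 2 * u / a) + w * (pi / b) + 2 * (pi / 2 * v / b)) / Dw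
       - (w * (- (pi / a)) - 2 * (- (pi / 2 * u / a)) + w * (- (pi / b)) + 2 * (- (pi / 2 * v / b))) / Dw
       = 2 * pi * (w * (u\<^sup>2 - u * v + v\<^sup>2 + 12)) / (a * b) / Dw" by (simp only: diff_divide_distrib[symmetric])
    also have "\<dots> = gap_pdf u v"
      using w ab unfolding Dw_def gap_pdf_def a_def[symmetric] b_def[symmetric]
      by (simp add: w_def power2_commute[of u v] power3_eq_cube power2_eq_square[of pi])
    finally show ?thesis unfolding a_def b_def .
  qed
  finally show ?thesis .
qed

text \<open>The density of the quotient of these differences; the junk values at \<open>k = 0\<close> and \<open>k = 1\<close> are harmless.\<close>

definition cr_pdf :: "real \<Rightarrow> real" where
  "cr_pdf k = (- ln \<bar>1 - k\<bar> / k - ln \<bar>k\<bar> / (1 - k)) / pi\<^sup>2"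

definition cr_ratio :: "real \<Rightarrow> real" where
  "cr_ratio k = mid_ratio \<bar>1 - k\<bar> \<bar>k\<bar> 1"

lemma cr_ratio_measurable [measurable]: "cr_ratio \<in> borel_measurable borel"
  unfolding cr_ratio_def by measurable

lemma cr_pdf_measurable [measurable]: "cr_pdf \<in> borel_measurable borel"
  unfolding cr_pdf_def by measurable

lemma gap_pdf_measurable [measurable]:
  assumes [measurable]: "f \<in> borel_measurable M" "g \<in> borel_measurable M"
  shows "(\<lambda>x. gap_pdf (f x) (g x)) \<in> borel_measurable M"
  unfolding gap_pdf_def by measurable

lemma gap_pdf_nonneg: "gap_pdf u v \<ge> 0"
proof -
  have "u\<^sup>2 - u * v + v\<^sup>2 + 12 = (u - v / 2)\<^sup>2 + 3 / 4 * v\<^sup>2 + 12" by (simp add: power2_eq_square algebra_simps)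
  also have "\<dots> \<ge> 0" by (intro add_nonneg_nonneg) auto
  finally have "u\<^sup>2 - u * v + v\<^sup>2 + 12 \<ge> 0" .
  then show ?thesis unfolding gap_pdf_def by (intro divide_nonneg_nonneg mult_nonneg_nonneg) simp_all
qed

lemma nn_integral_even:
  fixes f :: "real \<Rightarrow> ennreal"
  assumes [measurable]: "f \<in> borel_measurable borel" and ev: "\<And>x. f (- x) = f x"
  shows "(\<integral>\<^sup>+x. f x \<partial>lborel) = 2 * (\<integral>\<^sup>+x. f x * indicator {0..} x \<partial>lborel)"
proof -
  have "(\<integral>\<^sup>+x. f x * indicator {..0} x \<partial>lborel) = (\<integral>\<^sup>+x. f x * indicator {0..} x \<partial>lborel)"
    by (subst nn_integral_real_affine[where c = "-1" and t = 0]) (auto intro!: nn_integral_cong simp: indicator_def ev)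
  moreover have "(\<integral>\<^sup>+x. f x \<partial>lborel) = (\<integral>\<^sup>+x. f x * indicator {0..} x + f x * indicator {..0} x \<partial>lborel)"
    by (intro nn_integral_cong_AE eventually_mono[OF AE_lborel_singleton[of 0]]) (auto simp: indicator_def)
  ultimately show ?thesis by (subst (asm) nn_integral_add) (simp_all add: mult_2)
qed

text \<open>The density of the quotient \<open>v / u\<close>, where \<open>|u|\<close> is the
  Jacobian of \<open>v = u * k\<close>. The integrand is even, and on the half-line its
  antiderivative consists of three logarithms.\<close>

lemma nn_integral_gap_pdf:
  assumes k: "k \<noteq> 0" "k \<noteq> 1"
  shows "(\<integral>\<^sup>+u. ennreal (\<bar>u\<bar> * gap_pdf u (u * k)) \<partial>lborel) = ennreal (cr_pdf k)"
proof -
  define j where "j = 1 - k"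
  have j: "j \<noteq> 0" using k by (simp add: j_def)
  define a b c where "a u = 1 + u\<^sup>2 / 4" and "b u = 1 + k\<^sup>2 * (u\<^sup>2 / 4)" and "c u = 1 + j\<^sup>2 * (u\<^sup>2 / 4)" for u :: real
  have abc: "a u > 0" "b u > 0" "c u > 0" for u by (simp_all add: a_def b_def c_def add_pos_nonneg)
  define F where "F u = (ln (a u) / (k * j) - ln (b u) / j - ln (c u) / k) / (4 * pi\<^sup>2)" for u
  have "(\<integral>\<^sup>+u. ennreal (\<bar>u\<bar> * gap_pdf u (u * k)) * indicator {0..} u \<partial>lborel) = (\<integral>\<^sup>+u. ennreal (u * gap_pdf u (u * k)) * indicator {0..} u \<partial>lborel)"
    by (intro nn_integral_cong) (auto simp: indicator_def)
  also have "\<dots> = ennreal ((- (2 * ln \<bar>k\<bar>) / j - 2 * ln \<bar>j\<bar> / k) / (4 * pi\<^sup>2) - F 0)"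
  proof (rule nn_integral_FTC_atLeast)
    show "(\<lambda>u. u * gap_pdf u (u * k)) \<in> borel_measurable borel" by measurable
    show "0 \<le> u * gap_pdf u (u * k)" if "0 \<le> u" for u using that gap_pdf_nonneg by simp
    have da: "DERIV a u :> u / 2" "DERIV b u :> k\<^sup>2 * (u / 2)" "DERIV c u :> j\<^sup>2 * (u / 2)" for u
      unfolding a_def b_def c_def by (auto intro!: derivative_eq_intros)
    show "DERIV F u :> u * gap_pdf u (u * k)" for u
    proof -
      have "DERIV F u :> ((1 / a u * (u / 2)) / (k * j) - (1 / b u * (k\<^sup>2 * (u / 2))) / j - (1 / c u * (j\<^sup>2 * (u / 2))) / k) / (4 * pi\<^sup>2)"
        unfolding F_def
        by (intro DERIV_cdivide DERIV_diff DERIV_chain'[OF _ DERIV_ln_divide] da abc)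
      also have "((1 / a u * (u / 2)) / (k * j) - (1 / b u * (k\<^sup>2 * (u / 2))) / j - (1 / c u * (j\<^sup>2 * (u / 2))) / k) / (4 * pi\<^sup>2)
        = u / 2 * ((b u * c u - k * k\<^sup>2 * (a u * c u) - j * j\<^sup>2 * (a u * b u)) / (k * j * (a u * b u * c u))) / (4 * pi\<^sup>2)"
        using abc[of u] k j by (simp add: field_simps)
      also have "b u * c u - k * k\<^sup>2 * (a u * c u) - j * j\<^sup>2 * (a u * b u) = k * j * ((1 - k + k\<^sup>2) * (u\<^sup>2 / 4) + 3)"
        unfolding a_def b_def c_def j_def by (simp add: field_simps power2_eq_square) 
      also have "u / 2 * (k * j * ((1 - k + k\<^sup>2) * (u\<^sup>2 / 4) + 3) / (k * j * (a u * b u * c u))) / (4 * pi\<^sup>2)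
         = u / 2 * (((1 - k + k\<^sup>2) * (u\<^sup>2 / 4) + 3) / (a u * b u * c u)) / (4 * pi\<^sup>2)" using k j by simp
      also have "\<dots> = u * gap_pdf u (u * k)"
      proof -
        have e: "u\<^sup>2 + 4 = 4 * a u" "(u * k)\<^sup>2 + 4 = 4 * b u" "(u - u * k)\<^sup>2 + 4 = 4 * c u"
          "u\<^sup>2 - u * (u * k) + (u * k)\<^sup>2 + 12 = 4 * ((1 - k + k\<^sup>2) * (u\<^sup>2 / 4) + 3)"
          by (simp_all add: a_def b_def c_def j_def power2_eq_square field_simps)
        show ?thesis unfolding gap_pdf_def e using abc[of u] by (simp add: field_simps)
      qed
      finally show ?thesis .
    qed
    have ba: "ln (b u) = ln (a u) + ln (b u / a u)" "ln (c u) = ln (a u) + ln (c u / a u)" for u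
      using abc[of u] by (simp_all add: ln_div)
    \<comment> \<open>The unbounded terms \<open>ln (a u)\<close> cancel because
      \<open>k + j = 1\<close>; in this form the limit at infinity can be read off.\<close>
    have F: "F u = (- ln (b u / a u) / j - ln (c u / a u) / k) / (4 * pi\<^sup>2)" for u
    proof -
      have "x / (k * j) - (x + y) / j - (x + z) / k = x * (1 - k - j) / (k * j) - y / j - z / k" for x y z
        using k j by (simp add: field_simps)
      then show ?thesis unfolding F_def ba by (simp add: j_def)
    qed
    have inv: "((\<lambda>u. 1 / a u) \<longlongrightarrow> 0) at_top" unfolding a_def by real_asymp
    have r: "b u / a u = k\<^sup>2 + (1 - k\<^sup>2) * (1 / a u)" "c u / a u = j\<^sup>2 + (1 - j\<^sup>2) * (1 / a u)" for u
    proof -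
      have "b u = k\<^sup>2 * a u + (1 - k\<^sup>2)" "c u = j\<^sup>2 * a u + (1 - j\<^sup>2)" by (simp_all add: a_def b_def c_def algebra_simps)
      then show "b u / a u = k\<^sup>2 + (1 - k\<^sup>2) * (1 / a u)" "c u / a u = j\<^sup>2 + (1 - j\<^sup>2) * (1 / a u)"
        using abc[of u] by (simp_all add: add_divide_distrib)
    qed
    have lim: "((\<lambda>u. b u / a u) \<longlongrightarrow> k\<^sup>2 + (1 - k\<^sup>2) * 0) at_top" "((\<lambda>u. c u / a u) \<longlongrightarrow> j\<^sup>2 + (1 - j\<^sup>2) * 0) at_top"
      unfolding r by (intro tendsto_add tendsto_mult tendsto_const inv)+
    have "(F \<longlongrightarrow> (- ln (k\<^sup>2 + (1 - k\<^sup>2) * 0) / j - ln (j\<^sup>2 + (1 - j\<^sup>2) * 0) / k) / (4 * pi\<^sup>2)) at_top"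
      unfolding F by (intro tendsto_divide tendsto_diff tendsto_minus tendsto_ln lim tendsto_const) (use k j in auto)
    moreover have "ln (x\<^sup>2) = 2 * ln \<bar>x\<bar>" if "x \<noteq> 0" for x :: real
      using ln_realpow[of "\<bar>x\<bar>" 2] that by simp
    then have "ln (k\<^sup>2) = 2 * ln \<bar>k\<bar>" "ln (j\<^sup>2) = 2 * ln \<bar>j\<bar>" using k j by blast+
    ultimately show "(F \<longlongrightarrow> (- (2 * ln \<bar>k\<bar>) / j - 2 * ln \<bar>j\<bar> / k) / (4 * pi\<^sup>2)) at_top" by simp
  qed
  finally have half: "(\<integral>\<^sup>+u. ennreal (\<bar>u\<bar> * gap_pdf u (u * k)) * indicator {0..} u \<partial>lborel)
     = ennreal ((- (2 * ln \<bar>k\<bar>) / j - 2 * ln \<bar>j\<bar> / k) / (4 * pi\<^sup>2) - F 0)" .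
  have "gap_pdf (- u) (- u * k) = gap_pdf u (u * k)" for u
  proof -
    have "(- u - - u * k)\<^sup>2 = (u - u * k)\<^sup>2" by (simp add: power2_eq_square algebra_simps)
    then show ?thesis unfolding gap_pdf_def by simp
  qed
  then have "(\<integral>\<^sup>+u. ennreal (\<bar>u\<bar> * gap_pdf u (u * k)) \<partial>lborel) = 2 * (\<integral>\<^sup>+u. ennreal (\<bar>u\<bar> * gap_pdf u (u * k)) * indicator {0..} u \<partial>lborel)"
    by (intro nn_integral_even) simp_all
  also have "\<dots> = ennreal (2 * ((- (2 * ln \<bar>k\<bar>) / j - 2 * ln \<bar>j\<bar> / k) / (4 * pi\<^sup>2)))"
  proof -
    have "F 0 = 0" by (simp add: F_def a_def b_def c_def)
    then show ?thesis unfolding half by (simp only: ennreal_mult' zero_le_numeral ennreal_numeral diff_zero)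
  qed
  also have "2 * ((- (2 * ln \<bar>k\<bar>) / j - 2 * ln \<bar>j\<bar> / k) / (4 * pi\<^sup>2)) = cr_pdf k"
    by (simp add: cr_pdf_def j_def field_simps)
  finally show ?thesis .
qed

text \<open>With \<open>b = x\<close>, \<open>c = x + u\<close> and \<open>d = x + v\<close> the
  ratio depends only on \<open>u\<close> and \<open>v\<close>; with \<open>v = u * k\<close> it
  depends only on \<open>k\<close>, since \<open>mid_ratio\<close> is homogeneous of degree 0.
  Integrating out first \<open>x\<close> and then \<open>u\<close> leaves the density of
  \<open>k\<close>.\<close>

lemma nn_integral_ratio3:
  assumes g [measurable]: "g \<in> borel_measurable borel"
  shows "(\<integral>\<^sup>+b. \<integral>\<^sup>+c. \<integral>\<^sup>+d. g (ratio3 b c d) \<partial>cauchy \<partial>cauchy \<partial>cauchy)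
    = (\<integral>\<^sup>+k. ennreal (cr_pdf k) * g (cr_ratio k) \<partial>lborel)"
proof -
  define R where "R u v = mid_ratio \<bar>u - v\<bar> \<bar>v\<bar> \<bar>u\<bar>" for u v :: real
  define p where "p x u v = cauchy_pdf x * cauchy_pdf (x + u) * cauchy_pdf (x + v)" for x u v
  have Rm [measurable]: "(\<lambda>x. R (f x) (h x)) \<in> borel_measurable M"
    if [measurable]: "f \<in> borel_measurable M" "h \<in> borel_measurable M" for f h and M :: "'c measure"
    unfolding R_def by measurable
  have "(\<integral>\<^sup>+b. \<integral>\<^sup>+c. \<integral>\<^sup>+d. g (ratio3 b c d) \<partial>cauchy \<partial>cauchy \<partial>cauchy)
    = (\<integral>\<^sup>+b. ennreal (cauchy_pdf b) * (\<integral>\<^sup>+c. ennreal (cauchy_pdf c) * (\<integral>\<^sup>+d. ennreal (cauchy_pdf d) * g (ratio3 b c d) \<partial>lborel) \<partial>lborel) \<partial>lborel)"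
    by (simp add: nn_integral_cauchy)
  also have "\<dots> = (\<integral>\<^sup>+b. \<integral>\<^sup>+c. \<integral>\<^sup>+d. ennreal (cauchy_pdf b) * (ennreal (cauchy_pdf c) * (ennreal (cauchy_pdf d) * g (ratio3 b c d))) \<partial>lborel \<partial>lborel \<partial>lborel)"
    by (simp add: nn_integral_cmult)
  also have "\<dots> = (\<integral>\<^sup>+x. \<integral>\<^sup>+u. \<integral>\<^sup>+v. ennreal (p x u v) * g (R u v) \<partial>lborel \<partial>lborel \<partial>lborel)"
  proof (rule nn_integral_cong)
    fix x :: real
    let ?h = "\<lambda>c d. ennreal (cauchy_pdf x) * (ennreal (cauchy_pdf c) * (ennreal (cauchy_pdf d) * g (ratio3 x c d)))"
    have "(\<integral>\<^sup>+c. \<integral>\<^sup>+d. ?h c d \<partial>lborel \<partial>lborel) = (\<integral>\<^sup>+u. \<integral>\<^sup>+d. ?h (x + 1 * u) d \<partial>lborel \<partial>lborel)"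
      by (subst nn_integral_real_affine[where c = 1 and t = x]) simp_all
    also have "\<dots> = (\<integral>\<^sup>+u. \<integral>\<^sup>+v. ?h (x + 1 * u) (x + 1 * v) \<partial>lborel \<partial>lborel)"
      by (rule nn_integral_cong, subst nn_integral_real_affine[where c = 1 and t = x]) simp_all
    also have "\<dots> = (\<integral>\<^sup>+u. \<integral>\<^sup>+v. ennreal (p x u v) * g (R u v) \<partial>lborel \<partial>lborel)"
    proof (intro nn_integral_cong)
      fix u v :: real
      have "ratio3 x (x + u) (x + v) = R u v" by (simp add: ratio3_def R_def)
      then show "?h (x + 1 * u) (x + 1 * v) = ennreal (p x u v) * g (R u v)"
        by (simp add: p_def ennreal_mult cauchy_pdf_nonneg mult.assoc)
    qed
    finally show "(\<integral>\<^sup>+c. \<integral>\<^sup>+d. ?h c d \<partial>lborel \<partial>lborel) = (\<integral>\<^sup>+u. \<integral>\<^sup>+v. ennreal (p x u v) * g (R u v) \<partial>lborel \<partial>lborel)" .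
  qed
  also have "\<dots> = (\<integral>\<^sup>+u. \<integral>\<^sup>+x. \<integral>\<^sup>+v. ennreal (p x u v) * g (R u v) \<partial>lborel \<partial>lborel \<partial>lborel)"
    unfolding p_def by (rule lborel_pair.Fubini') measurable
  also have "\<dots> = (\<integral>\<^sup>+u. \<integral>\<^sup>+v. \<integral>\<^sup>+x. ennreal (p x u v) * g (R u v) \<partial>lborel \<partial>lborel \<partial>lborel)"
    unfolding p_def by (rule nn_integral_cong, rule lborel_pair.Fubini') measurable
  also have "\<dots> = (\<integral>\<^sup>+u. \<integral>\<^sup>+k. ennreal (\<bar>u\<bar> * gap_pdf u (u * k)) * g (cr_ratio k) \<partial>lborel \<partial>lborel)"
  proof (rule nn_integral_cong_AE, rule eventually_mono[OF AE_lborel_singleton[of 0]])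
    fix u :: real assume u: "u \<noteq> 0"
    have "(\<integral>\<^sup>+v. \<integral>\<^sup>+x. ennreal (p x u v) * g (R u v) \<partial>lborel \<partial>lborel) = (\<integral>\<^sup>+v. ennreal (gap_pdf u v) * g (R u v) \<partial>lborel)"
    proof (rule nn_integral_cong_AE, rule eventually_mono[OF eventually_conj[OF AE_lborel_singleton[of 0] AE_lborel_singleton[of u]]])
      fix v :: real assume v: "v \<noteq> 0 \<and> v \<noteq> u"
      have "(\<integral>\<^sup>+x. ennreal (p x u v) * g (R u v) \<partial>lborel) = (\<integral>\<^sup>+x. ennreal (p x u v) \<partial>lborel) * g (R u v)"
        unfolding p_def by (rule nn_integral_multc) measurable
      also have "(\<integral>\<^sup>+x. ennreal (p x u v) \<partial>lborel) = ennreal (gap_pdf u v)"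
        unfolding p_def using u v by (intro nn_integral_cauchy_product) auto
      finally show "(\<integral>\<^sup>+x. ennreal (p x u v) * g (R u v) \<partial>lborel) = ennreal (gap_pdf u v) * g (R u v)" .
    qed
    also have "\<dots> = ennreal \<bar>u\<bar> * (\<integral>\<^sup>+k. ennreal (gap_pdf u (0 + u * k)) * g (R u (0 + u * k)) \<partial>lborel)"
      by (rule nn_integral_real_affine) (use u in measurable)
    also have "\<dots> = (\<integral>\<^sup>+k. ennreal \<bar>u\<bar> * (ennreal (gap_pdf u (0 + u * k)) * g (R u (0 + u * k))) \<partial>lborel)"
      by (rule nn_integral_cmult[symmetric]) measurable
    also have "\<dots> = (\<integral>\<^sup>+k. ennreal (\<bar>u\<bar> * gap_pdf u (u * k)) * g (cr_ratio k) \<partial>lborel)"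
    proof (rule nn_integral_cong)
      fix k :: real
      have "u - u * k = u * (1 - k)" by (simp add: algebra_simps)
      then have "R u (u * k) = mid_ratio (\<bar>u\<bar> * \<bar>1 - k\<bar>) (\<bar>u\<bar> * \<bar>k\<bar>) (\<bar>u\<bar> * 1)" by (simp add: R_def abs_mult)
      also have "\<dots> = cr_ratio k" unfolding cr_ratio_def using u by (intro mid_ratio_scale) simp
      finally show "ennreal \<bar>u\<bar> * (ennreal (gap_pdf u (0 + u * k)) * g (R u (0 + u * k))) = ennreal (\<bar>u\<bar> * gap_pdf u (u * k)) * g (cr_ratio k)"
        by (simp add: ennreal_mult gap_pdf_nonneg mult.assoc)
    qed
    finally show "(\<integral>\<^sup>+v. \<integral>\<^sup>+x. ennreal (p x u v) * g (R u v) \<partial>lborel \<partial>lborel) = (\<integral>\<^sup>+k. ennreal (\<bar>u\<bar> * gap_pdf u (u * k)) * g (cr_ratio k) \<partial>lborel)" .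
  qed
  also have "\<dots> = (\<integral>\<^sup>+k. \<integral>\<^sup>+u. ennreal (\<bar>u\<bar> * gap_pdf u (u * k)) * g (cr_ratio k) \<partial>lborel \<partial>lborel)"
    by (rule lborel_pair.Fubini') measurable
  also have "\<dots> = (\<integral>\<^sup>+k. ennreal (cr_pdf k) * g (cr_ratio k) \<partial>lborel)"
  proof (rule nn_integral_cong_AE, rule eventually_mono[OF eventually_conj[OF AE_lborel_singleton[of 0] AE_lborel_singleton[of 1]]])
    fix k :: real assume "k \<noteq> 0 \<and> k \<noteq> 1"
    then have "(\<integral>\<^sup>+u. ennreal (\<bar>u\<bar> * gap_pdf u (u * k)) \<partial>lborel) = ennreal (cr_pdf k)" by (intro nn_integral_gap_pdf) auto
    moreover have "(\<integral>\<^sup>+u. ennreal (\<bar>u\<bar> * gap_pdf u (u * k)) * g (cr_ratio k) \<partial>lborel) = (\<integral>\<^sup>+u. ennreal (\<bar>u\<bar> * gap_pdf u (u * k)) \<partial>lborel) * g (cr_ratio k)"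
      by (rule nn_integral_multc) measurable
    ultimately show "(\<integral>\<^sup>+u. ennreal (\<bar>u\<bar> * gap_pdf u (u * k)) * g (cr_ratio k) \<partial>lborel) = ennreal (cr_pdf k) * g (cr_ratio k)" by simp
  qed
  finally show ?thesis .
qed

text \<open>The six orderings of \<open>|1 - k|\<close>, \<open>|k|\<close> and \<open>1\<close> correspond to the images of \<open>(0, 1)\<close> under six Moebius
  maps, each of which contributes the same density.\<close>

definition mr_pdf :: "real \<Rightarrow> real" where
  "mr_pdf m = (ln (1 + m) / m - ln m / (1 + m)) / pi\<^sup>2"

lemma mr_pdf_measurable [measurable]: "mr_pdf \<in> borel_measurable borel"
  unfolding mr_pdf_def by measurable

lemma mr_pdf_nonneg: "0 < m \<Longrightarrow> m < 1 \<Longrightarrow> mr_pdf m \<ge> 0"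
  unfolding mr_pdf_def by (intro divide_nonneg_nonneg) (auto simp: divide_nonpos_pos order.trans[of _ 0])

text \<open>The total mass is inherited from the Cauchy laws without computing this integral. It
  supplies the finiteness for the substitutions that follow and the total mass of the density of the
  length.\<close>

lemma nn_integral_cr_pdf: "(\<integral>\<^sup>+k. ennreal (cr_pdf k) \<partial>lborel) = 1"
proof -
  interpret C: prob_space cauchy by (rule prob_space_cauchy)
  show ?thesis using nn_integral_ratio3[of "\<lambda>_. 1"] C.emeasure_space_1 by simp
qed

text \<open>\<open>\<phi>\<close> is an inverse branch of \<open>cr_ratio\<close> with image
  \<open>T\<close>. Hypothesis \<open>d\<close> also yields \<open>cr_pdf >= 0\<close> on
  \<open>T\<close>, as \<open>mr_pdf\<close> is nonnegative and \<open>\<phi>'\<close> does not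
  vanish.\<close>

lemma nn_integral_cr_pdf_piece:
  fixes \<phi> \<phi>' :: "real \<Rightarrow> real"
  assumes T: "\<phi> ` {0<..<1} = T" "T \<in> sets borel" and B: "B \<in> sets borel"
    and der: "\<And>m. 0 < m \<Longrightarrow> m < 1 \<Longrightarrow> (\<phi> has_field_derivative \<phi>' m) (at m)"
    and inj: "inj_on \<phi> {0<..<1}"
    and r: "\<And>m. 0 < m \<Longrightarrow> m < 1 \<Longrightarrow> cr_ratio (\<phi> m) = m"
    and d: "\<And>m. 0 < m \<Longrightarrow> m < 1 \<Longrightarrow> \<bar>\<phi>' m\<bar> * cr_pdf (\<phi> m) = mr_pdf m"
    and d0: "\<And>m. 0 < m \<Longrightarrow> m < 1 \<Longrightarrow> \<phi>' m \<noteq> 0"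
  shows "(\<integral>\<^sup>+k. ennreal (cr_pdf k) * indicator B (cr_ratio k) * indicator T k \<partial>lborel)
    = (\<integral>\<^sup>+m. ennreal (mr_pdf m) * indicator B m * indicator {0<..<1} m \<partial>lborel)"
proof -
  note [measurable] = B T(2)
  define f :: "real \<Rightarrow> real" where "f k = cr_pdf k * indicator B (cr_ratio k)" for k
  have f: "f \<in> borel_measurable borel" unfolding f_def by measurable
  have fnn: "f k \<ge> 0" if "k \<in> T" for k
  proof -
    have "k \<in> \<phi> ` {0<..<1}" using that T(1) by simp
    then obtain m where m: "0 < m" "m < 1" "k = \<phi> m" by auto
    have "\<bar>\<phi>' m\<bar> * cr_pdf k \<ge> 0" using d[OF m(1,2)] mr_pdf_nonneg[OF m(1,2)] m(3) by simp
    then have "cr_pdf k \<ge> 0" using d0[OF m(1,2)] by (simp add: zero_le_mult_iff)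
    then show ?thesis by (simp add: f_def)
  qed
  have e: "(\<integral>\<^sup>+k. ennreal (cr_pdf k) * indicator B (cr_ratio k) * indicator T k \<partial>lborel) = (\<integral>\<^sup>+k. ennreal (f k) * indicator T k \<partial>lborel)"
    by (intro nn_integral_cong) (auto simp: f_def indicator_def)
  have "(\<integral>\<^sup>+k. ennreal (f k) * indicator T k \<partial>lborel) \<le> (\<integral>\<^sup>+k. ennreal (cr_pdf k) \<partial>lborel)"
    by (intro nn_integral_mono) (auto simp: f_def indicator_def)
  then have fin: "(\<integral>\<^sup>+k. ennreal (f k) * indicator T k \<partial>lborel) < \<infinity>"
    unfolding nn_integral_cr_pdf by (simp add: order.strict_trans1)
  have "(\<integral>\<^sup>+m. ennreal (\<bar>\<phi>' m\<bar> * f (\<phi> m)) * indicator {0<..<1} m \<partial>lborel) = (\<integral>\<^sup>+k. ennreal (f k) * indicator T k \<partial>lborel)"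
    by (rule nn_integral_change_of_variables[OF _ T _ inj f fnn fin]) (use der in auto)
  moreover have "(\<integral>\<^sup>+m. ennreal (\<bar>\<phi>' m\<bar> * f (\<phi> m)) * indicator {0<..<1} m \<partial>lborel)
      = (\<integral>\<^sup>+m. ennreal (mr_pdf m) * indicator B m * indicator {0<..<1} m \<partial>lborel)"
  proof (rule nn_integral_cong)
    fix m :: real
    show "ennreal (\<bar>\<phi>' m\<bar> * f (\<phi> m)) * indicator {0<..<1} m = ennreal (mr_pdf m) * indicator B m * indicator {0<..<1} m"
      using d[of m] r[of m] by (auto simp: f_def indicator_def)
  qed
  ultimately show ?thesis using e by simp
qed
lemma mid_ratio_small:
  assumes "0 < m" "m < 1"
  shows "mid_ratio 1 m (1 + m) = m" "mid_ratio m 1 (1 + m) = m" "mid_ratio m (1 + m) 1 = m"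
    "mid_ratio 1 (1 + m) m = m" "mid_ratio (1 + m) m 1 = m" "mid_ratio (1 + m) 1 m = m"
  using assms by (simp_all add: mid_ratio_def min_def max_def)

lemma image_eqI_inverse:
  assumes "\<And>m. m \<in> S \<Longrightarrow> \<phi> m \<in> T" "\<And>k. k \<in> T \<Longrightarrow> \<psi> k \<in> S \<and> \<phi> (\<psi> k) = k"
  shows "\<phi> ` S = T"
  using assms by (metis image_eqI image_subsetI subsetI subset_antisym)

context
  fixes B :: "real set"
  assumes B: "B \<in> sets borel"
begin

lemma cr_piece1:
  "(\<integral>\<^sup>+k. ennreal (cr_pdf k) * indicator B (cr_ratio k) * indicator {0<..<1/2} k \<partial>lborel)
    = (\<integral>\<^sup>+m. ennreal (mr_pdf m) * indicator B m * indicator {0<..<1} m \<partial>lborel)"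
proof (rule nn_integral_cr_pdf_piece[OF _ _ B])
  show "(\<lambda>m. m / (1 + m)) ` {0<..<1} = {0<..<1/2::real}"
    by (rule image_eqI_inverse[where \<psi> = "\<lambda>k. k / (1 - k)"]) (auto simp: field_simps)
  show "inj_on (\<lambda>m::real. m / (1 + m)) {0<..<1}"
    by (rule inj_on_inverseI[where g = "\<lambda>k. k / (1 - k)"]) (auto simp: field_simps)
  fix m :: real assume m: "0 < m" "m < 1"
  show "((\<lambda>m. m / (1 + m)) has_field_derivative 1 / (1 + m)\<^sup>2) (at m)"
    using m by (auto intro!: derivative_eq_intros simp: power2_eq_square)
  have k: "1 - m / (1 + m) = 1 / (1 + m)" using m by (simp add: field_simps)
  have "cr_ratio (m / (1 + m)) = mid_ratio (1 / (1 + m) * 1) (1 / (1 + m) * m) (1 / (1 + m) * (1 + m))"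
    unfolding cr_ratio_def k using m by simp
  then show "cr_ratio (m / (1 + m)) = m" using m by (subst (asm) mid_ratio_scale) (simp_all add: mid_ratio_small)
  show "\<bar>1 / (1 + m)\<^sup>2\<bar> * cr_pdf (m / (1 + m)) = mr_pdf m"
    unfolding cr_pdf_def mr_pdf_def k using m by (simp add: ln_div) (simp add: divide_simps power2_eq_square, simp add: algebra_simps)?
  show "1 / (1 + m)\<^sup>2 \<noteq> 0" using m by simp
qed auto

lemma cr_piece2:
  "(\<integral>\<^sup>+k. ennreal (cr_pdf k) * indicator B (cr_ratio k) * indicator {1/2<..<1} k \<partial>lborel)
    = (\<integral>\<^sup>+m. ennreal (mr_pdf m) * indicator B m * indicator {0<..<1} m \<partial>lborel)"
proof (rule nn_integral_cr_pdf_piece[OF _ _ B])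
  show "(\<lambda>m. 1 / (1 + m)) ` {0<..<1} = {1/2<..<1::real}"
    by (rule image_eqI_inverse[where \<psi> = "\<lambda>k. 1 / k - 1"]) (auto simp: field_simps)
  show "inj_on (\<lambda>m::real. 1 / (1 + m)) {0<..<1}"
    by (rule inj_on_inverseI[where g = "\<lambda>k. 1 / k - 1"]) (auto simp: field_simps)
  fix m :: real assume m: "0 < m" "m < 1"
  show "((\<lambda>m. 1 / (1 + m)) has_field_derivative - 1 / (1 + m)\<^sup>2) (at m)"
    using m by (auto intro!: derivative_eq_intros simp: power2_eq_square)
  have k: "1 - 1 / (1 + m) = m / (1 + m)" using m by (simp add: field_simps)
  have "cr_ratio (1 / (1 + m)) = mid_ratio (1 / (1 + m) * m) (1 / (1 + m) * 1) (1 / (1 + m) * (1 + m))"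
    unfolding cr_ratio_def k using m by simp
  then show "cr_ratio (1 / (1 + m)) = m" using m by (subst (asm) mid_ratio_scale) (simp_all add: mid_ratio_small)
  show "\<bar>- 1 / (1 + m)\<^sup>2\<bar> * cr_pdf (1 / (1 + m)) = mr_pdf m"
    unfolding cr_pdf_def mr_pdf_def k using m by (simp add: ln_div) (simp add: divide_simps power2_eq_square, simp add: algebra_simps)?
  show "- 1 / (1 + m)\<^sup>2 \<noteq> 0" using m by simp
qed auto

lemma cr_piece3:
  "(\<integral>\<^sup>+k. ennreal (cr_pdf k) * indicator B (cr_ratio k) * indicator {1<..<2} k \<partial>lborel)
    = (\<integral>\<^sup>+m. ennreal (mr_pdf m) * indicator B m * indicator {0<..<1} m \<partial>lborel)"
proof (rule nn_integral_cr_pdf_piece[OF _ _ B])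
  show "(\<lambda>m. 1 + m) ` {0<..<1} = {1<..<2::real}"
    by (rule image_eqI_inverse[where \<psi> = "\<lambda>k. k - 1"]) auto
  show "inj_on (\<lambda>m::real. 1 + m) {0<..<1}" by (auto simp: inj_on_def)
  fix m :: real assume m: "0 < m" "m < 1"
  show "((\<lambda>m. 1 + m) has_field_derivative 1) (at m)" by (auto intro!: derivative_eq_intros)
  show "cr_ratio (1 + m) = m" unfolding cr_ratio_def using m by (simp add: mid_ratio_small)
  show "\<bar>1\<bar> * cr_pdf (1 + m) = mr_pdf m"
    unfolding cr_pdf_def mr_pdf_def using m by (simp add: divide_simps)
qed auto

lemma cr_piece4:
  "(\<integral>\<^sup>+k. ennreal (cr_pdf k) * indicator B (cr_ratio k) * indicator {2<..} k \<partial>lborel)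
    = (\<integral>\<^sup>+m. ennreal (mr_pdf m) * indicator B m * indicator {0<..<1} m \<partial>lborel)"
proof (rule nn_integral_cr_pdf_piece[OF _ _ B])
  show "(\<lambda>m. (1 + m) / m) ` {0<..<1} = {(2::real)<..}"
    by (rule image_eqI_inverse[where \<psi> = "\<lambda>k. 1 / (k - 1)"]) (auto simp: field_simps)
  show "inj_on (\<lambda>m::real. (1 + m) / m) {0<..<1}"
    by (rule inj_on_inverseI[where g = "\<lambda>k. 1 / (k - 1)"]) (auto simp: field_simps)
  fix m :: real assume m: "0 < m" "m < 1"
  show "((\<lambda>m. (1 + m) / m) has_field_derivative - 1 / m\<^sup>2) (at m)"
    using m by (auto intro!: derivative_eq_intros simp: power2_eq_square)
  have k: "1 - (1 + m) / m = - (1 / m)" using m by (simp add: field_simps)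
  have "cr_ratio ((1 + m) / m) = mid_ratio (1 / m * 1) (1 / m * (1 + m)) (1 / m * m)"
    unfolding cr_ratio_def k using m by simp
  then show "cr_ratio ((1 + m) / m) = m" using m by (subst (asm) mid_ratio_scale) (simp_all add: mid_ratio_small)
  show "\<bar>- 1 / m\<^sup>2\<bar> * cr_pdf ((1 + m) / m) = mr_pdf m"
    unfolding cr_pdf_def mr_pdf_def k using m by (simp add: ln_div) (simp add: divide_simps power2_eq_square, simp add: algebra_simps)?
  show "- 1 / m\<^sup>2 \<noteq> 0" using m by simp
qed auto

lemma cr_piece5:
  "(\<integral>\<^sup>+k. ennreal (cr_pdf k) * indicator B (cr_ratio k) * indicator {-1<..<0} k \<partial>lborel)
    = (\<integral>\<^sup>+m. ennreal (mr_pdf m) * indicator B m * indicator {0<..<1} m \<partial>lborel)"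
proof (rule nn_integral_cr_pdf_piece[OF _ _ B])
  show "(\<lambda>m. - m) ` {0<..<1} = {-1<..<0::real}"
    by (rule image_eqI_inverse[where \<psi> = "\<lambda>k. - k"]) auto
  show "inj_on (\<lambda>m::real. - m) {0<..<1}" by (auto simp: inj_on_def)
  fix m :: real assume m: "0 < m" "m < 1"
  show "((\<lambda>m. - m) has_field_derivative - 1) (at m)" by (auto intro!: derivative_eq_intros)
  show "cr_ratio (- m) = m" unfolding cr_ratio_def using m by (simp add: mid_ratio_small)
  show "\<bar>- 1\<bar> * cr_pdf (- m) = mr_pdf m"
    unfolding cr_pdf_def mr_pdf_def using m by (simp add: divide_simps)
qed auto

lemma cr_piece6:
  "(\<integral>\<^sup>+k. ennreal (cr_pdf k) * indicator B (cr_ratio k) * indicator {..< -1} k \<partial>lborel)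
    = (\<integral>\<^sup>+m. ennreal (mr_pdf m) * indicator B m * indicator {0<..<1} m \<partial>lborel)"
proof (rule nn_integral_cr_pdf_piece[OF _ _ B])
  show "(\<lambda>m. - 1 / m) ` {0<..<1} = {..< (-1::real)}"
    by (rule image_eqI_inverse[where \<psi> = "\<lambda>k. - 1 / k"]) (auto simp: field_simps)
  show "inj_on (\<lambda>m::real. - 1 / m) {0<..<1}" by (auto simp: inj_on_def)
  fix m :: real assume m: "0 < m" "m < 1"
  show "((\<lambda>m. - 1 / m) has_field_derivative 1 / m\<^sup>2) (at m)"
    using m by (auto intro!: derivative_eq_intros simp: power2_eq_square)
  have k: "1 - - 1 / m = (1 + m) / m" using m by (simp add: field_simps)
  have "cr_ratio (- 1 / m) = mid_ratio (1 / m * (1 + m)) (1 / m * 1) (1 / m * m)"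
    unfolding cr_ratio_def k using m by simp
  then show "cr_ratio (- 1 / m) = m" using m by (subst (asm) mid_ratio_scale) (simp_all add: mid_ratio_small)
  show "\<bar>1 / m\<^sup>2\<bar> * cr_pdf (- 1 / m) = mr_pdf m"
    unfolding cr_pdf_def mr_pdf_def k using m by (simp add: ln_div) (simp add: divide_simps power2_eq_square, simp add: algebra_simps)?
  show "1 / m\<^sup>2 \<noteq> 0" using m by simp
qed auto

lemma nn_integral_mr_pdf:
  "(\<integral>\<^sup>+k. ennreal (cr_pdf k) * indicator B (cr_ratio k) \<partial>lborel)
    = 6 * (\<integral>\<^sup>+m. ennreal (mr_pdf m) * indicator B m * indicator {0<..<1} m \<partial>lborel)"
proof -
  note [measurable] = B
  let ?h = "\<lambda>k. ennreal (cr_pdf k) * indicator B (cr_ratio k)"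
  have "(\<integral>\<^sup>+k. ?h k \<partial>lborel) = (\<integral>\<^sup>+k. ?h k * indicator {0<..<1/2} k + (?h k * indicator {1/2<..<1} k + (?h k * indicator {1<..<2} k
     + (?h k * indicator {2<..} k + (?h k * indicator {-1<..<0} k + ?h k * indicator {..< -1} k)))) \<partial>lborel)"
  proof (rule nn_integral_cong_AE, rule eventually_mono[OF eventually_conj[OF AE_lborel_singleton[of 0]
        eventually_conj[OF AE_lborel_singleton[of "1/2"] eventually_conj[OF AE_lborel_singleton[of 1]
          eventually_conj[OF AE_lborel_singleton[of 2] AE_lborel_singleton[of "-1"]]]]]])
    fix k :: real assume k: "k \<noteq> 0 \<and> k \<noteq> 1/2 \<and> k \<noteq> 1 \<and> k \<noteq> 2 \<and> k \<noteq> - 1"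
    then consider "0 < k" "k < 1/2" | "1/2 < k" "k < 1" | "1 < k" "k < 2" | "2 < k" | "-1 < k" "k < 0" | "k < -1" by linarith
    then show "?h k = ?h k * indicator {0<..<1/2} k + (?h k * indicator {1/2<..<1} k + (?h k * indicator {1<..<2} k
     + (?h k * indicator {2<..} k + (?h k * indicator {-1<..<0} k + ?h k * indicator {..< -1} k))))"
      by cases (simp_all add: indicator_def)
  qed
  also have "\<dots> = 6 * (\<integral>\<^sup>+m. ennreal (mr_pdf m) * indicator B m * indicator {0<..<1} m \<partial>lborel)" (is "_ = 6 * ?I")
  proof -
    have "x + (x + (x + (x + (x + x)))) = 6 * x" for x :: ennreal
    proof -
      have "x + (x + (x + (x + (x + x)))) = (1 + (1 + (1 + (1 + (1 + 1))))) * x" by (simp only: distrib_right mult_1)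
      then show ?thesis by simp
    qed
    then show ?thesis
      by (subst nn_integral_add, simp, simp)+ (simp only: cr_piece1 cr_piece2 cr_piece3 cr_piece4 cr_piece5 cr_piece6)
  qed
  finally show ?thesis .
qed

end

section \<open>The distribution of the length\<close>

definition length_pdf :: "real \<Rightarrow> real" where
  "length_pdf l = 6 / pi\<^sup>2 * csch l * (4 * ln (cosh (l / 2)) + 2 * (cosh l - 1) * ln (coth (l / 2)))"

text \<open>The substitution \<open>m = sinh (l / 2)^2\<close>, inverse to
  \<open>l = 2 * arsinh (sqrt m)\<close>, has the derivative
  \<open>sinh (l / 2) * cosh (l / 2)\<close>; the factor 6 counts the orderings.\<close>

lemma length_pdf_eq:
  assumes "l > 0"
  shows "length_pdf l = \<bar>sinh (l / 2) * cosh (l / 2)\<bar> * (6 * mr_pdf ((sinh (l / 2))\<^sup>2))"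
proof -
  define S C where "S = sinh (l / 2)" and "C = cosh (l / 2)"
  have S: "S > 0" "C > 0" using assms by (simp_all add: S_def C_def)
  have CS: "C\<^sup>2 = 1 + S\<^sup>2" unfolding S_def C_def by (simp add: cosh_square_eq)
  have l: "l = 2 * (l / 2)" by simp
  have sh: "sinh l = 2 * S * C" unfolding S_def C_def by (subst l, subst sinh_double) simp
  have ch: "cosh l - 1 = 2 * S\<^sup>2" unfolding S_def by (subst l, subst cosh_double) (simp add: cosh_square_eq)
  have logs: "ln (coth (l / 2)) = ln C - ln S" "ln (S\<^sup>2) = 2 * ln S" "ln (1 + S\<^sup>2) = 2 * ln C"
    using S by (simp_all add: coth_def S_def[symmetric] C_def[symmetric] ln_div ln_realpow CS[symmetric])
  have "length_pdf l = 6 / pi\<^sup>2 * (1 / (2 * S * C)) * (4 * ln C + 2 * (2 * S\<^sup>2) * (ln C - ln S))"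
    unfolding length_pdf_def csch_def sh ch logs C_def[symmetric] ..
  also have "\<dots> = 6 / pi\<^sup>2 * (1 / (2 * S * C)) * (4 * (C\<^sup>2 * ln C - S\<^sup>2 * ln S))"
    unfolding CS by (simp add: algebra_simps)
  also have "\<dots> = S * C * (6 * ((2 * ln C / S\<^sup>2 - 2 * ln S / C\<^sup>2) / pi\<^sup>2))"
    using S by (simp add: divide_simps) (simp add: power2_eq_square algebra_simps)
  also have "\<dots> = \<bar>S * C\<bar> * (6 * mr_pdf (S\<^sup>2))"
    unfolding mr_pdf_def logs using S by (simp add: CS)
  finally show ?thesis by (simp only: S_def C_def)
qed

lemma log_bound_eq: "ln ((sqrt 2 + 1) / (sqrt 2 - 1)) = 2 * arsinh 1" "ln (3 + 2 * sqrt 2) = 2 * arsinh (1::real)"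
proof -
  have "2 * arsinh 1 = ln ((1 + sqrt 2)\<^sup>2)" by (simp add: arsinh_real_def ln_realpow)
  also have "(1 + sqrt 2)\<^sup>2 = 3 + 2 * sqrt 2" by (simp add: power2_eq_square algebra_simps)
  finally show 1: "ln (3 + 2 * sqrt 2) = 2 * arsinh (1::real)" by simp
  have "sqrt 2 > 1" by simp
  then have "(sqrt 2 + 1) / (sqrt 2 - 1) = 3 + 2 * sqrt 2" by (simp add: divide_simps) (simp add: algebra_simps)
  then show "ln ((sqrt 2 + 1) / (sqrt 2 - 1)) = 2 * arsinh 1" using 1 by simp
qed

lemma nn_integral_length_pdf:
  assumes B [measurable]: "B \<in> sets borel"
  shows "6 * (\<integral>\<^sup>+m. ennreal (mr_pdf m) * indicator B (2 * arsinh (sqrt m)) * indicator {0<..<1} m \<partial>lborel)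
    = (\<integral>\<^sup>+l. ennreal (if 0 < l \<and> l \<le> 2 * arsinh 1 then length_pdf l else 0) * indicator B l \<partial>lborel)"
proof -
  have am [measurable]: "arsinh \<in> borel_measurable (borel :: real measure)"
    by (intro borel_measurable_continuous_onI continuous_on_arsinh)
  define f :: "real \<Rightarrow> real" where "f m = 6 * mr_pdf m * indicator B (2 * arsinh (sqrt m))" for m
  have f: "f \<in> borel_measurable borel" unfolding f_def by measurable
  have fnn: "f m \<ge> 0" if "m \<in> {0<..<1}" for m using that mr_pdf_nonneg by (simp add: f_def)
  have six: "6 * (\<integral>\<^sup>+m. ennreal (mr_pdf m) * g m \<partial>lborel) = (\<integral>\<^sup>+m. 6 * (ennreal (mr_pdf m) * g m) \<partial>lborel)"
    if [measurable]: "g \<in> borel_measurable borel" for g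
    by (rule nn_integral_cmult[symmetric]) measurable
  have ef: "6 * (\<integral>\<^sup>+m. ennreal (mr_pdf m) * indicator B (2 * arsinh (sqrt m)) * indicator {0<..<1} m \<partial>lborel)
     = (\<integral>\<^sup>+m. ennreal (f m) * indicator {0<..<1} m \<partial>lborel)"
    unfolding mult.assoc by (subst six) (auto intro!: nn_integral_cong simp: f_def indicator_def ennreal_mult' mr_pdf_nonneg)
  have "6 * (\<integral>\<^sup>+m. ennreal (mr_pdf m) * indicator UNIV m * indicator {0<..<1} m \<partial>lborel) = 1"
    by (subst nn_integral_mr_pdf[symmetric]) (simp_all add: nn_integral_cr_pdf)
  moreover have "(\<integral>\<^sup>+m. ennreal (mr_pdf m) * indicator B (2 * arsinh (sqrt m)) * indicator {0<..<1} m \<partial>lborel)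
     \<le> (\<integral>\<^sup>+m. ennreal (mr_pdf m) * indicator UNIV m * indicator {0<..<1} m \<partial>lborel)"
    by (intro nn_integral_mono) (auto simp: indicator_def)
  then have "6 * (\<integral>\<^sup>+m. ennreal (mr_pdf m) * indicator B (2 * arsinh (sqrt m)) * indicator {0<..<1} m \<partial>lborel)
     \<le> 6 * (\<integral>\<^sup>+m. ennreal (mr_pdf m) * indicator UNIV m * indicator {0<..<1} m \<partial>lborel)"
    by (rule mult_left_mono) simp
  ultimately have "6 * (\<integral>\<^sup>+m. ennreal (mr_pdf m) * indicator B (2 * arsinh (sqrt m)) * indicator {0<..<1} m \<partial>lborel) \<le> 1"
    by simp
  then have fin: "(\<integral>\<^sup>+m. ennreal (f m) * indicator {0<..<1} m \<partial>lborel) < \<infinity>"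
    unfolding ef by (simp add: order.strict_trans1)
  define b where "b = 2 * arsinh (1::real)"
  have half: "arsinh (sinh (l / 2)) = l / 2" for l :: real by (rule arsinh_sinh_real)
  have img: "(\<lambda>l. (sinh (l / 2))\<^sup>2) ` {0<..<b} = {0<..<1}"
  proof (rule image_eqI_inverse[where \<psi> = "\<lambda>m. 2 * arsinh (sqrt m)"])
    fix l assume "l \<in> {0<..<b}"
    then have l: "0 < l" "arsinh (sinh (l / 2)) < arsinh 1" unfolding half b_def by auto
    then have "sinh (l / 2) > 0" "sinh (l / 2) < 1" by (simp_all only: arsinh_less_iff_real sinh_real_pos_iff half_gt_zero)
    then show "(sinh (l / 2))\<^sup>2 \<in> {0<..<1}" by (simp add: power_less_one_iff)
  next
    fix m :: real assume "m \<in> {0<..<1}"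
    then show "2 * arsinh (sqrt m) \<in> {0<..<b} \<and> (sinh (2 * arsinh (sqrt m) / 2))\<^sup>2 = m"
      by (simp add: b_def)
  qed
  have "(\<integral>\<^sup>+l. ennreal (\<bar>sinh (l / 2) * cosh (l / 2)\<bar> * f ((sinh (l / 2))\<^sup>2)) * indicator {0<..<b} l \<partial>lborel)
     = (\<integral>\<^sup>+m. ennreal (f m) * indicator {0<..<1} m \<partial>lborel)"
  proof (rule nn_integral_change_of_variables[OF _ img _ _ _ f fnn fin])
    show "((\<lambda>l. (sinh (l / 2))\<^sup>2) has_real_derivative sinh (l / 2) * cosh (l / 2)) (at l)" for l :: real
      by (auto intro!: derivative_eq_intros)
    show "inj_on (\<lambda>l. (sinh (l / 2))\<^sup>2) {0<..<b}"
    proof (rule inj_on_inverseI[where g = "\<lambda>m. 2 * arsinh (sqrt m)"])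
      fix l assume "l \<in> {0<..<b}"
      then have "sinh (l / 2) \<ge> 0" by simp
      then show "2 * arsinh (sqrt ((sinh (l / 2))\<^sup>2)) = l" by (simp add: half)
    qed
  qed auto
  moreover have "(\<integral>\<^sup>+l. ennreal (\<bar>sinh (l / 2) * cosh (l / 2)\<bar> * f ((sinh (l / 2))\<^sup>2)) * indicator {0<..<b} l \<partial>lborel)
     = (\<integral>\<^sup>+l. ennreal (if 0 < l \<and> l \<le> 2 * arsinh 1 then length_pdf l else 0) * indicator B l \<partial>lborel)"
  proof (intro nn_integral_cong_AE eventually_mono[OF AE_lborel_singleton[of b]])
    fix l assume lb: "l \<noteq> b"
    show "ennreal (\<bar>sinh (l / 2) * cosh (l / 2)\<bar> * f ((sinh (l / 2))\<^sup>2)) * indicator {0<..<b} l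
      = ennreal (if 0 < l \<and> l \<le> 2 * arsinh 1 then length_pdf l else 0) * indicator B l"
    proof (cases "0 < l \<and> l < b")
      case True
      then have "sinh (l / 2) \<ge> 0" by simp
      then have "2 * arsinh (sqrt ((sinh (l / 2))\<^sup>2)) = l" by (simp add: half)
      then have "\<bar>sinh (l / 2) * cosh (l / 2)\<bar> * f ((sinh (l / 2))\<^sup>2) = length_pdf l * indicator B l"
        using True by (simp add: f_def length_pdf_eq mult.assoc)
      then show ?thesis using True by (auto simp: b_def indicator_def)
    next
      case False
      then have "\<not> (0 < l \<and> l \<le> 2 * arsinh 1)" using lb by (auto simp: b_def)
      then show ?thesis using False by (auto simp: indicator_def)
    qed
  qed
  ultimately show ?thesis unfolding ef by simp
qed

section \<open>The law of the length of the shortest geodesic\<close>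

definition circle_length :: "complex \<Rightarrow> complex \<Rightarrow> complex \<Rightarrow> complex \<Rightarrow> real" where
  "circle_length a b c d = 2 * arsinh (sqrt (mid_ratio (norm (a - b) * norm (c - d))
     (norm (a - c) * norm (b - d)) (norm (a - d) * norm (b - c))))"

lemma shortest_geodesic_length_eq_circle_length:
  assumes "norm a = 1" "norm b = 1" "norm c = 1" "norm d = 1"
  shows "shortest_geodesic_length {a, b, c, d} = circle_length a b c d"
proof (cases "distinct [a, b, c, d]")
  case True
  then show ?thesis unfolding circle_length_def by (intro shortest_geodesic_length_circle assms)
next
  case False
  have "card {a, b, c, d} \<noteq> 4"
  proof
    assume "card {a, b, c, d} = 4"
    then have "distinct [a, b, c, d]" by (intro card_distinct) simp
    then show False using False by simp
  qed
  then have "shortest_geodesic_length {a, b, c, d} = 0"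
    by (simp add: shortest_geodesic_length_def ideal_vertices_def)
  \<comment> \<open>Two equal points make one of the three products 0, hence the numerator 0,
    whatever the denominator is.\<close>
  moreover have "mid_ratio (norm (a - b) * norm (c - d)) (norm (a - c) * norm (b - d)) (norm (a - d) * norm (b - c)) = 0"
    using False by (auto simp: mid_ratio_def min_def mult_le_0_iff)
  ultimately show ?thesis by (simp add: circle_length_def)
qed

lemma circle_length_measurable [measurable]:
  assumes [measurable]: "f1 \<in> borel_measurable M" "f2 \<in> borel_measurable M" "f3 \<in> borel_measurable M" "f4 \<in> borel_measurable M"
  shows "(\<lambda>x. circle_length (f1 x) (f2 x) (f3 x) (f4 x)) \<in> borel_measurable M"
proof -
  have [measurable]: "(arsinh :: real \<Rightarrow> real) \<in> borel_measurable borel"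
    by (intro borel_measurable_continuous_onI continuous_intros)
  show ?thesis unfolding circle_length_def by measurable
qed

text \<open>Independence makes the joint law a product measure, from which the coordinates are split
  off one at a time, the last one becoming the outermost integral.\<close>

lemma (in prob_space) nn_integral_indep_vars_4:
  fixes P :: "nat \<Rightarrow> 'a \<Rightarrow> complex" and g :: "complex \<Rightarrow> complex \<Rightarrow> complex \<Rightarrow> complex \<Rightarrow> ennreal"
  assumes indep: "indep_vars (\<lambda>_. borel) P {..<4}"
    and P: "\<And>i. i < 4 \<Longrightarrow> distr M borel (P i) = N"
    and g: "(\<lambda>(a, b, c, d). g a b c d) \<in> borel_measurable (borel \<Otimes>\<^sub>M borel \<Otimes>\<^sub>M borel \<Otimes>\<^sub>M borel)"
  shows "(\<integral>\<^sup>+\<omega>. g (P 0 \<omega>) (P 1 \<omega>) (P 2 \<omega>) (P 3 \<omega>) \<partial>M) = (\<integral>\<^sup>+d. \<integral>\<^sup>+c. \<integral>\<^sup>+b. \<integral>\<^sup>+a. g a b c d \<partial>N \<partial>N \<partial>N \<partial>N)"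
proof -
  have Pm[measurable]: "random_variable borel (P i)" if "i < 4" for i
    using indep that by (auto simp: indep_vars_def)
  have N: "prob_space N" using P[of 0] prob_space_distr[OF Pm[of 0]] by simp
  have sN[measurable_cong]: "sets N = sets borel" using P[of 0] by (metis sets_distr zero_less_numeral)
  interpret N: prob_space N by (rule N)
  interpret product_sigma_finite "\<lambda>_::nat. N" by unfold_locales
  define f where "f = (\<lambda>x. (\<lambda>(a, b, c, d). g a b c d) (x 0, x 1, x 2, x (3::nat)))"
  have [measurable]: "(\<lambda>(a, b, c, d). g a b c d) \<in> borel_measurable (N \<Otimes>\<^sub>M N \<Otimes>\<^sub>M N \<Otimes>\<^sub>M N)"
    using g by (simp add: sN cong: measurable_cong_sets sets_pair_measure_cong)
  have gm: "f \<in> borel_measurable (PiM {..<4} (\<lambda>_. N))"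
    unfolding f_def by (rule measurable_compose[OF _ \<open>(\<lambda>(a, b, c, d). g a b c d) \<in> borel_measurable (N \<Otimes>\<^sub>M N \<Otimes>\<^sub>M N \<Otimes>\<^sub>M N)\<close>])
      (intro measurable_Pair measurable_component_singleton; simp)
  have seteq: "{..<4} = insert 3 (insert 2 (insert 1 {0::nat}))" by auto
  have sPi: "sets (PiM {..<4::nat} (\<lambda>_. borel :: complex measure)) = sets (PiM {..<4} (\<lambda>_. N))"
    by (intro sets_PiM_cong) (auto simp: sN)
  have d: "distr M (PiM {..<4} (\<lambda>_. borel)) (\<lambda>\<omega>. \<lambda>i\<in>{..<4}. P i \<omega>) = PiM {..<4} (\<lambda>_. N)"
  proof -
    have "{..<4::nat} \<noteq> {}" by (simp add: lessThan_empty_iff)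
    then have "distr M (PiM {..<4} (\<lambda>_. borel)) (\<lambda>\<omega>. \<lambda>i\<in>{..<4}. P i \<omega>) = PiM {..<4} (\<lambda>i. distr M borel (P i))"
      by (rule indep_vars_iff_distr_eq_PiM'[THEN iffD1, OF _ _ indep]) (simp add: Pm)
    also have "\<dots> = PiM {..<4} (\<lambda>_. N)" by (intro PiM_cong) (auto simp: P)
    finally show ?thesis .
  qed
  have "(\<integral>\<^sup>+\<omega>. g (P 0 \<omega>) (P 1 \<omega>) (P 2 \<omega>) (P 3 \<omega>) \<partial>M) = (\<integral>\<^sup>+\<omega>. f (\<lambda>i\<in>{..<4}. P i \<omega>) \<partial>M)"
    by (simp add: f_def)
  also have "\<dots> = (\<integral>\<^sup>+x. f x \<partial>distr M (PiM {..<4} (\<lambda>_. borel)) (\<lambda>\<omega>. \<lambda>i\<in>{..<4}. P i \<omega>))"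
  proof (rule nn_integral_distr[symmetric])
    show "(\<lambda>\<omega>. \<lambda>i\<in>{..<4}. P i \<omega>) \<in> measurable M (PiM {..<4} (\<lambda>_. borel))"
      by (intro measurable_restrict) (auto intro: Pm)
    show "f \<in> borel_measurable (distr M (PiM {..<4} (\<lambda>_. borel)) (\<lambda>\<omega>. \<lambda>i\<in>{..<4}. P i \<omega>))"
      using gm unfolding d .
  qed
  also have "\<dots> = (\<integral>\<^sup>+x. f x \<partial>PiM {..<4} (\<lambda>_. N))" unfolding d ..
  also have "\<dots> = (\<integral>\<^sup>+d. \<integral>\<^sup>+x. f (x(3 := d)) \<partial>PiM (insert 2 (insert 1 {0})) (\<lambda>_. N) \<partial>N)"
    using gm unfolding seteq by (subst product_nn_integral_insert_rev) auto
  also have "\<dots> = (\<integral>\<^sup>+d. \<integral>\<^sup>+c. \<integral>\<^sup>+x. f (x(2 := c, 3 := d)) \<partial>PiM (insert 1 {0}) (\<lambda>_. N) \<partial>N \<partial>N)"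
  proof (rule nn_integral_cong)
    fix d :: complex
    assume "d \<in> space N"
    then have m: "(\<lambda>x. f (x(3 := d))) \<in> borel_measurable (PiM (insert 2 (insert 1 {0})) (\<lambda>_. N))"
      by (intro measurable_compose[OF _ gm[unfolded seteq]] measurable_fun_upd[where J = "insert 2 (insert 1 {0})"]) auto
    show "(\<integral>\<^sup>+x. f (x(3 := d)) \<partial>PiM (insert 2 (insert 1 {0})) (\<lambda>_. N)) =
      (\<integral>\<^sup>+c. \<integral>\<^sup>+x. f (x(2 := c, 3 := d)) \<partial>PiM (insert 1 {0}) (\<lambda>_. N) \<partial>N)"
      using product_nn_integral_insert_rev[OF _ _ m] by simp
  qed
  also have "\<dots> = (\<integral>\<^sup>+d. \<integral>\<^sup>+c. \<integral>\<^sup>+b. \<integral>\<^sup>+x. f (x(1 := b, 2 := c, 3 := d)) \<partial>PiM {0} (\<lambda>_. N) \<partial>N \<partial>N \<partial>N)"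
  proof (rule nn_integral_cong, rule nn_integral_cong)
    fix d c :: complex
    assume "d \<in> space N" "c \<in> space N"
    then have m: "(\<lambda>x. f (x(2 := c, 3 := d))) \<in> borel_measurable (PiM (insert 1 {0}) (\<lambda>_. N))"
      by (intro measurable_compose[OF _ gm[unfolded seteq]] measurable_fun_upd[where J = "insert 2 (insert 1 {0})"]
        measurable_fun_upd[where J = "insert 1 {0}"]) auto
    show "(\<integral>\<^sup>+x. f (x(2 := c, 3 := d)) \<partial>PiM (insert 1 {0}) (\<lambda>_. N)) =
      (\<integral>\<^sup>+b. \<integral>\<^sup>+x. f (x(1 := b, 2 := c, 3 := d)) \<partial>PiM {0} (\<lambda>_. N) \<partial>N)"
      using product_nn_integral_insert_rev[OF _ _ m] by simp
  qed
  also have "\<dots> = (\<integral>\<^sup>+d. \<integral>\<^sup>+c. \<integral>\<^sup>+b. \<integral>\<^sup>+a. g a b c d \<partial>N \<partial>N \<partial>N \<partial>N)"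
  proof (rule nn_integral_cong, rule nn_integral_cong, rule nn_integral_cong)
    fix d c b :: complex
    assume "d \<in> space N" "c \<in> space N" "b \<in> space N"
    then have "(\<lambda>a. (\<lambda>(a, b, c, d). g a b c d) (a, b, c, d)) \<in> borel_measurable N"
      by (intro measurable_compose[OF _ \<open>(\<lambda>(a, b, c, d). g a b c d) \<in> borel_measurable (N \<Otimes>\<^sub>M N \<Otimes>\<^sub>M N \<Otimes>\<^sub>M N)\<close>] measurable_Pair) auto
    then show "(\<integral>\<^sup>+x. f (x(1 := b, 2 := c, 3 := d)) \<partial>PiM {0} (\<lambda>_. N)) = (\<integral>\<^sup>+a. g a b c d \<partial>N)"
      using product_nn_integral_singleton[of "\<lambda>a. g a b c d" 0] by (simp add: f_def)
  qed
  finally show ?thesis .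
qed

text \<open>Independence leaves the fourth point outermost, while \<open>nn_integral_ratio4\<close>
  has its first argument there; the reversal reconciles the two.\<close>

lemma ratio4_rev: "ratio4 d c b a = ratio4 a b c d"
  by (simp add: ratio4_def mid_ratio_commute(2) abs_minus_commute mult.commute mult.left_commute)

lemma nn_integral_uniform_circle:
  assumes "f \<in> borel_measurable borel"
  shows "(\<integral>\<^sup>+x. f x \<partial>uniform_circle) = (\<integral>\<^sup>+x. f (cay x) \<partial>cauchy)"
  unfolding uniform_circle_eq_cauchy using assms cay_measurable by (subst nn_integral_distr) auto

lemma nn_integral_circle_length:
  assumes B: "B \<in> sets borel"
  shows "(\<integral>\<^sup>+d. \<integral>\<^sup>+c. \<integral>\<^sup>+b. \<integral>\<^sup>+a. indicator B (circle_length a b c d) \<partial>uniform_circle \<partial>uniform_circle \<partial>uniform_circle \<partial>uniform_circle)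
    = (\<integral>\<^sup>+l. ennreal (if 0 < l \<and> l \<le> 2 * arsinh 1 then length_pdf l else 0) * indicator B l \<partial>lborel)"
proof -
  interpret C: prob_space cauchy by (rule prob_space_cauchy)
  have sets_uc [measurable_cong]: "sets uniform_circle = sets borel" by (simp add: uniform_circle_def)
  interpret U: prob_space uniform_circle
    unfolding uniform_circle_eq_cauchy by (rule C.prob_space_distr) simp
  note [measurable] = B
  define B' where "B' = (\<lambda>m. 2 * arsinh (sqrt m)) -` B"
  have "(\<lambda>m. 2 * arsinh (sqrt m)) \<in> borel_measurable (borel :: real measure)"
    by (intro borel_measurable_continuous_onI continuous_intros)
  then have B'[measurable]: "B' \<in> sets borel" using B unfolding B'_def by (simp add: measurable_sets_borel)
  have m1: "(\<lambda>a. indicator B (circle_length a b c d) :: ennreal) \<in> borel_measurable borel" for b c d by measurable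
  have m2: "(\<lambda>b. \<integral>\<^sup>+a. indicator B (circle_length a b c d) \<partial>uniform_circle) \<in> borel_measurable borel" for c d by measurable
  have m3: "(\<lambda>c. \<integral>\<^sup>+b. \<integral>\<^sup>+a. indicator B (circle_length a b c d) \<partial>uniform_circle \<partial>uniform_circle) \<in> borel_measurable borel" for d by measurable
  have m4: "(\<lambda>d. \<integral>\<^sup>+c. \<integral>\<^sup>+b. \<integral>\<^sup>+a. indicator B (circle_length a b c d) \<partial>uniform_circle \<partial>uniform_circle \<partial>uniform_circle) \<in> borel_measurable borel" by measurable
  have len: "(indicator B (circle_length (cay a) (cay b) (cay c) (cay d)) :: ennreal) = indicator B' (ratio4 d c b a)" for a b c d
    by (simp add: circle_length_def mid_ratio_cay B'_def indicator_def ratio4_rev)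
  have "(\<integral>\<^sup>+d. \<integral>\<^sup>+c. \<integral>\<^sup>+b. \<integral>\<^sup>+a. indicator B (circle_length a b c d) \<partial>uniform_circle \<partial>uniform_circle \<partial>uniform_circle \<partial>uniform_circle)
    = (\<integral>\<^sup>+d. \<integral>\<^sup>+c. \<integral>\<^sup>+b. \<integral>\<^sup>+a. indicator B' (ratio4 d c b a) \<partial>cauchy \<partial>cauchy \<partial>cauchy \<partial>cauchy)"
    unfolding nn_integral_uniform_circle[OF m4] unfolding nn_integral_uniform_circle[OF m3]
    unfolding nn_integral_uniform_circle[OF m2] unfolding nn_integral_uniform_circle[OF m1] len ..
  also have "\<dots> = (\<integral>\<^sup>+b. \<integral>\<^sup>+c. \<integral>\<^sup>+d. indicator B' (ratio3 b c d) \<partial>cauchy \<partial>cauchy \<partial>cauchy)"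
    by (rule nn_integral_ratio4) simp
  also have "\<dots> = (\<integral>\<^sup>+k. ennreal (cr_pdf k) * indicator B' (cr_ratio k) \<partial>lborel)"
    by (rule nn_integral_ratio3) simp
  also have "\<dots> = 6 * (\<integral>\<^sup>+m. ennreal (mr_pdf m) * indicator B' m * indicator {0<..<1} m \<partial>lborel)"
    by (rule nn_integral_mr_pdf) simp
  also have "\<dots> = 6 * (\<integral>\<^sup>+m. ennreal (mr_pdf m) * indicator B (2 * arsinh (sqrt m)) * indicator {0<..<1} m \<partial>lborel)"
    by (simp add: B'_def indicator_def)
  also have "\<dots> = (\<integral>\<^sup>+l. ennreal (if 0 < l \<and> l \<le> 2 * arsinh 1 then length_pdf l else 0) * indicator B l \<partial>lborel)"
    by (rule nn_integral_length_pdf[OF B])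
  finally show ?thesis .
qed
definition length_density :: "real \<Rightarrow> real" where
  "length_density l = (if 0 < l \<and> l \<le> 2 * arsinh 1 then length_pdf l else 0)"

lemma length_pdf_measurable [measurable]: "length_pdf \<in> borel_measurable borel"
proof -
  have [measurable]: "(sinh :: real \<Rightarrow> real) \<in> borel_measurable borel" "(cosh :: real \<Rightarrow> real) \<in> borel_measurable borel"
    by (intro borel_measurable_continuous_onI continuous_intros)+
  show ?thesis unfolding length_pdf_def[abs_def] csch_def coth_def by measurable
qed

lemma length_density_measurable [measurable]: "length_density \<in> borel_measurable borel"
  unfolding length_density_def[abs_def] by measurable

lemma length_pdf_pos: "0 < l \<Longrightarrow> 0 < length_pdf l"
proof -
  assume l: "0 < l"
  have "sinh l > 0" "cosh l > 1" "cosh (l / 2) > 1" "sinh (l / 2) > 0"     using l cosh_real_strict_mono[of 0 l] cosh_real_strict_mono[of 0 "l / 2"] by simp_all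
  moreover have "cosh (l / 2) > sinh (l / 2)" by (rule sinh_less_cosh_real)
  ultimately have "ln (cosh (l / 2)) > 0" "ln (coth (l / 2)) > 0" "csch l > 0" "cosh l - 1 > 0"
    by (simp_all add: coth_def csch_def ln_gt_zero)
  then show ?thesis unfolding length_pdf_def by (intro mult_pos_pos add_pos_pos) simp_all
qed

text \<open>At \<open>l = 0\<close> the value is 0, because
  \<open>csch 0 = 1 / 0 = 0\<close>.\<close>

lemma length_pdf_nonneg: "0 \<le> l \<Longrightarrow> 0 \<le> length_pdf l"
  using length_pdf_pos[of l] by (cases "l = 0") (simp_all add: length_pdf_def csch_def)

lemma length_density_nonneg: "0 \<le> length_density l"
  unfolding length_density_def using length_pdf_pos[of l] by auto

lemma AE_uniform_circle: "AE z in uniform_circle. norm z = 1"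
proof -
  have [measurable]: "cis \<in> borel_measurable borel"
    by (intro borel_measurable_continuous_onI continuous_intros)
  have "cis \<in> borel_measurable (uniform_measure lborel {0..2 * pi})" by measurable
  then show ?thesis unfolding uniform_circle_def by (subst AE_distr_iff) auto
qed

lemma (in prob_space) distributed_shortest_geodesic_length:
  fixes P :: "nat \<Rightarrow> 'a \<Rightarrow> complex"
  assumes indep: "indep_vars (\<lambda>_. borel) P {..<4}"
    and P: "\<And>i. i < 4 \<Longrightarrow> distr M borel (P i) = uniform_circle"
  shows "distributed M lborel (\<lambda>\<omega>. shortest_geodesic_length ((\<lambda>i. P i \<omega>) ` {..<4})) (\<lambda>l. ennreal (length_density l))"
proof -
  define L where "L = (\<lambda>\<omega>. shortest_geodesic_length ((\<lambda>i. P i \<omega>) ` {..<4}))"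
  have Pm: "random_variable borel (P i)" if "i < 4" for i
    using indep that by (auto simp: indep_vars_def)
  have [measurable]: "P 0 \<in> borel_measurable M" "P 1 \<in> borel_measurable M" "P 2 \<in> borel_measurable M" "P 3 \<in> borel_measurable M"
    by (simp_all add: Pm)
  have "{..<4::nat} = {0, 1, 2, 3}" by auto
  then have im: "(\<lambda>i. P i \<omega>) ` {..<4} = {P 0 \<omega>, P 1 \<omega>, P 2 \<omega>, P 3 \<omega>}" for \<omega> by simp
  \<comment> \<open>An expression for \<open>L\<close> at every \<omega>, not only almost
    everywhere: off the circle the convention for degenerate vertices gives 0. Measurability of
    \<open>L\<close> rests on this form, as the definition by \<open>LEAST\<close> does not show
    it.\<close>
  have L: "L \<omega> = (if norm (P 0 \<omega>) = 1 \<and> norm (P 1 \<omega>) = 1 \<and> norm (P 2 \<omega>) = 1 \<and> norm (P 3 \<omega>) = 1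
      then circle_length (P 0 \<omega>) (P 1 \<omega>) (P 2 \<omega>) (P 3 \<omega>) else 0)" for \<omega>
  proof (cases "norm (P 0 \<omega>) = 1 \<and> norm (P 1 \<omega>) = 1 \<and> norm (P 2 \<omega>) = 1 \<and> norm (P 3 \<omega>) = 1")
    case True
    then show ?thesis unfolding L_def im using shortest_geodesic_length_eq_circle_length by simp
  next
    case False
    then have "\<not> ideal_vertices {P 0 \<omega>, P 1 \<omega>, P 2 \<omega>, P 3 \<omega>}" by (auto simp: ideal_vertices_def)
    then show ?thesis using False unfolding L_def im by (auto simp: shortest_geodesic_length_def)
  qed
  have Lm[measurable]: "L \<in> borel_measurable M" unfolding L[abs_def] by measurable
  have AE1: "AE \<omega> in M. norm (P i \<omega>) = 1" if "i < 4" for i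
    using AE_uniform_circle unfolding P[OF that, symmetric] by (subst (asm) AE_distr_iff) (use Pm[OF that] in auto)
  have "AE \<omega> in M. L \<omega> = circle_length (P 0 \<omega>) (P 1 \<omega>) (P 2 \<omega>) (P 3 \<omega>)"
    using AE1[of 0, simplified] AE1[of 1, simplified] AE1[of 2, simplified] AE1[of 3, simplified]
    by eventually_elim (simp add: L)
  then have AE: "AE \<omega> in M. indicator B (L \<omega>) = (indicator B (circle_length (P 0 \<omega>) (P 1 \<omega>) (P 2 \<omega>) (P 3 \<omega>)) :: ennreal)" for B
    by eventually_elim simp
  have "distr M lborel L = density lborel (\<lambda>l. ennreal (length_density l))"
  proof (rule measure_eqI)
    fix B assume "B \<in> sets (distr M lborel L)"
    then have B[measurable]: "B \<in> sets borel" by simp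
    have "emeasure (distr M lborel L) B = (\<integral>\<^sup>+\<omega>. indicator (L -` B \<inter> space M) \<omega> \<partial>M)"
      by (subst emeasure_distr) simp_all
    also have "\<dots> = (\<integral>\<^sup>+\<omega>. indicator B (L \<omega>) \<partial>M)"
      by (intro nn_integral_cong) (auto simp: indicator_def)
    also have "\<dots> = (\<integral>\<^sup>+\<omega>. indicator B (circle_length (P 0 \<omega>) (P 1 \<omega>) (P 2 \<omega>) (P 3 \<omega>)) \<partial>M)"
      by (rule nn_integral_cong_AE[OF AE])
    also have "\<dots> = (\<integral>\<^sup>+d. \<integral>\<^sup>+c. \<integral>\<^sup>+b. \<integral>\<^sup>+a. indicator B (circle_length a b c d)
        \<partial>uniform_circle \<partial>uniform_circle \<partial>uniform_circle \<partial>uniform_circle)"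
      by (rule nn_integral_indep_vars_4[OF indep P]) (unfold split_beta, measurable)
    also have "\<dots> = (\<integral>\<^sup>+l. ennreal (length_density l) * indicator B l \<partial>lborel)"
      unfolding nn_integral_circle_length[OF B] length_density_def ..
    also have "\<dots> = emeasure (density lborel (\<lambda>l. ennreal (length_density l))) B"
      by (rule emeasure_density[symmetric]) simp_all
    finally show "emeasure (distr M lborel L) B = emeasure (density lborel (\<lambda>l. ennreal (length_density l))) B" .
  qed simp
  then show ?thesis unfolding distributed_def L_def[symmetric] by simp
qed

section \<open>Expectation, distribution function and median\<close>

lemma nn_integral_length_density: "(\<integral>\<^sup>+l. ennreal (length_density l) \<partial>lborel) = 1"
proof -
  have "(\<integral>\<^sup>+l. ennreal (length_density l) * indicator UNIV l \<partial>lborel)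
    = 6 * (\<integral>\<^sup>+m. ennreal (mr_pdf m) * indicator UNIV (2 * arsinh (sqrt m)) * indicator {0<..<1} m \<partial>lborel)"
    unfolding length_density_def by (rule nn_integral_length_pdf[symmetric]) simp
  also have "\<dots> = (\<integral>\<^sup>+k. ennreal (cr_pdf k) * indicator UNIV (cr_ratio k) \<partial>lborel)"
    by (subst nn_integral_mr_pdf) simp_all
  finally show ?thesis by (simp add: nn_integral_cr_pdf)
qed

lemma integrable_length_density: "integrable lborel length_density"
  by (rule integrableI_nonneg) (simp_all add: length_density_nonneg nn_integral_length_density)

lemma lborel_integral_length_density: "(\<integral>l. length_density l \<partial>lborel) = 1"
  by (subst integral_eq_nn_integral) (simp_all add: length_density_nonneg nn_integral_length_density)

lemma length_pdf_has_integral: "(length_pdf has_integral 1) {0..2 * arsinh 1}"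
proof -
  have "(length_density has_integral 1) UNIV"
    using has_integral_integral_lborel[OF integrable_length_density] by (simp add: lborel_integral_length_density)
  then have "((\<lambda>l. if l \<in> {0..2 * arsinh 1} then (if l = 0 then 0 else length_pdf l) else 0) has_integral 1) UNIV"
    by (rule has_integral_eq[rotated]) (auto simp: length_density_def)
  then have "((\<lambda>l. if l = 0 then 0 else length_pdf l) has_integral 1) {0..2 * arsinh 1}"
    by (simp only: has_integral_restrict_UNIV)
  then show ?thesis by (rule has_integral_spike_finite[of "{0}", rotated 2]) auto
qed

lemma (in prob_space) expectation_length_density:
  assumes "distributed M lborel L (\<lambda>l. ennreal (length_density l))"
  shows "((\<lambda>l. length_pdf l * l) has_integral expectation L) {0..2 * arsinh 1}"
proof -
  have "expectation L = (\<integral>l. length_density l * l \<partial>lborel)"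
    using distributed_integral[OF assms, of "\<lambda>l. l"] by (simp add: length_density_nonneg)
  moreover have "integrable lborel (\<lambda>l. length_density l * l)"
  proof (rule Bochner_Integration.integrable_bound)
    show "integrable lborel (\<lambda>l. 2 * arsinh 1 * length_density l)"
      by (intro integrable_mult_right integrable_length_density)
    have "norm (length_density l * l) \<le> norm (2 * arsinh 1 * length_density l)" for l
      using length_density_nonneg[of l]
      by (auto simp: length_density_def abs_mult mult.commute[of "length_pdf l"] intro!: mult_right_mono)
    then show "AE l in lborel. norm (length_density l * l) \<le> norm (2 * arsinh 1 * length_density l)" by simp
  qed simp
  ultimately have "((\<lambda>l. length_density l * l) has_integral expectation L) UNIV"
    using has_integral_integral_lborel[of "\<lambda>l. length_density l * l"] by simp
  then have "((\<lambda>l. if l \<in> {0..2 * arsinh 1} then length_pdf l * l else 0) has_integral expectation L) UNIV"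
    by (rule has_integral_eq[rotated]) (auto simp: length_density_def)
  then show ?thesis by (simp only: has_integral_restrict_UNIV)
qed

lemma (in prob_space) prob_le_length_density:
  assumes D: "distributed M lborel L (\<lambda>l. ennreal (length_density l))" and x: "0 \<le> x" "x \<le> 2 * arsinh 1"
  shows "prob {\<omega> \<in> space M. L \<omega> \<le> x} = integral {0..x} length_pdf"
proof -
  have int: "length_pdf integrable_on {0..x}"
    using x by (intro integrable_subinterval_real[OF has_integral_integrable[OF length_pdf_has_integral]]) auto
  have nn: "0 \<le> length_pdf l" if "l \<in> {0..x}" for l using that by (simp add: length_pdf_nonneg)
  then have ge: "0 \<le> integral {0..x} length_pdf" by (intro integral_nonneg int)
  have "emeasure M (L -` {..x} \<inter> space M) = (\<integral>\<^sup>+l. ennreal (length_density l) * indicator {..x} l \<partial>lborel)"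
    by (rule distributed_emeasure[OF D]) simp
  also have "\<dots> = (\<integral>\<^sup>+l. ennreal (length_pdf l) * indicator {0..x} l \<partial>lborel)"
    by (intro nn_integral_cong_AE eventually_mono[OF AE_lborel_singleton[of 0]]) (use x in \<open>auto simp: length_density_def indicator_def\<close>)
  also have "\<dots> = ennreal (integral {0..x} length_pdf)"
    by (rule nn_integral_absolutely_integrable) (use nn int in \<open>auto intro: nonnegative_absolutely_integrable_1\<close>)
  finally have "prob (L -` {..x} \<inter> space M) = integral {0..x} length_pdf"
    using ge by (simp add: measure_def)
  moreover have "L -` {..x} \<inter> space M = {\<omega> \<in> space M. L \<omega> \<le> x}" by auto
  ultimately show ?thesis by simp
qed

text \<open>A law with a density has no atoms, so the two conditions on a median add up to equality
  with \<open>1 / 2\<close>. Outside the support the distribution function is 0 or 1.\<close>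

lemma (in prob_space) is_median_length_density:
  assumes D: "distributed M lborel L (\<lambda>l. ennreal (length_density l))"
  shows "is_median M L x \<longleftrightarrow> 0 \<le> x \<and> x \<le> 2 * arsinh 1 \<and> integral {0..x} length_pdf = 1 / 2"
proof -
  have [measurable]: "L \<in> borel_measurable M" using distributed_measurable[OF D] by simp
  have "emeasure M (L -` {x} \<inter> space M) = (\<integral>\<^sup>+l. ennreal (length_density l) * indicator {x} l \<partial>lborel)"
    by (rule distributed_emeasure[OF D]) simp
  also have "\<dots> = 0"
    by (subst nn_integral_0_iff_AE) (auto intro!: eventually_mono[OF AE_lborel_singleton[of x]])
  finally have "L -` {x} \<inter> space M \<in> null_sets M" by (auto simp: null_sets_def)
  then have "prob {\<omega> \<in> space M. L \<omega> \<le> x} = prob ({\<omega> \<in> space M. L \<omega> \<le> x} - L -` {x} \<inter> space M)"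
    by (intro measure_Diff_null_set[symmetric]) auto
  moreover have "{\<omega> \<in> space M. L \<omega> \<le> x} - L -` {x} \<inter> space M = space M - {\<omega> \<in> space M. L \<omega> \<ge> x}" by auto
  ultimately have "prob {\<omega> \<in> space M. L \<omega> \<ge> x} = 1 - prob {\<omega> \<in> space M. L \<omega> \<le> x}"
    by (simp add: prob_compl)
  then have iff: "is_median M L x \<longleftrightarrow> prob {\<omega> \<in> space M. L \<omega> \<le> x} = 1 / 2"
    by (auto simp: is_median_def)
  have b: "arsinh 1 > (0::real)" using arsinh_less_iff_real[of 0 1] by simp
  consider "x < 0" | "x > 2 * arsinh 1" | "0 \<le> x" "x \<le> 2 * arsinh 1" by linarith
  then show ?thesis
  proof cases
    case 1
    have "prob {\<omega> \<in> space M. L \<omega> \<le> x} \<le> prob {\<omega> \<in> space M. L \<omega> \<le> 0}"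
      using 1 by (intro finite_measure_mono) auto
    also have "\<dots> = 0" using prob_le_length_density[OF D, of 0] b by simp
    finally show ?thesis using 1 unfolding iff by simp
  next
    case 2
    have "1 = prob {\<omega> \<in> space M. L \<omega> \<le> 2 * arsinh 1}"
      using prob_le_length_density[OF D, of "2 * arsinh 1"] b by (simp add: integral_unique[OF length_pdf_has_integral])
    also have "\<dots> \<le> prob {\<omega> \<in> space M. L \<omega> \<le> x}"
      using 2 by (intro finite_measure_mono) auto
    finally show ?thesis using 2 unfolding iff by simp
  next
    case 3
    then show ?thesis unfolding iff by (simp add: prob_le_length_density[OF D])
  qed
qed

text \<open>The density is continuous and positive away from 0. As \<open>x\<close> may be 0, a
  positive lower bound is taken only on the right half of the interval, from its midpoint
  \<open>z\<close> to \<open>y\<close>.\<close>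

lemma integral_length_pdf_strict_mono:
  assumes "0 \<le> x" "x < y" "y \<le> 2 * arsinh 1"
  shows "integral {0..x} length_pdf < integral {0..y} length_pdf"
proof -
  define z where "z = (x + y) / 2"
  have z: "x < z" "z < y" using assms by (simp_all add: z_def)
  have int: "length_pdf integrable_on {a..b}" if "0 \<le> a" "b \<le> 2 * arsinh 1" for a b
    using that by (intro integrable_subinterval_real[OF has_integral_integrable[OF length_pdf_has_integral]]) auto
  have "continuous_on {z..y} length_pdf"
    unfolding length_pdf_def[abs_def] csch_def coth_def
    by (intro continuous_intros) (use assms z in \<open>auto simp: sinh_real_zero_iff cosh_real_nonzero less_imp_neq\<close>)
  then obtain w where w: "w \<in> {z..y}" "\<And>t. t \<in> {z..y} \<Longrightarrow> length_pdf w \<le> length_pdf t"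
    using continuous_attains_inf[of "{z..y}" length_pdf] z by auto
  have "0 < length_pdf w * (y - z)" using w assms z by (intro mult_pos_pos length_pdf_pos) auto
  also have "\<dots> = integral {z..y} (\<lambda>_. length_pdf w)" using z by simp
  also have "\<dots> \<le> integral {z..y} length_pdf" by (intro integral_le int) (use w assms z in auto)
  finally have "integral {z..y} length_pdf > 0" .
  moreover have "integral {x..z} length_pdf \<ge> 0"
    by (intro integral_nonneg int) (use assms z in \<open>auto intro: length_pdf_nonneg\<close>)
  moreover have "integral {0..x} length_pdf + integral {x..z} length_pdf = integral {0..z} length_pdf"
    by (intro Henstock_Kurzweil_Integration.integral_combine int) (use assms z in auto)
  moreover have "integral {0..z} length_pdf + integral {z..y} length_pdf = integral {0..y} length_pdf"
    by (intro Henstock_Kurzweil_Integration.integral_combine int) (use assms z in auto)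
  ultimately show ?thesis by linarith
qed

lemma (in prob_space) unique_median_length_density:
  assumes D: "distributed M lborel L (\<lambda>l. ennreal (length_density l))"
    and xy: "0 \<le> x" "x \<le> y" "y \<le> 2 * arsinh 1"
    and half: "integral {0..x} length_pdf < 1 / 2" "1 / 2 < integral {0..y} length_pdf"
  shows "\<exists>m. (\<forall>t. is_median M L t \<longleftrightarrow> t = m) \<and> x < m \<and> m < y"
proof -
  have "continuous_on {0..2 * arsinh 1} (\<lambda>t. integral {0..t} length_pdf)"
    by (rule indefinite_integral_continuous_1[OF has_integral_integrable[OF length_pdf_has_integral]])
  then have "continuous_on {x..y} (\<lambda>t. integral {0..t} length_pdf)"
    by (rule continuous_on_subset) (use xy in auto)
  then obtain m where m: "x \<le> m" "m \<le> y" "integral {0..m} length_pdf = 1 / 2"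
    using IVT'[of "\<lambda>t. integral {0..t} length_pdf" x "1 / 2" y] half xy by auto
  have "is_median M L t \<longleftrightarrow> t = m" for t
    unfolding is_median_length_density[OF D]
    using integral_length_pdf_strict_mono[of t m] integral_length_pdf_strict_mono[of m t] m xy
    by (cases t m rule: linorder_cases) auto
  moreover have "x < m" "m < y" using m half by (auto simp: less_le)
  ultimately show ?thesis by blast
qed

section \<open>Numerical bounds\<close>

text \<open>The last factor \<open>(1 - y^2) / 2\<close> is the derivative of
  \<open>tanh (l / 2)\<close>, so the integral over \<open>l\<close> becomes an integral over
  \<open>y\<close> of the bracket, which has a simple series.\<close>

lemma length_pdf_tanh:
  assumes l: "0 < l"
  defines "y \<equiv> tanh (l / 2)"
  shows "length_pdf l = 24 / pi\<^sup>2 * (- ln (1 - y\<^sup>2) / 2 / y - ln y * (y / (1 - y\<^sup>2))) * ((1 - y\<^sup>2) / 2)"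
proof -
  define C S where "C = cosh (l / 2)" and "S = sinh (l / 2)"
  have pos: "C > 0" "S > 0" using l by (simp_all add: C_def S_def)
  have CS: "C\<^sup>2 = 1 + S\<^sup>2" unfolding C_def S_def by (simp add: cosh_square_eq)
  have y: "y = S / C" by (simp add: y_def tanh_def C_def S_def)
  have "1 - y\<^sup>2 = (C\<^sup>2 - S\<^sup>2) / C\<^sup>2" using pos by (simp add: y field_simps)
  then have y2: "1 - y\<^sup>2 = 1 / C\<^sup>2" using CS by simp
  have sh: "sinh l = 2 * S * C" using sinh_double[of "l / 2"] by (simp add: S_def C_def)
  have ch: "cosh l - 1 = 2 * S\<^sup>2" using cosh_double[of "l / 2"] CS by (simp add: S_def C_def)
  have ln: "ln (1 - y\<^sup>2) = - 2 * ln C" "ln y = ln S - ln C" "ln (coth (l / 2)) = ln C - ln S"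
    unfolding y2 unfolding y coth_def C_def[symmetric] S_def[symmetric]
    using pos by (simp_all add: ln_div ln_realpow)
  have "length_pdf l = 6 / pi\<^sup>2 * (1 / (2 * S * C)) * (4 * ln C + 2 * (2 * S\<^sup>2) * (ln C - ln S))"
    unfolding length_pdf_def csch_def sh ch ln C_def[symmetric] ..
  also have "\<dots> = 24 / pi\<^sup>2 * (ln C * (C / S) - (ln S - ln C) * (S * C)) * (1 / (2 * C\<^sup>2))"
    using pos by (simp add: field_simps power2_eq_square)
  also have "\<dots> = 24 / pi\<^sup>2 * (- ln (1 - y\<^sup>2) / 2 / y - ln y * (y / (1 - y\<^sup>2))) * ((1 - y\<^sup>2) / 2)"
    unfolding ln unfolding y2 unfolding y using pos by (simp add: field_simps power2_eq_square)
  finally show ?thesis .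
qed

lemma geometric_sum_even:
  fixes y :: real
  assumes "y\<^sup>2 \<noteq> 1"
  shows "y ^ e / (1 - y\<^sup>2) - (\<Sum>k<N. y ^ (2 * k + e)) = y ^ (2 * N + e) / (1 - y\<^sup>2)"
proof -
  have "(\<Sum>k<N. y ^ (2 * k + e)) = y ^ e * (\<Sum>k<N. (y\<^sup>2) ^ k)"
    by (simp add: sum_distrib_left power_add power_mult mult.commute[of _ "y ^ e"])
  also have "\<dots> = y ^ e * ((1 - (y\<^sup>2) ^ N) / (1 - y\<^sup>2))"
    using assms by (subst sum_gp_strict) simp
  finally have "y ^ e / (1 - y\<^sup>2) - (\<Sum>k<N. y ^ (2 * k + e)) = (y ^ e - y ^ e * (1 - (y\<^sup>2) ^ N)) / (1 - y\<^sup>2)"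
    by (simp only: diff_divide_distrib[of "y ^ e"] times_divide_eq_right)
  also have "y ^ e - y ^ e * (1 - (y\<^sup>2) ^ N) = (y\<^sup>2) ^ N * y ^ e" by (simp add: algebra_simps)
  finally show ?thesis by (simp add: power_add power_mult)
qed

text \<open>Both bounds compare derivatives from 0: the derivative of \<open>f\<close> minus the
  partial sum is \<open>t^(2 N + e) / (1 - t^2)\<close>, which lies between 0 and
  \<open>2 * t^(2 N + e)\<close> because \<open>t^2 <= 1 / 2\<close>.\<close>

lemma series_bounds:
  fixes f :: "real \<Rightarrow> real"
  assumes der: "\<And>y. 0 \<le> y \<Longrightarrow> y < 1 \<Longrightarrow> DERIV f y :> y ^ e / (1 - y\<^sup>2)" and f0: "f 0 = 0"
    and y: "0 \<le> y" "y\<^sup>2 \<le> 1 / 2"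
  shows "(\<Sum>k<N. y ^ Suc (2 * k + e) / real (Suc (2 * k + e))) \<le> f y"
    and "f y \<le> (\<Sum>k<N. y ^ Suc (2 * k + e) / real (Suc (2 * k + e))) + 2 * (y ^ Suc (2 * N + e) / real (Suc (2 * N + e)))"
proof -
  have y1: "0 \<le> t" "t < 1" "t\<^sup>2 \<le> 1 / 2" if "0 \<le> t" "t \<le> y" for t
  proof -
    show "0 \<le> t" by fact
    have "t\<^sup>2 \<le> y\<^sup>2" using that by (intro power_mono) auto
    then show "t\<^sup>2 \<le> 1 / 2" using y by simp
    then have "t\<^sup>2 < 1\<^sup>2" by simp
    then show "t < 1" by (rule power_less_imp_less_base) simp
  qed
  let ?S = "\<lambda>y. \<Sum>k<N. y ^ Suc (2 * k + e) / real (Suc (2 * k + e))"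
  have p: "((\<lambda>y. y ^ Suc n / real (Suc n)) has_real_derivative t ^ n) (at t)" for n and t :: real
    using DERIV_cdivide[OF DERIV_pow[of "Suc n" t], of "real (Suc n)"] by (simp del: of_nat_Suc power_Suc)
  have S: "DERIV ?S t :> (\<Sum>k<N. t ^ (2 * k + e))" for t
    by (intro DERIV_sum p)
  have d1: "DERIV (\<lambda>y. f y - ?S y) t :> t ^ (2 * N + e) / (1 - t\<^sup>2)" if "0 \<le> t" "t \<le> y" for t
    using DERIV_diff[OF der[OF y1(1,2)[OF that]] S[of t]] geometric_sum_even[of t e N] y1[OF that]
    by (simp del: of_nat_Suc power_Suc)
  have d2: "DERIV (\<lambda>y. 2 * (y ^ Suc (2 * N + e) / real (Suc (2 * N + e))) - (f y - ?S y)) t :> 2 * t ^ (2 * N + e) - t ^ (2 * N + e) / (1 - t\<^sup>2)"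
    if "0 \<le> t" "t \<le> y" for t
    by (intro DERIV_diff DERIV_cmult p d1 that)
  have "f 0 - ?S 0 \<le> f y - ?S y"
  proof (rule DERIV_nonneg_imp_nondecreasing[OF y(1)])
    fix t assume t: "0 \<le> t" "t \<le> y"
    show "\<exists>z. DERIV (\<lambda>y. f y - ?S y) t :> z \<and> 0 \<le> z"
      using d1[OF t] y1[OF t] by (intro exI[of _ "t ^ (2 * N + e) / (1 - t\<^sup>2)"] conjI) auto
  qed
  then show "?S y \<le> f y" by (simp add: f0)
  have "2 * (0 ^ Suc (2 * N + e) / real (Suc (2 * N + e))) - (f 0 - ?S 0) \<le> 2 * (y ^ Suc (2 * N + e) / real (Suc (2 * N + e))) - (f y - ?S y)"
  proof (rule DERIV_nonneg_imp_nondecreasing[OF y(1)])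
    fix t assume t: "0 \<le> t" "t \<le> y"
    have "t ^ (2 * N + e) / (1 - t\<^sup>2) \<le> t ^ (2 * N + e) / (1 / 2)"
      using y1[OF t] by (intro divide_left_mono) auto
    then show "\<exists>z. DERIV (\<lambda>y. 2 * (y ^ Suc (2 * N + e) / real (Suc (2 * N + e))) - (f y - ?S y)) t :> z \<and> 0 \<le> z"
      using d2[OF t] by (intro exI[of _ "2 * t ^ (2 * N + e) - t ^ (2 * N + e) / (1 - t\<^sup>2)"] conjI) auto
  qed
  then show "f y \<le> ?S y + 2 * (y ^ Suc (2 * N + e) / real (Suc (2 * N + e)))" by (simp add: f0)
qed

text \<open>As \<open>y\<^sup>2 \<le> 1 / 2\<close>, the tail of a geometric series in \<open>y\<^sup>2\<close> is at most twice its first term.\<close>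

definition tail_weight :: "nat \<Rightarrow> nat \<Rightarrow> real" where
  "tail_weight N k = (if k = N then 2 else 1)"

lemma sum_tail_weight: "(\<Sum>k\<le>N. tail_weight N k * f k) = (\<Sum>k<N. f k) + 2 * f N"
proof -
  have "{..N} = insert N {..<N}" by auto
  moreover have "(\<Sum>k<N. tail_weight N k * f k) = (\<Sum>k<N. f k)"
    by (intro sum.cong) (auto simp: tail_weight_def)
  ultimately show ?thesis by (simp add: tail_weight_def)
qed

lemma artanh_bounds:
  fixes y :: real
  assumes y: "0 \<le> y" "y\<^sup>2 \<le> 1 / 2"
  shows "(\<Sum>k<N. y ^ (2 * k + 1) / real (2 * k + 1)) \<le> artanh y"
    and "artanh y \<le> (\<Sum>k\<le>N. tail_weight N k * (y ^ (2 * k + 1) / real (2 * k + 1)))"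
proof -
  have "DERIV artanh t :> t ^ 0 / (1 - t\<^sup>2)" if "0 \<le> t" "t < 1" for t :: real
    using that by (auto intro!: derivative_eq_intros simp: divide_inverse)
  from series_bounds[OF this _ y, of N] show "(\<Sum>k<N. y ^ (2 * k + 1) / real (2 * k + 1)) \<le> artanh y"
    "artanh y \<le> (\<Sum>k\<le>N. tail_weight N k * (y ^ (2 * k + 1) / real (2 * k + 1)))"
    unfolding sum_tail_weight by simp_all
qed

text \<open>The sum of two geometric type series, for \<open>- ln (1 - y^2) / (2 y)\<close> and for
  \<open>y / (1 - y^2)\<close>, the latter multiplied by \<open>- ln y\<close>. As
  \<open>- ln y >= 0\<close> all terms are nonnegative, and the logarithm can be kept as a
  symbol.\<close>

lemma log_quotient_bounds:
  fixes y :: real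
  assumes y: "0 < y" "y\<^sup>2 \<le> 1 / 2"
  defines "h \<equiv> - ln (1 - y\<^sup>2) / 2 / y - ln y * (y / (1 - y\<^sup>2))"
  shows "(\<Sum>k<N. (1 / real (2 * k + 2) - ln y) * y ^ (2 * k + 1)) \<le> h"
    and "h \<le> (\<Sum>k\<le>N. tail_weight N k * ((1 / real (2 * k + 2) - ln y) * y ^ (2 * k + 1)))"
proof -
  have "y\<^sup>2 < 1\<^sup>2" using y by simp
  then have "y < 1" by (rule power_less_imp_less_base) simp
  then have l: "0 \<le> - ln y" using y by simp
  have d: "DERIV (\<lambda>y. - ln (1 - y\<^sup>2) / 2) t :> t ^ 1 / (1 - t\<^sup>2)" if "0 \<le> t" "t < 1" for t :: real
  proof -
    have "t\<^sup>2 < 1\<^sup>2" using that by (intro power_strict_mono) auto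
    then have "DERIV (\<lambda>y. ln (1 - y\<^sup>2)) t :> - (2 * t) / (1 - t\<^sup>2)"
      by (auto intro!: derivative_eq_intros)
    then have "DERIV (\<lambda>y. - ln (1 - y\<^sup>2) / 2) t :> - (- (2 * t) / (1 - t\<^sup>2)) / 2"
      by (intro DERIV_cdivide DERIV_minus)
    moreover have "- (- (2 * t) / u) / 2 = t ^ 1 / u" for u by simp
    ultimately show ?thesis by (simp only:)
  qed
  have s: "y ^ Suc (2 * k + 1) / real (Suc (2 * k + 1)) = y * (y ^ (2 * k + 1) / real (2 * k + 2))" for k by simp
  note g = series_bounds[OF d _ less_imp_le[OF y(1)] y(2), of N, unfolded s sum_distrib_left[symmetric]]
  have g': "(\<Sum>k<N. y ^ (2 * k + 1) / real (2 * k + 2)) \<le> - ln (1 - y\<^sup>2) / 2 / y"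
    unfolding pos_le_divide_eq[OF y(1)] mult.commute[of _ y] using g(1) by simp
  have g'': "- ln (1 - y\<^sup>2) / 2 / y \<le> (\<Sum>k<N. y ^ (2 * k + 1) / real (2 * k + 2)) + 2 * (y ^ (2 * N + 1) / real (2 * N + 2))"
    unfolding pos_divide_le_eq[OF y(1)] distrib_right using g(2) by (simp only: mult_ac) simp
  have r: "y / (1 - y\<^sup>2) = (\<Sum>k<N. y ^ (2 * k + 1)) + y ^ (2 * N + 1) / (1 - y\<^sup>2)"
    using geometric_sum_even[of y 1 N] y by simp
  moreover have "y ^ (2 * N + 1) / (1 - y\<^sup>2) \<le> y ^ (2 * N + 1) / (1 / 2)"
    using y by (intro divide_left_mono) auto
  moreover have "0 \<le> y ^ (2 * N + 1) / (1 - y\<^sup>2)"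
    using y by (intro divide_nonneg_nonneg) auto
  ultimately have r': "(\<Sum>k<N. y ^ (2 * k + 1)) \<le> y / (1 - y\<^sup>2)" "y / (1 - y\<^sup>2) \<le> (\<Sum>k<N. y ^ (2 * k + 1)) + 2 * y ^ (2 * N + 1)"
    by simp_all
  have e: "(\<Sum>k<N. (1 / real (2 * k + 2) - ln y) * y ^ (2 * k + 1))
    = (\<Sum>k<N. y ^ (2 * k + 1) / real (2 * k + 2)) + (- ln y) * (\<Sum>k<N. y ^ (2 * k + 1))"
    unfolding sum_distrib_left sum.distrib[symmetric] by (simp add: algebra_simps)
  show "(\<Sum>k<N. (1 / real (2 * k + 2) - ln y) * y ^ (2 * k + 1)) \<le> h"
    unfolding e h_def using g' mult_left_mono[OF r'(1) l] by simp
  show "h \<le> (\<Sum>k\<le>N. tail_weight N k * ((1 / real (2 * k + 2) - ln y) * y ^ (2 * k + 1)))"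
    unfolding sum_tail_weight e h_def using g'' mult_left_mono[OF r'(2) l] by (simp add: algebra_simps)
qed

text \<open>The antiderivative, vanishing at 0, of the sum of the terms
  \<open>(c i - d i * ln y) * y ^ p i\<close>.\<close>

definition log_sum :: "'i set \<Rightarrow> ('i \<Rightarrow> nat) \<Rightarrow> ('i \<Rightarrow> real) \<Rightarrow> ('i \<Rightarrow> real) \<Rightarrow> real \<Rightarrow> real" where
  "log_sum I p c d y = (\<Sum>i\<in>I. (c i / real (Suc (p i)) + d i / (real (Suc (p i)))\<^sup>2 - d i * ln y / real (Suc (p i))) * y ^ Suc (p i))"

lemma continuous_on_mult_ln: "continuous_on {0..} (\<lambda>y::real. y * ln y)"
proof -
  have "((\<lambda>y::real. y * ln y) \<longlongrightarrow> 0) (at_right 0)" by real_asymp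
  then have "continuous (at 0 within {0..}) (\<lambda>y::real. y * ln y)"
    by (simp add: continuous_within at_within_Ici_at_right)
  moreover have "continuous (at y within {0..}) (\<lambda>y::real. y * ln y)" if "y > 0" for y
    using that by (intro continuous_intros) auto
  ultimately show ?thesis unfolding continuous_on_eq_continuous_within by (metis atLeast_iff order_le_less)
qed

lemma has_integral_log_sum:
  assumes "finite I" "0 \<le> x"
  shows "((\<lambda>l. (\<Sum>i\<in>I. (c i - d i * ln (tanh (l / 2))) * tanh (l / 2) ^ p i) * ((1 - (tanh (l / 2))\<^sup>2) / 2))
    has_integral log_sum I p c d (tanh (x / 2))) {0..x}"
proof -
  have dl: "((\<lambda>y. (A / real (Suc n) + B / (real (Suc n))\<^sup>2 - B * ln y / real (Suc n)) * y ^ Suc n) has_real_derivative (A - B * ln y) * y ^ n) (at y)"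
    if "y > 0" for A B y :: real and n :: nat
  proof -
    define K where "K = real (Suc n)"
    have K: "K > 0" by (simp add: K_def)
    have P: "((\<lambda>y. y ^ Suc n / K) has_real_derivative y ^ n) (at y)"
      using DERIV_cdivide[OF DERIV_pow[of "Suc n" y], of K] by (simp add: K_def del: power_Suc of_nat_Suc)
    have "((\<lambda>y. A * (y ^ Suc n / K) + B / K * (y ^ Suc n / K) - B * (ln y * (y ^ Suc n / K))) has_real_derivative
       A * y ^ n + B / K * y ^ n - B * (1 / y * (y ^ Suc n / K) + y ^ n * ln y)) (at y)"
      using that by (intro DERIV_diff DERIV_add DERIV_cmult DERIV_mult P) (auto intro!: derivative_eq_intros)
    also have "A * y ^ n + B / K * y ^ n - B * (1 / y * (y ^ Suc n / K) + y ^ n * ln y) = (A - B * ln y) * y ^ n"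
      using that by (simp add: algebra_simps)
    also have "(\<lambda>y. A * (y ^ Suc n / K) + B / K * (y ^ Suc n / K) - B * (ln y * (y ^ Suc n / K)))
      = (\<lambda>y. (A / K + B / K\<^sup>2 - B * ln y / K) * y ^ Suc n)"
      by (simp add: fun_eq_iff ring_distribs power2_eq_square)
    finally show ?thesis unfolding K_def .
  qed
  have dF: "(log_sum I p c d has_real_derivative (\<Sum>i\<in>I. (c i - d i * ln y) * y ^ p i)) (at y)" if "y > 0" for y
    unfolding log_sum_def[abs_def] using dl[OF that] by (intro DERIV_sum) simp
  \<comment> \<open>One power of \<open>y\<close> stays with the logarithm, since
    \<open>y * ln y\<close> is continuous at 0 while \<open>ln y\<close> is not.\<close>
  have "continuous_on {0..} (\<lambda>y. \<Sum>i\<in>I. (c i / real (Suc (p i)) + d i / (real (Suc (p i)))\<^sup>2) * y ^ Suc (p i) - d i / real (Suc (p i)) * y ^ p i * (y * ln y))"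
    by (intro continuous_intros continuous_on_mult_ln)
  then have cF: "continuous_on {0..} (log_sum I p c d)"
    by (simp add: log_sum_def[abs_def] algebra_simps)
  have "((\<lambda>l. (\<Sum>i\<in>I. (c i - d i * ln (tanh (l / 2))) * tanh (l / 2) ^ p i) * ((1 - (tanh (l / 2))\<^sup>2) / 2))
    has_integral log_sum I p c d (tanh (x / 2)) - log_sum I p c d (tanh (0 / 2))) {0..x}"
  proof (rule fundamental_theorem_of_calculus_interior[OF assms(2)])
    show "continuous_on {0..x} (\<lambda>l. log_sum I p c d (tanh (l / 2)))"
      by (rule continuous_on_compose2[OF cF]) (auto intro!: continuous_intros simp: cosh_real_nonzero)
    fix l assume "l \<in> {0<..<x}"
    then have "tanh (l / 2) > 0" by simp
    moreover have "((\<lambda>l. tanh (l / 2)) has_real_derivative (1 - (tanh (l / 2))\<^sup>2) / 2) (at l)"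
      by (auto intro!: derivative_eq_intros)
    ultimately show "((\<lambda>l. log_sum I p c d (tanh (l / 2))) has_vector_derivative
        (\<Sum>i\<in>I. (c i - d i * ln (tanh (l / 2))) * tanh (l / 2) ^ p i) * ((1 - (tanh (l / 2))\<^sup>2) / 2)) (at l)"
      unfolding has_real_derivative_iff_has_vector_derivative[symmetric] by (intro DERIV_chain2[OF dF])
  qed
  then show ?thesis by (simp add: log_sum_def)
qed

lemma has_integral_log_quotient_sum:
  fixes w :: "nat \<Rightarrow> real"
  assumes "finite I" "0 \<le> x"
  defines "t \<equiv> \<lambda>l::real. tanh (l / 2)"
  shows "((\<lambda>l. (\<Sum>k\<in>I. w k * ((1 / real (2 * k + 2) - ln (t l)) * t l ^ (2 * k + 1))) * ((1 - (t l)\<^sup>2) / 2)) has_integral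
    (\<Sum>k\<in>I. w k * ((2 / real (2 * k + 2) ^ 2 - ln (t x) / real (2 * k + 2)) * t x ^ (2 * k + 2)))) {0..x}"
proof -
  have "log_sum I (\<lambda>k. 2 * k + 1) (\<lambda>k. w k / real (2 * k + 2)) w y =
    (\<Sum>k\<in>I. w k * ((2 / real (2 * k + 2) ^ 2 - ln y / real (2 * k + 2)) * y ^ (2 * k + 2)))" for y
  proof -
    have "(w k / K / K + w k / K\<^sup>2 - w k * L / K) * Y = w k * ((2 / K\<^sup>2 - L / K) * Y)" for k K L Y
      by (simp add: power2_eq_square algebra_simps)
    moreover have "Suc (2 * k + 1) = 2 * k + 2" for k by simp
    ultimately show ?thesis unfolding log_sum_def by (simp only:)
  qed
  moreover have "(w k / K - w k * L) * Y = w k * ((1 / K - L) * Y)" for k K L Y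
    by (simp add: algebra_simps)
  ultimately show ?thesis
    using has_integral_log_sum[OF assms(1,2), of "\<lambda>k. w k / real (2 * k + 2)" w "\<lambda>k. 2 * k + 1"]
    unfolding t_def by (simp only:)
qed

text \<open>Serves the expectation: the first sum approximates
  \<open>artanh (tanh (l / 2)) = l / 2\<close>, the second the bracket of
  \<open>length_pdf_tanh\<close>. The product is integrated termwise over pairs of indices.\<close>

lemma has_integral_artanh_log_quotient_sum:
  fixes w :: "nat \<Rightarrow> real"
  assumes "finite I" "0 \<le> x"
  defines "t \<equiv> \<lambda>l::real. tanh (l / 2)"
  shows "((\<lambda>l. ((\<Sum>k\<in>I. w k * (t l ^ (2 * k + 1) / real (2 * k + 1))) *
      (\<Sum>k\<in>I. w k * ((1 / real (2 * k + 2) - ln (t l)) * t l ^ (2 * k + 1)))) * ((1 - (t l)\<^sup>2) / 2)) has_integral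
    (\<Sum>i\<in>I. \<Sum>j\<in>I. w i * w j * ((1 / (real (2 * j + 2) * real (2 * i + 2 * j + 3)) + 1 / real (2 * i + 2 * j + 3) ^ 2
        - ln (t x) / real (2 * i + 2 * j + 3)) / real (2 * i + 1) * t x ^ (2 * i + 2 * j + 3)))) {0..x}"
proof -
  let ?p = "\<lambda>(i, j). 2 * i + 2 * j + 2" and ?d = "\<lambda>(i, j). w i * w j / real (2 * i + 1)"
  let ?c = "\<lambda>(i, j). w i * w j / real (2 * i + 1) / real (2 * j + 2)"
  have "log_sum (I \<times> I) ?p ?c ?d y =
    (\<Sum>i\<in>I. \<Sum>j\<in>I. w i * w j * ((1 / (real (2 * j + 2) * real (2 * i + 2 * j + 3)) + 1 / real (2 * i + 2 * j + 3) ^ 2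
        - ln y / real (2 * i + 2 * j + 3)) / real (2 * i + 1) * y ^ (2 * i + 2 * j + 3)))" for y
  proof -
    have "(W / A / B / K + W / A / K\<^sup>2 - W / A * L / K) * Y = W * ((1 / (B * K) + 1 / K\<^sup>2 - L / K) / A * Y)" for W A B K L Y :: real
      by (simp add: diff_divide_distrib add_divide_distrib algebra_simps)
    moreover have "Suc (2 * i + 2 * j + 2) = 2 * i + 2 * j + 3" for i j by simp
    ultimately show ?thesis unfolding log_sum_def sum.cartesian_product' prod.case by (simp only:)
  qed
  moreover have "(\<Sum>z\<in>I \<times> I. (?c z - ?d z * ln y) * y ^ ?p z) =
     (\<Sum>k\<in>I. w k * (y ^ (2 * k + 1) / real (2 * k + 1))) * (\<Sum>k\<in>I. w k * ((1 / real (2 * k + 2) - ln y) * y ^ (2 * k + 1)))" for y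
  proof -
    have "(W * V / A / B - W * V / A * L) * (X * Y) = W * (X / A) * (V * ((1 / B - L) * Y))" for W V A B L X Y :: real
      by (simp add: algebra_simps)
    moreover have "y ^ (2 * i + 2 * j + 2) = y ^ (2 * i + 1) * y ^ (2 * j + 1)" for i j
      unfolding power_add[symmetric] by (simp add: add_ac)
    ultimately show ?thesis unfolding sum_product sum.cartesian_product' prod.case by (simp only:)
  qed
  ultimately show ?thesis
    using has_integral_log_sum[of "I \<times> I" x ?c ?d ?p] assms(1,2)
    unfolding t_def by (simp only: finite_cartesian_product)
qed

lemma tanh_artanh_real:
  fixes y :: real
  assumes "\<bar>y\<bar> < 1"
  shows "tanh (artanh y) = y"
proof -
  have y: "1 + y > 0" "1 - y > 0" using assms by auto
  have "exp (- 2 * artanh y) = exp (ln ((1 - y) / (1 + y)))"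
    using y by (simp add: artanh_def ln_div)
  also have "\<dots> = (1 - y) / (1 + y)" using y by simp
  finally have "exp (- 2 * artanh y) = (1 - y) / (1 + y)" .
  then show ?thesis unfolding tanh_real_altdef
    by (simp only:) (use y in \<open>simp add: field_simps\<close>)
qed

lemma tanh_half_bounds:
  fixes y :: real
  assumes "0 \<le> y" "y\<^sup>2 \<le> 1 / 2"
  shows "tanh (2 * artanh y / 2) = y" and "0 \<le> 2 * artanh y"
    and "0 < l \<Longrightarrow> l \<le> 2 * artanh y \<Longrightarrow> (tanh (l / 2))\<^sup>2 \<le> 1 / 2"
proof -
  have "y\<^sup>2 < 1\<^sup>2" using assms by simp
  then have "y < 1" by (rule power_less_imp_less_base) simp
  then show t: "tanh (2 * artanh y / 2) = y" using assms by (simp add: tanh_artanh_real)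
  then have "0 \<le> tanh (2 * artanh y / 2)" using assms by simp
  then show "0 \<le> 2 * artanh y" by simp
  assume l: "0 < l" "l \<le> 2 * artanh y"
  then have "tanh (l / 2) \<le> tanh (2 * artanh y / 2)" by simp
  then have "(tanh (l / 2))\<^sup>2 \<le> y\<^sup>2" unfolding t using l by (intro power_mono) simp_all
  then show "(tanh (l / 2))\<^sup>2 \<le> 1 / 2" using assms by simp
qed

lemma length_pdf_0: "length_pdf 0 = 0"
  by (simp add: length_pdf_def csch_def)

lemma integral_length_pdf_bounds:
  assumes y: "0 < y" "y\<^sup>2 \<le> 1 / 2" and int: "length_pdf integrable_on {0..2 * artanh y}"
  shows "24 / pi\<^sup>2 * (\<Sum>k<N. (2 / real (2 * k + 2) ^ 2 - ln y / real (2 * k + 2)) * y ^ (2 * k + 2)) \<le> integral {0..2 * artanh y} length_pdf"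
    and "integral {0..2 * artanh y} length_pdf \<le>
      24 / pi\<^sup>2 * (\<Sum>k\<le>N. tail_weight N k * ((2 / real (2 * k + 2) ^ 2 - ln y / real (2 * k + 2)) * y ^ (2 * k + 2)))"
proof -
  note t = tanh_half_bounds[OF less_imp_le[OF y(1)] y(2)]
  have h: "length_pdf l = 24 / pi\<^sup>2 * ((- ln (1 - (tanh (l / 2))\<^sup>2) / 2 / tanh (l / 2) - ln (tanh (l / 2)) *
      (tanh (l / 2) / (1 - (tanh (l / 2))\<^sup>2))) * ((1 - (tanh (l / 2))\<^sup>2) / 2))" if "0 < l" for l
    using length_pdf_tanh[OF that] by (simp only: mult.assoc)
  have pi: "0 \<le> 24 / pi\<^sup>2" by simp
  have q: "0 \<le> (1 - (tanh (l / 2))\<^sup>2) / 2" if "0 < l" "l \<le> 2 * artanh y" for l using t(3)[OF that] by simp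
  note lo = has_integral_log_quotient_sum[of "{..<N}" "2 * artanh y" "\<lambda>_. 1", unfolded t(1) mult_1, OF finite_lessThan t(2)]
  note up = has_integral_log_quotient_sum[of "{..N}" "2 * artanh y" "tail_weight N", unfolded t(1), OF finite_atMost t(2)]
  show "24 / pi\<^sup>2 * (\<Sum>k<N. (2 / real (2 * k + 2) ^ 2 - ln y / real (2 * k + 2)) * y ^ (2 * k + 2)) \<le> integral {0..2 * artanh y} length_pdf"
  proof (rule has_integral_le[OF has_integral_mult_right[OF lo] integrable_integral[OF int]])
    fix l assume l: "l \<in> {0..2 * artanh y}"
    show "24 / pi\<^sup>2 * ((\<Sum>k<N. (1 / real (2 * k + 2) - ln (tanh (l / 2))) * tanh (l / 2) ^ (2 * k + 1)) * ((1 - (tanh (l / 2))\<^sup>2) / 2)) \<le> length_pdf l"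
    proof (cases "l = 0")
      case True
      then show ?thesis by (simp add: length_pdf_0)
    next
      case False
      then have l: "0 < l" "l \<le> 2 * artanh y" using l by auto
      then show ?thesis unfolding h[OF l(1)]
        by (intro mult_left_mono[OF mult_right_mono] pi q log_quotient_bounds t(3)) simp_all
    qed
  qed
  show "integral {0..2 * artanh y} length_pdf \<le>
      24 / pi\<^sup>2 * (\<Sum>k\<le>N. tail_weight N k * ((2 / real (2 * k + 2) ^ 2 - ln y / real (2 * k + 2)) * y ^ (2 * k + 2)))"
  proof (rule has_integral_le[OF integrable_integral[OF int] has_integral_mult_right[OF up]])
    fix l assume l: "l \<in> {0..2 * artanh y}"
    show "length_pdf l \<le> 24 / pi\<^sup>2 * ((\<Sum>k\<le>N. tail_weight N k * ((1 / real (2 * k + 2) - ln (tanh (l / 2))) * tanh (l / 2) ^ (2 * k + 1))) * ((1 - (tanh (l / 2))\<^sup>2) / 2))"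
    proof (cases "l = 0")
      case True
      then show ?thesis by (simp add: length_pdf_0)
    next
      case False
      then have l: "0 < l" "l \<le> 2 * artanh y" using l by auto
      then show ?thesis unfolding h[OF l(1)]
        by (intro mult_left_mono[OF mult_right_mono] pi q log_quotient_bounds t(3)) simp_all
    qed
  qed
qed

text \<open>The factor \<open>l = 2 * artanh y\<close> turns 24 into 48. Both factors lie between
  nonnegative sums, so the bounds for them multiply.\<close>

lemma integral_length_pdf_mult_bounds:
  assumes y: "0 < y" "y\<^sup>2 \<le> 1 / 2" and int: "((\<lambda>l. length_pdf l * l) has_integral E) {0..2 * artanh y}"
  shows "48 / pi\<^sup>2 * (\<Sum>i<N. \<Sum>j<N. (1 / (real (2 * j + 2) * real (2 * i + 2 * j + 3)) + 1 / real (2 * i + 2 * j + 3) ^ 2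
        - ln y / real (2 * i + 2 * j + 3)) / real (2 * i + 1) * y ^ (2 * i + 2 * j + 3)) \<le> E"
    and "E \<le> 48 / pi\<^sup>2 * (\<Sum>i\<le>N. \<Sum>j\<le>N. tail_weight N i * tail_weight N j *
        ((1 / (real (2 * j + 2) * real (2 * i + 2 * j + 3)) + 1 / real (2 * i + 2 * j + 3) ^ 2
        - ln y / real (2 * i + 2 * j + 3)) / real (2 * i + 1) * y ^ (2 * i + 2 * j + 3)))"
proof -
  note t = tanh_half_bounds[OF less_imp_le[OF y(1)] y(2)]
  define h where "h = (\<lambda>t. - ln (1 - t\<^sup>2) / 2 / t - ln t * (t / (1 - t\<^sup>2)) :: real)"
  have h: "length_pdf l * l = 48 / pi\<^sup>2 * ((artanh (tanh (l / 2)) * h (tanh (l / 2))) * ((1 - (tanh (l / 2))\<^sup>2) / 2))" if "0 < l" for l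
  proof -
    have "24 / P * H * Q * l = 48 / P * (l / 2 * H * Q)" for P H Q :: real by simp
    then show ?thesis unfolding length_pdf_tanh[OF that] artanh_tanh_real h_def .
  qed
  have pi: "0 \<le> 48 / pi\<^sup>2" by simp
  have q: "0 \<le> (1 - (tanh (l / 2))\<^sup>2) / 2" if "0 < l" "l \<le> 2 * artanh y" for l using t(3)[OF that] by simp
  have hl: "(\<Sum>k<n. (1 / real (2 * k + 2) - ln (tanh (l / 2))) * tanh (l / 2) ^ (2 * k + 1)) \<le> h (tanh (l / 2))"
    and hu: "h (tanh (l / 2)) \<le> (\<Sum>k\<le>n. tail_weight n k * ((1 / real (2 * k + 2) - ln (tanh (l / 2))) * tanh (l / 2) ^ (2 * k + 1)))"
    if "0 < l" "l \<le> 2 * artanh y" for l n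
    unfolding h_def using that by (intro log_quotient_bounds t(3); simp)+
  have h0: "0 \<le> h (tanh (l / 2))" if "0 < l" "l \<le> 2 * artanh y" for l
    using hl[OF that, of 0] by simp
  note lo = has_integral_artanh_log_quotient_sum[of "{..<N}" "2 * artanh y" "\<lambda>_. 1", unfolded t(1) mult_1, OF finite_lessThan t(2)]
  note up = has_integral_artanh_log_quotient_sum[of "{..N}" "2 * artanh y" "tail_weight N", unfolded t(1), OF finite_atMost t(2)]
  show "48 / pi\<^sup>2 * (\<Sum>i<N. \<Sum>j<N. (1 / (real (2 * j + 2) * real (2 * i + 2 * j + 3)) + 1 / real (2 * i + 2 * j + 3) ^ 2
        - ln y / real (2 * i + 2 * j + 3)) / real (2 * i + 1) * y ^ (2 * i + 2 * j + 3)) \<le> E"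
  proof (rule has_integral_le[OF has_integral_mult_right[OF lo] int])
    fix l assume l: "l \<in> {0..2 * artanh y}"
    show "48 / pi\<^sup>2 * (((\<Sum>k<N. tanh (l / 2) ^ (2 * k + 1) / real (2 * k + 1)) *
       (\<Sum>k<N. (1 / real (2 * k + 2) - ln (tanh (l / 2))) * tanh (l / 2) ^ (2 * k + 1))) * ((1 - (tanh (l / 2))\<^sup>2) / 2)) \<le> length_pdf l * l"
    proof (cases "l = 0")
      case True
      then show ?thesis by simp
    next
      case False
      then have l: "0 < l" "l \<le> 2 * artanh y" using l by auto
      have "0 \<le> tanh (l / 2)" using l by simp
      moreover have "0 \<le> (\<Sum>k<N. tanh (l / 2) ^ (2 * k + 1) / real (2 * k + 1))" using l by (intro sum_nonneg) simp
      ultimately show ?thesis unfolding h[OF l(1)]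
        by (intro mult_left_mono[OF mult_right_mono[OF order_trans[OF mult_left_mono[OF hl] mult_right_mono]]] pi q h0 artanh_bounds t(3) l)
    qed
  qed
  show "E \<le> 48 / pi\<^sup>2 * (\<Sum>i\<le>N. \<Sum>j\<le>N. tail_weight N i * tail_weight N j *
        ((1 / (real (2 * j + 2) * real (2 * i + 2 * j + 3)) + 1 / real (2 * i + 2 * j + 3) ^ 2
        - ln y / real (2 * i + 2 * j + 3)) / real (2 * i + 1) * y ^ (2 * i + 2 * j + 3)))"
  proof (rule has_integral_le[OF int has_integral_mult_right[OF up]])
    fix l assume l: "l \<in> {0..2 * artanh y}"
    show "length_pdf l * l \<le> 48 / pi\<^sup>2 * (((\<Sum>k\<le>N. tail_weight N k * (tanh (l / 2) ^ (2 * k + 1) / real (2 * k + 1))) *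
       (\<Sum>k\<le>N. tail_weight N k * ((1 / real (2 * k + 2) - ln (tanh (l / 2))) * tanh (l / 2) ^ (2 * k + 1)))) * ((1 - (tanh (l / 2))\<^sup>2) / 2))"
    proof (cases "l = 0")
      case True
      then show ?thesis by simp
    next
      case False
      then have l: "0 < l" "l \<le> 2 * artanh y" using l by auto
      have "0 \<le> tanh (l / 2)" using l by simp
      moreover have "0 \<le> (\<Sum>k\<le>N. tail_weight N k * (tanh (l / 2) ^ (2 * k + 1) / real (2 * k + 1)))"
        using l by (intro sum_nonneg) (simp add: tail_weight_def)
      ultimately show ?thesis unfolding h[OF l(1)]
        by (intro mult_left_mono[OF mult_right_mono[OF order_trans[OF mult_right_mono mult_left_mono[OF hu]]]] pi q h0 artanh_bounds t(3) l)
    qed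
  qed
qed

section \<open>Rational bounds for pi and ln 2\<close>

lemma arctan_bounds:
  fixes y :: real
  assumes y: "0 \<le> y"
  shows "(\<Sum>k<2 * N. (- 1) ^ k * (y ^ Suc (2 * k) / real (Suc (2 * k)))) \<le> arctan y"
    and "arctan y \<le> (\<Sum>k<2 * N + 1. (- 1) ^ k * (y ^ Suc (2 * k) / real (Suc (2 * k))))"
proof -
  let ?S = "\<lambda>n y. \<Sum>k<n. (- 1) ^ k * (y ^ Suc (2 * k) / real (Suc (2 * k)))"
  have p: "((\<lambda>y. y ^ Suc n / real (Suc n)) has_real_derivative t ^ n) (at t)" for n and t :: real
    using DERIV_cdivide[OF DERIV_pow[of "Suc n" t], of "real (Suc n)"] by (simp del: of_nat_Suc power_Suc)
  have S: "DERIV (?S n) t :> (1 - (- (t\<^sup>2)) ^ n) / (1 + t\<^sup>2)" for n and t :: real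
  proof -
    have "(\<Sum>k<n. (- 1) ^ k * t ^ (2 * k)) = (\<Sum>k<n. (- (t\<^sup>2)) ^ k)"
      by (intro sum.cong refl) (simp add: power_mult power_mult_distrib[symmetric])
    also have "\<dots> = (1 - (- (t\<^sup>2)) ^ n) / (1 - - (t\<^sup>2))"
      using sum_gp_strict[of "- (t\<^sup>2)" n] by (metis neg_equal_0_iff_equal not_one_le_zero neg_le_0_iff_le zero_le_power2)
    finally have "(\<Sum>k<n. (- 1) ^ k * t ^ (2 * k)) = (1 - (- (t\<^sup>2)) ^ n) / (1 + t\<^sup>2)" by simp
    moreover have "DERIV (?S n) t :> (\<Sum>k<n. (- 1) ^ k * t ^ (2 * k))" by (intro DERIV_sum DERIV_cmult p)
    ultimately show ?thesis by simp
  qed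
  have a: "DERIV arctan t :> 1 / (1 + t\<^sup>2)" for t :: real
    using DERIV_arctan[of t] by (simp add: divide_inverse)
  have "arctan 0 - ?S (2 * N) 0 \<le> arctan y - ?S (2 * N) y"
  proof (rule DERIV_nonneg_imp_nondecreasing[OF y])
    fix t :: real
    have "(- (t\<^sup>2)) ^ (2 * N) \<ge> 0" by (simp add: power_mult)
    then have "0 \<le> 1 / (1 + t\<^sup>2) - (1 - (- (t\<^sup>2)) ^ (2 * N)) / (1 + t\<^sup>2)"
      unfolding diff_divide_distrib[symmetric] by (intro divide_nonneg_nonneg) auto
    then show "\<exists>z. DERIV (\<lambda>y. arctan y - ?S (2 * N) y) t :> z \<and> 0 \<le> z"
      using DERIV_diff[OF a S] by blast
  qed
  then show "?S (2 * N) y \<le> arctan y" by simp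
  have "?S (2 * N + 1) 0 - arctan 0 \<le> ?S (2 * N + 1) y - arctan y"
  proof (rule DERIV_nonneg_imp_nondecreasing[OF y])
    fix t :: real
    have "(- (t\<^sup>2)) ^ (2 * N) \<ge> 0" by (simp add: power_mult)
    then have "(- (t\<^sup>2)) ^ (2 * N + 1) \<le> 0" by simp
    then have "0 \<le> (1 - (- (t\<^sup>2)) ^ (2 * N + 1)) / (1 + t\<^sup>2) - 1 / (1 + t\<^sup>2)"
      unfolding diff_divide_distrib[symmetric] by (intro divide_nonneg_nonneg) auto
    then show "\<exists>z. DERIV (\<lambda>y. ?S (2 * N + 1) y - arctan y) t :> z \<and> 0 \<le> z"
      using DERIV_diff[OF S a] by blast
  qed
  then show "arctan y \<le> ?S (2 * N + 1) y" by simp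
qed

text \<open>Machin's formula \<open>pi / 4 = 4 * arctan (1 / 5) - arctan (1 / 239)\<close>. The
  chosen numbers of terms enclose \<open>pi\<close> to about \<open>10^-9\<close>, enough for the
  seventh decimal of the expectation.\<close>

lemma pi_bounds: "3.14159265257 \<le> pi" "pi \<le> 3.14159265365"
proof -
  have "(\<Sum>k<6. (- 1) ^ k * ((1 / 5) ^ Suc (2 * k) / real (Suc (2 * k)))) \<le> arctan (1 / 5 :: real)"
    "arctan (1 / 5 :: real) \<le> (\<Sum>k<7. (- 1) ^ k * ((1 / 5) ^ Suc (2 * k) / real (Suc (2 * k))))"
    "(\<Sum>k<2. (- 1) ^ k * ((1 / 239) ^ Suc (2 * k) / real (Suc (2 * k)))) \<le> arctan (1 / 239 :: real)"
    "arctan (1 / 239 :: real) \<le> (\<Sum>k<3. (- 1) ^ k * ((1 / 239) ^ Suc (2 * k) / real (Suc (2 * k))))"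
    using arctan_bounds[of "1 / 5" 3] arctan_bounds[of "1 / 239" 1] by simp_all
  then have "0.1973955597868 \<le> arctan (1 / 5 :: real)" "arctan (1 / 5 :: real) \<le> 0.1973955598525"
    "0.004184076 \<le> arctan (1 / 239 :: real)" "arctan (1 / 239 :: real) \<le> 0.004184076003"
    by (simp_all add: lessThan_nat_numeral power_divide)
  then show "3.14159265257 \<le> pi" "pi \<le> 3.14159265365" using machin by simp_all
qed

lemma ln_eq_artanh: "0 < x \<Longrightarrow> ln x = 2 * artanh ((x - 1) / (x + 1))" for x :: real
proof -
  assume x: "0 < x"
  then have "(1 + (x - 1) / (x + 1)) / (1 - (x - 1) / (x + 1)) = x" by (simp add: field_simps)
  then show ?thesis by (simp add: artanh_def)
qed

lemma ln_2_bounds: "0.6931471802 \<le> ln (2::real)" "ln (2::real) \<le> 0.6931471809"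
proof -
  have "ln 2 = 2 * artanh (1 / 3 :: real)" using ln_eq_artanh[of 2] by simp
  then show "0.6931471802 \<le> ln (2::real)" "ln (2::real) \<le> 0.6931471809"
    using artanh_bounds[of "1 / 3" 10] by (simp_all add: lessThan_nat_numeral atMost_nat_numeral tail_weight_def power2_eq_square power_divide)
qed

section \<open>Numerical values of the expectation and the median\<close>

lemma log_sum_term_eq:
  fixes A B k P M :: real
  assumes "A > 0" "B > 0" "k > 0"
  shows "(1 / (B * k) + 1 / k\<^sup>2 + M / k) / A * (1 / P) = ((k + B) + M * B * k) / (A * B * k\<^sup>2 * P)"
  using assms by (cases "P = 0") (simp_all add: field_simps power2_eq_square)

text \<open>Rounding each term of the double sums to a multiple of \<open>10 ^ - 12\<close> by integer division keeps the
  numerals short; the exact sums have denominators of more than seventy digits.\<close>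

lemma div_le_log_sum_term:
  fixes A B k P m :: nat and M :: real
  assumes "A > 0" "B > 0" "k > 0" "P > 0" and M: "real m / 10 ^ 12 \<le> M"
  shows "real ((10 ^ 12 * (k + B) + m * (B * k)) div (A * B * k\<^sup>2 * P)) / 10 ^ 12
    \<le> (1 / (real B * real k) + 1 / (real k)\<^sup>2 + M / real k) / real A * (1 / real P)"
proof -
  have num: "real (10 ^ 12 * (k + B) + m * (B * k)) = ((real k + real B) + real m / 10 ^ 12 * real B * real k) * 10 ^ 12"
    by (simp add: algebra_simps)
  have den: "real (A * B * k\<^sup>2 * P) = real A * real B * (real k)\<^sup>2 * real P" by simp
  have K: "X \<le> n * 10 ^ 12 / d \<Longrightarrow> X / 10 ^ 12 \<le> n / d" for X n d :: real by (simp add: pos_divide_le_eq)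
  have "real ((10 ^ 12 * (k + B) + m * (B * k)) div (A * B * k\<^sup>2 * P)) / 10 ^ 12
     \<le> ((real k + real B) + real m / 10 ^ 12 * real B * real k) / (real A * real B * (real k)\<^sup>2 * real P)"
    by (rule K, fold num den, rule of_nat_div_le_of_nat)
  also have "\<dots> \<le> ((real k + real B) + M * real B * real k) / (real A * real B * (real k)\<^sup>2 * real P)"
    using M by (intro divide_right_mono add_mono mult_right_mono order_refl) auto
  finally show ?thesis using assms by (simp only: log_sum_term_eq of_nat_0_less_iff)
qed

lemma log_sum_term_le_div:
  fixes A B k P m w :: nat and M :: real
  assumes "A > 0" "B > 0" "k > 0" "P > 0" and M: "M \<le> real m / 10 ^ 12"
  shows "real w * ((1 / (real B * real k) + 1 / (real k)\<^sup>2 + M / real k) / real A * (1 / real P))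
    \<le> (real (w * (10 ^ 12 * (k + B) + m * (B * k)) div (A * B * k\<^sup>2 * P)) + 1) / 10 ^ 12"
proof -
  have num: "real (w * (10 ^ 12 * (k + B) + m * (B * k))) = real w * ((real k + real B) + real m / 10 ^ 12 * real B * real k) * 10 ^ 12"
    by (simp add: algebra_simps)
  have den: "real (A * B * k\<^sup>2 * P) = real A * real B * (real k)\<^sup>2 * real P" by simp
  have "((real k + real B) + M * real B * real k) / (real A * real B * (real k)\<^sup>2 * real P)
     \<le> ((real k + real B) + real m / 10 ^ 12 * real B * real k) / (real A * real B * (real k)\<^sup>2 * real P)"
    using M by (intro divide_right_mono add_mono mult_right_mono order_refl) auto
  then have "(1 / (real B * real k) + 1 / (real k)\<^sup>2 + M / real k) / real A * (1 / real P)
     \<le> ((real k + real B) + real m / 10 ^ 12 * real B * real k) / (real A * real B * (real k)\<^sup>2 * real P)"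
    using assms by (simp only: log_sum_term_eq of_nat_0_less_iff)
  then have "real w * ((1 / (real B * real k) + 1 / (real k)\<^sup>2 + M / real k) / real A * (1 / real P))
     \<le> real w * (((real k + real B) + real m / 10 ^ 12 * real B * real k) / (real A * real B * (real k)\<^sup>2 * real P))"
    by (rule mult_left_mono) simp
  moreover have K: "n * 10 ^ 12 / d - X \<le> 1 \<Longrightarrow> n / d \<le> (X + 1) / 10 ^ 12" for X n d :: real by (simp add: pos_le_divide_eq)
  have "real w * ((real k + real B) + real m / 10 ^ 12 * real B * real k) / (real A * real B * (real k)\<^sup>2 * real P)
     \<le> (real (w * (10 ^ 12 * (k + B) + m * (B * k)) div (A * B * k\<^sup>2 * P)) + 1) / 10 ^ 12"
    using real_of_int_div3[of "int (w * (10 ^ 12 * (k + B) + m * (B * k)))" "int (A * B * k\<^sup>2 * P)"]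
    by (intro K) (simp only: zdiv_int[symmetric] of_int_of_nat_eq num den)
  ultimately show ?thesis by (simp only: times_divide_eq_right)
qed

text \<open>With 17 terms in each index the lower and the upper bound differ by about
  \<open>1.1 * 10^-7\<close>. After multiplication by \<open>48 / pi^2 / sqrt 2\<close> this is
  below \<open>4 * 10^-7\<close>, which fits into the window of width \<open>10^-6\<close> around
  the stated value.\<close>

lemma expectation_sum_lower:
  fixes M :: real
  assumes M: "0.34657359 \<le> M"
  shows "0.286178121183 \<le> (\<Sum>i<17. \<Sum>j<17. (1 / (real (2 * j + 2) * real (2 * i + 2 * j + 3)) + 1 / real (2 * i + 2 * j + 3) ^ 2
        + M / real (2 * i + 2 * j + 3)) / real (2 * i + 1) * (1 / real (2 ^ (i + j + 1))))"
proof -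
  \<comment> \<open>\<open>346573590000 / 10^12\<close> is the lower bound for \<open>M\<close>,
    which stands for \<open>ln 2 / 2 = - ln (1 / sqrt 2)\<close>; the power of 2 comes from
    \<open>y^2 = 1 / 2\<close>.\<close>
  let ?f = "\<lambda>i j. (10 ^ 12 * ((2 * i + 2 * j + 3) + (2 * j + 2)) + 346573590000 * ((2 * j + 2) * (2 * i + 2 * j + 3)))
     div ((2 * i + 1) * (2 * j + 2) * (2 * i + 2 * j + 3)\<^sup>2 * 2 ^ (i + j + 1)) :: nat"
  have "286178121183 \<le> (\<Sum>i<17. \<Sum>j<17. ?f i j)"
    by (simp add: lessThan_nat_numeral)
  then have "real 286178121183 \<le> real (\<Sum>i<17. \<Sum>j<17. ?f i j)" by (simp only: of_nat_le_iff)
  then have "0.286178121183 \<le> (\<Sum>i<17. \<Sum>j<17. real (?f i j) / 10 ^ 12)"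
    unfolding sum_divide_distrib[symmetric] of_nat_sum[symmetric] by simp
  also have "\<dots> \<le> (\<Sum>i<17. \<Sum>j<17. (1 / (real (2 * j + 2) * real (2 * i + 2 * j + 3)) + 1 / real (2 * i + 2 * j + 3) ^ 2
        + M / real (2 * i + 2 * j + 3)) / real (2 * i + 1) * (1 / real (2 ^ (i + j + 1))))"
    by (intro sum_mono div_le_log_sum_term) (use M in auto)
  finally show ?thesis .
qed

lemma expectation_sum_upper:
  fixes M :: real
  assumes M: "M \<le> 0.346573591"
  shows "(\<Sum>i\<le>17. \<Sum>j\<le>17. tail_weight 17 i * tail_weight 17 j * ((1 / (real (2 * j + 2) * real (2 * i + 2 * j + 3)) + 1 / real (2 * i + 2 * j + 3) ^ 2
        + M / real (2 * i + 2 * j + 3)) / real (2 * i + 1) * (1 / real (2 ^ (i + j + 1))))) \<le> 0.286178231506"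
proof -
  let ?w = "\<lambda>i j. (if i = 17 then 2 else 1) * (if j = 17 then 2 else 1) :: nat"
  let ?f = "\<lambda>i j. ?w i j * (10 ^ 12 * ((2 * i + 2 * j + 3) + (2 * j + 2)) + 346573591000 * ((2 * j + 2) * (2 * i + 2 * j + 3)))
     div ((2 * i + 1) * (2 * j + 2) * (2 * i + 2 * j + 3)\<^sup>2 * 2 ^ (i + j + 1)) :: nat"
  have eq: "real (?f i j + 1) = real (?f i j) + 1" for i j by (simp only: of_nat_add of_nat_1)
  have w: "tail_weight 17 i * tail_weight 17 j = real (?w i j)" for i j by (simp add: tail_weight_def)
  have "(\<Sum>i\<le>17. \<Sum>j\<le>17. ?f i j + 1) \<le> 286178231506"
    by (simp add: atMost_nat_numeral)
  then have "real (\<Sum>i\<le>17. \<Sum>j\<le>17. ?f i j + 1) \<le> real 286178231506" by (simp only: of_nat_le_iff)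
  then have "(\<Sum>i\<le>17. \<Sum>j\<le>17. real (?f i j + 1) / 10 ^ 12) \<le> 0.286178231506"
    unfolding sum_divide_distrib[symmetric] of_nat_sum[symmetric] by simp
  moreover have "(\<Sum>i\<le>17. \<Sum>j\<le>17. tail_weight 17 i * tail_weight 17 j * ((1 / (real (2 * j + 2) * real (2 * i + 2 * j + 3)) + 1 / real (2 * i + 2 * j + 3) ^ 2
        + M / real (2 * i + 2 * j + 3)) / real (2 * i + 1) * (1 / real (2 ^ (i + j + 1))))) \<le> (\<Sum>i\<le>17. \<Sum>j\<le>17. real (?f i j + 1) / 10 ^ 12)"
    unfolding w eq by (intro sum_mono log_sum_term_le_div) (use M in auto)
  ultimately show ?thesis by linarith
qed

lemma expectation_bounds:
  assumes E: "((\<lambda>l. length_pdf l * l) has_integral E) {0..2 * arsinh 1}"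
  shows "\<bar>E - 0.984154\<bar> < 5 / 10 ^ 7"
proof -
  \<comment> \<open>\<open>y\<close> is \<open>tanh (arsinh 1)\<close>, the value at the end of the
    support. There \<open>y^2 = 1 / 2\<close> is exactly the limit up to which the series bounds
    hold.\<close>
  define y M where "y = sqrt (1 / 2 :: real)" and "M = ln 2 / (2 :: real)"
  have y: "0 < y" "y\<^sup>2 = 1 / 2" by (simp_all add: y_def)
  have lny: "ln y = - M" by (simp add: y_def M_def ln_sqrt ln_div)
  have "tanh (arsinh 1) = y"
    by (simp add: tanh_def cosh_arsinh_real y_def real_sqrt_divide)
  then have "arsinh 1 = artanh y" using artanh_tanh_real[of "arsinh 1"] by simp
  then have E': "((\<lambda>l. length_pdf l * l) has_integral E) {0..2 * artanh y}" using E by simp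
  \<comment> \<open>All exponents are odd, so a single irrational factor \<open>y\<close> can be
    taken out of the double sums, which leaves rational numbers and \<open>M\<close>.\<close>
  have pw: "X * y ^ (2 * i + 2 * j + 3) = X * (1 / real (2 ^ (i + j + 1))) * y" for X and i j :: nat
  proof -
    have "y ^ (2 * i + 2 * j + 3) = (y\<^sup>2) ^ (i + j + 1) * y"
      unfolding power_mult[symmetric] power_Suc2[symmetric] by (rule arg_cong[where f = "\<lambda>n. y ^ n"]) simp
    then show ?thesis unfolding y(2) by (simp add: power_one_over)
  qed
  have M: "0.34657359 \<le> M" "M \<le> 0.346573591" using ln_2_bounds by (simp_all add: M_def)
  have neg: "a - - M / b = a + M / b" for a b by simp
  have "48 / pi\<^sup>2 * (\<Sum>i<17. \<Sum>j<17. (1 / (real (2 * j + 2) * real (2 * i + 2 * j + 3)) + 1 / real (2 * i + 2 * j + 3) ^ 2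
        + M / real (2 * i + 2 * j + 3)) / real (2 * i + 1) * (1 / real (2 ^ (i + j + 1))) * y) \<le> E"
    using integral_length_pdf_mult_bounds(1)[OF y(1) _ E', of 17] unfolding lny pw neg y(2) by simp
  then have lo: "48 / pi\<^sup>2 * ((\<Sum>i<17. \<Sum>j<17. (1 / (real (2 * j + 2) * real (2 * i + 2 * j + 3)) + 1 / real (2 * i + 2 * j + 3) ^ 2
        + M / real (2 * i + 2 * j + 3)) / real (2 * i + 1) * (1 / real (2 ^ (i + j + 1)))) * y) \<le> E"
    by (simp only: sum_distrib_right)
  have "E \<le> 48 / pi\<^sup>2 * (\<Sum>i\<le>17. \<Sum>j\<le>17. tail_weight 17 i * tail_weight 17 j * ((1 / (real (2 * j + 2) * real (2 * i + 2 * j + 3)) + 1 / real (2 * i + 2 * j + 3) ^ 2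
        + M / real (2 * i + 2 * j + 3)) / real (2 * i + 1) * (1 / real (2 ^ (i + j + 1))) * y))"
    using integral_length_pdf_mult_bounds(2)[OF y(1) _ E', of 17] unfolding lny pw neg y(2) by simp
  then have up: "E \<le> 48 / pi\<^sup>2 * ((\<Sum>i\<le>17. \<Sum>j\<le>17. tail_weight 17 i * tail_weight 17 j * ((1 / (real (2 * j + 2) * real (2 * i + 2 * j + 3)) + 1 / real (2 * i + 2 * j + 3) ^ 2
        + M / real (2 * i + 2 * j + 3)) / real (2 * i + 1) * (1 / real (2 ^ (i + j + 1))))) * y)"
    by (simp only: sum_distrib_right mult.assoc)
  have yb: "0.7071067811 \<le> y" "y \<le> 0.7071067812"
    unfolding y_def by (rule real_le_rsqrt, simp add: power2_eq_square) (rule real_le_lsqrt; simp add: power2_eq_square)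
  have "3.14159265257\<^sup>2 \<le> pi\<^sup>2" "pi\<^sup>2 \<le> 3.14159265365\<^sup>2" using pi_bounds by (auto intro!: power_mono)
  then have p: "48 / 3.14159265365\<^sup>2 \<le> 48 / pi\<^sup>2" "48 / pi\<^sup>2 \<le> 48 / 3.14159265257\<^sup>2"
    by (intro divide_left_mono; simp)+
  have "48 / 3.14159265365\<^sup>2 * (0.286178121183 * 0.7071067811) \<le> E"
    by (rule order_trans[OF mult_mono'[OF p(1) mult_mono'[OF expectation_sum_lower[OF M(1)] yb(1)]] lo]) simp_all
  moreover have "E \<le> 48 / 3.14159265257\<^sup>2 * (0.286178231506 * 0.7071067812)"
    by (rule order_trans[OF up], rule order_trans[OF mult_left_mono[OF mult_mono[OF expectation_sum_upper[OF M(2)] yb(2)]] mult_right_mono[OF p(2)]])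
      (simp_all add: y less_imp_le)
  ultimately have "0.9841535 < E" "E < 0.9841545" by (simp_all add: power2_eq_square)
  then show ?thesis unfolding abs_less_iff by simp
qed

text \<open>\<open>357 / 773\<close> and \<open>938 / 2031\<close> enclose \<open>tanh (m / 2)\<close> for the median \<open>m\<close>.\<close>

lemma median_artanh_bounds: "0.99928 < 2 * artanh (357 / 773 :: real)" "2 * artanh (938 / 2031 :: real) < 0.9993"
proof -
  have "0.49964 < (\<Sum>k<8. (357 / 773) ^ (2 * k + 1) / real (2 * k + 1) :: real)"
    by (simp add: lessThan_nat_numeral power_divide)
  also have "\<dots> \<le> artanh (357 / 773)" by (intro artanh_bounds) (simp_all add: power2_eq_square)
  finally show "0.99928 < 2 * artanh (357 / 773 :: real)" by simp
  have "artanh (938 / 2031 :: real) \<le> (\<Sum>k\<le>8. tail_weight 8 k * ((938 / 2031) ^ (2 * k + 1) / real (2 * k + 1)))"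
    by (intro artanh_bounds) (simp_all add: power2_eq_square)
  also have "\<dots> < 0.49965"
    by (simp add: atMost_nat_numeral tail_weight_def power_divide)
  finally show "2 * artanh (938 / 2031 :: real) < 0.9993" by simp
qed

text \<open>Amounts to comparing the series with \<open>pi^2 / 48\<close>, which is about 0.2056168:
  it stays just below this value at \<open>357 / 773\<close>, and at \<open>938 / 2031\<close> it is
  just above.\<close>

lemma median_lower:
  assumes "length_pdf integrable_on {0..2 * artanh (357 / 773)}"
  shows "integral {0..2 * artanh (357 / 773)} length_pdf < 1 / 2"
proof -
  have y: "0 < (357 / 773 :: real)" "(357 / 773 :: real)\<^sup>2 \<le> 1 / 2" by (simp_all add: power2_eq_square)
  \<comment> \<open>\<open>208 / 565\<close> is \<open>(x - 1) / (x + 1)\<close> for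
    \<open>x = 773 / 357\<close>, so this bounds half of \<open>ln (773 / 357)\<close>.\<close>
  have "artanh (208 / 565) \<le> (\<Sum>k\<le>8. tail_weight 8 k * ((208 / 565) ^ (2 * k + 1) / real (2 * k + 1)) :: real)"
    by (intro artanh_bounds) (simp_all add: power2_eq_square)
  also have "\<dots> \<le> 0.386271636"
    by (simp add: atMost_nat_numeral tail_weight_def power_divide)
  finally have ln: "- ln (357 / 773) \<le> (0.772543272 :: real)"
    using ln_eq_artanh[of "773 / 357"] by (simp add: ln_div)
  have "integral {0..2 * artanh (357 / 773)} length_pdf \<le> 24 / pi\<^sup>2 * (\<Sum>k\<le>8. tail_weight 8 k * ((2 / real (2 * k + 2) ^ 2 - ln (357 / 773) / real (2 * k + 2)) * (357 / 773) ^ (2 * k + 2)))"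
    by (rule integral_length_pdf_bounds[OF y assms])
  also have "\<dots> \<le> 24 / pi\<^sup>2 * (\<Sum>k\<le>8. tail_weight 8 k * ((2 / real (2 * k + 2) ^ 2 + 0.772543272 / real (2 * k + 2)) * (357 / 773) ^ (2 * k + 2)))"
  proof (intro mult_left_mono sum_mono mult_right_mono)
    fix k :: nat
    have "- ln (357 / 773) / real (2 * k + 2) \<le> 0.772543272 / real (2 * k + 2)" using ln by (intro divide_right_mono) auto
    then show "2 / real (2 * k + 2) ^ 2 - ln (357 / 773) / real (2 * k + 2) \<le> 2 / real (2 * k + 2) ^ 2 + 0.772543272 / real (2 * k + 2)" by simp
  qed (simp_all add: tail_weight_def)
  also have "\<dots> \<le> 24 / pi\<^sup>2 * 0.2056142"
    by (intro mult_left_mono) (simp_all add: atMost_nat_numeral tail_weight_def power_divide)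
  also have "\<dots> < 1 / 2"
  proof -
    have "3.14159265257\<^sup>2 \<le> pi\<^sup>2" using pi_bounds by (intro power_mono) auto
    then show ?thesis by (simp add: field_simps power2_eq_square)
  qed
  finally show "integral {0..2 * artanh (357 / 773)} length_pdf < 1 / 2" .
qed

lemma median_upper:
  assumes "length_pdf integrable_on {0..2 * artanh (938 / 2031)}"
  shows "1 / 2 < integral {0..2 * artanh (938 / 2031)} length_pdf"
proof -
  have y: "0 < (938 / 2031 :: real)" "(938 / 2031 :: real)\<^sup>2 \<le> 1 / 2" by (simp_all add: power2_eq_square)
  \<comment> \<open>\<open>1093 / 2969\<close> is \<open>(x - 1) / (x + 1)\<close> for
    \<open>x = 2031 / 938\<close>.\<close>
  have "0.3862668 \<le> (\<Sum>k<8. (1093 / 2969) ^ (2 * k + 1) / real (2 * k + 1) :: real)"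
    by (simp add: lessThan_nat_numeral power_divide)
  also have "\<dots> \<le> artanh (1093 / 2969)" by (intro artanh_bounds) (simp_all add: power2_eq_square)
  finally have ln: "(0.7725336 :: real) \<le> - ln (938 / 2031)"
    using ln_eq_artanh[of "2031 / 938"] by (simp add: ln_div)
  have "1 / 2 < 24 / pi\<^sup>2 * 0.2056172"
  proof -
    have "pi\<^sup>2 \<le> 3.14159265365\<^sup>2" using pi_bounds by (intro power_mono) auto
    then show ?thesis by (simp add: field_simps power2_eq_square)
  qed
  also have "\<dots> \<le> 24 / pi\<^sup>2 * (\<Sum>k<8. (2 / real (2 * k + 2) ^ 2 + 0.7725336 / real (2 * k + 2)) * (938 / 2031) ^ (2 * k + 2))"
    by (intro mult_left_mono) (simp_all add: lessThan_nat_numeral power_divide)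
  also have "\<dots> \<le> 24 / pi\<^sup>2 * (\<Sum>k<8. (2 / real (2 * k + 2) ^ 2 - ln (938 / 2031) / real (2 * k + 2)) * (938 / 2031) ^ (2 * k + 2))"
  proof (intro mult_left_mono sum_mono mult_right_mono)
    fix k :: nat
    have "0.7725336 / real (2 * k + 2) \<le> - ln (938 / 2031) / real (2 * k + 2)" using ln by (intro divide_right_mono) auto
    then show "2 / real (2 * k + 2) ^ 2 + 0.7725336 / real (2 * k + 2) \<le> 2 / real (2 * k + 2) ^ 2 - ln (938 / 2031) / real (2 * k + 2)" by simp
  qed simp_all
  also have "\<dots> \<le> integral {0..2 * artanh (938 / 2031)} length_pdf"
    by (rule integral_length_pdf_bounds[OF y assms])
  finally show "1 / 2 < integral {0..2 * artanh (938 / 2031)} length_pdf" .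
qed

theorem theorem5p6:
  fixes M :: "'a measure" and P :: "nat \<Rightarrow> 'a \<Rightarrow> complex" and L :: "'a \<Rightarrow> real"
  assumes "prob_space M"
    and "prob_space.indep_vars M (\<lambda>_. borel) P {..<4}"
    and "\<And>i. i < 4 \<Longrightarrow> distr M borel (P i) = uniform_circle"
  defines "L \<equiv> \<lambda>\<omega>. shortest_geodesic_length ((\<lambda>i. P i \<omega>) ` {..<4})"
  shows "distributed M lborel L
           (\<lambda>l. ennreal (if 0 < l \<and> l \<le> ln ((sqrt 2 + 1) / (sqrt 2 - 1))
              then 6 / pi\<^sup>2 * csch l *
                     (4 * ln (cosh (l / 2)) + 2 * (cosh l - 1) * ln (coth (l / 2)))
              else 0))
       \<and> prob_space.expectation M L =
           6 / pi\<^sup>2 * integral {0..ln (3 + 2 * sqrt 2)}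
             (\<lambda>l. csch l * (4 * ln (cosh (l / 2)) + 2 * (cosh l - 1) * ln (coth (l / 2))) * l)
       \<and> \<bar>prob_space.expectation M L - 0.984154\<bar> < 5 / 10 ^ 7
       \<and> (\<exists>m. (\<forall>x. is_median M L x \<longleftrightarrow> x = m) \<and> \<bar>m - 0.99929\<bar> < 1 / 10 ^ 5)"
proof -
  interpret prob_space M by (rule assms(1))
  have dens: "(\<lambda>l. ennreal (if 0 < l \<and> l \<le> ln ((sqrt 2 + 1) / (sqrt 2 - 1))
      then 6 / pi\<^sup>2 * csch l * (4 * ln (cosh (l / 2)) + 2 * (cosh l - 1) * ln (coth (l / 2)))
      else 0)) = (\<lambda>l. ennreal (length_density l))"
    unfolding log_bound_eq length_density_def length_pdf_def ..
  have D: "distributed M lborel L (\<lambda>l. ennreal (length_density l))"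
    unfolding L_def using assms(2,3) by (rule distributed_shortest_geodesic_length)
  note E = expectation_length_density[OF D]
  have E_eq: "expectation L = 6 / pi\<^sup>2 * integral {0..ln (3 + 2 * sqrt 2)}
      (\<lambda>l. csch l * (4 * ln (cosh (l / 2)) + 2 * (cosh l - 1) * ln (coth (l / 2))) * l)"
    using integral_unique[OF E] unfolding log_bound_eq length_pdf_def mult.assoc integral_mult_right by simp
  define x y where "x = 2 * artanh (357 / 773 :: real)" and "y = 2 * artanh (938 / 2031 :: real)"
  \<comment> \<open>The bracket for the median lies inside the support, because
    \<open>arsinh 1 = ln (1 + sqrt 2)\<close> exceeds \<open>ln 2\<close>.\<close>
  have "y < 0.9993" using median_artanh_bounds by (simp add: y_def)
  moreover have "(0.9993 :: real) \<le> 2 * ln 2" using ln_2_bounds by simp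
  moreover have "2 * ln 2 \<le> 2 * arsinh (1 :: real)"
    using ln_mono[of 2 "1 + sqrt 2 :: real"] by (simp add: arsinh_real_def)
  ultimately have b: "y < 0.9993" "y \<le> 2 * arsinh 1" by simp_all
  have a: "0.99928 < x" "0 \<le> x" using median_artanh_bounds by (simp_all add: x_def)
  have "tanh (x / 2) \<le> tanh (y / 2)" by (simp add: x_def y_def tanh_artanh_real)
  then have "x \<le> y" by simp
  have int: "length_pdf integrable_on {0..z}" if "z \<le> 2 * arsinh 1" for z
    using that by (intro integrable_subinterval_real[OF has_integral_integrable[OF length_pdf_has_integral]]) auto
  obtain m where m: "\<forall>t. is_median M L t \<longleftrightarrow> t = m" "x < m" "m < y"
    using unique_median_length_density[OF D a(2) \<open>x \<le> y\<close> b(2)] median_lower median_upper int[of x] int[of y] \<open>x \<le> y\<close> b(2)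
    unfolding x_def y_def by auto
  have "\<bar>m - 0.99929\<bar> < 1 / 10 ^ 5" unfolding abs_less_iff using a b m by simp
  then show ?thesis unfolding dens using D E_eq expectation_bounds[OF E] m(1) by blast
qed

end
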